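(* Let $k \ge 1$ and $0 \le m \le k$ be integers and let $1 \le p \le \infty$. There exists a constant $C = C(k,m,p)$, depending only on $k$, $m$, $p$ (and in particular independent of the geometry of the triangle), such that for every triangle $K \subset \mathbb{R}^2$ and every $v \in W^{k+1,p}(K)$, $$|v - \mathcal{I}_K^k v|_{m,p,K} \le C \left(\frac{R_K}{h_K}\right)^m h_K^{k+1-m} |v|_{k+1,p,K} = C R_K^m h_K^{k+1-2m} |v|_{k+1,p,K}.$$
   Context: A triangle $K\subset\mathbb{R}^2$ is a closed nondegenerate triangle; $h_K$ is its diameter (the length of its longest edge) and $R_K$ is its circumradius. $\Sigma^k(K)$ is the set of points of $K$ whose barycentric coordinates with respect to the three vertices are $(a_1/k,a_2/k,a_3/k)$ with $a_1,a_2,a_3$ nonnegative integers, $a_1+a_2+a_3=k$. $\mathcal{P}_k(K)$ is the set of polynomials on $K$ of degree at most $k$. For $v\in C^0(K)$, the $k$th-order Lagrange interpolation $\mathcal{I}_K^k v\in\mathcal{P}_k(K)$ is the polynomial with $(\mathcal{I}_K^k v)(\mathbf{x}) = v(\mathbf{x})$ for all $\mathbf{x}\in\Sigma^k(K)$; functions in $W^{k+1,p}(K)$, $k\ge 1$, are identified with their continuous representatives. Sobolev seminorms: $|v|_{j,p,K} = \bigl(\sum_{|\delta|=j}\|\partial^\delta v\|_{L^p(K)}^p\bigr)^{1/p}$ for $1\le p<\infty$ and $|v|_{j,\infty,K}=\max_{|\delta|=j}\|\partial^\delta v\|_{L^\infty(K)}$. *)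

theory Defs
  imports "HOL-Analysis.Analysis" "HOL-Probability.Essential_Supremum"
begin

text \<open>A closed nondegenerate triangle \<open>K\<close> is a set with \<open>2 simplex K\<close>
  (\<open>simplex\<close> requires affinely independent vertices).  Its vertices are its extreme points.\<close>

type_synonym plane = "real^2"

definition vertices :: "plane set \<Rightarrow> plane set" where
  "vertices K = {x. x extreme_point_of K}"

definition circumradius :: "plane set \<Rightarrow> real" where
  "circumradius K = (THE r. \<exists>z. \<forall>x\<in>vertices K. dist z x = r)"

lemma vertices_convex_hull: "\<not> affine_dependent C \<Longrightarrow> vertices (convex hull C) = C"
  by (simp add: vertices_def extreme_point_of_convex_hull_affine_independent)

definition lattice_points :: "nat \<Rightarrow> plane set \<Rightarrow> plane set" where
  "lattice_points k K =
     {x. \<exists>a :: plane \<Rightarrow> nat. (\<Sum>u\<in>vertices K. a u) = k \<and>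
           x = (\<Sum>u\<in>vertices K. (real (a u) / real k) *\<^sub>R u)}"

definition polys :: "nat \<Rightarrow> (plane \<Rightarrow> real) set" where
  "polys k = {q. \<exists>c :: nat \<Rightarrow> nat \<Rightarrow> real.
     \<forall>x. q x = (\<Sum>i\<le>k. \<Sum>j\<le>k - i. c i j * (x $ 1) ^ i * (x $ 2) ^ j)}"

text \<open>A polynomial on a triangle determines a polynomial on the whole plane, which is
  how the interpolant is represented here.\<close>

definition lagrange_interp :: "nat \<Rightarrow> plane set \<Rightarrow> (plane \<Rightarrow> real) \<Rightarrow> plane \<Rightarrow> real" where
  "lagrange_interp k K v =
     (THE q. q \<in> polys k \<and> (\<forall>x\<in>lattice_points k K. q x = v x))"

definition partial :: "2 \<Rightarrow> (plane \<Rightarrow> real) \<Rightarrow> plane \<Rightarrow> real" where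
  "partial i f = (\<lambda>x. frechet_derivative f (at x) (axis i 1))"

type_synonym multi_index = "nat \<times> nat"

definition mi_order :: "multi_index \<Rightarrow> nat" where
  "mi_order \<delta> = fst \<delta> + snd \<delta>"

definition mpartial :: "multi_index \<Rightarrow> (plane \<Rightarrow> real) \<Rightarrow> plane \<Rightarrow> real" where
  "mpartial \<delta> f = (partial 1 ^^ fst \<delta>) ((partial 2 ^^ snd \<delta>) f)"

text \<open>\<open>C\<^sup>\<infinity>\<close>: all iterated partial derivatives, in any order, are differentiable everywhere.\<close>

definition smooth :: "(plane \<Rightarrow> real) \<Rightarrow> bool" where
  "smooth f \<longleftrightarrow> (\<forall>ds :: 2 list. \<forall>x. foldr partial ds f differentiable (at x))"

definition test_function :: "plane set \<Rightarrow> (plane \<Rightarrow> real) \<Rightarrow> bool" where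
  "test_function \<Omega> \<phi> \<longleftrightarrow>
     smooth \<phi> \<and> compact (closure {x. \<phi> x \<noteq> 0}) \<and> closure {x. \<phi> x \<noteq> 0} \<subseteq> \<Omega>"

definition Lp_space :: "ennreal \<Rightarrow> plane set \<Rightarrow> (plane \<Rightarrow> real) set" where
  "Lp_space p \<Omega> = {f \<in> borel_measurable (lebesgue_on \<Omega>).
     if p = \<infinity> then \<exists>B. AE x in lebesgue_on \<Omega>. \<bar>f x\<bar> \<le> B
     else integrable (lebesgue_on \<Omega>) (\<lambda>x. \<bar>f x\<bar> powr enn2real p)}"

text \<open>Only meaningful on \<open>Lp_space p \<Omega>\<close>.\<close>

definition Lp_norm :: "ennreal \<Rightarrow> plane set \<Rightarrow> (plane \<Rightarrow> real) \<Rightarrow> real" where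
  "Lp_norm p \<Omega> f =
     (if p = \<infinity> then real_of_ereal (esssup (lebesgue_on \<Omega>) (\<lambda>x. ereal \<bar>f x\<bar>))
      else (LINT x|lebesgue_on \<Omega>. \<bar>f x\<bar> powr enn2real p) powr (1 / enn2real p))"

definition locally_integrable :: "plane set \<Rightarrow> (plane \<Rightarrow> real) \<Rightarrow> bool" where
  "locally_integrable \<Omega> f \<longleftrightarrow> (\<forall>S. compact S \<and> S \<subseteq> \<Omega> \<longrightarrow> integrable (lebesgue_on S) f)"

definition has_weak_partial ::
    "plane set \<Rightarrow> multi_index \<Rightarrow> (plane \<Rightarrow> real) \<Rightarrow> (plane \<Rightarrow> real) \<Rightarrow> bool" where
  "has_weak_partial \<Omega> \<delta> v w \<longleftrightarrow>
     locally_integrable \<Omega> v \<and> locally_integrable \<Omega> w \<and>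
     (\<forall>\<phi>. test_function \<Omega> \<phi> \<longrightarrow>
        (LINT x|lebesgue_on \<Omega>. v x * mpartial \<delta> \<phi> x) =
        (-1) ^ mi_order \<delta> * (LINT x|lebesgue_on \<Omega>. w x * \<phi> x))"

text \<open>Weak derivatives are unique up to null sets; one representative is chosen.\<close>

definition weak_partial ::
    "plane set \<Rightarrow> multi_index \<Rightarrow> (plane \<Rightarrow> real) \<Rightarrow> plane \<Rightarrow> real" where
  "weak_partial \<Omega> \<delta> v = (SOME w. has_weak_partial \<Omega> \<delta> v w)"

definition sobolev_space :: "nat \<Rightarrow> ennreal \<Rightarrow> plane set \<Rightarrow> (plane \<Rightarrow> real) set" where
  "sobolev_space n p \<Omega> = {v \<in> Lp_space p \<Omega>.
     \<forall>\<delta>. mi_order \<delta> \<le> n \<longrightarrow> (\<exists>w\<in>Lp_space p \<Omega>. has_weak_partial \<Omega> \<delta> v w)}"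

text \<open>Only meaningful for functions whose weak derivatives of order \<open>j\<close> exist in
  \<open>Lp_space p \<Omega>\<close>.\<close>

definition sobolev_seminorm :: "nat \<Rightarrow> ennreal \<Rightarrow> plane set \<Rightarrow> (plane \<Rightarrow> real) \<Rightarrow> real" where
  "sobolev_seminorm j p \<Omega> v =
     (if p = \<infinity> then Max ((\<lambda>\<delta>. Lp_norm p \<Omega> (weak_partial \<Omega> \<delta> v)) ` {\<delta>. mi_order \<delta> = j})
      else (\<Sum>\<delta> | mi_order \<delta> = j. Lp_norm p \<Omega> (weak_partial \<Omega> \<delta> v) powr enn2real p)
             powr (1 / enn2real p))"

text \<open>For a triangle \<open>K\<close>, functions on \<open>K\<close> are treated through \<open>\<Omega> = interior K\<close>; the
  boundary is a null set, so \<open>L\<^sup>p\<close> norms over \<open>K\<close> and over its interior coincide.\<close>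

lemma finite_mi_order: "finite {\<delta>. mi_order \<delta> = j}"
proof (rule finite_subset)
  show "{\<delta>. mi_order \<delta> = j} \<subseteq> {..j} \<times> {..j}"
    by (auto simp: mi_order_def)
qed simp

end

theory Submission
  imports Defs "HOL-Probability.Probability_Measure"
begin

text \<open>
  On the reference triangle the interpolant is written in Newton form.  Then the derivative
  \<open>\<partial>\<^sup>\<delta>\<close> of the interpolant involves only finite differences of order at least \<open>\<delta>\<close>,
  which are iterated integrals of \<open>\<partial>\<^sup>\<delta> u\<close> along grid segments and hence, by a trace estimate, bounded by
  \<open>\<partial>\<^sup>\<delta> u\<close> and its derivatives up to total order \<open>k + 1\<close>.  Subtracting a polynomial with the same mean derivatives and
  applying Poincare's inequality repeatedly leaves the derivatives of total order \<open>k + 1\<close> only, so the error of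
  \<open>\<partial>\<^sup>\<delta> u\<close> is bounded by derivatives of \<open>\<partial>\<^sup>\<delta> u\<close>.

  On \<open>K\<close>, differentiate in the directions of the two edges that meet at the vertex opposite the
  longest edge.  In the estimate for \<open>\<partial>\<^sub>A\<^sup>a \<partial>\<^sub>B\<^sup>b\<close> the powers of the two edge lengths coming from
  the scaling to the reference triangle cancel, and what is left is at most \<open>h\<^sub>K\<^sup>k\<^sup>+\<^sup>1\<^sup>-\<^sup>m\<close>.  Passing to coordinate
  derivatives of order \<open>m\<close> costs the \<open>m\<close>-th power of \<open>1 / sin \<theta>\<close>, where \<open>\<theta>\<close> is the angle
  at that vertex, and \<open>1 / sin \<theta> = 2 R\<^sub>K / h\<^sub>K\<close> by the law of sines.

  This is carried out for smooth functions.  A Sobolev function is dilated slightly about an interior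
  point and mollified, and Fatou's lemma gives the limit.  As the constant does not depend on the finite
  exponent, the case \<open>p = \<infinity>\<close> follows by letting the exponent tend to infinity.
\<close>

section \<open>Families of partial derivatives\<close>

text \<open>The obstacle is anisotropy. The two edges at the chosen vertex may have very different
  lengths; a reference bound for the error of \<open>U a b\<close> by all derivatives of order
  \<open>k + 1\<close> would leave quotients of these lengths after scaling. This is why every
  derivative on the right must be a further derivative of \<open>U a b\<close>. Spare derivatives
  make this possible. A difference of positive order in both indices is an integral over a
  rectangle. If one index is zero, restriction to a line costs one more derivative, and a + b \<le>
  k leaves at least one. If both are zero, a point value costs two, and k + 1 \<ge> 2. Estimates are
  proved for p-th powers of norms, with constants of the form \<open>C powr p\<close> where
  \<open>C\<close> is free of \<open>p\<close>, so p-th roots stay bounded as \<open>p\<close>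
  grows. This dictates crude bounds such as 4 * 2^p \<le> 8^p. A smooth function is carried as the
  whole family of its partial derivatives. Chain rules and differences then become index arithmetic,
  polynomials are families that vanish beyond some order, and two families agree as soon as their
  members of order zero do.\<close>

abbreviation pt :: "real \<Rightarrow> real \<Rightarrow> plane" where
  "pt s t \<equiv> vector [s, t]"

lemma pt_eta: "pt (x $ 1) (x $ 2) = x"
  by (simp add: vec_eq_iff forall_2)

text \<open>\<open>U a b\<close> plays the role of \<open>\<partial>\<^sup>(\<^sup>a\<^sup>,\<^sup>b\<^sup>)\<close> of the smooth function \<open>U 0 0\<close>.\<close>

definition jet :: "(nat \<Rightarrow> nat \<Rightarrow> plane \<Rightarrow> real) \<Rightarrow> bool" where
  "jet U \<longleftrightarrow> (\<forall>a b x. (U a b has_derivative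
     (\<lambda>h. h $ 1 * U (Suc a) b x + h $ 2 * U a (Suc b) x)) (at x))"

text \<open>All members are differentiated along \<open>e\<close> at once, so the result is again a
  family of this kind and the operation can be iterated.\<close>

definition dir_shift ::
    "plane \<Rightarrow> (nat \<Rightarrow> nat \<Rightarrow> plane \<Rightarrow> real) \<Rightarrow> nat \<Rightarrow> nat \<Rightarrow> plane \<Rightarrow> real" where
  "dir_shift e U = (\<lambda>a b x. e $ 1 * U (Suc a) b x + e $ 2 * U a (Suc b) x)"

definition aff :: "plane \<Rightarrow> plane \<Rightarrow> plane \<Rightarrow> plane \<Rightarrow> plane" where
  "aff z e f x = z + (x $ 1) *\<^sub>R e + (x $ 2) *\<^sub>R f"

text \<open>The derivative of \<open>U 0 0\<close> taken \<open>a\<close> times along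
  \<open>e\<close> and \<open>b\<close> times along \<open>f\<close>. Composed with
  \<open>aff z e f\<close> it is the (a, b) coordinate derivative of the composition.\<close>

definition pull_dirs ::
    "plane \<Rightarrow> plane \<Rightarrow> (nat \<Rightarrow> nat \<Rightarrow> plane \<Rightarrow> real) \<Rightarrow> nat \<Rightarrow> nat \<Rightarrow> plane \<Rightarrow> real" where
  "pull_dirs e f U a b = ((dir_shift e ^^ a) ((dir_shift f ^^ b) U)) 0 0"

text \<open>Polynomials of total degree at most \<open>k\<close>, described without coefficients:
  stability under affine maps and differences is then visible directly. The link with
  \<open>polys\<close> is \<open>polys_polyjet\<close> and \<open>polyjet_polys\<close>.\<close>

definition polyjet :: "nat \<Rightarrow> (nat \<Rightarrow> nat \<Rightarrow> plane \<Rightarrow> real) \<Rightarrow> bool" where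
  "polyjet k U \<longleftrightarrow> jet U \<and> (\<forall>a b. k < a + b \<longrightarrow> U a b = (\<lambda>_. 0))"

lemma vec_nth_has_derivative: "((\<lambda>x :: plane. x $ i) has_derivative (\<lambda>h. h $ i)) (at x)"
  by (rule bounded_linear_imp_has_derivative[OF bounded_linear_vec_nth])

lemma jetD:
  "jet U \<Longrightarrow> (U a b has_derivative (\<lambda>h. h $ 1 * U (Suc a) b x + h $ 2 * U a (Suc b) x)) (at x)"
  by (simp add: jet_def)

lemma jet_continuous: "jet U \<Longrightarrow> continuous_on S (U a b)"
  by (meson continuous_at_imp_continuous_on has_derivative_continuous jetD)

lemma jet_add: "jet U \<Longrightarrow> jet V \<Longrightarrow> jet (\<lambda>a b x. U a b x + V a b x)"
  unfolding jet_def
  by (auto intro!: derivative_eq_intros simp: algebra_simps)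

lemma jet_diff: "jet U \<Longrightarrow> jet V \<Longrightarrow> jet (\<lambda>a b x. U a b x - V a b x)"
  unfolding jet_def
  by (auto intro!: derivative_eq_intros simp: algebra_simps)

lemma jet_scale: "jet U \<Longrightarrow> jet (\<lambda>a b x. c * U a b x)"
  unfolding jet_def
  by (auto intro!: derivative_eq_intros simp: algebra_simps)

lemma jet_sum:
  "(\<And>i. i \<in> I \<Longrightarrow> jet (U i)) \<Longrightarrow> jet (\<lambda>a b x. \<Sum>i\<in>I. U i a b x)"
proof (induction I rule: infinite_finite_induct)
  case (infinite I) then show ?case by (simp add: jet_def)
next
  case empty then show ?case by (simp add: jet_def)
next
  case (insert i I) then show ?case by (simp add: jet_add)
qed

lemma jet_shift: "jet U \<Longrightarrow> jet (\<lambda>a b. U (a + i) (b + j))"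
  by (simp add: jet_def)

lemma jet_dir_shift: "jet U \<Longrightarrow> jet (dir_shift e U)"
proof -
  assume U: "jet U"
  have "jet (\<lambda>a b x. e $ 1 * U (a + 1) (b + 0) x + e $ 2 * U (a + 0) (b + 1) x)"
    by (intro jet_add jet_scale jet_shift U)
  then show ?thesis by (simp add: dir_shift_def)
qed

lemma jet_dir_shift_funpow: "jet U \<Longrightarrow> jet ((dir_shift e ^^ n) U)"
  by (induction n) (auto intro: jet_dir_shift)

lemma dir_shift_commute: "dir_shift e (dir_shift f U) = dir_shift f (dir_shift e U)"
  by (auto simp: dir_shift_def fun_eq_iff algebra_simps)

lemma dir_shift_funpow_commute:
  "dir_shift e ((dir_shift f ^^ n) U) = (dir_shift f ^^ n) (dir_shift e U)"
proof (induction n)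
  case (Suc n)
  have "dir_shift e ((dir_shift f ^^ Suc n) U) = dir_shift f (dir_shift e ((dir_shift f ^^ n) U))"
    by (simp add: dir_shift_commute[of e f])
  then show ?case by (simp add: Suc)
qed simp

lemma dir_shift_scale:
  "dir_shift (c *\<^sub>R e) U = (\<lambda>a b x. c * dir_shift e U a b x)"
  by (simp add: dir_shift_def fun_eq_iff algebra_simps)

lemma dir_shift_mult: "dir_shift e (\<lambda>a b x. c * U a b x) = (\<lambda>a b x. c * dir_shift e U a b x)"
  by (simp add: dir_shift_def fun_eq_iff algebra_simps)

lemma dir_shift_funpow_mult:
  "(dir_shift e ^^ n) (\<lambda>a b x. c * U a b x) = (\<lambda>a b x. c * (dir_shift e ^^ n) U a b x)"
  by (induction n) (auto simp: dir_shift_mult)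

lemma dir_shift_funpow_scale:
  "(dir_shift (c *\<^sub>R e) ^^ n) U = (\<lambda>a b x. c ^ n * (dir_shift e ^^ n) U a b x)"
  by (induction n) (auto simp: dir_shift_mult dir_shift_scale algebra_simps)

lemma pull_dirs_scale:
  "pull_dirs (c *\<^sub>R e) (d *\<^sub>R f) U a b x = c ^ a * d ^ b * pull_dirs e f U a b x"
  by (simp add: pull_dirs_def dir_shift_funpow_scale dir_shift_funpow_mult)

lemma dir_shift_diff:
  "dir_shift e (\<lambda>a b x. U a b x - V a b x) = (\<lambda>a b x. dir_shift e U a b x - dir_shift e V a b x)"
  by (simp add: dir_shift_def fun_eq_iff algebra_simps)

lemma dir_shift_funpow_diff:
  "(dir_shift e ^^ n) (\<lambda>a b x. U a b x - V a b x)
     = (\<lambda>a b x. (dir_shift e ^^ n) U a b x - (dir_shift e ^^ n) V a b x)"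
  by (induction n) (auto simp: dir_shift_diff)

lemma pull_dirs_diff:
  "pull_dirs e f (\<lambda>a b x. U a b x - V a b x) = (\<lambda>a b x. pull_dirs e f U a b x - pull_dirs e f V a b x)"
  by (simp add: pull_dirs_def dir_shift_funpow_diff fun_eq_iff)

lemma pull_dirs_0 [simp]: "pull_dirs e f U 0 0 = U 0 0"
  by (simp add: pull_dirs_def)

lemma jet_affine:
  assumes "jet U"
  shows "jet (\<lambda>a b x. pull_dirs e f U a b (aff z e f x))"
  unfolding jet_def
proof (intro allI)
  fix a b x
  define X where "X = (dir_shift e ^^ a) ((dir_shift f ^^ b) U)"
  have X: "jet X" unfolding X_def by (intro jet_dir_shift_funpow assms)
  have L: "(aff z e f has_derivative (\<lambda>h. (h $ 1) *\<^sub>R e + (h $ 2) *\<^sub>R f)) (at x)"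
    unfolding aff_def[abs_def]
    by (auto intro!: derivative_eq_intros vec_nth_has_derivative)
  have "((\<lambda>x. X 0 0 (aff z e f x)) has_derivative
      (\<lambda>h. ((h $ 1) *\<^sub>R e + (h $ 2) *\<^sub>R f) $ 1 * X (Suc 0) 0 (aff z e f x)
         + ((h $ 1) *\<^sub>R e + (h $ 2) *\<^sub>R f) $ 2 * X 0 (Suc 0) (aff z e f x))) (at x)"
    by (rule has_derivative_compose[OF L jetD[OF X]])
  moreover have "pull_dirs e f U (Suc a) b = dir_shift e X 0 0"
    by (simp add: pull_dirs_def X_def)
  \<comment> \<open>The chain rule puts the new \<open>f\<close> derivative outermost, whereas
    \<open>pull_dirs\<close> expects it inside the \<open>e\<close> derivatives; commutation moves
    it there.\<close>
  moreover have "pull_dirs e f U a (Suc b) = dir_shift f X 0 0"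
    by (simp add: pull_dirs_def X_def dir_shift_funpow_commute)
  moreover have "pull_dirs e f U a b = X 0 0"
    by (simp add: pull_dirs_def X_def)
  ultimately show "((\<lambda>x. pull_dirs e f U a b (aff z e f x)) has_derivative
      (\<lambda>h. h $ 1 * pull_dirs e f U (Suc a) b (aff z e f x)
         + h $ 2 * pull_dirs e f U a (Suc b) (aff z e f x))) (at x)"
    by (simp add: dir_shift_def algebra_simps)
qed

text \<open>The sums of order \<open>n\<close> based at (Suc i, j) and at (i, Suc j) are both parts
  of the sum of order \<open>Suc n\<close> based at (i, j); the two components of \<open>e\<close>
  give the factor 2 * M.\<close>

lemma dir_shift_bound:
  fixes M :: real
  assumes "\<bar>e $ 1\<bar> \<le> M" "\<bar>e $ 2\<bar> \<le> M"
    and X: "\<And>i j. \<bar>X i j x\<bar> \<le> c * (\<Sum>l\<le>n. \<bar>U (i + l) (j + n - l) x\<bar>)" and "0 \<le> c"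
  shows "\<bar>dir_shift e X i j x\<bar> \<le> 2 * M * c * (\<Sum>l\<le>Suc n. \<bar>U (i + l) (j + Suc n - l) x\<bar>)"
proof -
  have M: "0 \<le> M" using assms(1) by linarith
  let ?B = "\<Sum>l\<le>Suc n. \<bar>U (i + l) (j + Suc n - l) x\<bar>"
  have "(\<Sum>l\<le>n. \<bar>U (Suc i + l) (j + n - l) x\<bar>) \<le> ?B"
    unfolding sum.atMost_Suc_shift by simp
  then have 1: "\<bar>X (Suc i) j x\<bar> \<le> c * ?B"
    by (intro order_trans[OF X mult_left_mono] assms(4))
  have "(\<Sum>l\<le>n. \<bar>U (i + l) (Suc j + n - l) x\<bar>) \<le> ?B"
    by simp
  then have 2: "\<bar>X i (Suc j) x\<bar> \<le> c * ?B"
    by (intro order_trans[OF X mult_left_mono] assms(4))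
  have "\<bar>dir_shift e X i j x\<bar> \<le> \<bar>e $ 1\<bar> * \<bar>X (Suc i) j x\<bar> + \<bar>e $ 2\<bar> * \<bar>X i (Suc j) x\<bar>"
    unfolding dir_shift_def by (simp add: abs_mult[symmetric])
  also have "\<dots> \<le> M * (c * ?B) + M * (c * ?B)"
    by (intro add_mono mult_mono 1 2 assms M) auto
  finally show ?thesis by (simp add: algebra_simps)
qed

lemma dir_shift_funpow_bound:
  fixes M :: real
  assumes e: "\<bar>e $ 1\<bar> \<le> M" "\<bar>e $ 2\<bar> \<le> M"
    and X: "\<And>i j. \<bar>X i j x\<bar> \<le> (2 * M) ^ n * (\<Sum>l\<le>n. \<bar>U (i + l) (j + n - l) x\<bar>)"
  shows "\<bar>(dir_shift e ^^ m) X i j x\<bar>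
      \<le> (2 * M) ^ (m + n) * (\<Sum>l\<le>m + n. \<bar>U (i + l) (j + (m + n) - l) x\<bar>)"
proof (induction m arbitrary: i j)
  case 0 show ?case using X by simp
next
  case (Suc m)
  have "0 \<le> M" using e by linarith
  then have "0 \<le> (2 * M) ^ (m + n)" by simp
  from dir_shift_bound[OF e _ this, where X = "(dir_shift e ^^ m) X" and n = "m + n" and U = U, OF Suc.IH]
  show ?case by (simp only: funpow.simps o_apply power_Suc add_Suc)
qed

lemma pull_dirs_bound:
  fixes M :: real
  assumes "\<bar>e $ 1\<bar> \<le> M" "\<bar>e $ 2\<bar> \<le> M" "\<bar>f $ 1\<bar> \<le> M" "\<bar>f $ 2\<bar> \<le> M"
  shows "\<bar>pull_dirs e f U a b x\<bar> \<le> (2 * M) ^ (a + b) * (\<Sum>l\<le>a + b. \<bar>U l (a + b - l) x\<bar>)"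
proof -
  have "\<bar>(dir_shift f ^^ b) U i j x\<bar> \<le> (2 * M) ^ b * (\<Sum>l\<le>b. \<bar>U (i + l) (j + b - l) x\<bar>)" for i j
    using dir_shift_funpow_bound[OF assms(3,4), where n = 0 and X = U and U = U] by simp
  from dir_shift_funpow_bound[OF assms(1,2), where X = "(dir_shift f ^^ b) U" and U = U and n = b, OF this, of a 0 0]
  show ?thesis by (simp add: pull_dirs_def)
qed

section \<open>Polynomials as families of derivatives\<close>

lemma polyjet_jet: "polyjet k U \<Longrightarrow> jet U"
  by (simp add: polyjet_def)

lemma polyjet_affine:
  assumes "polyjet k U"
  shows "polyjet k (\<lambda>a b x. pull_dirs e f U a b (aff z e f x))"
proof -
  have "pull_dirs e f U a b x = 0" if "k < a + b" for a b x
  proof -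
    \<comment> \<open>Any bound for the four components serves: it multiplies derivatives of order
      above \<open>k\<close>, which all vanish.\<close>
    define M where "M = \<bar>e $ 1\<bar> + \<bar>e $ 2\<bar> + (\<bar>f $ 1\<bar> + \<bar>f $ 2\<bar>)"
    have "\<bar>pull_dirs e f U a b x\<bar> \<le> (2 * M) ^ (a + b) * (\<Sum>l\<le>a + b. \<bar>U l (a + b - l) x\<bar>)"
      by (rule pull_dirs_bound) (auto simp: M_def)
    also have "(\<Sum>l\<le>a + b. \<bar>U l (a + b - l) x\<bar>) = 0"
      using assms that by (auto simp: polyjet_def intro!: sum.neutral)
    finally show ?thesis by simp
  qed
  then show ?thesis using assms by (auto simp: polyjet_def jet_affine)
qed

lemma polyjet_diff: "polyjet k U \<Longrightarrow> polyjet k V \<Longrightarrow> polyjet k (\<lambda>a b x. U a b x - V a b x)"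
  by (auto simp: polyjet_def jet_diff)

lemma polyjet_add: "polyjet k U \<Longrightarrow> polyjet k V \<Longrightarrow> polyjet k (\<lambda>a b x. U a b x + V a b x)"
  by (auto simp: polyjet_def jet_add)

lemma polyjet_scale: "polyjet k U \<Longrightarrow> polyjet k (\<lambda>a b x. c * U a b x)"
  by (auto simp: polyjet_def jet_scale)

lemma polyjet_sum:
  "(\<And>i. i \<in> I \<Longrightarrow> polyjet k (U i)) \<Longrightarrow> polyjet k (\<lambda>a b x. \<Sum>i\<in>I. U i a b x)"
  by (auto simp: polyjet_def jet_sum)

lemma polyjet_mono: "polyjet k U \<Longrightarrow> k \<le> l \<Longrightarrow> polyjet l U"
  by (auto simp: polyjet_def)

lemma jet_DERIV_1:
  assumes "jet U"
  shows "((\<lambda>s. U a b (pt s t)) has_real_derivative U (Suc a) b (pt s t)) (at s)"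
proof -
  have L: "((\<lambda>s. pt s t) has_derivative (\<lambda>h. pt h 0)) (at s)"
    by (subst has_derivative_componentwise_within)
      (auto simp: Basis_vec_def inner_axis forall_2 UNIV_2 intro!: derivative_eq_intros)
  have "((\<lambda>s. U a b (pt s t)) has_derivative
      (\<lambda>h. pt h 0 $ 1 * U (Suc a) b (pt s t) + pt h 0 $ 2 * U a (Suc b) (pt s t))) (at s)"
    by (rule has_derivative_compose[OF L jetD[OF assms]])
  then show ?thesis
    by (simp add: has_field_derivative_def mult.commute[of _ "U (Suc a) b (pt s t)"])
qed

lemma jet_DERIV_2:
  assumes "jet U"
  shows "((\<lambda>t. U a b (pt s t)) has_real_derivative U a (Suc b) (pt s t)) (at t)"
proof -
  have L: "((\<lambda>t. pt s t) has_derivative (\<lambda>h. pt 0 h)) (at t)"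
    by (subst has_derivative_componentwise_within)
      (auto simp: Basis_vec_def inner_axis forall_2 UNIV_2 intro!: derivative_eq_intros)
  have "((\<lambda>t. U a b (pt s t)) has_derivative
      (\<lambda>h. pt 0 h $ 1 * U (Suc a) b (pt s t) + pt 0 h $ 2 * U a (Suc b) (pt s t))) (at t)"
    by (rule has_derivative_compose[OF L jetD[OF assms]])
  then show ?thesis
    by (simp add: has_field_derivative_def mult.commute[of _ "U a (Suc b) (pt s t)"])
qed

lemma has_derivative_coord1:
  assumes "(f has_real_derivative d) (at (x $ 1))"
  shows "((\<lambda>x :: plane. f (x $ 1)) has_derivative (\<lambda>h. h $ 1 * d)) (at x)"
proof -
  from has_derivative_compose[OF vec_nth_has_derivative[of 1 x]] assms show ?thesis
    by (simp add: has_field_derivative_def mult.commute)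
qed

lemma has_derivative_coord2:
  assumes "(f has_real_derivative d) (at (x $ 2))"
  shows "((\<lambda>x :: plane. f (x $ 2)) has_derivative (\<lambda>h. h $ 2 * d)) (at x)"
proof -
  from has_derivative_compose[OF vec_nth_has_derivative[of 2 x]] assms show ?thesis
    by (simp add: has_field_derivative_def mult.commute)
qed

lemma jet_tensor:
  fixes f g :: "nat \<Rightarrow> real \<Rightarrow> real"
  assumes f: "\<And>n s. (f n has_real_derivative f (Suc n) s) (at s)"
    and g: "\<And>n s. (g n has_real_derivative g (Suc n) s) (at s)"
  shows "jet (\<lambda>a b x. f a (x $ 1) * g b (x $ 2))"
  unfolding jet_def
proof (intro allI)
  fix a b and x :: plane
  show "((\<lambda>x. f a (x $ 1) * g b (x $ 2)) has_derivative
      (\<lambda>h. h $ 1 * (f (Suc a) (x $ 1) * g b (x $ 2)) + h $ 2 * (f a (x $ 1) * g (Suc b) (x $ 2)))) (at x)"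
    using has_derivative_mult[OF has_derivative_coord1[OF f] has_derivative_coord2[OF g]]
    by (rule has_derivative_eq_rhs) (auto simp: fun_eq_iff algebra_simps)
qed

lemma pderiv_funpow_0: "degree P < n \<Longrightarrow> (pderiv ^^ n) P = (0 :: real poly)"
proof (induction n arbitrary: P)
  case (Suc n)
  show ?case
  proof (cases "degree P = 0")
    case True
    then have "pderiv P = 0" by (simp add: pderiv_eq_0_iff)
    moreover have "(pderiv ^^ n) 0 = (0 :: real poly)" by (induction n) auto
    ultimately show ?thesis by (simp add: funpow_swap1)
  next
    case False
    then show ?thesis using Suc by (simp add: funpow_swap1 degree_pderiv)
  qed
qed simp

lemma polyjet_tensor:
  fixes P Q :: "real poly"
  assumes "degree P + degree Q \<le> k"
  shows "polyjet k (\<lambda>a b x. poly ((pderiv ^^ a) P) (x $ 1) * poly ((pderiv ^^ b) Q) (x $ 2))"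
  unfolding polyjet_def
proof (intro conjI allI impI)
  show "jet (\<lambda>a b x. poly ((pderiv ^^ a) P) (x $ 1) * poly ((pderiv ^^ b) Q) (x $ 2))"
    by (rule jet_tensor) auto
  fix a b assume "k < a + b"
  then consider "degree P < a" | "degree Q < b" using assms by linarith
  then show "(\<lambda>x :: plane. poly ((pderiv ^^ a) P) (x $ 1) * poly ((pderiv ^^ b) Q) (x $ 2)) = (\<lambda>_. 0)"
    by cases (auto simp: pderiv_funpow_0)
qed

lemma polys_polyjet:
  assumes "q \<in> polys k"
  obtains U where "polyjet k U" "U 0 0 = q"
proof -
  from assms obtain c where c: "\<And>x. q x = (\<Sum>i\<le>k. \<Sum>j\<le>k - i. c i j * (x $ 1) ^ i * (x $ 2) ^ j)"
    unfolding polys_def by blast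
  define U where "U = (\<lambda>a b x. \<Sum>i\<le>k. \<Sum>j\<le>k - i. c i j *
      (poly ((pderiv ^^ a) (monom 1 i)) (x $ 1) * poly ((pderiv ^^ b) (monom 1 j)) ((x :: plane) $ 2)))"
  have "polyjet k U"
    unfolding U_def
    by (intro polyjet_sum polyjet_scale polyjet_tensor) (auto simp: degree_monom_eq)
  moreover have "U 0 0 = q"
    by (auto simp: U_def c poly_monom algebra_simps fun_eq_iff)
  ultimately show ?thesis using that by blast
qed

text \<open>The Lagrange remainder is a multiple of \<open>f (Suc n)\<close>, hence zero.\<close>

lemma taylor_exact:
  fixes f :: "nat \<Rightarrow> real \<Rightarrow> real"
  assumes f: "\<And>n s. (f n has_real_derivative f (Suc n) s) (at s)" and "\<And>s. f (Suc n) s = 0"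
  shows "f 0 s = (\<Sum>i\<le>n. f i 0 / fact i * s ^ i)"
proof -
  obtain t where "f 0 s = (\<Sum>m<Suc n. f m 0 / fact m * s ^ m) + f (Suc n) t / fact (Suc n) * s ^ Suc n"
    using Maclaurin_all_le[of f "f 0" s "Suc n"] f by auto
  then show ?thesis using assms(2) by (simp add: lessThan_Suc_atMost)
qed

text \<open>Taylor expansion in the first variable has coefficients U i 0 (0, t); these are
  polynomials in \<open>t\<close> of degree at most \<open>k - i\<close>, because U i j vanishes for
  i + j > k. This produces the triangular index range of \<open>polys\<close>.\<close>

lemma polyjet_polys:
  assumes "polyjet k U"
  shows "U 0 0 \<in> polys k"
proof -
  have J: "jet U" and Z: "\<And>a b x. k < a + b \<Longrightarrow> U a b x = 0"
    using assms by (auto simp: polyjet_def)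
  have 1: "U 0 0 (pt s t) = (\<Sum>i\<le>k. U i 0 (pt 0 t) / fact i * s ^ i)" for s t
    by (rule taylor_exact[of "\<lambda>n s. U n 0 (pt s t)"]) (auto intro: jet_DERIV_1 J Z)
  have 2: "U i 0 (pt 0 t) = (\<Sum>j\<le>k - i. U i j (pt 0 0) / fact j * t ^ j)" if "i \<le> k" for i t
    by (rule taylor_exact[of "\<lambda>n t. U i n (pt 0 t)"]) (use that in \<open>auto intro!: jet_DERIV_2 J Z\<close>)
  define c where "c i j = U i j (pt 0 0) / fact j / fact i" for i j
  have "U 0 0 x = (\<Sum>i\<le>k. \<Sum>j\<le>k - i. c i j * (x $ 1) ^ i * (x $ 2) ^ j)" for x
  proof -
    have "U 0 0 x = (\<Sum>i\<le>k. U i 0 (pt 0 (x $ 2)) / fact i * (x $ 1) ^ i)"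
      using 1[of "x $ 1" "x $ 2"] by (simp add: pt_eta)
    also have "\<dots> = (\<Sum>i\<le>k. \<Sum>j\<le>k - i. c i j * (x $ 1) ^ i * (x $ 2) ^ j)"
      by (intro sum.cong refl) (simp add: 2 c_def sum_divide_distrib sum_distrib_right sum_distrib_left mult_ac)
    finally show ?thesis .
  qed
  then show ?thesis unfolding polys_def by blast
qed

section \<open>Newton form of the Lagrange interpolant\<close>

definition df :: "(nat \<Rightarrow> real) \<Rightarrow> nat \<Rightarrow> real" where
  "df w r = w (Suc r) - w r"

definition mdiff :: "nat \<Rightarrow> nat \<Rightarrow> (nat \<Rightarrow> nat \<Rightarrow> real) \<Rightarrow> nat \<Rightarrow> nat \<Rightarrow> real" where
  "mdiff i j W r s = (df ^^ i) (\<lambda>r'. (df ^^ j) (W r') s) r"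

definition grid_fun :: "nat \<Rightarrow> (plane \<Rightarrow> real) \<Rightarrow> nat \<Rightarrow> nat \<Rightarrow> real" where
  "grid_fun k f r s = f (pt (real r / real k) (real s / real k))"

text \<open>The binomial coefficient "k x choose i" as a polynomial in \<open>x\<close>; it takes
  integer values at the grid coordinates r / k.\<close>

definition newton_poly :: "nat \<Rightarrow> nat \<Rightarrow> real poly" where
  "newton_poly k i = smult (1 / fact i) (\<Prod>l<i. [:- real l, real k:])"

text \<open>Newton's forward difference form in two variables, with all its derivatives. The
  differences at the origin with i + j \<le> k see only the values \<open>W r s\<close> with r + s
  \<le> k, that is, the interpolation nodes.\<close>

definition newton_jet :: "nat \<Rightarrow> (nat \<Rightarrow> nat \<Rightarrow> real) \<Rightarrow> nat \<Rightarrow> nat \<Rightarrow> plane \<Rightarrow> real" where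
  "newton_jet k W a b x = (\<Sum>i\<le>k. \<Sum>j\<le>k - i. mdiff i j W 0 0 *
     (poly ((pderiv ^^ a) (newton_poly k i)) (x $ 1) * poly ((pderiv ^^ b) (newton_poly k j)) (x $ 2)))"

lemma df_funpow_diff: "(df ^^ n) (\<lambda>r. v r - w r) q = (df ^^ n) v q - (df ^^ n) w q"
  by (induction n arbitrary: q) (auto simp: df_def)

lemma df_funpow_Suc: "(df ^^ Suc n) w = (df ^^ n) (\<lambda>r. w (Suc r) - w r)"
proof -
  have "df w = (\<lambda>r. w (Suc r) - w r)" by (simp add: df_def fun_eq_iff)
  then show ?thesis by (simp add: funpow_swap1)
qed

lemma df_funpow_bound:
  "(\<And>q. r \<le> q \<Longrightarrow> q \<le> r + n \<Longrightarrow> \<bar>v q\<bar> \<le> c) \<Longrightarrow> \<bar>(df ^^ n) v r\<bar> \<le> 2 ^ n * c"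
proof (induction n arbitrary: r)
  case (Suc n)
  have "\<bar>(df ^^ n) v (Suc r)\<bar> \<le> 2 ^ n * c" "\<bar>(df ^^ n) v r\<bar> \<le> 2 ^ n * c"
    by (auto intro!: Suc)
  then show ?case by (auto simp: df_def[of "(df ^^ n) v"])
qed simp

lemma df_funpow_commute:
  "(df ^^ a) (\<lambda>r'. (df ^^ j) (Y r') s) r = (df ^^ j) (\<lambda>s'. (df ^^ a) (\<lambda>r'. Y r' s') r) s"
proof (induction a arbitrary: Y r)
  case (Suc a)
  then show ?case by (simp only: df_funpow_Suc flip: df_funpow_diff)
qed simp

text \<open>Every difference of order at least (a, b) is itself a difference of
  \<open>mdiff a b W\<close>. Hence a bound for the differences of order exactly (a, b) controls all
  the higher ones.\<close>

lemma mdiff_add: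
  "mdiff (i + a) (j + b) W r s = mdiff i j (mdiff a b W) r s"
proof -
  have "mdiff (i + a) (j + b) W r s = (df ^^ i) ((df ^^ a) (\<lambda>r'. (df ^^ j) ((df ^^ b) (W r')) s)) r"
    by (simp add: mdiff_def funpow_add)
  also have "(df ^^ a) (\<lambda>r'. (df ^^ j) ((df ^^ b) (W r')) s)
      = (\<lambda>r'. (df ^^ j) (mdiff a b W r') s)"
    unfolding mdiff_def[abs_def] by (rule ext) (rule df_funpow_commute)
  finally show ?thesis by (simp add: mdiff_def)
qed

lemma mdiff_bound:
  assumes "\<And>p q. r \<le> p \<Longrightarrow> p \<le> r + i \<Longrightarrow> s \<le> q \<Longrightarrow> q \<le> s + j \<Longrightarrow> \<bar>W p q\<bar> \<le> c"
  shows "\<bar>mdiff i j W r s\<bar> \<le> 2 ^ (i + j) * c"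
proof -
  have "\<bar>(df ^^ j) (W p) s\<bar> \<le> 2 ^ j * c" if "r \<le> p" "p \<le> r + i" for p
    using that by (intro df_funpow_bound assms)
  then have "\<bar>mdiff i j W r s\<bar> \<le> 2 ^ i * (2 ^ j * c)"
    unfolding mdiff_def by (intro df_funpow_bound[of r i "\<lambda>r'. (df ^^ j) (W r') s"])
  then show ?thesis by (simp add: power_add mult.assoc)
qed

lemma mdiff_Suc1: "mdiff (Suc i) j W = mdiff i j (\<lambda>r s. W (Suc r) s - W r s)"
  by (simp only: mdiff_def[abs_def] fun_eq_iff df_funpow_Suc df_funpow_diff) simp

lemma mdiff_Suc2: "mdiff i (Suc j) W = mdiff i j (\<lambda>r s. W r (Suc s) - W r s)"
  by (simp only: mdiff_def[abs_def] fun_eq_iff df_funpow_Suc) simp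

text \<open>The shift by \<open>r\<close> is the r-th power of identity plus difference, expanded by
  the binomial theorem. Pascal's rule splits the sum into the induction hypothesis for
  \<open>w\<close> and for its difference.\<close>

lemma newton_forward: "(\<Sum>i\<le>r. real (r choose i) * (df ^^ i) w q) = w (q + r)"
proof (induction r arbitrary: w)
  case (Suc r)
  have "(\<Sum>i\<le>Suc r. real (Suc r choose i) * (df ^^ i) w q)
      = (w q + (\<Sum>i\<le>r. real (r choose Suc i) * (df ^^ Suc i) w q)) + (\<Sum>i\<le>r. real (r choose i) * (df ^^ Suc i) w q)"
    by (subst sum.atMost_Suc_shift) (simp add: algebra_simps sum.distrib)
  also have "w q + (\<Sum>i\<le>r. real (r choose Suc i) * (df ^^ Suc i) w q)
      = (\<Sum>i\<le>Suc r. real (r choose i) * (df ^^ i) w q)"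
  proof -
    have "(\<Sum>i\<le>Suc r. real (r choose i) * (df ^^ i) w q)
        = w q + (\<Sum>i\<le>r. real (r choose Suc i) * (df ^^ Suc i) w q)"
      unfolding sum.atMost_Suc_shift by simp
    then show ?thesis by simp
  qed
  also have "\<dots> = w (q + r)" by (simp add: Suc.IH)
  finally have "(\<Sum>i\<le>Suc r. real (Suc r choose i) * (df ^^ i) w q)
      = w (q + r) + (\<Sum>i\<le>r. real (r choose i) * (df ^^ i) (\<lambda>r. w (Suc r) - w r) q)"
    unfolding df_funpow_Suc by simp
  then show ?case by (simp add: Suc.IH)
qed simp

lemma degree_newton_poly: "degree (newton_poly k i) \<le> i"
proof -
  have "degree (\<Prod>l<i. [:- real l, real k:]) \<le> sum (degree \<circ> (\<lambda>l. [:- real l, real k:])) {..<i}"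
    by (rule degree_prod_sum_le) simp
  also have "\<dots> \<le> (\<Sum>l<i. 1)" by (rule sum_mono) auto
  finally show ?thesis unfolding newton_poly_def by (simp add: degree_smult_le order_trans)
qed

lemma poly_newton_poly: "k > 0 \<Longrightarrow> poly (newton_poly k i) (real r / real k) = real (r choose i)"
  by (simp add: newton_poly_def poly_prod binomial_gbinomial gbinomial_prod_rev lessThan_atLeast0)

lemma polyjet_newton: "polyjet k (newton_jet k W)"
  unfolding newton_jet_def[abs_def]
proof (intro polyjet_sum polyjet_scale polyjet_tensor)
  fix i j assume "i \<in> {..k}" "j \<in> {..k - i}"
  then show "degree (newton_poly k i) + degree (newton_poly k j) \<le> k"
    using degree_newton_poly[of k i] degree_newton_poly[of k j] by simp
qed

text \<open>At the node (r, s) the binomial factors vanish for i > r or j > s. The triangular sum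
  therefore reduces to the rectangle i \<le> r, j \<le> s, which lies in the triangle as r + s \<le>
  k, and there Newton's formula applies in each index separately.\<close>

lemma newton_interpolates:
  assumes k: "k > 0" and rs: "r + s \<le> k"
  shows "newton_jet k W 0 0 (pt (real r / real k) (real s / real k)) = W r s"
proof -
  have "newton_jet k W 0 0 (pt (real r / real k) (real s / real k))
      = (\<Sum>i\<le>k. \<Sum>j\<le>k - i. mdiff i j W 0 0 * (real (r choose i) * real (s choose j)))"
    by (simp add: newton_jet_def poly_newton_poly k)
  also have "\<dots> = (\<Sum>i\<le>r. \<Sum>j\<le>k - i. mdiff i j W 0 0 * (real (r choose i) * real (s choose j)))"
    using rs by (intro sum.mono_neutral_right) (auto intro!: sum.neutral simp: binomial_eq_0)
  also have "\<dots> = (\<Sum>i\<le>r. \<Sum>j\<le>s. mdiff i j W 0 0 * (real (r choose i) * real (s choose j)))"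
    using rs by (intro sum.cong refl sum.mono_neutral_right) auto
  also have "\<dots> = (\<Sum>i\<le>r. real (r choose i) * (\<Sum>j\<le>s. real (s choose j) * mdiff i j W 0 0))"
    by (simp add: sum_distrib_left algebra_simps)
  also have "\<dots> = (\<Sum>i\<le>r. real (r choose i) * (df ^^ i) (\<lambda>r'. W r' s) 0)"
  proof (intro sum.cong refl)
    fix i
    have "(\<Sum>j\<le>s. real (s choose j) * mdiff i j W 0 0)
        = (\<Sum>j\<le>s. real (s choose j) * (df ^^ j) (\<lambda>s'. (df ^^ i) (\<lambda>r'. W r' s') 0) 0)"
      unfolding mdiff_def by (subst df_funpow_commute) (rule refl)
    also have "\<dots> = (df ^^ i) (\<lambda>r'. W r' s) 0"
      using newton_forward[of s "\<lambda>s'. (df ^^ i) (\<lambda>r'. W r' s') 0" 0] by simp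
    finally show "real (r choose i) * (\<Sum>j\<le>s. real (s choose j) * mdiff i j W 0 0)
        = real (r choose i) * (df ^^ i) (\<lambda>r'. W r' s) 0" by simp
  qed
  also have "\<dots> = W r s" by (simp add: newton_forward[of r _ 0, simplified])
  finally show ?thesis .
qed

text \<open>The derivative at a point is unique, so each member determines the next ones. Identities
  between families need to be checked only for the functions of order zero.\<close>

lemma jet_unique:
  assumes "jet U" "jet V" "U 0 0 = V 0 0"
  shows "U a b = V a b"
proof -
  have step: "U (Suc a) b = V (Suc a) b \<and> U a (Suc b) = V a (Suc b)" if "U a b = V a b" for a b
  proof -
    have E: "(\<lambda>h :: plane. h $ 1 * U (Suc a) b x + h $ 2 * U a (Suc b) x)
        = (\<lambda>h. h $ 1 * V (Suc a) b x + h $ 2 * V a (Suc b) x)" for x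
      by (rule has_derivative_unique[OF jetD[OF assms(1), of a b x]
            jetD[OF assms(2), of a b x, folded that]])
    have "h $ 1 * U (Suc a) b x + h $ 2 * U a (Suc b) x = h $ 1 * V (Suc a) b x + h $ 2 * V a (Suc b) x"
      for h x :: plane
      using fun_cong[OF E[of x], of h] by (simp only:)
    from this[of "pt 1 0"] this[of "pt 0 1"] show ?thesis by (simp add: fun_eq_iff)
  qed
  have *: "U a 0 = V a 0"
  proof (induction a)
    case (Suc a) then show ?case using step by blast
  qed (rule assms(3))
  show ?thesis
  proof (induction b)
    case (Suc b) then show ?case using step by blast
  qed (rule *)
qed

section \<open>Unisolvence of the grid for polynomials\<close>

lemma polyjet_top_const:
  assumes "polyjet n U" "a + b = n"
  shows "U a b x = U a b y"
proof -
  have "polyjet 0 (\<lambda>a' b'. U (a' + a) (b' + b))"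
    using assms by (auto simp: polyjet_def intro: jet_shift)
  from polyjet_polys[OF this] obtain c :: "nat \<Rightarrow> nat \<Rightarrow> real" where "\<forall>x. U a b x = c 0 0"
    by (auto simp: polys_def)
  then show ?thesis by simp
qed

lemma aff_id: "aff z (pt 1 0) (pt 0 1) x = z + x"
  by (simp add: aff_def vec_eq_iff forall_2)

lemma pull_dirs_id: "pull_dirs (pt 1 0) (pt 0 1) U a b = U a b"
proof -
  have "(dir_shift (pt 0 1) ^^ b) U = (\<lambda>i j. U i (j + b))" for b
    by (induction b) (auto simp: dir_shift_def)
  moreover have "(dir_shift (pt 1 0) ^^ a) V = (\<lambda>i j. V (i + a) j)" for a V
    by (induction a) (auto simp: dir_shift_def)
  ultimately show ?thesis by (simp add: pull_dirs_def)
qed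

lemma polyjet_translate: "polyjet n U \<Longrightarrow> polyjet n (\<lambda>a b x. U a b (z + x))"
  using polyjet_affine[of n U "pt 1 0" "pt 0 1" z] by (simp add: aff_id pull_dirs_id)

text \<open>The derivatives of top order are constant and cancel in the difference, which lowers the
  degree by one.\<close>

lemma polyjet_difference:
  assumes "polyjet (Suc n) U"
  shows "polyjet n (\<lambda>a b x. U a b (z + x) - U a b x)"
proof -
  have "polyjet (Suc n) (\<lambda>a b x. U a b (z + x) - U a b x)"
    by (intro polyjet_diff polyjet_translate assms)
  moreover have "U a b (z + x) - U a b x = 0" if "a + b = Suc n" for a b x
    using polyjet_top_const[OF assms that, of "z + x" x] by simp
  ultimately show ?thesis
    unfolding polyjet_def
  proof (intro conjI allI impI)
    fix a b assume V: "jet (\<lambda>a b x. U a b (z + x) - U a b x) \<and>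
        (\<forall>a b. Suc n < a + b \<longrightarrow> (\<lambda>x. U a b (z + x) - U a b x) = (\<lambda>_. 0))"
      and top: "\<And>a b x. a + b = Suc n \<Longrightarrow> U a b (z + x) - U a b x = 0" and n: "n < a + b"
    show "(\<lambda>x. U a b (z + x) - U a b x) = (\<lambda>_. 0)"
    proof (cases "a + b = Suc n")
      case True show ?thesis by (rule ext, rule top[OF True])
    next
      case False then show ?thesis using V n by auto
    qed
  qed simp
qed

lemma pt_add: "pt a b + pt c d = pt (a + c) (b + d)"
  by (simp add: vec_eq_iff forall_2)

text \<open>On polynomials of degree \<open>n\<close> the difference quotients of order
  \<open>n\<close> are exact. One difference in either direction gives a polynomial of degree one
  less, to which the induction hypothesis applies.\<close>

lemma mdiff_top:
  assumes "polyjet n U" "a + b = n" "k > 0"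
  shows "real k ^ n * mdiff a b (grid_fun k (U 0 0)) r s = U a b 0"
  using assms(1,2)
proof (induction n arbitrary: U a b)
  case 0
  then show ?case using polyjet_top_const[OF 0(1), of 0 0 _ 0]
    by (simp add: mdiff_def grid_fun_def)
next
  case (Suc n)
  have J: "jet U" using Suc.prems by (simp add: polyjet_def)
  note const = polyjet_top_const[OF Suc.prems, of _ 0]
  define h where "h = 1 / real k"
  have h: "h > 0" using assms by (simp add: h_def)
  consider a' where "a = Suc a'" | b' where "b = Suc b'" using Suc.prems by (cases a; cases b) auto
  then show ?case
  proof cases
    case 1
    define V where "V = (\<lambda>a b x. U a b (pt h 0 + x) - U a b x)"
    have V: "polyjet n V" unfolding V_def by (rule polyjet_difference) (use Suc in auto)
    have "(\<lambda>r s. grid_fun k (U 0 0) (Suc r) s - grid_fun k (U 0 0) r s) = grid_fun k (V 0 0)"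
      by (simp add: V_def grid_fun_def h_def add_divide_distrib fun_eq_iff pt_add)
    then have "real k ^ n * mdiff a b (grid_fun k (U 0 0)) r s = V a' b 0"
      using Suc.IH[OF V, of a' b] Suc.prems by (simp add: 1 mdiff_Suc1)
    also have "V a' b 0 = U a' b (pt h 0) - U a' b (pt 0 0)"
      using pt_eta[of 0] by (simp add: V_def)
    \<comment> \<open>The intermediate point is irrelevant, because the derivative of top order is
      constant.\<close>
    also obtain z where "U a' b (pt h 0) - U a' b (pt 0 0) = (h - 0) * U (Suc a') b (pt z 0)"
      using MVT2[OF h, of "\<lambda>s. U a' b (pt s 0)" "\<lambda>s. U (Suc a') b (pt s 0)"] jet_DERIV_1[OF J] by blast
    also have "(h - 0) * U (Suc a') b (pt z 0) = h * U a b 0" using const 1 by simp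
    finally show ?thesis using assms by (simp add: h_def field_simps)
  next
    case 2
    define V where "V = (\<lambda>a b x. U a b (pt 0 h + x) - U a b x)"
    have V: "polyjet n V" unfolding V_def by (rule polyjet_difference) (use Suc in auto)
    have "(\<lambda>r s. grid_fun k (U 0 0) r (Suc s) - grid_fun k (U 0 0) r s) = grid_fun k (V 0 0)"
      by (simp add: V_def grid_fun_def h_def add_divide_distrib fun_eq_iff pt_add)
    then have "real k ^ n * mdiff a b (grid_fun k (U 0 0)) r s = V a b' 0"
      using Suc.IH[OF V, of a b'] Suc.prems by (simp add: 2 mdiff_Suc2)
    also have "V a b' 0 = U a b' (pt 0 h) - U a b' (pt 0 0)"
      using pt_eta[of 0] by (simp add: V_def)
    also obtain z where "U a b' (pt 0 h) - U a b' (pt 0 0) = (h - 0) * U a (Suc b') (pt 0 z)"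
      using MVT2[OF h, of "\<lambda>s. U a b' (pt 0 s)" "\<lambda>s. U a (Suc b') (pt 0 s)"] jet_DERIV_2[OF J] by blast
    also have "(h - 0) * U a (Suc b') (pt 0 z) = h * U a b 0" using const 2 by simp
    finally show ?thesis using assms by (simp add: h_def field_simps)
  qed
qed

text \<open>By \<open>mdiff_top\<close> the derivatives of top order are multiples of differences of
  the zero grid values, so they vanish and the degree drops. The degree \<open>n\<close> is separate
  from \<open>k\<close> so that the induction lowers it while the grid stays fixed.\<close>

lemma polyjet_zero_on_grid:
  assumes "polyjet n U" "n \<le> k" "k > 0"
    and "\<And>r s. r + s \<le> k \<Longrightarrow> U 0 0 (pt (real r / real k) (real s / real k)) = 0"
  shows "U a b = (\<lambda>_. 0)"
proof -
  have top: "U a b x = 0" if "polyjet n U" "a + b = n" "n \<le> k" for a b n x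
  proof -
    have "\<bar>mdiff a b (grid_fun k (U 0 0)) 0 0\<bar> \<le> 2 ^ (a + b) * 0"
      using assms(4) that by (intro mdiff_bound) (auto simp: grid_fun_def)
    then have "U a b 0 = 0" using mdiff_top[OF that(1,2) assms(3), of 0 0] by simp
    then show ?thesis using polyjet_top_const[OF that(1,2), of x 0] by simp
  qed
  from assms(1,2) have "\<forall>a b. U a b = (\<lambda>_. 0)"
  proof (induction n)
    case 0
    have "U 0 0 x = 0" for x by (rule top[OF 0(1)]) auto
    then have "U a b = (\<lambda>_. 0)" for a b
      using 0 by (cases "a + b = 0") (auto simp: polyjet_def)
    then show ?case by blast
  next
    case (Suc n)
    have "polyjet n U"
      unfolding polyjet_def
    proof (intro conjI allI impI)
      show "jet U" using Suc.prems by (simp add: polyjet_def)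
      fix a b assume "n < a + b"
      then consider "a + b = Suc n" | "Suc n < a + b" by linarith
      then show "U a b = (\<lambda>_. 0)"
      proof cases
        case 1 show ?thesis by (rule ext, rule top[OF Suc.prems(1) 1 Suc.prems(2)])
      next
        case 2 then show ?thesis using Suc.prems by (simp add: polyjet_def)
      qed
    qed
    then show ?case using Suc by simp
  qed
  then show ?thesis by blast
qed

text \<open>Interpolant and polynomial agree on the grid, so their difference is zero by
  unisolvence, with all its derivatives.\<close>

lemma newton_poly_reproduces:
  assumes "polyjet k U" "k > 0"
  shows "newton_jet k (grid_fun k (U 0 0)) a b = U a b"
proof -
  have "polyjet k (\<lambda>a b x. newton_jet k (grid_fun k (U 0 0)) a b x - U a b x)"
    by (intro polyjet_diff polyjet_newton assms)
  from polyjet_zero_on_grid[OF this, of k a b] have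
    "(\<lambda>x. newton_jet k (grid_fun k (U 0 0)) a b x - U a b x) = (\<lambda>_. 0)"
    using assms(2) by (simp add: newton_interpolates grid_fun_def)
  then show ?thesis by (simp add: fun_eq_iff)
qed

lemma newton_jet_diff:
  "newton_jet k (grid_fun k (\<lambda>x. f x - g x)) a b x
     = newton_jet k (grid_fun k f) a b x - newton_jet k (grid_fun k g) a b x"
proof -
  have "mdiff i j (grid_fun k (\<lambda>x. f x - g x)) 0 0
      = mdiff i j (grid_fun k f) 0 0 - mdiff i j (grid_fun k g) 0 0" for i j
    by (simp add: mdiff_def grid_fun_def[abs_def] df_funpow_diff)
  then show ?thesis by (simp add: newton_jet_def left_diff_distrib sum_subtractf)
qed

section \<open>The unit triangle and polynomials with prescribed mean derivatives\<close>

definition unit_tri :: "plane set" where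
  "unit_tri = {x. 0 \<le> x $ 1 \<and> 0 \<le> x $ 2 \<and> x $ 1 + x $ 2 \<le> 1}"

lemma compact_unit_tri: "compact unit_tri"
proof -
  have "closed unit_tri" unfolding unit_tri_def
    by (intro closed_Collect_conj closed_Collect_le continuous_intros)
  moreover have "unit_tri \<subseteq> cbox 0 (pt 1 1)"
    by (auto simp: unit_tri_def mem_box_cart forall_2)
  ultimately show ?thesis by (meson bounded_cbox bounded_subset compact_eq_bounded_closed)
qed

lemma convex_unit_tri: "convex unit_tri"
proof -
  have "u * x1 + v * y1 + (u * x2 + v * y2) \<le> 1"
    if "x1 + x2 \<le> 1" "y1 + y2 \<le> 1" "0 \<le> u" "0 \<le> v" "u + v = 1" for u v x1 x2 y1 y2 :: real
    using convex_bound_le[OF that] by (simp add: algebra_simps)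
  then show ?thesis by (auto simp: convex_def unit_tri_def)
qed

lemma integrable_on_compact:
  fixes f :: "plane \<Rightarrow> real"
  assumes "compact S" "continuous_on S f"
  shows "f integrable_on S"
proof -
  have "set_integrable lborel S f" unfolding set_integrable_def
    using borel_integrable_compact[OF assms] by simp
  then show ?thesis by (rule set_borel_integral_eq_integral(1))
qed

lemma jet_integrable: "jet U \<Longrightarrow> U a b integrable_on unit_tri"
  by (intro integrable_on_compact compact_unit_tri jet_continuous)

lemma pderiv_funpow_monom: "(pderiv ^^ i) (monom c i) = [:fact i * c :: real:]"
proof (induction i arbitrary: c)
  case (Suc i)
  have "(pderiv ^^ Suc i) (monom c (Suc i)) = (pderiv ^^ i) (pderiv (monom c (Suc i)))"
    by (simp only: funpow_Suc_right o_apply)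
  then show ?case by (simp add: pderiv_monom Suc algebra_simps del: funpow.simps)
qed (simp add: monom_0)

text \<open>The system is triangular in the order of the derivative. A homogeneous polynomial of
  degree \<open>k\<close> settles the means of order \<open>k\<close>; the lower means are then
  corrected by a polynomial of smaller degree, whose derivatives of order \<open>k\<close>
  vanish.\<close>

lemma polyjet_prescribed_means:
  fixes c :: "nat \<Rightarrow> nat \<Rightarrow> real"
  assumes \<mu>: "integral unit_tri (\<lambda>_. 1 :: real) = \<mu>" "\<mu> \<noteq> 0"
  shows "\<exists>Q. polyjet k Q \<and> (\<forall>a b. a + b \<le> k \<longrightarrow> integral unit_tri (Q a b) = c a b)"
proof -
  have top: "\<exists>M. polyjet k M \<and> (\<forall>a b. a + b = k \<longrightarrow> integral unit_tri (M a b) = c a b)" for c k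
  proof -
    \<comment> \<open>The monomials of degree \<open>k\<close> are dual to the derivatives of order
      \<open>k\<close> up to the factorials; division by the area \<open>\<mu>\<close> turns the
      constant derivative into the required integral.\<close>
    define M where "M = (\<lambda>a b x. \<Sum>i\<le>k. c i (k - i) / (\<mu> * fact i * fact (k - i)) *
      (poly ((pderiv ^^ a) (monom 1 i)) (x $ 1) * poly ((pderiv ^^ b) (monom 1 (k - i))) ((x :: plane) $ 2)))"
    have "polyjet k M" unfolding M_def
      by (intro polyjet_sum polyjet_scale polyjet_tensor) (auto simp: degree_monom_eq)
    moreover have "integral unit_tri (M a b) = c a b" if ab: "a + b = k" for a b
    proof -
      have "M a b x = c a b / \<mu>" for x
      proof -
        have b: "b = k - a" "a \<in> {..k}" using ab by auto
        have "M a b x = (\<Sum>i\<in>{..k}. if i = a then c a b / \<mu> else 0)"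
          unfolding M_def
        proof (intro sum.cong refl)
          fix i assume i: "i \<in> {..k}"
          \<comment> \<open>If i \<noteq> a, one exponent of the monomial is smaller than the order
            of differentiation in that variable.\<close>
          consider "i = a" | "i < a" | "k - i < b" using ab i by fastforce
          then show "c i (k - i) / (\<mu> * fact i * fact (k - i)) *
              (poly ((pderiv ^^ a) (monom 1 i)) (x $ 1) * poly ((pderiv ^^ b) (monom 1 (k - i))) (x $ 2))
            = (if i = a then c a b / \<mu> else 0)"
          proof cases
            case 1 then show ?thesis using b by (simp add: pderiv_funpow_monom)
          next
            case 2 then show ?thesis by (simp add: pderiv_funpow_0 degree_monom_eq)
          next
            case 3 then show ?thesis using ab i by (simp add: pderiv_funpow_0 degree_monom_eq)
          qed
        qed
        then show ?thesis using b by (simp add: sum.delta)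
      qed
      then have "M a b = (\<lambda>x. c a b / \<mu> * 1)" by auto
      then show ?thesis by (simp only: integral_mult_right \<mu>) (use \<mu> in simp)
    qed
    ultimately show ?thesis by blast
  qed
  show ?thesis
  proof (induction k arbitrary: c)
    case 0 show ?case using top[of 0 c] by auto
  next
    case (Suc k)
    obtain M where M: "polyjet (Suc k) M" "\<And>a b. a + b = Suc k \<Longrightarrow> integral unit_tri (M a b) = c a b"
      using top[of "Suc k" c] by blast
    obtain Q where Q: "polyjet k Q"
        "\<And>a b. a + b \<le> k \<Longrightarrow> integral unit_tri (Q a b) = c a b - integral unit_tri (M a b)"
      using Suc[of "\<lambda>a b. c a b - integral unit_tri (M a b)"] by blast
    have "integral unit_tri (\<lambda>x. M a b x + Q a b x) = c a b" if "a + b \<le> Suc k" for a b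
    proof -
      have "integral unit_tri (\<lambda>x. M a b x + Q a b x) = integral unit_tri (M a b) + integral unit_tri (Q a b)"
        using M Q by (intro integral_add jet_integrable) (auto simp: polyjet_def)
      moreover have "Q a b = (\<lambda>_. 0)" if "a + b = Suc k" using Q(1) that by (simp add: polyjet_def)
      ultimately show ?thesis using M(2) Q(2) that by (cases "a + b = Suc k") auto
    qed
    moreover have "polyjet (Suc k) (\<lambda>a b x. M a b x + Q a b x)"
      by (intro polyjet_add M polyjet_mono[OF Q(1)]) simp
    ultimately show ?case by blast
  qed
qed

section \<open>Poincare's inequality\<close>

lemma powr_above_tangent:
  fixes u v p :: real
  assumes "1 \<le> p" "0 < u" "0 \<le> v"
  shows "u powr p + p * u powr (p - 1) * (v - u) \<le> v powr p"
proof (cases "v = 0")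
  case True
  have "u powr (p - 1) * u = u powr p" using assms by (simp add: powr_mult_base mult.commute)
  moreover have "p * u powr (p - 1) * (v - u) = - (p * (u powr (p - 1) * u))" using True by simp
  ultimately have "p * u powr (p - 1) * (v - u) = - (p * u powr p)" by simp
  moreover have "1 * u powr p \<le> p * u powr p" using assms by (intro mult_right_mono) auto
  moreover have "v powr p = 0" using True by simp
  ultimately show ?thesis by linarith
next
  case False
  have "v powr p - u powr p \<ge> (p * u powr (p - 1)) * (v - u)"
  proof (rule convex_on_imp_above_tangent[OF powr_convex[OF assms(1)]])
    show "((\<lambda>x. x powr p) has_real_derivative p * u powr (p - 1)) (at u within {0<..})"
      using assms by (auto intro!: derivative_eq_intros)
  qed (use assms False in \<open>auto simp: interior_open\<close>)
  then show ?thesis by simp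
qed

lemma powr_le_1_plus:
  fixes v p :: real
  assumes "1 \<le> p" "0 \<le> v"
  shows "v \<le> 1 + v powr p"
proof (cases "v \<le> 1")
  case False
  then have "v powr 1 \<le> v powr p" using assms by (intro powr_mono) auto
  then show ?thesis using False by simp
qed (use assms in \<open>simp add: add.commute add_increasing2\<close>)

text \<open>Integrate the tangent inequality taken at the mean of \<open>f\<close>. It needs a
  positive point of tangency; for mean zero the left side is zero.\<close>

lemma (in prob_space) jensen_powr:
  fixes f :: "'a \<Rightarrow> real"
  assumes p: "1 \<le> p" and [measurable]: "f \<in> borel_measurable M" and f: "\<And>x. x \<in> space M \<Longrightarrow> 0 \<le> f x"
    and int: "integrable M (\<lambda>x. f x powr p)"
  shows "integrable M f" "(\<integral>x. f x \<partial>M) powr p \<le> (\<integral>x. f x powr p \<partial>M)"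
proof -
  show i: "integrable M f"
  proof (rule Bochner_Integration.integrable_bound)
    show "integrable M (\<lambda>x. 1 + f x powr p)" using int by simp
    show "AE x in M. norm (f x) \<le> norm (1 + f x powr p)"
      using powr_le_1_plus[OF p f] f by (intro AE_I2) (auto simp: add_nonneg_nonneg)
  qed simp
  define u where "u = (\<integral>x. f x \<partial>M)"
  have u: "0 \<le> u" unfolding u_def by (intro integral_nonneg_AE AE_I2 f)
  show "(\<integral>x. f x \<partial>M) powr p \<le> (\<integral>x. f x powr p \<partial>M)"
  proof (cases "u = 0")
    case True then show ?thesis by (simp flip: u_def)
  next
    case False
    have "(\<integral>x. u powr p + p * u powr (p - 1) * (f x - u) \<partial>M) \<le> (\<integral>x. f x powr p \<partial>M)"
      using i int powr_above_tangent[OF p _ f] False u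
      by (intro integral_mono) auto
    also have "(\<integral>x. u powr p + p * u powr (p - 1) * (f x - u) \<partial>M)
        = u powr p + p * u powr (p - 1) * ((\<integral>x. f x \<partial>M) - u)"
      using i by (simp add: prob_space)
    finally show ?thesis by (simp add: u_def)
  qed
qed

text \<open>The same argument for averages in the gauge integral; it is applied on
  \<open>unit_tri\<close> and on the unit interval.\<close>

lemma jensen_integral:
  fixes f :: "'a::euclidean_space \<Rightarrow> real"
  assumes p: "1 \<le> p" and \<mu>: "((\<lambda>_. 1 :: real) has_integral \<mu>) S" "0 < \<mu>"
    and f: "\<And>x. x \<in> S \<Longrightarrow> 0 \<le> f x"
    and i: "f integrable_on S" and int: "(\<lambda>x. f x powr p) integrable_on S"
  shows "(integral S f / \<mu>) powr p \<le> integral S (\<lambda>x. f x powr p) / \<mu>"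
proof -
  define u where "u = integral S f / \<mu>"
  have u: "0 \<le> u" unfolding u_def using \<mu> i f by (auto intro!: divide_nonneg_pos integral_nonneg)
  have one: "(\<lambda>_. 1 :: real) integrable_on S" "integral S (\<lambda>_. 1 :: real) = \<mu>"
    using \<mu> by auto
  have const: "(\<lambda>_. c :: real) integrable_on S" "integral S (\<lambda>_. c :: real) = c * \<mu>" for c
    using integrable_on_cmult_left[OF one(1), of c] integral_mult_right[of S c "\<lambda>_. 1 :: real"] one(2) by auto
  show ?thesis
  proof (cases "u = 0")
    case True
    have "0 \<le> integral S (\<lambda>x. f x powr p)" by (intro integral_nonneg int) auto
    then show ?thesis using True \<mu> by (simp flip: u_def)
  next
    case False
    have "integral S (\<lambda>x. u powr p + p * u powr (p - 1) * (f x - u)) \<le> integral S (\<lambda>x. f x powr p)"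
      using i int const powr_above_tangent[OF p _ f] False u
      by (intro integral_le integrable_add integrable_on_mult_right integrable_diff) auto
    also have "integral S (\<lambda>x. u powr p + p * u powr (p - 1) * (f x - u))
        = u powr p * \<mu> + p * u powr (p - 1) * (integral S f - u * \<mu>)"
      using i const
      by (subst integral_add) (auto intro!: integrable_on_mult_right integrable_diff simp: integral_diff)
    also have "u * \<mu> = integral S f" using \<mu> by (simp add: u_def)
    finally show ?thesis using \<mu> by (simp add: pos_le_divide_eq flip: u_def)
  qed
qed

text \<open>Every summand is at most the maximum, whose p-th power is one of the terms on the right.
  The number of terms is deliberately left inside a p-th power.\<close>

lemma sum_powr_le:
  fixes a :: "'i \<Rightarrow> real"
  assumes "finite I" "\<And>i. i \<in> I \<Longrightarrow> 0 \<le> a i" "1 \<le> p"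
  shows "(\<Sum>i\<in>I. a i) powr p \<le> real (card I) powr p * (\<Sum>i\<in>I. a i powr p)"
proof (cases "I = {}")
  case False
  define m where "m = Max (a ` I)"
  have "m \<in> a ` I" unfolding m_def using assms False by (intro Max_in) auto
  then obtain j where j: "j \<in> I" "a j = m" by auto
  have "(\<Sum>i\<in>I. a i) \<le> (\<Sum>i\<in>I. m)"
    by (intro sum_mono) (auto simp: m_def assms)
  then have "(\<Sum>i\<in>I. a i) powr p \<le> (real (card I) * m) powr p"
    using assms by (intro powr_mono2 sum_nonneg) auto
  also have "\<dots> = real (card I) powr p * m powr p"
    using assms j by (simp add: powr_mult)
  also have "m powr p \<le> (\<Sum>i\<in>I. a i powr p)"
    unfolding j(2)[symmetric] using assms j by (intro member_le_sum) auto
  finally show ?thesis by (simp add: mult_left_mono)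
qed simp

lemma powr_add_le:
  fixes a b p :: real
  assumes "0 \<le> a" "0 \<le> b" "1 \<le> p"
  shows "(a + b) powr p \<le> 2 powr p * (a powr p + b powr p)"
proof -
  have "(a + b) powr p \<le> (2 * max a b) powr p" using assms by (intro powr_mono2) auto
  also have "\<dots> = 2 powr p * (max a b) powr p" using assms by (simp add: powr_mult)
  also have "(max a b) powr p \<le> a powr p + b powr p" by (simp add: max_def)
  finally show ?thesis by (simp add: mult_left_mono)
qed

section \<open>From gauge integrals to nonnegative integrals, where Tonelli's theorem
  applies\<close>

lemma nn_integral_compact:
  fixes g :: "plane \<Rightarrow> real"
  assumes "compact S" "continuous_on S g" "\<And>x. x \<in> S \<Longrightarrow> 0 \<le> g x"
  shows "(\<integral>\<^sup>+x. ennreal (indicator S x * g x) \<partial>lborel) = ennreal (integral S g)"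
proof -
  have i: "integrable lborel (\<lambda>x. indicator S x *\<^sub>R g x)"
    by (rule borel_integrable_compact[OF assms(1,2)])
  then have "(\<integral>\<^sup>+x. ennreal (indicator S x * g x) \<partial>lborel) = ennreal (\<integral>x. indicator S x *\<^sub>R g x \<partial>lborel)"
    using assms(3) by (subst nn_integral_eq_integral) (auto simp: indicator_def)
  also have "(\<integral>x. indicator S x *\<^sub>R g x \<partial>lborel) = integral S g"
    using set_borel_integral_eq_integral(2)[of S g] i by (simp add: set_integrable_def set_lebesgue_integral_def)
  finally show ?thesis .
qed

lemma nn_integral_unit_interval:
  fixes g :: "real \<Rightarrow> real"
  assumes "continuous_on {0..1} g" "\<And>x. 0 \<le> g x"
  shows "(\<integral>\<^sup>+x. ennreal (indicator {0..1} x * g x) \<partial>lborel) = ennreal (integral {0..1} g)"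
proof -
  have i: "integrable lborel (\<lambda>x. indicator {0..1} x *\<^sub>R g x)"
    by (rule borel_integrable_compact[OF _ assms(1)]) simp
  then have "(\<integral>\<^sup>+x. ennreal (indicator {0..1} x * g x) \<partial>lborel) = ennreal (\<integral>x. indicator {0..1} x *\<^sub>R g x \<partial>lborel)"
    using assms(2) by (subst nn_integral_eq_integral) (auto simp: indicator_def)
  also have "(\<integral>x. indicator {0..1} x *\<^sub>R g x \<partial>lborel) = integral {0..1} g"
    using set_borel_integral_eq_integral(2)[of "{0..1}" g] i by (simp add: set_integrable_def set_lebesgue_integral_def)
  finally show ?thesis .
qed

lemma nn_integral_plane_affine:
  fixes f :: "plane \<Rightarrow> ennreal"
  assumes [measurable]: "f \<in> borel_measurable borel" and c: "c \<noteq> 0"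
  shows "(\<integral>\<^sup>+x. f x \<partial>lborel) = ennreal (c\<^sup>2) * (\<integral>\<^sup>+x. f (t + c *\<^sub>R x) \<partial>lborel)"
  by (subst lborel_affine[OF c, of t])
     (simp add: nn_integral_density nn_integral_distr nn_integral_cmult)

definition area :: real where "area = integral unit_tri (\<lambda>_. 1 :: real)"

lemma area_has_integral: "((\<lambda>_. 1 :: real) has_integral area) unit_tri"
  unfolding area_def by (intro integrable_integral integrable_on_compact compact_unit_tri) simp

lemma content_cbox_pt: "a \<le> c \<Longrightarrow> b \<le> d \<Longrightarrow> measure lborel (cbox (pt a b) (pt c d)) = (c - a) * (d - b)"
  by (subst content_cbox_cart)
    (auto simp: interval_eq_empty_cart UNIV_2 forall_2 not_less dest: spec[of _ "1::2"] spec[of _ "2::2"] intro: exI[of _ 1])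

lemma area_pos: "0 < area" and area_le_1: "area \<le> 1"
proof -
  have 1: "integral (cbox (pt a b) (pt c d)) (\<lambda>_. 1 :: real) = (c - a) * (d - b)" if "a \<le> c" "b \<le> d" for a b c d
    using content_cbox_pt[OF that] by simp
  have "integral (cbox (pt 0 0) (pt (1/2) (1/2))) (\<lambda>_. 1 :: real) \<le> area"
    unfolding area_def
    by (rule integral_subset_le)
      (auto simp: unit_tri_def mem_box_cart forall_2 intro!: integrable_on_compact compact_unit_tri[unfolded unit_tri_def])
  then show "0 < area" by (subst (asm) 1) auto
  have "area \<le> integral (cbox (pt 0 0) (pt 1 1)) (\<lambda>_. 1 :: real)"
    unfolding area_def
    by (rule integral_subset_le)
      (auto simp: unit_tri_def mem_box_cart forall_2 intro!: integrable_on_compact compact_unit_tri[unfolded unit_tri_def])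
  then show "area \<le> 1" by (subst (asm) 1) auto
qed

section \<open>Differences along segments and Poincare's inequality\<close>

definition grad1 :: "(nat \<Rightarrow> nat \<Rightarrow> plane \<Rightarrow> real) \<Rightarrow> nat \<Rightarrow> nat \<Rightarrow> plane \<Rightarrow> real" where
  "grad1 U a b x = \<bar>U (Suc a) b x\<bar> + \<bar>U a (Suc b) x\<bar>"

lemma grad1_continuous: "jet U \<Longrightarrow> continuous_on S (grad1 U a b)"
  unfolding grad1_def[abs_def] by (intro continuous_intros jet_continuous)

lemma continuous_powr_p:
  fixes g :: "'a::topological_space \<Rightarrow> real"
  assumes "continuous_on S g" "1 \<le> p"
  shows "continuous_on S (\<lambda>x. \<bar>g x\<bar> powr p)"
  using assms by (intro continuous_on_powr' continuous_intros) auto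

text \<open>Fundamental theorem of calculus along the segment from \<open>x\<close> to
  \<open>y\<close>, followed by Jensen's inequality on the unit interval, whose length is
  one.\<close>

lemma jet_segment:
  assumes "jet U" "x \<in> unit_tri" "y \<in> unit_tri" "1 \<le> p"
  shows "\<bar>U a b x - U a b y\<bar> powr p \<le> integral {0..1} (\<lambda>t. (grad1 U a b (x + t *\<^sub>R (y - x))) powr p)"
proof -
  let ?l = "\<lambda>t. x + t *\<^sub>R (y - x)"
  have cl: "continuous_on S ?l" for S by (intro continuous_intros)
  define g' where "g' t = (y - x) $ 1 * U (Suc a) b (?l t) + (y - x) $ 2 * U a (Suc b) (?l t)" for t
  have d: "((\<lambda>t. U a b (?l t)) has_vector_derivative g' t) (at t within {0..1})" for t
  proof -
    have "(?l has_derivative (\<lambda>h. h *\<^sub>R (y - x))) (at t)"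
      by (auto intro!: derivative_eq_intros)
    from has_derivative_compose[OF this jetD[OF assms(1)]]
    have "((\<lambda>t. U a b (?l t)) has_derivative (\<lambda>h. h *\<^sub>R g' t)) (at t)"
      by (rule has_derivative_eq_rhs) (simp add: g'_def fun_eq_iff algebra_simps)
    then show ?thesis by (simp add: has_vector_derivative_def has_derivative_at_withinI)
  qed
  have int: "(g' has_integral U a b y - U a b x) {0..1}"
    using fundamental_theorem_of_calculus[OF _ d] by simp
  have cU: "continuous_on S (\<lambda>t. U i j (?l t))" for S i j
    by (rule continuous_on_compose2[OF jet_continuous[OF assms(1), of UNIV] cl]) auto
  have cg: "continuous_on {0..1} (\<lambda>t. grad1 U a b (?l t))"
    unfolding grad1_def by (intro continuous_intros cU)
  have bnd: "\<bar>g' t\<bar> \<le> grad1 U a b (?l t)" for t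
  proof -
    \<comment> \<open>Coordinates in the unit triangle lie between 0 and 1, so the length of the
      segment does not enter.\<close>
    have "\<bar>(y - x) $ 1\<bar> \<le> 1" "\<bar>(y - x) $ 2\<bar> \<le> 1" using assms(2,3) by (auto simp: unit_tri_def)
    then have "\<bar>(y - x) $ 1 * U (Suc a) b (?l t)\<bar> + \<bar>(y - x) $ 2 * U a (Suc b) (?l t)\<bar>
        \<le> 1 * \<bar>U (Suc a) b (?l t)\<bar> + 1 * \<bar>U a (Suc b) (?l t)\<bar>"
      unfolding abs_mult by (intro add_mono mult_right_mono) auto
    then show ?thesis unfolding g'_def grad1_def by linarith
  qed
  have "\<bar>U a b x - U a b y\<bar> = \<bar>integral {0..1} g'\<bar>" using int by (simp add: integral_unique)
  also have "\<dots> \<le> integral {0..1} (\<lambda>t. grad1 U a b (?l t))"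
    using integral_norm_bound_integral[of g' "{0..1}" "\<lambda>t. grad1 U a b (?l t)"] int cg bnd
    by (auto intro: integrable_continuous_real)
  finally have "\<bar>U a b x - U a b y\<bar> powr p \<le> (integral {0..1} (\<lambda>t. grad1 U a b (?l t)) / 1) powr p"
    using assms by (intro powr_mono2) auto
  also have "\<dots> \<le> integral {0..1} (\<lambda>t. grad1 U a b (?l t) powr p) / 1"
  proof (rule jensen_integral)
    show "((\<lambda>_. 1 :: real) has_integral 1) {0..1 :: real}" using has_integral_const_real[of "1::real" 0 1] by simp
    show "(\<lambda>t. grad1 U a b (?l t) powr p) integrable_on {0..1}"
      using continuous_powr_p[OF cg assms(4)]
      by (intro integrable_continuous_real) (simp add: grad1_def)
  qed (use assms cg in \<open>auto simp: grad1_def intro: integrable_continuous_real\<close>)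
  finally show ?thesis by simp
qed

text \<open>The substitution \<open>z = (1 - t) x + t y\<close> is carried out in \<open>x\<close> for \<open>t \<le> 1/2\<close> and in \<open>y\<close>
  otherwise, so that the Jacobian stays bounded below.\<close>

lemma nn_integral_segments:
  fixes \<phi> :: "plane \<Rightarrow> ennreal"
  assumes [measurable]: "\<phi> \<in> borel_measurable borel" and t: "0 \<le> t" "t \<le> 1"
  shows "(\<integral>\<^sup>+x. \<integral>\<^sup>+y. indicator unit_tri x * indicator unit_tri y * \<phi> (x + t *\<^sub>R (y - x)) \<partial>lborel \<partial>lborel)
      \<le> 4 * ennreal area * (\<integral>\<^sup>+z. \<phi> z \<partial>lborel)"
proof -
  have [measurable]: "unit_tri \<in> sets borel" by (simp add: compact_unit_tri compact_imp_closed)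
  have em: "(\<integral>\<^sup>+y. indicator unit_tri y \<partial>lborel) = ennreal area"
    using nn_integral_compact[OF compact_unit_tri, of "\<lambda>_. 1"]
    by (simp add: area_def ennreal_indicator)
  have sub: "(\<integral>\<^sup>+x. indicator unit_tri x * \<phi> (z + c *\<^sub>R x) \<partial>lborel) \<le> 4 * (\<integral>\<^sup>+z. \<phi> z \<partial>lborel)"
    if c: "1/2 \<le> c" for c z
  proof -
    have "(\<integral>\<^sup>+x. indicator unit_tri x * \<phi> (z + c *\<^sub>R x) \<partial>lborel) \<le> (\<integral>\<^sup>+x. \<phi> (z + c *\<^sub>R x) \<partial>lborel)"
      by (intro nn_integral_mono) (auto simp: indicator_def)
    also have "\<dots> \<le> ennreal (4 * c\<^sup>2) * (\<integral>\<^sup>+x. \<phi> (z + c *\<^sub>R x) \<partial>lborel)"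
    proof -
      \<comment> \<open>This bounds the inverse Jacobian: for c \<ge> 1/2 it is at most 4, in two
        dimensions.\<close>
      have "(1/2)\<^sup>2 \<le> c\<^sup>2" using c by (intro power_mono) auto
      then have "ennreal 1 \<le> ennreal (4 * c\<^sup>2)" by (intro ennreal_leI) (simp add: power2_eq_square)
      from mult_right_mono[OF this, of "\<integral>\<^sup>+x. \<phi> (z + c *\<^sub>R x) \<partial>lborel"] show ?thesis by simp
    qed
    also have "\<dots> = 4 * (ennreal (c\<^sup>2) * (\<integral>\<^sup>+x. \<phi> (z + c *\<^sub>R x) \<partial>lborel))"
      by (simp add: ennreal_mult mult.assoc)
    also have "\<dots> = 4 * (\<integral>\<^sup>+z. \<phi> z \<partial>lborel)"
      using nn_integral_plane_affine[of \<phi> c z] c by simp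
    finally show ?thesis .
  qed

  show ?thesis
  proof (cases "t \<le> 1/2")
    case True
    have "(\<integral>\<^sup>+x. \<integral>\<^sup>+y. indicator unit_tri x * indicator unit_tri y * \<phi> (x + t *\<^sub>R (y - x)) \<partial>lborel \<partial>lborel)
        = (\<integral>\<^sup>+y. \<integral>\<^sup>+x. indicator unit_tri x * indicator unit_tri y * \<phi> (x + t *\<^sub>R (y - x)) \<partial>lborel \<partial>lborel)"
      by (subst lborel_pair.Fubini') auto
    also have "\<dots> = (\<integral>\<^sup>+y. indicator unit_tri y * (\<integral>\<^sup>+x. indicator unit_tri x * \<phi> (t *\<^sub>R y + (1 - t) *\<^sub>R x) \<partial>lborel) \<partial>lborel)"
      by (subst nn_integral_cmult[symmetric]) (auto simp: algebra_simps)
    also have "\<dots> \<le> (\<integral>\<^sup>+y. indicator unit_tri y * (4 * (\<integral>\<^sup>+z. \<phi> z \<partial>lborel)) \<partial>lborel)"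
      by (intro nn_integral_mono mult_left_mono sub) (use True in auto)
    also have "\<dots> = 4 * ennreal area * (\<integral>\<^sup>+z. \<phi> z \<partial>lborel)"
      by (simp add: nn_integral_multc em mult_ac)
    finally show ?thesis .
  next
    case False
    have "(\<integral>\<^sup>+x. \<integral>\<^sup>+y. indicator unit_tri x * indicator unit_tri y * \<phi> (x + t *\<^sub>R (y - x)) \<partial>lborel \<partial>lborel)
        = (\<integral>\<^sup>+x. indicator unit_tri x * (\<integral>\<^sup>+y. indicator unit_tri y * \<phi> ((1 - t) *\<^sub>R x + t *\<^sub>R y) \<partial>lborel) \<partial>lborel)"
      by (subst nn_integral_cmult[symmetric]) (auto simp: algebra_simps)
    also have "\<dots> \<le> (\<integral>\<^sup>+y. indicator unit_tri y * (4 * (\<integral>\<^sup>+z. \<phi> z \<partial>lborel)) \<partial>lborel)"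
      by (intro nn_integral_mono mult_left_mono sub) (use False in auto)
    also have "\<dots> = 4 * ennreal area * (\<integral>\<^sup>+z. \<phi> z \<partial>lborel)"
      by (simp add: nn_integral_multc em mult_ac)
    finally show ?thesis .
  qed
qed

text \<open>With mean zero, \<open>U a b x\<close> is the average of
  \<open>U a b x - U a b y\<close> over \<open>y\<close>. Jensen's inequality and
  \<open>jet_segment\<close> bound its p-th power by an average over segments; for a fixed parameter
  \<open>t\<close> on the segment, integration over \<open>x\<close> and \<open>y\<close> is
  controlled by \<open>nn_integral_segments\<close>.\<close>

lemma poincare:
  assumes U: "jet U" and p: "1 \<le> p" and mean: "integral unit_tri (U a b) = 0"
  shows "integral unit_tri (\<lambda>x. \<bar>U a b x\<bar> powr p)
      \<le> 8 powr p * (integral unit_tri (\<lambda>x. \<bar>U (Suc a) b x\<bar> powr p) + integral unit_tri (\<lambda>x. \<bar>U a (Suc b) x\<bar> powr p))"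
proof -
  let ?T = "unit_tri"
  have [measurable]: "?T \<in> sets borel" by (simp add: compact_unit_tri compact_imp_closed)
  have cU: "continuous_on S (U i j)" for S i j by (rule jet_continuous[OF U])
  have [measurable]: "U i j \<in> borel_measurable borel" for i j
    by (rule borel_measurable_continuous_onI[OF cU])
  have [measurable]: "grad1 U a b \<in> borel_measurable borel"
    by (rule borel_measurable_continuous_onI[OF grad1_continuous[OF U]])
  \<comment> \<open>Extension by zero makes the integrand a function on the plane, as
    \<open>nn_integral_segments\<close> requires; nothing is lost, since segments between points of
    the triangle stay inside.\<close>
  define H where "H z = indicator ?T z * grad1 U a b z powr p" for z
  have [measurable]: "H \<in> borel_measurable borel" unfolding H_def by simp
  have H0: "0 \<le> H z" for z by (simp add: H_def)
  have cH: "continuous_on S (\<lambda>z. grad1 U a b z powr p)" for S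
    using continuous_powr_p[OF grad1_continuous[OF U] p, of S a b] by (simp add: grad1_def)
  have iH: "(\<lambda>z. grad1 U a b z powr p) integrable_on ?T"
    by (intro integrable_on_compact compact_unit_tri cH)
  have HI: "(\<integral>\<^sup>+z. ennreal (H z) \<partial>lborel) = ennreal (integral ?T (\<lambda>z. grad1 U a b z powr p))"
    unfolding H_def by (intro nn_integral_compact compact_unit_tri cH) auto
  have cD: "continuous_on S (\<lambda>y. \<bar>U a b x - U a b y\<bar> powr p)" for S x
    by (intro continuous_powr_p p continuous_intros cU)
  have pw: "ennreal (\<bar>U a b x\<bar> powr p)
      \<le> ennreal (1 / area) * (\<integral>\<^sup>+y. \<integral>\<^sup>+t. indicator ?T x * indicator ?T y * (indicator {0..1} t * ennreal (H (x + t *\<^sub>R (y - x)))) \<partial>lborel \<partial>lborel)"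
    if x: "x \<in> ?T" for x
  proof -
    have i1: "(\<lambda>y. \<bar>U a b x - U a b y\<bar>) integrable_on ?T"
      by (intro integrable_on_compact compact_unit_tri continuous_intros cU)
    have i2: "(\<lambda>y. U a b x - U a b y) integrable_on ?T"
      by (intro integrable_on_compact compact_unit_tri continuous_intros cU)
    have "U a b x * area = integral ?T (\<lambda>y. U a b x * 1 - U a b y)"
    proof -
      have "integral ?T (\<lambda>y. U a b x * 1 - U a b y) = integral ?T (\<lambda>y. U a b x * 1) - integral ?T (U a b)"
        by (intro integral_diff integrable_on_compact compact_unit_tri cU) auto
      also have "integral ?T (\<lambda>y. U a b x * 1) = U a b x * area"
        unfolding area_def by (rule integral_mult_right)
      finally show ?thesis by (simp add: mean)
    qed
    then have "\<bar>U a b x * area\<bar> \<le> integral ?T (\<lambda>y. \<bar>U a b x - U a b y\<bar>)"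
      using integral_norm_bound_integral[OF i2 i1] by simp
    then have "\<bar>U a b x\<bar> \<le> integral ?T (\<lambda>y. \<bar>U a b x - U a b y\<bar>) / area"
      using area_pos by (simp add: abs_mult pos_le_divide_eq)
    then have "\<bar>U a b x\<bar> powr p \<le> (integral ?T (\<lambda>y. \<bar>U a b x - U a b y\<bar>) / area) powr p"
      using p by (intro powr_mono2) auto
    also have "\<dots> \<le> integral ?T (\<lambda>y. \<bar>U a b x - U a b y\<bar> powr p) / area"
      by (intro jensen_integral p area_has_integral area_pos i1 integrable_on_compact compact_unit_tri cD) auto
    finally have "ennreal (\<bar>U a b x\<bar> powr p) \<le> ennreal (1 / area) * ennreal (integral ?T (\<lambda>y. \<bar>U a b x - U a b y\<bar> powr p))"
      using area_pos by (subst ennreal_mult[symmetric]) (auto intro!: ennreal_leI integral_nonneg integrable_on_compact compact_unit_tri cD)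
    also have "ennreal (integral ?T (\<lambda>y. \<bar>U a b x - U a b y\<bar> powr p))
        = (\<integral>\<^sup>+y. ennreal (indicator ?T y * \<bar>U a b x - U a b y\<bar> powr p) \<partial>lborel)"
      by (rule nn_integral_compact[symmetric]) (auto intro!: compact_unit_tri cD)
    also have "\<dots> \<le> (\<integral>\<^sup>+y. \<integral>\<^sup>+t. indicator ?T x * indicator ?T y * (indicator {0..1} t * ennreal (H (x + t *\<^sub>R (y - x)))) \<partial>lborel \<partial>lborel)"
    proof (rule nn_integral_mono)
      fix y
      show "ennreal (indicator ?T y * \<bar>U a b x - U a b y\<bar> powr p)
          \<le> (\<integral>\<^sup>+t. indicator ?T x * indicator ?T y * (indicator {0..1} t * ennreal (H (x + t *\<^sub>R (y - x)))) \<partial>lborel)"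
      proof (cases "y \<in> ?T")
        case y: True
        have seg: "x + t *\<^sub>R (y - x) \<in> ?T" if "0 \<le> t" "t \<le> 1" for t
        proof -
          have "x + t *\<^sub>R (y - x) = (1 - t) *\<^sub>R x + t *\<^sub>R y" by (simp add: algebra_simps)
          then show ?thesis using convexD[OF convex_unit_tri x y, of "1 - t" t] that by simp
        qed
        have "ennreal (indicator ?T y * \<bar>U a b x - U a b y\<bar> powr p)
            \<le> ennreal (integral {0..1} (\<lambda>t. grad1 U a b (x + t *\<^sub>R (y - x)) powr p))"
          using jet_segment[OF U x y p] y by (auto intro: ennreal_leI)
        also have "\<dots> = (\<integral>\<^sup>+t. ennreal (indicator {0..1} t * grad1 U a b (x + t *\<^sub>R (y - x)) powr p) \<partial>lborel)"
          by (rule nn_integral_unit_interval[symmetric])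
            (auto intro!: continuous_on_compose2[OF cH[of UNIV]] continuous_intros)
        also have "\<dots> = (\<integral>\<^sup>+t. indicator ?T x * indicator ?T y * (indicator {0..1} t * ennreal (H (x + t *\<^sub>R (y - x)))) \<partial>lborel)"
          using x y seg by (intro nn_integral_cong) (auto simp: indicator_def H_def)
        finally show ?thesis .
      qed simp
    qed
    finally show ?thesis by (simp add: mult_left_mono)
  qed

  have "ennreal (integral ?T (\<lambda>x. \<bar>U a b x\<bar> powr p)) = (\<integral>\<^sup>+x. ennreal (indicator ?T x * \<bar>U a b x\<bar> powr p) \<partial>lborel)"
    by (rule nn_integral_compact[symmetric]) (auto intro!: compact_unit_tri continuous_powr_p p cU)
  also have "\<dots> \<le> (\<integral>\<^sup>+x. ennreal (1 / area) * (\<integral>\<^sup>+y. \<integral>\<^sup>+t. indicator ?T x * indicator ?T y * (indicator {0..1} t * ennreal (H (x + t *\<^sub>R (y - x)))) \<partial>lborel \<partial>lborel) \<partial>lborel)"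
    by (intro nn_integral_mono) (use pw in \<open>auto simp: indicator_def\<close>)
  also have "\<dots> = ennreal (1 / area) * (\<integral>\<^sup>+x. \<integral>\<^sup>+y. \<integral>\<^sup>+t. indicator ?T x * indicator ?T y * (indicator {0..1} t * ennreal (H (x + t *\<^sub>R (y - x)))) \<partial>lborel \<partial>lborel \<partial>lborel)"
    by (rule nn_integral_cmult) simp
  \<comment> \<open>Two applications of Tonelli's theorem bring the segment parameter
    \<open>t\<close> outermost.\<close>
  also have "(\<integral>\<^sup>+x. \<integral>\<^sup>+y. \<integral>\<^sup>+t. indicator ?T x * indicator ?T y * (indicator {0..1} t * ennreal (H (x + t *\<^sub>R (y - x)))) \<partial>lborel \<partial>lborel \<partial>lborel)
      = (\<integral>\<^sup>+x. \<integral>\<^sup>+t. \<integral>\<^sup>+y. indicator ?T x * indicator ?T y * (indicator {0..1} t * ennreal (H (x + t *\<^sub>R (y - x)))) \<partial>lborel \<partial>lborel \<partial>lborel)"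
    by (intro nn_integral_cong lborel_pair.Fubini'[symmetric]) simp
  also have "\<dots> = (\<integral>\<^sup>+t. \<integral>\<^sup>+x. \<integral>\<^sup>+y. indicator ?T x * indicator ?T y * (indicator {0..1} t * ennreal (H (x + t *\<^sub>R (y - x)))) \<partial>lborel \<partial>lborel \<partial>lborel)"
    by (intro lborel_pair.Fubini'[symmetric]) simp
  also have "\<dots> = (\<integral>\<^sup>+t. indicator {0..1} t * (\<integral>\<^sup>+x. \<integral>\<^sup>+y. indicator ?T x * indicator ?T y * ennreal (H (x + t *\<^sub>R (y - x))) \<partial>lborel \<partial>lborel) \<partial>lborel)"
    by (intro nn_integral_cong) (auto simp: indicator_def)
  also have "\<dots> \<le> (\<integral>\<^sup>+t. indicator {0..1::real} t * (4 * ennreal area * (\<integral>\<^sup>+z. ennreal (H z) \<partial>lborel)) \<partial>lborel)"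
  proof (rule nn_integral_mono)
    fix t :: real
    show "indicator {0..1} t * (\<integral>\<^sup>+x. \<integral>\<^sup>+y. indicator ?T x * indicator ?T y * ennreal (H (x + t *\<^sub>R (y - x))) \<partial>lborel \<partial>lborel)
        \<le> indicator {0..1::real} t * (4 * ennreal area * (\<integral>\<^sup>+z. ennreal (H z) \<partial>lborel))"
    proof (cases "t \<in> {0..1}")
      case True
      then have "(\<integral>\<^sup>+x. \<integral>\<^sup>+y. indicator ?T x * indicator ?T y * ennreal (H (x + t *\<^sub>R (y - x))) \<partial>lborel \<partial>lborel)
          \<le> 4 * ennreal area * (\<integral>\<^sup>+z. ennreal (H z) \<partial>lborel)"
        by (intro nn_integral_segments) auto
      then show ?thesis by (rule mult_left_mono) simp
    qed simp
  qed
  also have "\<dots> = 4 * ennreal area * (\<integral>\<^sup>+z. ennreal (H z) \<partial>lborel)"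
    by (simp add: nn_integral_multc)
  finally have "ennreal (integral ?T (\<lambda>x. \<bar>U a b x\<bar> powr p))
      \<le> ennreal (1 / area) * (4 * ennreal area * ennreal (integral ?T (\<lambda>z. grad1 U a b z powr p)))"
    by (simp add: mult_left_mono HI)
  \<comment> \<open>The factor 1 / area from averaging over \<open>y\<close> cancels the area of the
    remaining free integration.\<close>
  also have "\<dots> = (ennreal (1 / area) * ennreal area) * (4 * ennreal (integral ?T (\<lambda>z. grad1 U a b z powr p)))"
    by (simp add: mult_ac)
  also have "ennreal (1 / area) * ennreal area = 1"
    using area_pos by (simp flip: ennreal_mult)
  also have "1 * (4 * ennreal (integral ?T (\<lambda>z. grad1 U a b z powr p)))
      = ennreal (4 * integral ?T (\<lambda>z. grad1 U a b z powr p))"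
    by (simp add: ennreal_mult integral_nonneg[OF iH])
  finally have "integral ?T (\<lambda>x. \<bar>U a b x\<bar> powr p) \<le> 4 * integral ?T (\<lambda>z. grad1 U a b z powr p)"
    by (subst (asm) ennreal_le_iff) (auto intro!: integral_nonneg[OF iH])
  also have "integral ?T (\<lambda>z. grad1 U a b z powr p)
      \<le> integral ?T (\<lambda>z. 2 powr p * (\<bar>U (Suc a) b z\<bar> powr p + \<bar>U a (Suc b) z\<bar> powr p))"
    unfolding grad1_def
    by (intro integral_le powr_add_le p integrable_on_compact compact_unit_tri continuous_intros continuous_powr_p cU
         cH[unfolded grad1_def]) auto
  also have "\<dots> = 2 powr p * (integral ?T (\<lambda>x. \<bar>U (Suc a) b x\<bar> powr p) + integral ?T (\<lambda>x. \<bar>U a (Suc b) x\<bar> powr p))"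
    by (simp only: integral_mult_right, subst integral_add)
       (auto intro!: integrable_on_compact compact_unit_tri continuous_powr_p cU p)
  finally have le: "integral ?T (\<lambda>x. \<bar>U a b x\<bar> powr p)
      \<le> (4 * 2 powr p) * (integral ?T (\<lambda>x. \<bar>U (Suc a) b x\<bar> powr p) + integral ?T (\<lambda>x. \<bar>U a (Suc b) x\<bar> powr p))"
    by simp
  \<comment> \<open>The factor 4 from the Jacobian is absorbed into 4^p, and 2^p comes from
    splitting the two partial derivatives.\<close>
  have "(8 :: real) powr p = 4 powr p * 2 powr p" by (simp flip: powr_mult)
  moreover have "(4 :: real) powr 1 \<le> 4 powr p" using p by (intro powr_mono) auto
  ultimately have "4 * 2 powr p \<le> (8 :: real) powr p" by simp
  moreover have "0 \<le> integral ?T (\<lambda>x. \<bar>U (Suc a) b x\<bar> powr p) + integral ?T (\<lambda>x. \<bar>U a (Suc b) x\<bar> powr p)"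
    by (intro add_nonneg_nonneg integral_nonneg integrable_on_compact compact_unit_tri continuous_powr_p cU p) auto
  ultimately show ?thesis by (rule order_trans[OF le mult_right_mono])
qed

section \<open>Trace estimates for finite differences\<close>

lemma pt_combination: "pt s t = s *\<^sub>R pt 1 0 + t *\<^sub>R pt 0 1"
  by (simp add: vec_eq_iff forall_2)

lemma continuous_on_pt:
  assumes "continuous_on S f" "continuous_on S g"
  shows "continuous_on S (\<lambda>x. pt (f x) (g x))"
  by (subst pt_combination) (intro continuous_intros assms)

text \<open>This transports Fubini's theorem from pairs of reals to vectors of length two. It
  suffices to compare the measures of open boxes.\<close>

lemma lborel_plane_eq: "(lborel :: plane measure) = distr (lborel :: (real \<times> real) measure) borel (\<lambda>(s, t). pt s t)"
proof (rule lborel_eqI)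
  have [measurable]: "(\<lambda>(s, t). pt s t) \<in> borel \<rightarrow>\<^sub>M borel"
    by (rule borel_measurable_continuous_onI) (auto simp: split_beta intro!: continuous_on_pt continuous_intros)
  fix l u :: plane assume le: "\<And>b. b \<in> Basis \<Longrightarrow> l \<bullet> b \<le> u \<bullet> b"
  have le12: "l $ 1 \<le> u $ 1" "l $ 2 \<le> u $ 2"
    using le[of "axis 1 1"] le[of "axis 2 1"] by (auto simp: inner_axis axis_in_Basis_iff)
  have eq: "(\<lambda>(s, t). pt s t) -` box l u = box (l $ 1, l $ 2) (u $ 1, u $ 2)"
    by (auto simp: mem_box_cart forall_2 box_prod)
  have "emeasure (distr lborel borel (\<lambda>(s, t). pt s t)) (box l u)
      = emeasure lborel (box (l $ 1, l $ 2) (u $ 1, u $ 2))"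
    by (subst emeasure_distr) (auto simp: eq)
  also have "\<dots> = ennreal ((u $ 1 - l $ 1) * (u $ 2 - l $ 2))"
    using le12 by (subst emeasure_lborel_box) (auto simp: Basis_prod_def prod.union_disjoint)
  also have "(u $ 1 - l $ 1) * (u $ 2 - l $ 2) = (\<Prod>b\<in>Basis. (u - l) \<bullet> b)"
  proof -
    have B: "(Basis :: plane set) = {axis 1 1, axis 2 1}" by (auto simp: Basis_vec_def UNIV_2)
    have "axis 1 1 \<noteq> (axis 2 1 :: plane)" by (simp add: axis_eq_axis)
    then show ?thesis by (simp add: B inner_axis)
  qed
  finally show "emeasure (distr lborel borel (\<lambda>(s, t). pt s t)) (box l u) = ennreal (\<Prod>b\<in>Basis. (u - l) \<bullet> b)" .
qed simp

lemma integral_plane_box: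
  assumes f: "continuous_on UNIV (f :: plane \<Rightarrow> real)"
  shows "integral (cbox (pt a c) (pt b d)) f = integral {a..b} (\<lambda>s. integral {c..d} (\<lambda>t. f (pt s t)))"
proof -
  have [measurable]: "(\<lambda>(s, t). pt s t) \<in> borel \<rightarrow>\<^sub>M borel"
    by (rule borel_measurable_continuous_onI) (auto simp: split_beta intro!: continuous_on_pt continuous_intros)
  have [measurable]: "f \<in> borel_measurable borel" by (rule borel_measurable_continuous_onI[OF f])
  have fc: "continuous_on S f" for S using f continuous_on_subset by blast
  have fpc: "continuous_on S (\<lambda>x. f (pt (fst x) (snd x)))" for S
    by (rule continuous_on_compose2[OF f]) (auto intro!: continuous_on_pt continuous_intros)
  have 1: "set_integrable lborel (cbox (pt a c) (pt b d)) f"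
    using borel_integrable_compact[OF _ fc] by (simp add: set_integrable_def)
  have 2: "set_integrable lborel (cbox (a, c) (b, d)) (\<lambda>x. f (pt (fst x) (snd x)))"
    using borel_integrable_compact[OF _ fpc] by (simp add: set_integrable_def)
  have "integral (cbox (pt a c) (pt b d)) f = (LINT x|lborel. indicator (cbox (pt a c) (pt b d)) x *\<^sub>R f x)"
    using set_borel_integral_eq_integral(2)[OF 1] by (simp add: set_lebesgue_integral_def)
  also have "\<dots> = (LINT x|lborel. indicator (cbox (pt a c) (pt b d)) (pt (fst x) (snd x)) *\<^sub>R f (pt (fst x) (snd x)))"
    by (subst lborel_plane_eq, subst integral_distr) (auto simp: split_beta)
  also have "\<dots> = (LINT x|lborel. indicator (cbox (a, c) (b, d)) x *\<^sub>R f (pt (fst x) (snd x)))"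
    by (intro Bochner_Integration.integral_cong refl) (auto simp: indicator_def mem_box_cart forall_2 cbox_Pair_eq)
  also have "\<dots> = integral (cbox (a, c) (b, d)) (\<lambda>x. f (pt (fst x) (snd x)))"
    using set_borel_integral_eq_integral(2)[OF 2] by (simp add: set_lebesgue_integral_def)
  also have "\<dots> = integral {a..b} (\<lambda>s. integral {c..d} (\<lambda>t. f (pt s t)))"
    by (subst integral_prod_continuous) (auto intro: fpc)
  finally show ?thesis .
qed

lemma rectangle_integral_le:
  assumes f: "continuous_on UNIV (f :: plane \<Rightarrow> real)" "\<And>x. 0 \<le> f x"
    and sub: "0 \<le> a" "0 \<le> c" "b + d \<le> 1"
  shows "integral {a..b} (\<lambda>s. integral {c..d} (\<lambda>t. f (pt s t))) \<le> integral unit_tri f"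
proof -
  have "integral (cbox (pt a c) (pt b d)) f \<le> integral unit_tri f"
  proof (rule integral_subset_le)
    show "cbox (pt a c) (pt b d) \<subseteq> unit_tri"
      using sub by (auto simp: unit_tri_def mem_box_cart forall_2)
  qed (auto intro!: integrable_on_compact compact_unit_tri f continuous_on_subset[OF f(1)])
  then show ?thesis by (simp add: integral_plane_box f)
qed

lemma inner_integral_continuous:
  assumes f: "continuous_on UNIV (f :: plane \<Rightarrow> real)"
  shows "continuous_on S (\<lambda>s. integral {c..d} (\<lambda>t. f (pt s t)))"
proof -
  have "continuous_on (S \<times> cbox c d) (\<lambda>(x, t). f (pt x t))"
    unfolding split_beta
    by (rule continuous_on_compose2[OF f]) (auto intro!: continuous_on_pt continuous_intros)
  from integral_continuous_on_param[OF this] show ?thesis by simp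
qed

lemma pt_line_continuous:
  assumes f: "continuous_on UNIV (f :: plane \<Rightarrow> real)"
  shows "continuous_on S (\<lambda>s. f (pt s t))" "continuous_on S (\<lambda>t. f (pt s t))"
  by (rule continuous_on_compose2[OF f]; auto intro!: continuous_on_pt continuous_intros)+

text \<open>The determinant with columns \<open>e\<close> and \<open>f\<close>, which is the
  Jacobian of \<open>aff z e f\<close>.\<close>

definition cross2 :: "plane \<Rightarrow> plane \<Rightarrow> real" where
  "cross2 e f = e $ 1 * f $ 2 - e $ 2 * f $ 1"

lemma aff_has_derivative: "(aff z e f has_derivative (\<lambda>h. (h $ 1) *\<^sub>R e + (h $ 2) *\<^sub>R f)) (at x within S)"
  unfolding aff_def[abs_def]
  by (auto intro!: derivative_eq_intros has_derivative_at_withinI[OF vec_nth_has_derivative])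

text \<open>Cramer's rule.\<close>

lemma aff_inverse:
  assumes "cross2 e f \<noteq> 0"
  shows "aff z e f (pt (cross2 (y - z) f / cross2 e f) (cross2 e (y - z) / cross2 e f)) = y"
proof -
  have "cross2 (y - z) f * e $ i + cross2 e (y - z) * f $ i = cross2 e f * (y - z) $ i" for i
    using exhaust_2[of i] by (auto simp: cross2_def algebra_simps)
  then have "z $ i + (cross2 (y - z) f / cross2 e f * e $ i + cross2 e (y - z) / cross2 e f * f $ i) = y $ i" for i
    using assms by (simp add: add_divide_distrib[symmetric] del: cross2_def)
  then show ?thesis by (simp add: vec_eq_iff aff_def add.assoc)
qed

lemma aff_inj:
  assumes "cross2 e f \<noteq> 0"
  shows "inj (aff z e f)"
proof (rule injI)
  fix x y assume "aff z e f x = aff z e f y"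
  then have eq: "x $ 1 * e $ i + x $ 2 * f $ i = y $ 1 * e $ i + y $ 2 * f $ i" for i
    by (simp add: aff_def vec_eq_iff add.assoc)
  have "(x $ 1 - y $ 1) * cross2 e f = 0" "(x $ 2 - y $ 2) * cross2 e f = 0"
    using eq[of 1] eq[of 2] unfolding cross2_def by algebra+
  then show "x = y" using assms by (simp add: vec_eq_iff forall_2)
qed

lemma integral_affine_image:
  fixes g :: "plane \<Rightarrow> real"
  assumes g: "continuous_on UNIV g" and S: "compact S" and c: "cross2 e f \<noteq> 0"
  shows "integral (aff z e f ` S) g = \<bar>cross2 e f\<bar> * integral S (\<lambda>x. g (aff z e f x))"
proof -
  let ?F = "aff z e f" and ?L = "\<lambda>h :: plane. (h $ 1) *\<^sub>R e + (h $ 2) *\<^sub>R f"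
  have m: "matrix ?L = (\<chi> i j. if j = 1 then e $ i else f $ i)"
    by (simp add: matrix_def vec_eq_iff forall_2 axis_def)
  have d: "det (matrix ?L) = cross2 e f" by (simp add: m det_2 cross2_def)
  \<comment> \<open>The change of variables theorem is stated for vector-valued integrands, so
    \<open>g\<close> is wrapped into vectors of length one and unwrapped at the end.\<close>
  define G :: "plane \<Rightarrow> real^1" where "G x = g x *\<^sub>R 1" for x
  have cF: "continuous_on T ?F" for T
    by (meson aff_has_derivative continuous_at_imp_continuous_on has_derivative_continuous)
  have im: "compact (?F ` S)" by (intro compact_continuous_image cF S)
  have gi: "g absolutely_integrable_on (?F ` S)"
    by (intro absolutely_integrable_onI integrable_on_compact im continuous_intros continuous_on_subset[OF g]) auto
  then have "G absolutely_integrable_on (?F ` S)"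
    unfolding G_def by (rule absolutely_integrable_scaleR_right)
  then have "(\<lambda>x. \<bar>cross2 e f\<bar> *\<^sub>R G (?F x)) absolutely_integrable_on S"
    and eq: "integral S (\<lambda>x. \<bar>cross2 e f\<bar> *\<^sub>R G (?F x)) = integral (?F ` S) G"
    using has_absolute_integral_change_of_variables[of S ?F "\<lambda>_. ?L" G "integral (?F ` S) G"]
      aff_has_derivative inj_on_subset[OF aff_inj[OF c]] S
    by (auto simp: d compact_imp_closed)
  have gF: "continuous_on S (\<lambda>x. g (?F x))" by (rule continuous_on_compose2[OF g cF]) auto
  have lhs: "integral (?F ` S) G = integral (?F ` S) g *\<^sub>R 1"
    unfolding G_def
    using integral_linear[OF _ bounded_linear_scaleR_left[of "1 :: real^1"], of g "?F ` S"] gi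
    by (simp add: absolutely_integrable_on_def o_def)
  have "integral S (\<lambda>x. (\<bar>cross2 e f\<bar> * g (?F x)) *\<^sub>R (1 :: real^1)) = integral S (\<lambda>x. \<bar>cross2 e f\<bar> * g (?F x)) *\<^sub>R 1"
    using integral_linear[OF _ bounded_linear_scaleR_left[of "1 :: real^1"], of "\<lambda>x. \<bar>cross2 e f\<bar> * g (?F x)" S]
      integrable_on_compact[OF S continuous_on_mult_left[OF gF]]
    by (simp add: o_def)
  with eq lhs have "integral S (\<lambda>x. \<bar>cross2 e f\<bar> * g (?F x)) *\<^sub>R (1 :: real^1) = integral (?F ` S) g *\<^sub>R 1"
    by (simp add: G_def)
  then show ?thesis by (simp add: vec_eq_iff)
qed

section \<open>Traces on chords of the unit triangle\<close>

lemma integral_abs_deriv: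
  fixes g :: "real \<Rightarrow> real"
  assumes d: "\<And>x. (g has_real_derivative g' x) (at x)" and c: "continuous_on UNIV g'"
    and "x \<in> {\<alpha>..\<beta>}" "y \<in> {\<alpha>..\<beta>}"
  shows "\<bar>g x - g y\<bar> \<le> integral {\<alpha>..\<beta>} (\<lambda>t. \<bar>g' t\<bar>)"
proof -
  have cc: "continuous_on S g'" for S using c continuous_on_subset by blast
  have *: "\<bar>g y - g x\<bar> \<le> integral {\<alpha>..\<beta>} (\<lambda>t. \<bar>g' t\<bar>)" if "\<alpha> \<le> x" "x \<le> y" "y \<le> \<beta>" for x y
  proof -
    have "(g' has_integral g y - g x) {x..y}"
      using that d by (intro fundamental_theorem_of_calculus)
        (auto simp: has_real_derivative_iff_has_vector_derivative[symmetric] intro: has_field_derivative_at_within)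
    then have "\<bar>g y - g x\<bar> \<le> integral {x..y} (\<lambda>t. \<bar>g' t\<bar>)"
      using integral_norm_bound_integral[of g' "{x..y}" "\<lambda>t. \<bar>g' t\<bar>"]
      by (auto simp: integral_unique intro!: integrable_continuous_real continuous_intros cc)
    also have "\<dots> \<le> integral {\<alpha>..\<beta>} (\<lambda>t. \<bar>g' t\<bar>)"
      using that by (intro integral_subset_le integrable_continuous_real continuous_intros cc) auto
    finally show ?thesis .
  qed
  show ?thesis using *[of x y] *[of y x] assms(3,4) by (cases "x \<le> y") (auto simp: abs_minus_commute)
qed

text \<open>Average over \<open>y\<close> the inequality that bounds \<bar>g x\<bar> by \<bar>g
  y\<bar> plus the integral of \<bar>g'\<bar>. This is the one-dimensional trace inequality behind
  all estimates on grid lines.\<close>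

lemma point_value_le:
  fixes g :: "real \<Rightarrow> real"
  assumes d: "\<And>x. (g has_real_derivative g' x) (at x)" and c: "continuous_on UNIV g'"
    and "x \<in> {\<alpha>..\<beta>}" "\<alpha> < \<beta>"
  shows "\<bar>g x\<bar> \<le> integral {\<alpha>..\<beta>} (\<lambda>t. \<bar>g t\<bar>) / (\<beta> - \<alpha>) + integral {\<alpha>..\<beta>} (\<lambda>t. \<bar>g' t\<bar>)"
proof -
  have cg: "continuous_on S g" for S
    by (meson d DERIV_continuous continuous_at_imp_continuous_on)
  have ig: "(\<lambda>t. \<bar>g t\<bar>) integrable_on {\<alpha>..\<beta>}"
    by (intro integrable_continuous_real continuous_intros cg)
  let ?I = "integral {\<alpha>..\<beta>} (\<lambda>t. \<bar>g' t\<bar>)"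
  have "integral {\<alpha>..\<beta>} (\<lambda>y. \<bar>g x\<bar> - ?I) \<le> integral {\<alpha>..\<beta>} (\<lambda>t. \<bar>g t\<bar>)"
  proof (intro integral_le ig)
    fix y assume "y \<in> {\<alpha>..\<beta>}"
    from integral_abs_deriv[OF d c assms(3) this] show "\<bar>g x\<bar> - ?I \<le> \<bar>g y\<bar>" by linarith
  qed auto
  then have "(\<bar>g x\<bar> - ?I) * (\<beta> - \<alpha>) \<le> integral {\<alpha>..\<beta>} (\<lambda>t. \<bar>g t\<bar>)"
    using assms(4) by (simp add: mult.commute)
  then have "\<bar>g x\<bar> - ?I \<le> integral {\<alpha>..\<beta>} (\<lambda>t. \<bar>g t\<bar>) / (\<beta> - \<alpha>)"
    using assms(4) by (simp add: pos_le_divide_eq)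
  then show ?thesis by simp
qed

text \<open>Over the left half of the chord at height \<open>c\<close>, the square of side
  \<open>l\<close> standing on it stays in the triangle, since c + 2 * l = 1. The one-dimensional
  inequality is applied on its vertical segments and integrated.\<close>

lemma half_chord:
  assumes U: "jet U" and c: "0 \<le> c" "c < 1" and l: "l = (1 - c) / 2"
  shows "integral {0..l} (\<lambda>s. \<bar>U a b (pt s c)\<bar>)
    \<le> integral unit_tri (\<lambda>x. \<bar>U a b x\<bar>) / l + integral unit_tri (\<lambda>x. \<bar>U a (Suc b) x\<bar>)"
proof -
  have l0: "0 < l" using c l by simp
  have cU: "continuous_on S (U i j)" for S i j by (rule jet_continuous[OF U])
  have cA: "continuous_on UNIV (\<lambda>x. \<bar>U i j x\<bar>)" for i j by (intro continuous_intros cU)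
  have "integral {0..l} (\<lambda>s. \<bar>U a b (pt s c)\<bar>)
     \<le> integral {0..l} (\<lambda>s. integral {c..c+l} (\<lambda>t. \<bar>U a b (pt s t)\<bar>) / l + integral {c..c+l} (\<lambda>t. \<bar>U a (Suc b) (pt s t)\<bar>))"
  proof (rule integral_le)
    show "(\<lambda>s. \<bar>U a b (pt s c)\<bar>) integrable_on {0..l}"
      by (intro integrable_continuous_real pt_line_continuous cA)
    show "(\<lambda>s. integral {c..c+l} (\<lambda>t. \<bar>U a b (pt s t)\<bar>) / l + integral {c..c+l} (\<lambda>t. \<bar>U a (Suc b) (pt s t)\<bar>)) integrable_on {0..l}"
      using l0 by (intro integrable_continuous_real continuous_intros inner_integral_continuous cA) auto
    fix s
    show "\<bar>U a b (pt s c)\<bar> \<le> integral {c..c+l} (\<lambda>t. \<bar>U a b (pt s t)\<bar>) / l + integral {c..c+l} (\<lambda>t. \<bar>U a (Suc b) (pt s t)\<bar>)"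
      using point_value_le[of "\<lambda>t. U a b (pt s t)" "\<lambda>t. U a (Suc b) (pt s t)" c c "c + l"] l0
      by (auto intro: jet_DERIV_2 U pt_line_continuous cU)
  qed
  also have "\<dots> = integral {0..l} (\<lambda>s. integral {c..c+l} (\<lambda>t. \<bar>U a b (pt s t)\<bar>)) / l
      + integral {0..l} (\<lambda>s. integral {c..c+l} (\<lambda>t. \<bar>U a (Suc b) (pt s t)\<bar>))"
    using l0
    by (subst integral_add)
       (auto intro!: integrable_continuous_real continuous_intros inner_integral_continuous cA)
  also have "\<dots> \<le> integral unit_tri (\<lambda>x. \<bar>U a b x\<bar>) / l + integral unit_tri (\<lambda>x. \<bar>U a (Suc b) x\<bar>)"
    using l0 c l by (intro add_mono divide_right_mono rectangle_integral_le cA) (auto simp: field_simps)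
  finally show ?thesis .
qed

text \<open>This map exchanges the vertices (0, 0) and (1, 0), fixes (0, 1), and maps every
  horizontal chord to itself with the direction reversed.\<close>

lemma unit_tri_flip: "aff (pt 1 0) (pt (- 1) 0) (pt (- 1) 1) ` unit_tri = unit_tri"
proof -
  have a: "aff (pt 1 0) (pt (- 1) 0) (pt (- 1) 1) x = pt (1 - x $ 1 - x $ 2) (x $ 2)" for x
    by (simp add: aff_def vec_eq_iff forall_2)
  have "x \<in> (\<lambda>x. pt (1 - x $ 1 - x $ 2) (x $ 2)) ` unit_tri" if "x \<in> unit_tri" for x
    using that by (intro image_eqI[of _ _ "pt (1 - x $ 1 - x $ 2) (x $ 2)"]) (auto simp: unit_tri_def pt_eta)
  then show ?thesis by (auto simp: a unit_tri_def)
qed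

text \<open>The right half of the chord is the left half after the flip, which preserves area. The
  flip turns the vertical direction into (-1, 1); this is how the horizontal derivative enters the
  bound.\<close>

lemma chord:
  assumes U: "jet U" and c: "0 \<le> c" "c < 1"
  shows "integral {0..1 - c} (\<lambda>s. \<bar>U a b (pt s c)\<bar>)
    \<le> 4 / (1 - c) * (integral unit_tri (\<lambda>x. \<bar>U a b x\<bar>) + integral unit_tri (\<lambda>x. \<bar>U (Suc a) b x\<bar>)
         + integral unit_tri (\<lambda>x. \<bar>U a (Suc b) x\<bar>))"
proof -
  define l where "l = (1 - c) / 2"
  have l0: "0 < l" "l \<le> 1" using c by (auto simp: l_def)
  have cU: "continuous_on S (U i j)" for S i j by (rule jet_continuous[OF U])
  have cA: "continuous_on S (\<lambda>x. \<bar>U i j x\<bar>)" for i j S by (intro continuous_intros cU)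
  let ?I = "\<lambda>i j. integral unit_tri (\<lambda>x. \<bar>U i j x\<bar>)"
  let ?\<sigma> = "aff (pt 1 0) (pt (- 1) 0) (pt (- 1) 1)"
  have flip: "integral unit_tri (\<lambda>x. g (?\<sigma> x)) = integral unit_tri g" if "continuous_on UNIV g" for g :: "plane \<Rightarrow> real"
    using integral_affine_image[OF that compact_unit_tri, of "pt (- 1) 0" "pt (- 1) 1" "pt 1 0"]
    by (simp add: unit_tri_flip cross2_def)
  have nonneg: "0 \<le> ?I i j" for i j
    by (intro integral_nonneg integrable_on_compact compact_unit_tri cA) auto
  define V where "V = (\<lambda>i j x. pull_dirs (pt (- 1) 0) (pt (- 1) 1) (\<lambda>i j. U (i + a) (j + b)) i j (?\<sigma> x))"
  have V: "jet V" unfolding V_def by (intro jet_affine jet_shift U)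
  have V00: "V 0 0 x = U a b (?\<sigma> x)" for x by (simp add: V_def)
  have V01: "V 0 (Suc 0) x = U a (Suc b) (?\<sigma> x) - U (Suc a) b (?\<sigma> x)" for x
    by (simp add: V_def pull_dirs_def dir_shift_def)
  have left: "integral {0..l} (\<lambda>s. \<bar>U a b (pt s c)\<bar>) \<le> ?I a b / l + ?I a (Suc b)"
    by (rule half_chord[OF U c l_def])
  have "integral {0..l} (\<lambda>s. \<bar>V 0 0 (pt s c)\<bar>)
      \<le> integral unit_tri (\<lambda>x. \<bar>V 0 0 x\<bar>) / l + integral unit_tri (\<lambda>x. \<bar>V 0 (Suc 0) x\<bar>)"
    by (rule half_chord[OF V c l_def])
  also have "integral unit_tri (\<lambda>x. \<bar>V 0 0 x\<bar>) = ?I a b"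
    unfolding V00 by (rule flip) (rule cA)
  also have "integral unit_tri (\<lambda>x. \<bar>V 0 (Suc 0) x\<bar>) = integral unit_tri (\<lambda>x. \<bar>U a (Suc b) x - U (Suc a) b x\<bar>)"
    unfolding V01 by (rule flip) (intro continuous_intros cU)
  also have "\<dots> \<le> integral unit_tri (\<lambda>x. \<bar>U a (Suc b) x\<bar> + \<bar>U (Suc a) b x\<bar>)"
    by (intro integral_le integrable_on_compact compact_unit_tri continuous_intros cU) auto
  also have "\<dots> = ?I a (Suc b) + ?I (Suc a) b"
    by (intro integral_add integrable_on_compact compact_unit_tri cA)
  \<comment> \<open>The flip sends (s, c) to (1 - s - c, c), and 1 - c = 2 * l.\<close>
  also have "integral {0..l} (\<lambda>s. \<bar>V 0 0 (pt s c)\<bar>) = integral {0..l} (\<lambda>s. \<bar>U a b (pt (2 * l - s) c)\<bar>)"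
    by (simp add: V00 aff_def l_def pt_add[symmetric] vec_eq_iff forall_2 cong: if_cong)
      (rule arg_cong[where f = "integral _"], rule ext, rule arg_cong[where f = abs], rule arg_cong[where f = "U a b"],
       simp add: vec_eq_iff forall_2)
  also have "\<dots> = integral {l..2 * l} (\<lambda>s. \<bar>U a b (pt s c)\<bar>)"
  proof -
    have "((\<lambda>s. \<bar>U a b (pt s c)\<bar>) has_integral integral {l..2 * l} (\<lambda>s. \<bar>U a b (pt s c)\<bar>)) (cbox l (2 * l))"
      by (auto intro!: integrable_integral integrable_continuous_real pt_line_continuous cA)
    from has_integral_affinity[OF this, of "-1" "2 * l"]
    have "((\<lambda>x. \<bar>U a b (pt (2 * l - x) c)\<bar>) has_integral integral {l..2 * l} (\<lambda>s. \<bar>U a b (pt s c)\<bar>)) ((\<lambda>x. 2 * l - x) ` {l..2 * l})"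
      by simp
    moreover have "(\<lambda>x. 2 * l - x) ` {l..2 * l} = {0..l}" by simp
    ultimately show ?thesis by (simp add: integral_unique)
  qed
  finally have right: "integral {l..2 * l} (\<lambda>s. \<bar>U a b (pt s c)\<bar>) \<le> ?I a b / l + (?I a (Suc b) + ?I (Suc a) b)"
    by simp
  have "integral {0..2 * l} (\<lambda>s. \<bar>U a b (pt s c)\<bar>)
      = integral {0..l} (\<lambda>s. \<bar>U a b (pt s c)\<bar>) + integral {l..2 * l} (\<lambda>s. \<bar>U a b (pt s c)\<bar>)"
    using l0 by (intro Henstock_Kurzweil_Integration.integral_combine[symmetric] integrable_continuous_real pt_line_continuous cA) auto
  also have "\<dots> \<le> 2 / l * ?I a b + 2 * ?I a (Suc b) + 1 * ?I (Suc a) b"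
    using left right by simp
  also have "\<dots> \<le> 2 / l * ?I a b + 2 / l * ?I a (Suc b) + 2 / l * ?I (Suc a) b"
    using l0 by (intro add_mono mult_right_mono nonneg) (auto simp: field_simps)
  also have "\<dots> = 4 / (1 - c) * (?I a b + ?I (Suc a) b + ?I a (Suc b))"
    by (simp add: l_def algebra_simps)
  finally have "integral {0..2 * l} (\<lambda>s. \<bar>U a b (pt s c)\<bar>)
      \<le> 4 / (1 - c) * (?I a b + ?I (Suc a) b + ?I a (Suc b))" .
  moreover have "2 * l = 1 - c" by (simp add: l_def)
  ultimately show ?thesis by (simp only:)
qed

definition jet_swap :: "(nat \<Rightarrow> nat \<Rightarrow> plane \<Rightarrow> real) \<Rightarrow> nat \<Rightarrow> nat \<Rightarrow> plane \<Rightarrow> real" where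
  "jet_swap U a b x = U b a (pt (x $ 2) (x $ 1))"

lemma jet_swap: assumes "jet U" shows "jet (jet_swap U)"
proof -
  have L: "((\<lambda>x :: plane. pt (x $ 2) (x $ 1)) has_derivative (\<lambda>h. pt (h $ 2) (h $ 1))) (at x)" for x
    by (subst (1 2) pt_combination) (auto intro!: derivative_eq_intros vec_nth_has_derivative)
  have "((\<lambda>x :: plane. U b a (pt (x $ 2) (x $ 1))) has_derivative
      (\<lambda>h. pt (h $ 2) (h $ 1) $ 1 * U (Suc b) a (pt (x $ 2) (x $ 1)) + pt (h $ 2) (h $ 1) $ 2 * U b (Suc a) (pt (x $ 2) (x $ 1)))) (at x)" for a b x
    by (rule has_derivative_compose[OF L jetD[OF assms]])
  then show ?thesis by (simp add: jet_def jet_swap_def[abs_def] add.commute)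
qed

lemma integral_swap:
  fixes g :: "plane \<Rightarrow> real"
  assumes "continuous_on UNIV g"
  shows "integral unit_tri (\<lambda>x. g (pt (x $ 2) (x $ 1))) = integral unit_tri g"
proof -
  have a: "aff 0 (pt 0 1) (pt 1 0) x = pt (x $ 2) (x $ 1)" for x
    by (simp add: aff_def vec_eq_iff forall_2)
  have "x \<in> (\<lambda>x. pt (x $ 2) (x $ 1)) ` unit_tri" if "x \<in> unit_tri" for x
    using that by (intro image_eqI[of _ _ "pt (x $ 2) (x $ 1)"]) (auto simp: unit_tri_def pt_eta)
  then have "aff 0 (pt 0 1) (pt 1 0) ` unit_tri = unit_tri" by (auto simp: a unit_tri_def)
  then show ?thesis
    using integral_affine_image[OF assms compact_unit_tri, of "pt 0 1" "pt 1 0" 0] by (simp add: a cross2_def)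
qed

lemma chord_vertical:
  assumes U: "jet U" and c: "0 \<le> c" "c < 1"
  shows "integral {0..1 - c} (\<lambda>t. \<bar>U a b (pt c t)\<bar>)
    \<le> 4 / (1 - c) * (integral unit_tri (\<lambda>x. \<bar>U a b x\<bar>) + integral unit_tri (\<lambda>x. \<bar>U (Suc a) b x\<bar>)
         + integral unit_tri (\<lambda>x. \<bar>U a (Suc b) x\<bar>))"
proof -
  have "continuous_on UNIV (\<lambda>x. \<bar>U i j x\<bar>)" for i j by (intro continuous_intros jet_continuous U)
  from integral_swap[OF this] show ?thesis
    using chord[OF jet_swap[OF U] c, of b a] by (simp add: jet_swap_def add_ac)
qed

section \<open>Finite differences as iterated integrals\<close>

lemma DERIV_df_funpow:
  assumes "\<And>s. ((\<lambda>x. Y x s) has_real_derivative Y' s) (at x)"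
  shows "((\<lambda>x. (df ^^ b) (Y x) s) has_real_derivative (df ^^ b) Y' s) (at x)"
proof (induction b arbitrary: s)
  case (Suc b)
  have "((\<lambda>x. (df ^^ b) (Y x) (Suc s) - (df ^^ b) (Y x) s) has_real_derivative
      (df ^^ b) Y' (Suc s) - (df ^^ b) Y' s) (at x)"
    by (intro DERIV_diff Suc.IH)
  then show ?case by (simp add: df_def[of "(df ^^ b) _"])
qed (simp add: assms)

text \<open>A difference of order \<open>a\<close> is an iterated integral of the derivative of
  order \<open>a\<close>; all integrations but one run over lengths at most one. The case
  \<open>a = 0\<close> is excluded because a point value is not bounded by an integral of the
  function.\<close>

lemma df_funpow_le_integral:
  fixes g :: "nat \<Rightarrow> real \<Rightarrow> real"
  assumes d: "\<And>n x. (g n has_real_derivative g (Suc n) x) (at x)"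
    and a: "1 \<le> a" "a \<le> k"
  shows "\<bar>(df ^^ a) (\<lambda>r. g 0 (real r / real k)) r\<bar> \<le> integral {real r / real k..real (r + a) / real k} (\<lambda>x. \<bar>g a x\<bar>)"
  using a(1,2) d
proof (induction a arbitrary: g rule: nat_induct_at_least)
  case base
  have c: "continuous_on UNIV (g (Suc 0))"
    by (meson base.prems(2) DERIV_continuous continuous_at_imp_continuous_on)
  show ?case
    using integral_abs_deriv[OF base.prems(2) c, of "real (Suc r) / real k" "real r / real k" "real (r + 1) / real k"]
    by (simp add: df_def divide_right_mono)
next
  case (Suc a)
  have k: "k > 0" using Suc by simp
  \<comment> \<open>One difference is taken off the function and its derivatives alike; the
    induction hypothesis for the remaining differences of \<open>h\<close> then involves increments
    of \<open>g a\<close>, which are integrals of \<open>g (Suc a)\<close>.\<close>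
  define h where "h n x = g n (x + 1 / real k) - g n x" for n x
  have dh: "(h n has_real_derivative h (Suc n) x) (at x)" for n x
    unfolding h_def by (intro DERIV_diff Suc.prems DERIV_shift[THEN iffD1])
  have cg: "continuous_on S (g n)" for n S
    by (meson Suc.prems(2) DERIV_continuous continuous_at_imp_continuous_on)
  have ch: "continuous_on S (h n)" for n S
    by (meson dh DERIV_continuous continuous_at_imp_continuous_on)
  let ?l = "real r / real k" and ?u = "real (r + a) / real k" and ?v = "real (r + Suc a) / real k"
  let ?I = "integral {?l..?v} (\<lambda>x. \<bar>g (Suc a) x\<bar>)"
  have I: "0 \<le> ?I" by (intro integral_nonneg integrable_continuous_real continuous_intros cg) auto
  have "(df ^^ Suc a) (\<lambda>r. g 0 (real r / real k)) r = (df ^^ a) (\<lambda>r. h 0 (real r / real k)) r"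
    by (simp add: df_funpow_Suc h_def add_divide_distrib add.commute del: funpow.simps)
  also have "\<bar>\<dots>\<bar> \<le> integral {?l..?u} (\<lambda>x. \<bar>h a x\<bar>)"
    using Suc.prems dh by (intro Suc.IH) auto
  also have "\<dots> \<le> integral {?l..?u} (\<lambda>x. ?I)"
  proof (intro integral_le integrable_continuous_real continuous_intros ch)
    fix x assume x: "x \<in> {?l..?u}"
    then have "x + 1 / real k \<in> {?l..?v}" "x \<in> {?l..?v}"
      using k by (auto simp: add_divide_distrib) (simp_all add: field_simps)
    then show "\<bar>h a x\<bar> \<le> ?I"
      unfolding h_def by (intro integral_abs_deriv[OF Suc.prems(2) cg])
  qed
  also have "\<dots> = real a / real k * ?I" by (simp add: add_divide_distrib divide_right_mono)
  also have "\<dots> \<le> 1 * ?I" using k Suc.prems by (intro mult_right_mono I) auto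
  finally show ?case by simp
qed

definition tri_idx :: "nat \<Rightarrow> (nat \<times> nat) set" where
  "tri_idx n = {(i, j). i + j \<le> n}"

lemma finite_tri_idx: "finite (tri_idx n)"
  by (rule finite_subset[of _ "{..n} \<times> {..n}"]) (auto simp: tri_idx_def)

text \<open>The Sobolev norm of \<open>U a b\<close> with \<open>n\<close> derivatives, exponent
  one, on the unit triangle.\<close>

definition sob1 :: "(nat \<Rightarrow> nat \<Rightarrow> plane \<Rightarrow> real) \<Rightarrow> nat \<Rightarrow> nat \<Rightarrow> nat \<Rightarrow> real" where
  "sob1 U a b n = (\<Sum>(i, j)\<in>tri_idx n. integral unit_tri (\<lambda>x. \<bar>U (a + i) (b + j) x\<bar>))"

lemma integral_abs_nonneg: "jet U \<Longrightarrow> 0 \<le> integral unit_tri (\<lambda>x. \<bar>U a b x\<bar>)"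
  by (intro integral_nonneg integrable_on_compact compact_unit_tri continuous_intros jet_continuous) auto

lemma sob1_ge:
  assumes "jet U" "I \<subseteq> tri_idx n"
  shows "(\<Sum>(i, j)\<in>I. integral unit_tri (\<lambda>x. \<bar>U (a + i) (b + j) x\<bar>)) \<le> sob1 U a b n"
  unfolding sob1_def using assms
  by (intro sum_mono2 finite_tri_idx) (auto simp: integral_abs_nonneg)

lemma sob1_nonneg: "jet U \<Longrightarrow> 0 \<le> sob1 U a b n"
  using sob1_ge[of U "{}" n] by simp

text \<open>If \<open>a\<close> and \<open>b\<close> are positive, the difference is bounded by an
  integral over a grid rectangle inside the triangle. If just one is positive, it is bounded by an
  integral over a chord, and the trace estimate costs one derivative. If both vanish, the value at
  the node is bounded along a chord and the chord estimate is used twice; this takes two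
  derivatives, available since k \<ge> 1.\<close>

lemma mdiff_le_sob1:
  assumes U: "jet U" and k: "1 \<le> k" and rs: "a + b + r + s \<le> k"
  shows "\<bar>mdiff a b (grid_fun k (U 0 0)) r s\<bar> \<le> 8 * (real k)\<^sup>2 * sob1 U a b (k + 1 - a - b)"
proof -
  let ?n = "k + 1 - a - b" and ?s = "real s / real k" and ?r = "real r / real k"
  let ?I = "\<lambda>i j. integral unit_tri (\<lambda>x. \<bar>U i j x\<bar>)"
  have k0: "0 < real k" "1 \<le> real k" using k by auto
  have cU: "continuous_on S (U i j)" for S i j by (rule jet_continuous[OF U])
  have cA: "continuous_on S (\<lambda>x. \<bar>U i j x\<bar>)" for i j S by (intro continuous_intros cU)
  have kk: "real k \<le> (real k)\<^sup>2" using k0 by (simp add: power2_eq_square)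
  have S0: "0 \<le> sob1 U a b ?n" by (rule sob1_nonneg[OF U])
  have fin: "?thesis" if "\<bar>mdiff a b (grid_fun k (U 0 0)) r s\<bar> \<le> c * sob1 U a b ?n" "c \<le> 8 * (real k)\<^sup>2" for c
    using order_trans[OF that(1) mult_right_mono[OF that(2) S0]] .
  have one: "?I a b + ?I (Suc a) b + ?I a (Suc b) \<le> sob1 U a b ?n"
  proof -
    have "Suc 0 \<le> ?n" using rs by linarith
    then show ?thesis
      using sob1_ge[OF U, of "{(0, 0), (1, 0), (0, 1)}" ?n a b] by (simp add: tri_idx_def add_ac)
  qed
  \<comment> \<open>A grid line with index q < k meets the triangle in a chord of length at least 1
    / k; hence the trace constant is at most 4 * k.\<close>
  have bound: "4 / (1 - c) * X \<le> 4 * real k * Y" if "c \<le> 1 - 1 / real k" "X \<le> Y" "0 \<le> Y" for c X Y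
  proof -
    have "0 < 1 / real k" using k0 by simp
    then have "1 / real k \<le> 1 - c" "0 < 1 - c" using that(1) by linarith+
    then have "4 / (1 - c) \<le> 4 * real k" using k0 by (simp add: field_simps)
    moreover have "4 / (1 - c) * X \<le> 4 / (1 - c) * Y" using that \<open>0 < 1 - c\<close> by (intro mult_left_mono) auto
    ultimately show ?thesis using that(3) by (meson mult_right_mono order_trans)
  qed
  have cle: "real q / real k \<le> 1 - 1 / real k" if "q < k" for q
  proof -
    have "real q + 1 \<le> real k" using that by simp
    then show ?thesis using k0 by (simp add: field_simps)
  qed
  have c1: "real q / real k < 1" if "q < k" for q using that by simp
  have hor: "integral {0..1 - real q / real k} (\<lambda>x. \<bar>U i j (pt x (real q / real k))\<bar>)
      \<le> 4 * real k * (?I i j + ?I (Suc i) j + ?I i (Suc j))" if "q < k" for q i j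
    by (rule order_trans[OF chord[OF U _ c1[OF that]] bound[OF cle[OF that]]])
      (auto intro!: add_nonneg_nonneg integral_abs_nonneg U)
  have ver: "integral {0..1 - real q / real k} (\<lambda>x. \<bar>U i j (pt (real q / real k) x)\<bar>)
      \<le> 4 * real k * (?I i j + ?I (Suc i) j + ?I i (Suc j))" if "q < k" for q i j
    by (rule order_trans[OF chord_vertical[OF U _ c1[OF that]] bound[OF cle[OF that]]])
      (auto intro!: add_nonneg_nonneg integral_abs_nonneg U)
  \<comment> \<open>The vertical differences are taken first, with horizontal derivatives kept
    continuous; \<open>g\<close> is then a function of one variable with its derivatives.\<close>
  define g where "g n x = (df ^^ b) (\<lambda>s. U n 0 (pt x (real s / real k))) s" for n x
  have dg: "(g n has_real_derivative g (Suc n) x) (at x)" for n x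
    unfolding g_def by (rule DERIV_df_funpow) (rule jet_DERIV_1[OF U])
  have cg: "continuous_on S (g n)" for n S
    by (meson dg DERIV_continuous continuous_at_imp_continuous_on)
  have mg: "mdiff a b (grid_fun k (U 0 0)) r s = (df ^^ a) (\<lambda>r. g 0 (real r / real k)) r"
    by (simp add: mdiff_def g_def grid_fun_def[abs_def])
  have gb: "\<bar>g n x\<bar> \<le> integral {?s..real (s + b) / real k} (\<lambda>y. \<bar>U n b (pt x y)\<bar>)" if "1 \<le> b" for n x
    unfolding g_def
    by (rule df_funpow_le_integral[of "\<lambda>m y. U n m (pt x y)" b k s, OF jet_DERIV_2[OF U] that]) (use rs in simp)
  show ?thesis
  proof (cases "1 \<le> a")
    case a: True
    have m: "\<bar>mdiff a b (grid_fun k (U 0 0)) r s\<bar> \<le> integral {?r..real (r + a) / real k} (\<lambda>x. \<bar>g a x\<bar>)"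
      unfolding mg by (rule df_funpow_le_integral[of g a k r, OF dg a]) (use rs in simp)
    show ?thesis
    proof (cases "1 \<le> b")
      case b: True
      note m
      also have "integral {?r..real (r + a) / real k} (\<lambda>x. \<bar>g a x\<bar>)
          \<le> integral {?r..real (r + a) / real k} (\<lambda>x. integral {?s..real (s + b) / real k} (\<lambda>y. \<bar>U a b (pt x y)\<bar>))"
        by (intro integral_le gb b integrable_continuous_real continuous_intros cg inner_integral_continuous cA)
      also have "\<dots> \<le> ?I a b"
      proof (rule rectangle_integral_le[OF cA])
        have "real (r + a) + real (s + b) \<le> real k" using rs by linarith
        then show "real (r + a) / real k + real (s + b) / real k \<le> 1"
          using k0 by (simp only: add_divide_distrib[symmetric] pos_divide_le_eq mult_1)
      qed auto
      also have "\<dots> \<le> 1 * sob1 U a b ?n"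
        using one integral_abs_nonneg[OF U, of "Suc a" b] integral_abs_nonneg[OF U, of a "Suc b"] by linarith
      finally show ?thesis by (rule fin) (use k0 kk in linarith)
    next
      case False
      then have b0: "b = 0" by simp
      note m
      also have "integral {?r..real (r + a) / real k} (\<lambda>x. \<bar>g a x\<bar>) \<le> integral {0..1 - ?s} (\<lambda>x. \<bar>g a x\<bar>)"
      proof (intro integral_subset_le integrable_continuous_real continuous_intros cg)
        have "real (r + a) \<le> real k - real s" using rs by linarith
        then have "real (r + a) / real k \<le> (real k - real s) / real k" by (rule divide_right_mono) simp
        then have "real (r + a) / real k \<le> 1 - ?s" using k0 by (simp add: diff_divide_distrib)
        then show "{?r..real (r + a) / real k} \<subseteq> {0..1 - ?s}" by (auto intro: order_trans[rotated])
      qed auto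
      also have "\<dots> \<le> 4 * real k * (?I a b + ?I (Suc a) b + ?I a (Suc b))"
        using hor[of s a b] rs a by (simp add: g_def b0)
      also have "\<dots> \<le> 4 * real k * sob1 U a b ?n" using one k0 by (intro mult_left_mono) auto
      finally show ?thesis by (rule fin) (use k0 kk in linarith)
    qed
  next
    case False
    then have a0: "a = 0" by simp
    show ?thesis
    proof (cases "1 \<le> b")
      case b: True
      have "\<bar>mdiff a b (grid_fun k (U 0 0)) r s\<bar> = \<bar>g 0 ?r\<bar>" using mg unfolding a0 by simp
      also have "\<dots> \<le> integral {?s..real (s + b) / real k} (\<lambda>y. \<bar>U 0 b (pt ?r y)\<bar>)" by (rule gb[OF b])
      also have "\<dots> \<le> integral {0..1 - ?r} (\<lambda>y. \<bar>U 0 b (pt ?r y)\<bar>)"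
      proof (intro integral_subset_le integrable_continuous_real pt_line_continuous cA)
        have "real (s + b) \<le> real k - real r" using rs by linarith
        then have "real (s + b) / real k \<le> (real k - real r) / real k" by (rule divide_right_mono) simp
        then have "real (s + b) / real k \<le> 1 - ?r" using k0 by (simp add: diff_divide_distrib)
        then show "{?s..real (s + b) / real k} \<subseteq> {0..1 - ?r}" by (auto intro: order_trans[rotated])
      qed auto
      also have "\<dots> \<le> 4 * real k * (?I a b + ?I (Suc a) b + ?I a (Suc b))"
        using ver[of r 0 b] rs b by (simp add: a0)
      also have "\<dots> \<le> 4 * real k * sob1 U a b ?n" using one k0 by (intro mult_left_mono) auto
      finally show ?thesis by (rule fin) (use k0 kk in linarith)
    next
      case False
      then have b0: "b = 0" by simp
      have ev: "mdiff a b (grid_fun k (U 0 0)) r s = U 0 0 (pt ?r ?s)"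
        by (simp add: a0 b0 mdiff_def grid_fun_def)
      have n: "tri_idx 2 \<subseteq> tri_idx ?n" using k by (auto simp: tri_idx_def a0 b0)
      have two: "?I (Suc 0) 0 + ?I (Suc (Suc 0)) 0 + ?I (Suc 0) (Suc 0) \<le> sob1 U a b ?n"
        using sob1_ge[OF U, of "{(1, 0), (2, 0), (1, 1)}" ?n a b] k by (simp add: tri_idx_def a0 b0 numeral_2_eq_2)
      have two': "?I 0 (Suc 0) + ?I (Suc 0) (Suc 0) + ?I 0 (Suc (Suc 0)) \<le> sob1 U a b ?n"
        using sob1_ge[OF U, of "{(0, 1), (1, 1), (0, 2)}" ?n a b] k by (simp add: tri_idx_def a0 b0 numeral_2_eq_2)
      \<comment> \<open>Both chord integrals carry the factor 4 * k. Dividing the first by the chord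
        length costs another factor \<open>k\<close>, and the total is at most 8 * k^2.\<close>
      have comb: "X / L + Y \<le> 8 * (real k)\<^sup>2 * sob1 U a b ?n"
        if "X \<le> 4 * real k * A" "A \<le> sob1 U a b ?n" "Y \<le> 4 * real k * B" "B \<le> sob1 U a b ?n" "1 / real k \<le> L"
        for X Y L A B
      proof -
        have L: "0 < L" using that(5) k0 by (meson less_le_trans zero_less_divide_1_iff)
        have X: "X \<le> 4 * real k * sob1 U a b ?n" and Y: "Y \<le> 4 * real k * sob1 U a b ?n"
          using that k0 by (auto intro: order_trans mult_left_mono)
        have "X / L \<le> (4 * real k * sob1 U a b ?n) / L" using X L by (simp add: divide_right_mono)
        also have "\<dots> = (4 * real k * sob1 U a b ?n) * (1 / L)" by simp
        also have "\<dots> \<le> (4 * real k * sob1 U a b ?n) * real k"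
          using that(5) L k0 S0 by (intro mult_left_mono) (auto simp: field_simps)
        finally have "X / L \<le> 4 * (real k)\<^sup>2 * sob1 U a b ?n" by (simp add: power2_eq_square mult_ac)
        moreover have "4 * real k * sob1 U a b ?n \<le> 4 * (real k)\<^sup>2 * sob1 U a b ?n"
          using kk S0 by (intro mult_right_mono) auto
        ultimately show ?thesis using Y by linarith
      qed
      show ?thesis
      proof (cases "s < k")
        case True
        have L: "1 / real k \<le> 1 - ?s" using cle[OF True] by simp
        have "?r \<le> 1 - ?s" using rs k0 by (simp add: field_simps flip: of_nat_add)
        then have "\<bar>U 0 0 (pt ?r ?s)\<bar> \<le> integral {0..1 - ?s} (\<lambda>x. \<bar>U 0 0 (pt x ?s)\<bar>) / (1 - ?s - 0)
            + integral {0..1 - ?s} (\<lambda>x. \<bar>U (Suc 0) 0 (pt x ?s)\<bar>)"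
          using L k0 True by (intro point_value_le jet_DERIV_1 U pt_line_continuous cU) auto
        also have "\<dots> \<le> 8 * (real k)\<^sup>2 * sob1 U a b ?n"
          using comb[OF hor[OF True, of 0 0] _ hor[OF True, of "Suc 0" 0] two L] one by (simp add: a0 b0)
        finally show ?thesis by (simp add: ev)
      next
        case False
        \<comment> \<open>At the vertex (0, 1) the horizontal chord degenerates to a point; the
          vertical chord through it, at r = 0, is used instead.\<close>
        then have rk: "r < k" "s \<le> k" "r = 0" using rs k by auto
        have L: "1 / real k \<le> 1 - ?r" using cle[OF rk(1)] by simp
        have "?s \<le> 1 - ?r" using rs k0 rk by (simp add: field_simps)
        then have "\<bar>U 0 0 (pt ?r ?s)\<bar> \<le> integral {0..1 - ?r} (\<lambda>x. \<bar>U 0 0 (pt ?r x)\<bar>) / (1 - ?r - 0)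
            + integral {0..1 - ?r} (\<lambda>x. \<bar>U 0 (Suc 0) (pt ?r x)\<bar>)"
          using L k0 rk by (intro point_value_le jet_DERIV_2 U pt_line_continuous cU) auto
        also have "\<dots> \<le> 8 * (real k)\<^sup>2 * sob1 U a b ?n"
          using comb[OF ver[OF rk(1), of 0 0] _ ver[OF rk(1), of 0 "Suc 0"] two' L] one by (simp add: a0 b0)
        finally show ?thesis by (simp add: ev)
      qed
    qed
  qed
qed

lemma newton_poly_deriv_bound:
  obtains B :: real where "0 \<le> B"
    "\<And>i a s. i \<le> k \<Longrightarrow> a \<le> k \<Longrightarrow> 0 \<le> s \<Longrightarrow> s \<le> 1 \<Longrightarrow> \<bar>poly ((pderiv ^^ a) (newton_poly k i)) s\<bar> \<le> B"
proof -
  have "\<exists>B. \<forall>s\<in>{0..1}. \<bar>poly ((pderiv ^^ a) (newton_poly k i)) s\<bar> \<le> B" for a i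
  proof -
    have "compact ((\<lambda>s. poly ((pderiv ^^ a) (newton_poly k i)) s) ` {0..1})"
      by (intro compact_continuous_image continuous_intros) auto
    then have "bounded ((\<lambda>s. poly ((pderiv ^^ a) (newton_poly k i)) s) ` {0..1})" by (rule compact_imp_bounded)
    then show ?thesis by (auto simp: bounded_iff)
  qed
  then obtain B where B: "\<And>a i s. s \<in> {0..1} \<Longrightarrow> \<bar>poly ((pderiv ^^ a) (newton_poly k i)) s\<bar> \<le> B a i"
    by metis
  have B0: "0 \<le> B a i" for a i using B[of 0 a i] by (simp add: order_trans[OF abs_ge_zero])
  show thesis
  proof (rule that[of "\<Sum>a\<le>k. \<Sum>i\<le>k. B a i"])
    show "0 \<le> (\<Sum>a\<le>k. \<Sum>i\<le>k. B a i)" by (intro sum_nonneg B0)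
    fix i a s assume *: "i \<le> k" "a \<le> k" "0 \<le> (s :: real)" "s \<le> 1"
    have "B a i \<le> (\<Sum>i\<le>k. B a i)" by (rule member_le_sum) (use * B0 in auto)
    also have "\<dots> \<le> (\<Sum>a\<le>k. \<Sum>i\<le>k. B a i)"
      by (rule member_le_sum[of a "{..k}" "\<lambda>a. \<Sum>i\<le>k. B a i"]) (use * B0 in \<open>auto intro: sum_nonneg\<close>)
    finally show "\<bar>poly ((pderiv ^^ a) (newton_poly k i)) s\<bar> \<le> (\<Sum>a\<le>k. \<Sum>i\<le>k. B a i)"
      using B[of s a i] * by auto
  qed
qed

text \<open>Only the differences of order at least \<open>(a, b)\<close> survive in the derivative of order \<open>(a, b)\<close>
  of the Newton form, so the derivative is controlled by derivatives of \<open>U a b\<close> alone.\<close>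

lemma newton_stability:
  assumes k: "1 \<le> k"
  shows "\<exists>C\<ge>0. \<forall>U a b x. jet U \<longrightarrow> a + b \<le> k \<longrightarrow> x \<in> unit_tri \<longrightarrow>
    \<bar>newton_jet k (grid_fun k (U 0 0)) a b x\<bar> \<le> C * sob1 U a b (k + 1 - a - b)"
proof -
  obtain B where B0: "0 \<le> B" and
    B: "\<And>i a s. i \<le> k \<Longrightarrow> a \<le> k \<Longrightarrow> 0 \<le> s \<Longrightarrow> s \<le> 1 \<Longrightarrow> \<bar>poly ((pderiv ^^ a) (newton_poly k i)) s\<bar> \<le> B"
    using newton_poly_deriv_bound by blast
  define C where "C = (\<Sum>i\<le>k. \<Sum>j\<le>k - i. 2 ^ k * (8 * (real k)\<^sup>2) * (B * B))"
  have "\<bar>newton_jet k (grid_fun k (U 0 0)) a b x\<bar> \<le> C * sob1 U a b (k + 1 - a - b)"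
    if U: "jet U" and ab: "a + b \<le> k" and x: "x \<in> unit_tri" for U a b x
  proof -
    let ?W = "grid_fun k (U 0 0)" and ?S = "sob1 U a b (k + 1 - a - b)"
    have S0: "0 \<le> ?S" by (rule sob1_nonneg[OF U])
    have x': "0 \<le> x $ 1" "x $ 1 \<le> 1" "0 \<le> x $ 2" "x $ 2 \<le> 1" using x by (auto simp: unit_tri_def)
    have "\<bar>mdiff i j ?W 0 0 * (poly ((pderiv ^^ a) (newton_poly k i)) (x $ 1) * poly ((pderiv ^^ b) (newton_poly k j)) (x $ 2))\<bar>
        \<le> 2 ^ k * (8 * (real k)\<^sup>2) * (B * B) * ?S" if ij: "i \<le> k" "j \<le> k - i" for i j
    proof (cases "a \<le> i \<and> b \<le> j")
      case True
      have "\<bar>mdiff (i - a + a) (j - b + b) ?W 0 0\<bar> \<le> 2 ^ ((i - a) + (j - b)) * (8 * (real k)\<^sup>2 * ?S)"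
        unfolding mdiff_add
      proof (rule mdiff_bound)
        \<comment> \<open>The nodes reached by the remaining differences satisfy a + b + p + q \<le>
          i + j \<le> k, so the bound for order (a, b) applies at each of them.\<close>
        fix p q assume "p \<le> 0 + (i - a)" "q \<le> 0 + (j - b)"
        then have "a + b + p + q \<le> k" using ij True by linarith
        from mdiff_le_sob1[OF U k this] show "\<bar>mdiff a b ?W p q\<bar> \<le> 8 * (real k)\<^sup>2 * ?S" .
      qed
      also have "\<dots> \<le> 2 ^ k * (8 * (real k)\<^sup>2 * ?S)"
        using ij True S0 by (intro mult_right_mono power_increasing) auto
      finally have 1: "\<bar>mdiff i j ?W 0 0\<bar> \<le> 2 ^ k * (8 * (real k)\<^sup>2 * ?S)" using True by simp
      have 2: "\<bar>poly ((pderiv ^^ a) (newton_poly k i)) (x $ 1) * poly ((pderiv ^^ b) (newton_poly k j)) (x $ 2)\<bar> \<le> B * B"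
        unfolding abs_mult using ij ab x' B0 by (intro mult_mono B) auto
      have "\<bar>mdiff i j ?W 0 0 * (poly ((pderiv ^^ a) (newton_poly k i)) (x $ 1) * poly ((pderiv ^^ b) (newton_poly k j)) (x $ 2))\<bar>
          \<le> (2 ^ k * (8 * (real k)\<^sup>2 * ?S)) * (B * B)"
        unfolding abs_mult[of "mdiff i j ?W 0 0"] using S0 by (intro mult_mono 1 2) auto
      then show ?thesis by (simp add: mult_ac)
    next
      case False
      \<comment> \<open>A Newton factor of degree below the order of differentiation is
        annihilated.\<close>
      then have "(pderiv ^^ a) (newton_poly k i) = 0 \<or> (pderiv ^^ b) (newton_poly k j) = 0"
        using degree_newton_poly[of k i] degree_newton_poly[of k j] by (auto intro!: pderiv_funpow_0)
      then show ?thesis using S0 B0 by auto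
    qed
    then have "\<bar>newton_jet k ?W a b x\<bar> \<le> (\<Sum>i\<le>k. \<Sum>j\<le>k - i. 2 ^ k * (8 * (real k)\<^sup>2) * (B * B) * ?S)"
      unfolding newton_jet_def
      by (intro order_trans[OF sum_abs] sum_mono) auto
    then show ?thesis by (simp add: C_def sum_distrib_right mult.assoc)
  qed
  moreover have "0 \<le> C" unfolding C_def using B0 by (intro sum_nonneg) auto
  ultimately show ?thesis by blast
qed

section \<open>The reference triangle\<close>

text \<open>The p-th power of the Sobolev seminorm of order \<open>n\<close> of
  \<open>U a b\<close>.\<close>

definition top_sum :: "real \<Rightarrow> (nat \<Rightarrow> nat \<Rightarrow> plane \<Rightarrow> real) \<Rightarrow> nat \<Rightarrow> nat \<Rightarrow> nat \<Rightarrow> real" where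
  "top_sum p U a b n = (\<Sum>l\<le>n. integral unit_tri (\<lambda>x. \<bar>U (a + l) (b + (n - l)) x\<bar> powr p))"

lemma integral_powr_nonneg: "jet U \<Longrightarrow> 1 \<le> p \<Longrightarrow> 0 \<le> integral unit_tri (\<lambda>x. \<bar>U a b x\<bar> powr p)"
  by (intro integral_nonneg integrable_on_compact compact_unit_tri continuous_powr_p jet_continuous) auto

text \<open>The number \<open>d\<close> counts the derivatives missing up to order \<open>n\<close>.
  As long as d > 0, the total order is at most \<open>k\<close> and the mean vanishes, so Poincare's
  inequality adds one derivative. It also doubles the number of terms, which is why 8^p becomes 16^p
  = 8^p * 2^p.\<close>

lemma poincare_iterated:
  assumes G: "jet G" and p: "1 \<le> p" and mean: "\<And>a b. a + b \<le> k \<Longrightarrow> integral unit_tri (G a b) = 0"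
    and n: "a + b + n = k + 1"
  shows "i + j + d = n \<Longrightarrow>
    integral unit_tri (\<lambda>x. \<bar>G (a + i) (b + j) x\<bar> powr p) \<le> (16 powr p) ^ d * top_sum p G a b n"
proof (induction d arbitrary: i j)
  case 0
  have "integral unit_tri (\<lambda>x. \<bar>G (a + i) (b + (n - i)) x\<bar> powr p) \<le> top_sum p G a b n"
    unfolding top_sum_def using 0
    by (intro member_le_sum[of i "{..n}" "\<lambda>l. integral unit_tri (\<lambda>x. \<bar>G (a + l) (b + (n - l)) x\<bar> powr p)"])
      (auto intro: integral_powr_nonneg G p)
  moreover have "n - i = j" using 0 by simp
  ultimately show ?case by simp
next
  case (Suc d)
  let ?R = "(16 powr p) ^ d * top_sum p G a b n"
  have "integral unit_tri (\<lambda>x. \<bar>G (a + i) (b + j) x\<bar> powr p)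
      \<le> 8 powr p * (integral unit_tri (\<lambda>x. \<bar>G (Suc (a + i)) (b + j) x\<bar> powr p) + integral unit_tri (\<lambda>x. \<bar>G (a + i) (Suc (b + j)) x\<bar> powr p))"
    by (rule poincare[OF G p mean]) (use n Suc.prems in linarith)
  also have "\<dots> \<le> 8 powr p * (?R + ?R)"
    using Suc.IH[of "Suc i" j] Suc.IH[of i "Suc j"] Suc.prems by (intro mult_left_mono add_mono) auto
  also have "\<dots> = (8 powr p * 2) * ?R" by simp
  also have "\<dots> \<le> 16 powr p * ?R"
  proof (rule mult_right_mono)
    have "(16 :: real) powr p = 8 powr p * 2 powr p" by (simp flip: powr_mult)
    moreover have "(2 :: real) powr 1 \<le> 2 powr p" using p by (intro powr_mono) auto
    ultimately show "8 powr p * 2 \<le> (16 :: real) powr p" by simp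
    show "0 \<le> ?R" unfolding top_sum_def by (intro mult_nonneg_nonneg sum_nonneg integral_powr_nonneg G p) auto
  qed
  finally show ?case by (simp add: mult_ac)
qed

text \<open>Only derivatives of \<open>U a b\<close> occur on the right, which is what survives anisotropic scaling.\<close>

theorem reference_estimate:
  assumes k: "1 \<le> k"
  shows "\<exists>C\<ge>1. \<forall>p\<ge>1. \<forall>U a b. jet U \<longrightarrow> a + b \<le> k \<longrightarrow>
    integral unit_tri (\<lambda>x. \<bar>U a b x - newton_jet k (grid_fun k (U 0 0)) a b x\<bar> powr p)
      \<le> C powr p * top_sum p U a b (k + 1 - a - b)"
proof -
  obtain D where D0: "0 \<le> D" and
    D: "\<And>U a b x. jet U \<Longrightarrow> a + b \<le> k \<Longrightarrow> x \<in> unit_tri \<Longrightarrow>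
      \<bar>newton_jet k (grid_fun k (U 0 0)) a b x\<bar> \<le> D * sob1 U a b (k + 1 - a - b)"
    using newton_stability[OF k] by blast
  define N where "N = real (card (tri_idx (k + 1)))"
  have N1: "1 \<le> N"
  proof -
    have "card {(0 :: nat, 0 :: nat)} \<le> card (tri_idx (k + 1))"
      by (rule card_mono[OF finite_tri_idx]) (auto simp: tri_idx_def)
    then show ?thesis by (simp add: N_def)
  qed
  define E where "E = (16 :: real) ^ (k + 1)"
  have E1: "1 \<le> E" unfolding E_def by (rule one_le_power) simp
  define C where "C = 2 * (1 + D * N * N) * E"
  have C1: "1 \<le> C"
  proof -
    have "1 * 1 \<le> (1 + D * N * N) * E" using D0 N1 E1 by (intro mult_mono) auto
    then show ?thesis unfolding C_def mult.assoc by linarith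
  qed
  have "integral unit_tri (\<lambda>x. \<bar>U a b x - newton_jet k (grid_fun k (U 0 0)) a b x\<bar> powr p)
      \<le> C powr p * top_sum p U a b (k + 1 - a - b)"
    if p: "1 \<le> p" and U: "jet U" and ab: "a + b \<le> k" for p U a b
  proof -
    let ?n = "k + 1 - a - b"
    \<comment> \<open>Subtracting \<open>Q\<close> makes all means of order up to \<open>k\<close>
      vanish, while the interpolation error is unchanged because interpolation reproduces
      \<open>Q\<close>.\<close>
    obtain Q where Q: "polyjet k Q" and Qm: "\<And>a b. a + b \<le> k \<Longrightarrow> integral unit_tri (Q a b) = integral unit_tri (U a b)"
      using polyjet_prescribed_means[of area k "\<lambda>a b. integral unit_tri (U a b)"] area_pos
      by (auto simp: area_def)
    define G where "G = (\<lambda>a b x. U a b x - Q a b x)"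
    have JQ: "jet Q" using Q by (rule polyjet_jet)
    have G: "jet G" unfolding G_def by (intro jet_diff U JQ)
    have mean: "integral unit_tri (G a b) = 0" if "a + b \<le> k" for a b
      unfolding G_def using Qm[OF that] by (subst integral_diff) (auto intro: jet_integrable U JQ)
    have n: "a + b + ?n = k + 1" using ab by simp
    \<comment> \<open>The derivatives in the sum have total order k + 1, where \<open>Q\<close>
      contributes nothing.\<close>
    have topG: "top_sum p G a b ?n = top_sum p U a b ?n"
      unfolding top_sum_def
    proof (intro sum.cong refl)
      fix l assume "l \<in> {..?n}"
      then have "k < a + l + (b + (?n - l))" using n by auto
      then show "integral unit_tri (\<lambda>x. \<bar>G (a + l) (b + (?n - l)) x\<bar> powr p)
          = integral unit_tri (\<lambda>x. \<bar>U (a + l) (b + (?n - l)) x\<bar> powr p)"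
        using Q by (simp add: G_def polyjet_def)
    qed
    define R where "R = E powr p * top_sum p U a b ?n"
    have T0: "0 \<le> top_sum p U a b ?n" unfolding top_sum_def by (intro sum_nonneg integral_powr_nonneg U p)
    have R0: "0 \<le> R" unfolding R_def using T0 by simp
    have Gb: "integral unit_tri (\<lambda>x. \<bar>G (a + i) (b + j) x\<bar> powr p) \<le> R" if "i + j \<le> ?n" for i j
    proof -
      have "integral unit_tri (\<lambda>x. \<bar>G (a + i) (b + j) x\<bar> powr p) \<le> (16 powr p) ^ (?n - i - j) * top_sum p G a b ?n"
        by (rule poincare_iterated[OF G p mean n]) (use that in auto)
      also have "\<dots> \<le> (16 powr p) ^ (k + 1) * top_sum p U a b ?n"
        unfolding topG using p by (intro mult_right_mono power_increasing T0) (auto intro: ge_one_powr_ge_zero)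
      \<comment> \<open>The iterated constant is rewritten as the p-th power of a number free of
        \<open>p\<close>.\<close>
      also have "((16 :: real) powr p) ^ (k + 1) = (16 powr p) powr real (k + 1)"
        by (rule powr_realpow[symmetric]) simp
      also have "\<dots> = (16 powr real (k + 1)) powr p" by (simp add: powr_powr mult.commute)
      also have "(16 :: real) powr real (k + 1) = E" unfolding E_def by (rule powr_realpow) simp
      finally show ?thesis by (simp add: R_def)
    qed
    \<comment> \<open>The L1 norms are bounded by p-th power integrals through Jensen's inequality;
      as the area is at most one, no factor appears. One \<open>N\<close> stems from the power of
      the sum, the other from the number of its terms.\<close>
    have sob: "(sob1 G a b ?n) powr p \<le> (N * N) powr p * R"
    proof -
      have i1: "(integral unit_tri (\<lambda>x. \<bar>G i j x\<bar>)) powr p \<le> integral unit_tri (\<lambda>x. \<bar>G i j x\<bar> powr p)" for i j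
      proof -
        let ?I = "integral unit_tri (\<lambda>x. \<bar>G i j x\<bar>)" and ?J = "integral unit_tri (\<lambda>x. \<bar>G i j x\<bar> powr p)"
        have "?I powr p = area powr p * (?I / area) powr p"
          using area_pos integral_abs_nonneg[OF G] by (simp flip: powr_mult)
        also have "\<dots> \<le> area powr p * (?J / area)"
          by (intro mult_left_mono jensen_integral p area_has_integral area_pos integrable_on_compact compact_unit_tri
              continuous_powr_p continuous_intros jet_continuous G) auto
        also have "\<dots> \<le> area powr 1 * (?J / area)"
          using area_pos area_le_1 p integral_powr_nonneg[OF G p]
          by (intro mult_right_mono powr_mono') auto
        finally show ?thesis using area_pos by simp
      qed
      have "(sob1 G a b ?n) powr p
          \<le> real (card (tri_idx ?n)) powr p * (\<Sum>z\<in>tri_idx ?n. (case z of (i, j) \<Rightarrow> integral unit_tri (\<lambda>x. \<bar>G (a + i) (b + j) x\<bar>)) powr p)"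
        unfolding sob1_def
        by (rule sum_powr_le[OF finite_tri_idx _ p]) (auto intro: integral_abs_nonneg G)
      also have "(\<Sum>z\<in>tri_idx ?n. (case z of (i, j) \<Rightarrow> integral unit_tri (\<lambda>x. \<bar>G (a + i) (b + j) x\<bar>)) powr p) \<le> (\<Sum>z\<in>tri_idx ?n. R)"
        by (intro sum_mono) (auto simp: tri_idx_def intro: order_trans[OF i1 Gb])
      also have "(\<Sum>z\<in>tri_idx ?n. R) = real (card (tri_idx ?n)) * R" by simp
      also have "real (card (tri_idx ?n)) powr p * (real (card (tri_idx ?n)) * R) \<le> N powr p * (N * R)"
      proof -
        have "real (card (tri_idx ?n)) \<le> N"
          unfolding N_def by (intro of_nat_mono card_mono finite_tri_idx) (auto simp: tri_idx_def)
        then show ?thesis using R0 p by (intro mult_mono powr_mono2) auto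
      qed
      also have "N * R \<le> N powr p * R"
      proof -
        have "N powr 1 \<le> N powr p" using p N1 by (intro powr_mono) auto
        then show ?thesis using R0 N1 by (intro mult_right_mono) auto
      qed
      finally show ?thesis using N1 by (simp add: powr_mult mult_left_mono mult.assoc)
    qed
    let ?I = "\<lambda>x. newton_jet k (grid_fun k (G 0 0)) a b x"
    have JN: "jet (newton_jet k (grid_fun k (G 0 0)))" using polyjet_newton by (rule polyjet_jet)
    have eq: "U a b x - newton_jet k (grid_fun k (U 0 0)) a b x = G a b x - ?I x" for x
    proof -
      have "newton_jet k (grid_fun k (Q 0 0)) a b x = Q a b x"
        using newton_poly_reproduces[OF Q] k by simp
      then show ?thesis by (simp add: G_def newton_jet_diff)
    qed
    have "integral unit_tri (\<lambda>x. \<bar>U a b x - newton_jet k (grid_fun k (U 0 0)) a b x\<bar> powr p)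
        \<le> integral unit_tri (\<lambda>x. 2 powr p * (\<bar>G a b x\<bar> powr p + (D * sob1 G a b ?n) powr p))"
      unfolding eq
    proof (intro integral_le integrable_on_compact compact_unit_tri continuous_powr_p continuous_intros jet_continuous G JN p)
      fix x assume x: "x \<in> unit_tri"
      have "\<bar>G a b x - ?I x\<bar> \<le> \<bar>G a b x\<bar> + D * sob1 G a b ?n" using D[OF G ab x] by linarith
      then have "\<bar>G a b x - ?I x\<bar> powr p \<le> (\<bar>G a b x\<bar> + D * sob1 G a b ?n) powr p"
        using p by (intro powr_mono2) auto
      also have "\<dots> \<le> 2 powr p * (\<bar>G a b x\<bar> powr p + (D * sob1 G a b ?n) powr p)"
        using D0 sob1_nonneg[OF G] by (intro powr_add_le p) auto
      finally show "\<bar>G a b x - ?I x\<bar> powr p \<le> 2 powr p * (\<bar>G a b x\<bar> powr p + (D * sob1 G a b ?n) powr p)" .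
    qed
    also have "\<dots> = 2 powr p * (integral unit_tri (\<lambda>x. \<bar>G a b x\<bar> powr p) + (D * sob1 G a b ?n) powr p * area)"
    proof -
      have "integral unit_tri (\<lambda>x. \<bar>G a b x\<bar> powr p + (D * sob1 G a b ?n) powr p * 1)
          = integral unit_tri (\<lambda>x. \<bar>G a b x\<bar> powr p) + integral unit_tri (\<lambda>x. (D * sob1 G a b ?n) powr p * 1)"
        by (intro integral_add integrable_on_compact compact_unit_tri continuous_powr_p continuous_intros jet_continuous G p)
      also have "integral unit_tri (\<lambda>x. (D * sob1 G a b ?n) powr p * 1) = (D * sob1 G a b ?n) powr p * area"
        unfolding area_def by (rule integral_mult_right)
      finally show ?thesis by (simp only: integral_mult_right mult_1_right)
    qed
    also have "\<dots> \<le> 2 powr p * (R + (D * N * N) powr p * R)"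
    proof (intro mult_left_mono add_mono)
      show "integral unit_tri (\<lambda>x. \<bar>G a b x\<bar> powr p) \<le> R" using Gb[of 0 0] by simp
      have "(D * sob1 G a b ?n) powr p * area \<le> (D * sob1 G a b ?n) powr p"
        using area_le_1 by (simp add: mult_left_le)
      also have "\<dots> = D powr p * (sob1 G a b ?n) powr p"
        using D0 sob1_nonneg[OF G] by (simp add: powr_mult)
      also have "\<dots> \<le> D powr p * ((N * N) powr p * R)" by (intro mult_left_mono sob) auto
      also have "\<dots> = (D * N * N) powr p * R" using D0 N1 by (simp add: powr_mult mult.assoc)
      finally show "(D * sob1 G a b ?n) powr p * area \<le> (D * N * N) powr p * R" .
    qed auto
    also have "\<dots> = 2 powr p * (1 powr p + (D * N * N) powr p) * R" by (simp add: algebra_simps)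
    also have "\<dots> \<le> 2 powr p * (1 + D * N * N) powr p * R"
    proof (intro mult_right_mono mult_left_mono R0)
      \<comment> \<open>Superadditivity of the p-th power merges the two constants into a single
        p-th power.\<close>
      have "1 powr p + (D * N * N) powr p \<le> (1 + D * N * N) powr p"
      proof -
        define y where "y = D * N * N"
        have y: "0 \<le> y" unfolding y_def using D0 N1 by simp
        have "1 + y powr p \<le> (1 + y) powr p"
        proof -
          have "1 \<le> (1 + y) powr (p - 1)" using y p by (intro ge_one_powr_ge_zero) auto
          moreover have "y * y powr (p - 1) \<le> y * (1 + y) powr (p - 1)"
            using y p by (intro mult_left_mono powr_mono2) auto
          moreover have "y * y powr (p - 1) = y powr p" using y by (cases "y = 0") (auto simp: powr_mult_base)
          moreover have "(1 + y) * (1 + y) powr (p - 1) = (1 + y) powr p" using y by (simp add: powr_mult_base)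
          ultimately show ?thesis by (simp add: algebra_simps)
        qed
        then show ?thesis by (simp add: y_def)
      qed
      then show "1 powr p + (D * N * N) powr p \<le> (1 + D * N * N) powr p" .
    qed auto
    also have "\<dots> = C powr p * top_sum p U a b ?n"
    proof -
      define Y where "Y = 1 + D * N * N"
      have "0 \<le> Y" using D0 N1 by (simp add: Y_def)
      then have "(2 * Y * E) powr p = 2 powr p * Y powr p * E powr p" using E1 by (simp add: powr_mult)
      then show ?thesis unfolding C_def R_def Y_def[symmetric] by (simp only: mult.assoc)
    qed
    finally show ?thesis .
  qed
  then show ?thesis using C1 by blast
qed

section \<open>General triangles\<close>

text \<open>\<open>inv1\<close> and \<open>inv2\<close> are the columns of the inverse of the matrix
  with columns \<open>e\<close> and \<open>f\<close>. They give \<open>aff_inv\<close> the form of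
  an \<open>aff\<close> map, so that \<open>jet_affine\<close> covers both directions.\<close>

definition inv1 :: "plane \<Rightarrow> plane \<Rightarrow> plane" where
  "inv1 e f = pt (f $ 2 / cross2 e f) (- (e $ 2) / cross2 e f)"

definition inv2 :: "plane \<Rightarrow> plane \<Rightarrow> plane" where
  "inv2 e f = pt (- (f $ 1) / cross2 e f) (e $ 1 / cross2 e f)"

definition inv0 :: "plane \<Rightarrow> plane \<Rightarrow> plane \<Rightarrow> plane" where
  "inv0 z e f = - ((z $ 1) *\<^sub>R inv1 e f + (z $ 2) *\<^sub>R inv2 e f)"

definition aff_inv :: "plane \<Rightarrow> plane \<Rightarrow> plane \<Rightarrow> plane \<Rightarrow> plane" where
  "aff_inv z e f = aff (inv0 z e f) (inv1 e f) (inv2 e f)"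

lemma aff_inv_aff:
  assumes "cross2 e f \<noteq> 0"
  shows "aff_inv z e f (aff z e f y) = y"
proof -
  have "cross2 e f * (aff_inv z e f (aff z e f y) $ i) = cross2 e f * (y $ i)" for i
    using exhaust_2[of i] assms
    by (auto simp: aff_inv_def aff_def inv0_def inv1_def inv2_def field_simps) (auto simp: cross2_def algebra_simps)
  then show ?thesis using assms by (simp add: vec_eq_iff)
qed

lemma aff_aff_inv:
  assumes "cross2 e f \<noteq> 0"
  shows "aff z e f (aff_inv z e f x) = x"
  using aff_inverse[OF assms, of z x] aff_inv_aff[OF assms] by metis

text \<open>The Lagrange interpolant on the triangle with corner \<open>z\<close> and edges
  \<open>e\<close>, \<open>f\<close>: interpolate the pullback on the reference triangle and
  transport the result back, together with all derivatives in the original coordinates.\<close>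

definition interp_jet ::
    "plane \<Rightarrow> plane \<Rightarrow> plane \<Rightarrow> nat \<Rightarrow> (plane \<Rightarrow> real) \<Rightarrow> nat \<Rightarrow> nat \<Rightarrow> plane \<Rightarrow> real" where
  "interp_jet z e f k v a b x =
     pull_dirs (inv1 e f) (inv2 e f) (newton_jet k (grid_fun k (\<lambda>y. v (aff z e f y)))) a b (aff_inv z e f x)"

lemma polyjet_interp_jet: "polyjet k (interp_jet z e f k v)"
  unfolding interp_jet_def[abs_def] aff_inv_def by (intro polyjet_affine polyjet_newton)

lemma tendsto_dir_shift_funpow:
  assumes "\<And>a b. (\<lambda>n. U n a b (y n)) \<longlonglongrightarrow> V a b x"
  shows "(\<lambda>n. (dir_shift e ^^ m) (U n) a b (y n)) \<longlonglongrightarrow> (dir_shift e ^^ m) V a b x"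
proof (induction m arbitrary: a b)
  case (Suc m)
  have "(\<lambda>n. dir_shift e ((dir_shift e ^^ m) (U n)) a b (y n)) \<longlonglongrightarrow> dir_shift e ((dir_shift e ^^ m) V) a b x"
    unfolding dir_shift_def[of e "(dir_shift e ^^ m) _"] by (intro tendsto_intros Suc)
  then show ?case by simp
qed (simp add: assms)

lemma tendsto_pull_dirs:
  assumes "\<And>a b. (\<lambda>n. U n a b (y n)) \<longlonglongrightarrow> V a b x"
  shows "(\<lambda>n. pull_dirs e f (U n) a b (y n)) \<longlonglongrightarrow> pull_dirs e f V a b x"
  unfolding pull_dirs_def by (intro tendsto_dir_shift_funpow assms)

lemma tendsto_df_funpow:
  assumes "\<And>q. r \<le> q \<Longrightarrow> q \<le> r + m \<Longrightarrow> (\<lambda>n. w n q) \<longlonglongrightarrow> w' q"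
  shows "(\<lambda>n. (df ^^ m) (w n) r) \<longlonglongrightarrow> (df ^^ m) w' r"
  using assms
proof (induction m arbitrary: r)
  case (Suc m)
  have "(\<lambda>n. (df ^^ m) (w n) (Suc r) - (df ^^ m) (w n) r) \<longlonglongrightarrow> (df ^^ m) w' (Suc r) - (df ^^ m) w' r"
    by (intro tendsto_intros Suc) auto
  then show ?case by (simp add: df_def[of "(df ^^ m) _"])
qed simp

text \<open>The interpolant depends on \<open>v\<close> through finitely many values, continuously,
  so convergence at the nodes is enough. The evaluation point may move as well, which the dilation
  argument requires.\<close>

lemma tendsto_interp_jet:
  assumes v: "\<And>r s. r + s \<le> k \<Longrightarrow> (\<lambda>n. v n (aff z e f (pt (real r / real k) (real s / real k))))
      \<longlonglongrightarrow> v' (aff z e f (pt (real r / real k) (real s / real k)))"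
    and y: "y \<longlonglongrightarrow> x"
  shows "(\<lambda>n. interp_jet z e f k (v n) a b (y n)) \<longlonglongrightarrow> interp_jet z e f k v' a b x"
proof -
  have y': "(\<lambda>n. aff_inv z e f (y n)) \<longlonglongrightarrow> aff_inv z e f x"
    unfolding aff_inv_def aff_def by (intro tendsto_intros y)
  have p: "(\<lambda>n. poly P (aff_inv z e f (y n) $ i)) \<longlonglongrightarrow> poly P (aff_inv z e f x $ i)" for P i
    by (rule isCont_tendsto_compose[OF poly_isCont]) (intro tendsto_intros y')
  have m: "(\<lambda>n. mdiff i j (grid_fun k (\<lambda>y. v n (aff z e f y))) 0 0) \<longlonglongrightarrow> mdiff i j (grid_fun k (\<lambda>y. v' (aff z e f y))) 0 0"
    if "i \<le> k" "j \<le> k - i" for i j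
    unfolding mdiff_def using that v by (intro tendsto_df_funpow) (auto simp: grid_fun_def)
  show ?thesis
    unfolding interp_jet_def
    by (rule tendsto_pull_dirs) (auto simp: newton_jet_def intro!: tendsto_sum tendsto_mult m p)
qed

text \<open>\<open>z\<close> is the vertex opposite the longest edge, so that the law of sines relates its angle to
  \<open>circumradius K / diameter K\<close>.\<close>

locale labelled_triangle =
  fixes K :: "plane set" and z A B :: plane
  assumes cross: "cross2 A B \<noteq> 0"
    and vert: "vertices K = {z, z + A, z + B}"
    and K_eq: "K = aff z A B ` unit_tri"
    and longest: "norm A \<le> norm (A - B)" "norm B \<le> norm (A - B)"
    and diam: "diameter K = norm (A - B)"
begin

lemma A_ne: "A \<noteq> 0" and B_ne: "B \<noteq> 0" and AB_ne: "A \<noteq> B"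
  using cross by (auto simp: cross2_def)

lemma lattice_points_eq:
  assumes "k > 0"
  shows "lattice_points k K = {aff z A B (pt (real r / real k) (real s / real k)) | r s. r + s \<le> k}"
proof -
  have d: "z \<noteq> z + A" "z \<noteq> z + B" "z + A \<noteq> z + B" using A_ne B_ne AB_ne by auto
  have s3: "(\<Sum>u\<in>vertices K. g u) = g z + g (z + A) + g (z + B)" for g :: "plane \<Rightarrow> 'b::comm_monoid_add"
    using d by (simp add: vert add_ac)
  have eq: "(real i / real k) *\<^sub>R z + (real r / real k) *\<^sub>R (z + A) + (real s / real k) *\<^sub>R (z + B)
      = aff z A B (pt (real r / real k) (real s / real k))" if "i + r + s = k" for i r s
  proof -
    \<comment> \<open>The barycentric weights sum to one, so the multiples of \<open>z\<close>
      combine to \<open>z\<close> itself.\<close>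
    have "real i / real k + real r / real k + real s / real k = 1"
      using that assms by (simp add: add_divide_distrib[symmetric] flip: of_nat_add)
    then have "(real i / real k + real r / real k + real s / real k) *\<^sub>R z = z" by simp
    then show ?thesis by (simp add: aff_def algebra_simps)
  qed
  show ?thesis
  proof (intro set_eqI iffI)
    fix x assume "x \<in> lattice_points k K"
    then obtain a :: "plane \<Rightarrow> nat" where a: "a z + a (z + A) + a (z + B) = k"
      "x = (real (a z) / real k) *\<^sub>R z + (real (a (z + A)) / real k) *\<^sub>R (z + A) + (real (a (z + B)) / real k) *\<^sub>R (z + B)"
      unfolding lattice_points_def s3 by blast
    have "x = aff z A B (pt (real (a (z + A)) / real k) (real (a (z + B)) / real k))"
      using eq[OF a(1)] a(2) by simp
    moreover have "a (z + A) + a (z + B) \<le> k" using a(1) by simp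
    ultimately show "x \<in> {aff z A B (pt (real r / real k) (real s / real k)) | r s. r + s \<le> k}" by blast
  next
    fix x assume "x \<in> {aff z A B (pt (real r / real k) (real s / real k)) | r s. r + s \<le> k}"
    then obtain r s where rs: "r + s \<le> k" "x = aff z A B (pt (real r / real k) (real s / real k))" by blast
    define a where "a = (\<lambda>u. if u = z then k - (r + s) else if u = z + A then r else s)"
    have "a z + a (z + A) + a (z + B) = k" using rs d by (simp add: a_def)
    moreover have "x = (real (a z) / real k) *\<^sub>R z + (real (a (z + A)) / real k) *\<^sub>R (z + A) + (real (a (z + B)) / real k) *\<^sub>R (z + B)"
      using eq[of "k - (r + s)" r s] rs d by (simp add: a_def)
    ultimately show "x \<in> lattice_points k K"
      unfolding lattice_points_def s3 by blast
  qed
qed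

text \<open>Existence is Newton interpolation on the reference triangle. For uniqueness, the
  difference of two interpolants is pulled back to a polynomial that vanishes on the grid.\<close>

lemma lagrange_interp_eq:
  assumes k: "k > 0"
  shows "lagrange_interp k K v = interp_jet z A B k v 0 0"
  unfolding lagrange_interp_def
proof (rule the_equality)
  let ?Q = "interp_jet z A B k v"
  have val: "?Q 0 0 (aff z A B (pt (real r / real k) (real s / real k))) = v (aff z A B (pt (real r / real k) (real s / real k)))"
    if "r + s \<le> k" for r s
    using that by (simp add: interp_jet_def aff_inv_aff cross newton_interpolates k grid_fun_def)
  show "?Q 0 0 \<in> polys k \<and> (\<forall>x\<in>lattice_points k K. ?Q 0 0 x = v x)"
    using polyjet_polys[OF polyjet_interp_jet] val by (auto simp: lattice_points_eq k)
  fix q assume q: "q \<in> polys k \<and> (\<forall>x\<in>lattice_points k K. q x = v x)"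
  then obtain V where V: "polyjet k V" "V 0 0 = q" using polys_polyjet by blast
  let ?D = "\<lambda>a b x. V a b x - ?Q a b x"
  have "polyjet k (\<lambda>a b x. pull_dirs A B ?D a b (aff z A B x))"
    by (intro polyjet_affine polyjet_diff V polyjet_interp_jet)
  moreover have "q (aff z A B (pt (real r / real k) (real s / real k))) = v (aff z A B (pt (real r / real k) (real s / real k)))"
    if "r + s \<le> k" for r s
    using q that by (auto simp: lattice_points_eq k)
  ultimately have "(\<lambda>x. V 0 0 (aff z A B x) - ?Q 0 0 (aff z A B x)) = (\<lambda>_. 0)"
    using polyjet_zero_on_grid[OF _ order_refl k, of "\<lambda>a b x. pull_dirs A B ?D a b (aff z A B x)" 0 0] val
    by (simp add: V(2))
  then have "q (aff z A B y) = ?Q 0 0 (aff z A B y)" for y by (simp add: V(2) fun_eq_iff)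
  from this[of "aff_inv z A B _"] show "q = ?Q 0 0" by (simp add: aff_aff_inv cross fun_eq_iff)
qed

lemma compact_K: "compact K"
  unfolding K_eq
  by (intro compact_continuous_image compact_unit_tri continuous_at_imp_continuous_on)
    (meson aff_has_derivative has_derivative_continuous)

lemma norm_plane: "norm (x :: plane) = sqrt ((x $ 1)\<^sup>2 + (x $ 2)\<^sup>2)"
  by (simp add: norm_vec_def L2_set_def sum_2)

lemma norm_plane_power2: "(norm (x :: plane))\<^sup>2 = (x $ 1)\<^sup>2 + (x $ 2)\<^sup>2"
  by (simp add: norm_plane)

lemma circumradius_eq: "circumradius K = norm A * norm B * norm (A - B) / (2 * \<bar>cross2 A B\<bar>)"
proof -
  let ?D = "cross2 A B" and ?a = "(A $ 1)\<^sup>2 + (A $ 2)\<^sup>2" and ?b = "(B $ 1)\<^sup>2 + (B $ 2)\<^sup>2"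
  \<comment> \<open>The circumcentre relative to \<open>z\<close>, found by Cramer's rule from the
    conditions that its inner products with \<open>A\<close> and \<open>B\<close> are half their
    squared norms.\<close>
  define q where "q = pt ((?a * B $ 2 - ?b * A $ 2) / (2 * ?D)) ((A $ 1 * ?b - B $ 1 * ?a) / (2 * ?D))"
  have qA: "q $ 1 * A $ 1 + q $ 2 * A $ 2 = ?a / 2" and qB: "q $ 1 * B $ 1 + q $ 2 * B $ 2 = ?b / 2"
    using cross by (simp_all add: q_def divide_simps) (simp_all add: cross2_def algebra_simps power2_eq_square)
  have "norm q = norm A * norm B * norm (A - B) / (2 * \<bar>?D\<bar>)"
  proof -
    have "(2 * ?D)\<^sup>2 * ((q $ 1)\<^sup>2 + (q $ 2)\<^sup>2) = ((2 * ?D) * q $ 1)\<^sup>2 + ((2 * ?D) * q $ 2)\<^sup>2"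
      by (simp add: power_mult_distrib algebra_simps)
    also have "(2 * ?D) * q $ 1 = ?a * B $ 2 - ?b * A $ 2" using cross by (simp add: q_def)
    also have "(2 * ?D) * q $ 2 = A $ 1 * ?b - B $ 1 * ?a" using cross by (simp add: q_def)
    \<comment> \<open>With A, B as vectors: the squared norm of \<bar>A\<bar>^2 B - \<bar>B\<bar>^2
      A equals \<bar>A\<bar>^2 \<bar>B\<bar>^2 \<bar>A - B\<bar>^2.\<close>
    also have "(?a * B $ 2 - ?b * A $ 2)\<^sup>2 + (A $ 1 * ?b - B $ 1 * ?a)\<^sup>2
        = ?a * ?b * (((A - B) $ 1)\<^sup>2 + ((A - B) $ 2)\<^sup>2)"
      by (simp add: power2_eq_square algebra_simps)
    finally have "(2 * ?D)\<^sup>2 * ((q $ 1)\<^sup>2 + (q $ 2)\<^sup>2) = ?a * ?b * (((A - B) $ 1)\<^sup>2 + ((A - B) $ 2)\<^sup>2)" .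
    then have "sqrt ((2 * ?D)\<^sup>2 * ((q $ 1)\<^sup>2 + (q $ 2)\<^sup>2)) = sqrt (?a * ?b * (((A - B) $ 1)\<^sup>2 + ((A - B) $ 2)\<^sup>2))"
      by simp
    then have "2 * \<bar>?D\<bar> * norm q = norm A * norm B * norm (A - B)"
      by (simp add: real_sqrt_mult norm_plane abs_mult)
    then show ?thesis using cross by (simp add: field_simps)
  qed
  moreover have "circumradius K = norm q"
    unfolding circumradius_def
  proof (rule the_equality)
    have e: "dist (z + q) z = norm q" "dist (z + q) (z + A) = norm (q - A)" "dist (z + q) (z + B) = norm (q - B)"
      by (simp_all add: dist_norm)
    have "((q - A) $ 1)\<^sup>2 + ((q - A) $ 2)\<^sup>2 = (q $ 1)\<^sup>2 + (q $ 2)\<^sup>2"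
      using qA by (simp add: power2_eq_square algebra_simps)
    moreover have "((q - B) $ 1)\<^sup>2 + ((q - B) $ 2)\<^sup>2 = (q $ 1)\<^sup>2 + (q $ 2)\<^sup>2"
      using qB by (simp add: power2_eq_square algebra_simps)
    ultimately have "norm (q - A) = norm q" "norm (q - B) = norm q" by (simp_all only: norm_plane)
    then show "\<exists>c. \<forall>x\<in>vertices K. dist c x = norm q" using e by (intro exI[of _ "z + q"]) (auto simp: vert)
    fix r assume "\<exists>c. \<forall>x\<in>vertices K. dist c x = r"
    then obtain c where c: "dist c z = r" "dist c (z + A) = r" "dist c (z + B) = r" by (auto simp: vert)
    define y where "y = c - z"
    have n: "norm y = r" "norm (y - A) = r" "norm (y - B) = r"
      using c by (simp_all add: dist_norm y_def algebra_simps)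
    then have "(norm (y - A))\<^sup>2 = (norm y)\<^sup>2" "(norm (y - B))\<^sup>2 = (norm y)\<^sup>2" by auto
    then have yA: "y $ 1 * A $ 1 + y $ 2 * A $ 2 = ?a / 2" and yB: "y $ 1 * B $ 1 + y $ 2 * B $ 2 = ?b / 2"
      unfolding norm_plane_power2 by (simp_all add: power2_eq_square algebra_simps)
    \<comment> \<open>Any equidistant point solves the same two linear equations, whose determinant
      is nonzero; this gives the uniqueness that \<open>THE\<close> demands.\<close>
    have "?D * (y $ 1 - q $ 1) = 0" "?D * (y $ 2 - q $ 2) = 0"
      using qA qB yA yB unfolding cross2_def by algebra+
    then have "y = q" using cross by (simp add: vec_eq_iff forall_2)
    then show "r = norm q" using n by simp
  qed
  ultimately show ?thesis by simp
qed

end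

text \<open>The maximal distance in the convex hull of a finite set is attained at two of the
  generating points; the third vertex becomes \<open>z\<close>.\<close>

lemma triangle_label:
  assumes "2 simplex K"
  obtains z A B where "labelled_triangle K z A B"
proof -
  obtain C where C: "\<not> affine_dependent C" "int (card C) = 2 + 1" "K = convex hull C"
    using assms by (auto simp: simplex_def)
  then have card: "card C = 3" by simp
  then have fin: "finite C" "C \<noteq> {}" by (auto intro: card_ge_0_finite)
  have vK: "vertices K = C" using C by (simp add: vertices_convex_hull)
  obtain u w where uw: "u \<in> C" "w \<in> C" and far: "\<And>x y. x \<in> K \<Longrightarrow> y \<in> K \<Longrightarrow> norm (x - y) \<le> norm (u - w)"
    using simplex_extremal_le[OF fin] C(3) by blast
  have CK: "C \<subseteq> K" using C(3) by (simp add: hull_subset)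
  have "u \<noteq> w"
  proof
    assume "u = w"
    then have "x = y" if "x \<in> C" "y \<in> C" for x y using far[of x y] that CK by auto
    then have "card C \<le> 1" using fin by (simp add: card_le_Suc0_iff_eq)
    then show False using card by simp
  qed
  then have "card (C - {u, w}) = 1" using card uw fin by (simp add: card_Diff_subset)
  then obtain z where z: "C - {u, w} = {z}" by (auto simp: card_1_singleton_iff)
  then have Ceq: "C = {z, u, w}" and ne: "z \<noteq> u" "z \<noteq> w" using uw by auto
  define A where "A = u - z"
  define B where "B = w - z"
  have cross: "cross2 A B \<noteq> 0"
  proof
    assume c0: "cross2 A B = 0"
    have "B $ 2 *\<^sub>R A - A $ 2 *\<^sub>R B = 0" "B $ 1 *\<^sub>R A - A $ 1 *\<^sub>R B = 0"
      using c0 by (auto simp: vec_eq_iff forall_2 cross2_def algebra_simps)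
    then have *: "\<exists>s t. (s \<noteq> 0 \<or> t \<noteq> 0) \<and> s *\<^sub>R A + t *\<^sub>R B = 0"
    proof (cases "A = 0")
      case True then show ?thesis by (intro exI[of _ 1] exI[of _ 0]) simp
    next
      case False
      then have "A $ 1 \<noteq> 0 \<or> A $ 2 \<noteq> 0" by (auto simp: vec_eq_iff forall_2)
      then show ?thesis
      proof
        assume "A $ 1 \<noteq> 0"
        then show ?thesis using \<open>B $ 1 *\<^sub>R A - A $ 1 *\<^sub>R B = 0\<close> by (intro exI[of _ "B $ 1"] exI[of _ "- (A $ 1)"]) simp
      next
        assume "A $ 2 \<noteq> 0"
        then show ?thesis using \<open>B $ 2 *\<^sub>R A - A $ 2 *\<^sub>R B = 0\<close> by (intro exI[of _ "B $ 2"] exI[of _ "- (A $ 2)"]) simp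
      qed
    qed
    then obtain s t where st: "s \<noteq> 0 \<or> t \<noteq> 0" "s *\<^sub>R A + t *\<^sub>R B = 0" by blast
    \<comment> \<open>A linear relation between the edge vectors becomes an affine one between the
      vertices when \<open>z\<close> receives the negative sum of the coefficients.\<close>
    define g where "g = (\<lambda>x. if x = u then s else if x = w then t else - (s + t))"
    have "sum g C = 0" "(\<Sum>x\<in>C. g x *\<^sub>R x) = 0"
      using st ne \<open>u \<noteq> w\<close> by (auto simp: Ceq g_def A_def B_def algebra_simps)
    moreover have "\<exists>v\<in>C. g v \<noteq> 0" using st ne \<open>u \<noteq> w\<close> by (auto simp: Ceq g_def)
    ultimately have "affine_dependent C" using fin by (auto simp: affine_dependent_explicit_finite)
    then show False using C(1) by simp
  qed
  have Kim: "K = aff z A B ` unit_tri"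
  proof -
    have "convex hull {z, u, w} = {z + s *\<^sub>R (u - z) + t *\<^sub>R (w - z) | s t. 0 \<le> s \<and> 0 \<le> t \<and> s + t \<le> 1}"
      by (rule convex_hull_3_alt)
    also have "\<dots> = aff z A B ` unit_tri"
    proof (intro set_eqI iffI)
      fix x assume "x \<in> {z + s *\<^sub>R (u - z) + t *\<^sub>R (w - z) | s t. 0 \<le> s \<and> 0 \<le> t \<and> s + t \<le> 1}"
      then obtain s t where "x = z + s *\<^sub>R (u - z) + t *\<^sub>R (w - z)" "0 \<le> s" "0 \<le> t" "s + t \<le> 1" by blast
      then show "x \<in> aff z A B ` unit_tri"
        by (intro image_eqI[of _ _ "pt s t"]) (auto simp: aff_def A_def B_def unit_tri_def)
    next
      fix x assume "x \<in> aff z A B ` unit_tri"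
      then show "x \<in> {z + s *\<^sub>R (u - z) + t *\<^sub>R (w - z) | s t. 0 \<le> s \<and> 0 \<le> t \<and> s + t \<le> 1}"
        by (auto simp: aff_def A_def B_def unit_tri_def)
    qed
    finally show ?thesis by (simp add: C(3) Ceq)
  qed
  have AB: "A - B = u - w" by (simp add: A_def B_def)
  have "diameter K = norm (A - B)"
  proof (rule antisym)
    show "diameter K \<le> norm (A - B)"
      unfolding AB by (rule diameter_le) (use CK uw far in \<open>auto simp: dist_norm\<close>)
    have "bounded K" using C(3) fin by (simp add: finite_imp_bounded_convex_hull)
    then show "norm (A - B) \<le> diameter K"
      unfolding AB using diameter_bounded_bound[of K u w] CK uw by (auto simp: dist_norm)
  qed
  moreover have "norm A \<le> norm (A - B)" "norm B \<le> norm (A - B)"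
    unfolding AB A_def B_def using far[of u z] far[of w z] CK Ceq by auto
  moreover have "vertices K = {z, z + A, z + B}" by (simp add: vK Ceq A_def B_def)
  ultimately have "labelled_triangle K z A B"
    unfolding labelled_triangle_def using cross Kim by blast
  then show thesis by (rule that)
qed

section \<open>Derivatives along the two edges at \<open>z\<close>\<close>

context labelled_triangle
begin

definition "e1 = A /\<^sub>R norm A"
definition "e2 = B /\<^sub>R norm B"

lemma A_e1: "A = norm A *\<^sub>R e1" and B_e2: "B = norm B *\<^sub>R e2"
  using A_ne B_ne by (simp_all add: e1_def e2_def)

lemma e_le_1: "\<bar>e1 $ i\<bar> \<le> 1" "\<bar>e2 $ i\<bar> \<le> 1"
  using component_le_norm_cart[of e1 i] component_le_norm_cart[of e2 i] A_ne B_ne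
  by (simp_all add: e1_def e2_def)

lemma cross_e: "cross2 e1 e2 = cross2 A B / (norm A * norm B)"
  by (simp add: e1_def e2_def cross2_def divide_inverse algebra_simps)

lemma diam_pos: "0 < diameter K" using AB_ne by (simp add: diam)

text \<open>The left side is one over the sine of the angle at \<open>z\<close>, as
  \<open>e1\<close> and \<open>e2\<close> are unit vectors.\<close>

lemma inverse_cross_e: "1 / \<bar>cross2 e1 e2\<bar> = 2 * circumradius K / diameter K"
  using AB_ne by (simp add: cross_e circumradius_eq diam abs_mult)

lemma cross_e_ne: "cross2 e1 e2 \<noteq> 0"
  using cross A_ne B_ne by (simp add: cross_e)

lemma ratio_pos: "0 < circumradius K / diameter K"
proof -
  have "0 < 1 / \<bar>cross2 e1 e2\<bar>" using cross_e_ne by simp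
  then show ?thesis unfolding inverse_cross_e by simp
qed

lemma inv_e_bound: "\<bar>inv1 e1 e2 $ i\<bar> \<le> 2 * circumradius K / diameter K" "\<bar>inv2 e1 e2 $ i\<bar> \<le> 2 * circumradius K / diameter K"
proof -
  have "\<bar>c\<bar> \<le> 1 \<Longrightarrow> \<bar>c / cross2 e1 e2\<bar> \<le> 1 / \<bar>cross2 e1 e2\<bar>" for c
    by (simp add: divide_right_mono)
  from this[OF e_le_1(1)[of 1]] this[OF e_le_1(1)[of 2]] this[OF e_le_1(2)[of 1]] this[OF e_le_1(2)[of 2]]
  show "\<bar>inv1 e1 e2 $ i\<bar> \<le> 2 * circumradius K / diameter K" "\<bar>inv2 e1 e2 $ i\<bar> \<le> 2 * circumradius K / diameter K"
    using exhaust_2[of i] unfolding inverse_cross_e[symmetric] by (auto simp: inv1_def inv2_def)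
qed

lemma integral_K:
  "continuous_on UNIV g \<Longrightarrow> integral K g = \<bar>cross2 A B\<bar> * integral unit_tri (\<lambda>x. g (aff z A B x))"
  unfolding K_eq by (rule integral_affine_image[OF _ compact_unit_tri cross])

lemma integrable_K: "continuous_on K g \<Longrightarrow> g integrable_on K" for g :: "plane \<Rightarrow> real"
  by (rule integrable_on_compact[OF compact_K])

lemma pull_dirs_AB: "pull_dirs A B U a b x = norm A ^ a * norm B ^ b * pull_dirs e1 e2 U a b x"
  using pull_dirs_scale[of "norm A" e1 "norm B" e2] by (simp flip: A_e1 B_e2)

lemma pull_dirs_continuous: "jet U \<Longrightarrow> continuous_on S (pull_dirs e f U a b)"
  unfolding pull_dirs_def by (intro jet_continuous jet_dir_shift_funpow)

text \<open>Passing to the coordinates of \<open>e1\<close>, \<open>e2\<close> and back restores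
  \<open>U\<close>, by \<open>jet_unique\<close>. Each order costs one application of the inverse
  matrix, with entries at most 2 R / h, and a factor 2 for its two components.\<close>

lemma jet_in_directions:
  assumes "jet U"
  shows "\<bar>U i j x\<bar> \<le> (4 * circumradius K / diameter K) ^ (i + j) * (\<Sum>l\<le>i + j. \<bar>pull_dirs e1 e2 U l (i + j - l) x\<bar>)"
proof -
  define V where "V = (\<lambda>a b y. pull_dirs e1 e2 U a b (aff z e1 e2 y))"
  have V: "jet V" unfolding V_def by (rule jet_affine[OF assms])
  define W where "W = (\<lambda>a b x. pull_dirs (inv1 e1 e2) (inv2 e1 e2) V a b (aff_inv z e1 e2 x))"
  have W: "jet W" unfolding W_def aff_inv_def by (rule jet_affine[OF V])
  have "W 0 0 = U 0 0" by (simp add: W_def V_def aff_aff_inv cross_e_ne fun_eq_iff)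
  then have "U i j = W i j" using jet_unique[OF W assms] by simp
  then have "\<bar>U i j x\<bar> \<le> (2 * (2 * circumradius K / diameter K)) ^ (i + j) * (\<Sum>l\<le>i + j. \<bar>V l (i + j - l) (aff_inv z e1 e2 x)\<bar>)"
    using pull_dirs_bound[OF inv_e_bound(1,1) inv_e_bound(2,2), of V i j "aff_inv z e1 e2 x"] by (simp add: W_def)
  then show ?thesis by (simp add: V_def aff_aff_inv cross_e_ne)
qed

text \<open>Pulling \<open>U\<close> back to the reference triangle turns \<open>\<partial>\<^sub>A\<^sup>a \<partial>\<^sub>B\<^sup>b\<close> into coordinate derivatives; the
  factors \<open>norm A ^ a * norm B ^ b\<close> occur on both sides and cancel.\<close>

lemma directional_estimate:
  assumes k: "1 \<le> k" and C: "1 \<le> C" and p: "1 \<le> p" and U: "jet U" and ab: "a + b \<le> k"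
    and ref: "\<And>U. jet U \<Longrightarrow>
      integral unit_tri (\<lambda>x. \<bar>U a b x - newton_jet k (grid_fun k (U 0 0)) a b x\<bar> powr p)
        \<le> C powr p * top_sum p U a b (k + 1 - a - b)"
  shows "integral K (\<lambda>x. \<bar>pull_dirs e1 e2 (\<lambda>a b x. U a b x - interp_jet z A B k (U 0 0) a b x) a b x\<bar> powr p)
    \<le> (C * diameter K ^ (k + 1 - a - b)) powr p *
      (\<Sum>l\<le>k + 1 - a - b. integral K (\<lambda>x. \<bar>pull_dirs e1 e2 U (a + l) (b + (k + 1 - a - b - l)) x\<bar> powr p))"
proof -
  let ?n = "k + 1 - a - b" and ?F = "aff z A B" and ?h = "diameter K"
  let ?Q = "interp_jet z A B k (U 0 0)"
  define E where "E = (\<lambda>a b x. U a b x - ?Q a b x)"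
  have Q: "jet ?Q" by (rule polyjet_jet[OF polyjet_interp_jet])
  have E: "jet E" unfolding E_def by (intro jet_diff U Q)
  define V where "V = (\<lambda>a b x. pull_dirs A B U a b (?F x))"
  have V: "jet V" unfolding V_def by (rule jet_affine[OF U])
  \<comment> \<open>Interpolation commutes with affine maps. Only the functions themselves are
    compared; their derivatives follow by \<open>jet_unique\<close>.\<close>
  have nw: "newton_jet k (grid_fun k (V 0 0)) a b x = pull_dirs A B ?Q a b (?F x)" for x
  proof -
    have "jet (newton_jet k (grid_fun k (V 0 0)))" by (rule polyjet_jet[OF polyjet_newton])
    moreover have "jet (\<lambda>a b x. pull_dirs A B ?Q a b (?F x))" by (rule jet_affine[OF Q])
    moreover have "newton_jet k (grid_fun k (V 0 0)) 0 0 = (\<lambda>x. pull_dirs A B ?Q 0 0 (?F x))"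
      by (simp add: fun_eq_iff interp_jet_def aff_inv_aff cross V_def)
    ultimately have "newton_jet k (grid_fun k (V 0 0)) a b = (\<lambda>x. pull_dirs A B ?Q a b (?F x))"
      by (rule jet_unique)
    then show ?thesis by (rule fun_cong)
  qed
  have pos: "0 < norm A" "0 < norm B" using A_ne B_ne by auto
  let ?D = "\<bar>cross2 A B\<bar>"
  have D: "0 < ?D" using cross by simp
  have cp: "continuous_on UNIV (\<lambda>x. \<bar>pull_dirs e1 e2 X i j x\<bar> powr p)" if "jet X" for X i j
    by (intro continuous_powr_p p pull_dirs_continuous that)
  have pull: "integral unit_tri (\<lambda>x. \<bar>pull_dirs A B X i j (?F x)\<bar> powr p)
      = (norm A ^ i * norm B ^ j) powr p * (integral K (\<lambda>x. \<bar>pull_dirs e1 e2 X i j x\<bar> powr p) / ?D)"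
    if "jet X" for X i j
  proof -
    have "integral unit_tri (\<lambda>x. \<bar>pull_dirs A B X i j (?F x)\<bar> powr p)
        = integral unit_tri (\<lambda>x. (norm A ^ i * norm B ^ j) powr p * \<bar>pull_dirs e1 e2 X i j (?F x)\<bar> powr p)"
      by (simp add: pull_dirs_AB abs_mult powr_mult)
    also have "\<dots> = (norm A ^ i * norm B ^ j) powr p * integral unit_tri (\<lambda>x. \<bar>pull_dirs e1 e2 X i j (?F x)\<bar> powr p)"
      by (rule integral_mult_right)
    also have "integral unit_tri (\<lambda>x. \<bar>pull_dirs e1 e2 X i j (?F x)\<bar> powr p)
        = integral K (\<lambda>x. \<bar>pull_dirs e1 e2 X i j x\<bar> powr p) / ?D"
      using D by (simp add: integral_K[OF cp[OF that]])
    finally show ?thesis .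
  qed
  let ?J = "\<lambda>l. integral K (\<lambda>x. \<bar>pull_dirs e1 e2 U (a + l) (b + (?n - l)) x\<bar> powr p)"
  have J0: "0 \<le> ?J l" for l
    by (intro integral_nonneg integrable_K continuous_on_subset[OF cp[OF U]]) auto
  let ?s = "norm A ^ a * norm B ^ b"
  have s0: "0 < ?s" using pos by simp
  have "?s powr p * (integral K (\<lambda>x. \<bar>pull_dirs e1 e2 E a b x\<bar> powr p) / ?D)
      = integral unit_tri (\<lambda>x. \<bar>V a b x - newton_jet k (grid_fun k (V 0 0)) a b x\<bar> powr p)"
    unfolding pull[OF E, symmetric] nw by (simp add: V_def E_def pull_dirs_diff)
  also have "\<dots> \<le> C powr p * top_sum p V a b ?n" by (rule ref[OF V])
  finally have 1: "?s powr p * (integral K (\<lambda>x. \<bar>pull_dirs e1 e2 E a b x\<bar> powr p) / ?D) \<le> C powr p * top_sum p V a b ?n" .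
  have "top_sum p V a b ?n = (\<Sum>l\<le>?n. (norm A ^ (a + l) * norm B ^ (b + (?n - l))) powr p * (?J l / ?D))"
    unfolding top_sum_def V_def by (simp add: pull[OF U])
  also have "\<dots> \<le> (\<Sum>l\<le>?n. (?s * ?h ^ ?n) powr p * (?J l / ?D))"
  proof (intro sum_mono mult_right_mono powr_mono2)
    fix l assume l: "l \<in> {..?n}"
    \<comment> \<open>After the common factor of order (a, b) is split off, the remaining edge
      lengths are bounded by the diameter.\<close>
    have "norm A ^ l * norm B ^ (?n - l) \<le> ?h ^ l * ?h ^ (?n - l)"
      using longest by (intro mult_mono power_mono) (auto simp: diam)
    also have "\<dots> = ?h ^ (l + (?n - l))" by (simp only: power_add)
    also have "l + (?n - l) = ?n" using l by simp
    finally have "?s * (norm A ^ l * norm B ^ (?n - l)) \<le> ?s * ?h ^ ?n" using s0 by (intro mult_left_mono) auto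
    then show "norm A ^ (a + l) * norm B ^ (b + (?n - l)) \<le> ?s * ?h ^ ?n"
      by (simp add: power_add mult_ac)
  qed (use p J0 D in auto)
  also have "\<dots> = ?s powr p * ((?h ^ ?n) powr p * (\<Sum>l\<le>?n. ?J l) / ?D)"
    using s0 diam_pos by (simp add: powr_mult sum_distrib_left sum_divide_distrib mult_ac)
  finally have 2: "top_sum p V a b ?n \<le> ?s powr p * ((?h ^ ?n) powr p * (\<Sum>l\<le>?n. ?J l) / ?D)" .
  have "?s powr p * (integral K (\<lambda>x. \<bar>pull_dirs e1 e2 E a b x\<bar> powr p) / ?D)
      \<le> C powr p * (?s powr p * ((?h ^ ?n) powr p * (\<Sum>l\<le>?n. ?J l) / ?D))"
    by (rule order_trans[OF 1 mult_left_mono[OF 2]]) simp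
  also have "\<dots> = ?s powr p * (C powr p * (?h ^ ?n) powr p * (\<Sum>l\<le>?n. ?J l) / ?D)" by simp
  finally have "?s powr p * (integral K (\<lambda>x. \<bar>pull_dirs e1 e2 E a b x\<bar> powr p) / ?D)
      \<le> ?s powr p * (C powr p * (?h ^ ?n) powr p * (\<Sum>l\<le>?n. ?J l) / ?D)" .
  moreover have "0 < ?s powr p" using s0 by (metis less_numeral_extra(3) powr_gt_zero)
  ultimately have "integral K (\<lambda>x. \<bar>pull_dirs e1 e2 E a b x\<bar> powr p) / ?D
      \<le> C powr p * (?h ^ ?n) powr p * (\<Sum>l\<le>?n. ?J l) / ?D"
    using mult_le_cancel_left_pos by blast
  then have "integral K (\<lambda>x. \<bar>pull_dirs e1 e2 E a b x\<bar> powr p) \<le> C powr p * (?h ^ ?n) powr p * (\<Sum>l\<le>?n. ?J l)"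
    using D by (simp add: divide_le_cancel)
  also have "C powr p * (?h ^ ?n) powr p = (C * ?h ^ ?n) powr p" using C diam_pos by (simp add: powr_mult)
  finally show ?thesis unfolding E_def .
qed

end

text \<open>The p-th power of the Sobolev seminorm of order \<open>n\<close> on \<open>K\<close>;
  the pairs (l, n - l) are the multi-indices of that order.\<close>

definition seminorm_K :: "plane set \<Rightarrow> real \<Rightarrow> (nat \<Rightarrow> nat \<Rightarrow> plane \<Rightarrow> real) \<Rightarrow> nat \<Rightarrow> real" where
  "seminorm_K K p U n = (\<Sum>l\<le>n. integral K (\<lambda>x. \<bar>U l (n - l) x\<bar> powr p))"

theorem triangle_estimate:
  assumes k: "1 \<le> k"
  shows "\<exists>C\<ge>1. \<forall>K z A B p U m. labelled_triangle K z A B \<longrightarrow> 1 \<le> p \<longrightarrow> jet U \<longrightarrow> m \<le> k \<longrightarrow>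
    seminorm_K K p (\<lambda>a b x. U a b x - interp_jet z A B k (U 0 0) a b x) m
      \<le> (C * (circumradius K / diameter K) ^ m * diameter K ^ (k + 1 - m)) powr p * seminorm_K K p U (k + 1)"
proof -
  obtain C where C: "1 \<le> C" and ref: "\<And>p U a b. 1 \<le> p \<Longrightarrow> jet U \<Longrightarrow> a + b \<le> k \<Longrightarrow>
    integral unit_tri (\<lambda>x. \<bar>U a b x - newton_jet k (grid_fun k (U 0 0)) a b x\<bar> powr p)
      \<le> C powr p * top_sum p U a b (k + 1 - a - b)"
    using reference_estimate[OF k] by blast
  define N where "N = real (k + 2)"
  have N: "1 \<le> N" by (simp add: N_def)
  \<comment> \<open>From left to right: \<open>4 ^ k * N\<close> for passing from edge directions to
    coordinates, one \<open>N\<close> for each of the two sums over derivatives of order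
    \<open>m\<close>, the reference constant \<open>C\<close>, \<open>N\<close> for the number of
    terms in the directional estimate, and \<open>2 ^ (k + 1) * N\<close> for writing directional
    derivatives of order k + 1 in coordinates.\<close>
  define C' where "C' = (4 ^ k * N) * (N * N) * C * (N * (2 ^ (k + 1) * N))"
  have "1 \<le> C'"
  proof -
    have "1 \<le> x * y" if "1 \<le> x" "1 \<le> y" for x y :: real
      using mult_mono[OF that] that by simp
    note 1 = this
    have "1 \<le> (4 :: real) ^ k" "1 \<le> (2 :: real) ^ (k + 1)" by (rule one_le_power, simp)+
    then show ?thesis unfolding C'_def by (intro 1 N C)
  qed
  moreover have "seminorm_K K p (\<lambda>a b x. U a b x - interp_jet z A B k (U 0 0) a b x) m
      \<le> (C' * (circumradius K / diameter K) ^ m * diameter K ^ (k + 1 - m)) powr p * seminorm_K K p U (k + 1)"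
    if "labelled_triangle K z A B" and p: "1 \<le> p" and U: "jet U" and m: "m \<le> k" for K z A B p U m
  proof -
    interpret labelled_triangle K z A B by fact
    let ?h = "diameter K" and ?\<rho> = "circumradius K / diameter K" and ?n = "k + 1 - m"
    define E where "E = (\<lambda>a b x. U a b x - interp_jet z A B k (U 0 0) a b x)"
    have E: "jet E" unfolding E_def by (intro jet_diff U polyjet_jet[OF polyjet_interp_jet])
    have NN: "N \<le> N powr p" using powr_mono[OF p N] N by simp
    have TK0: "0 \<le> integral K (\<lambda>x. \<bar>X i j x\<bar> powr p)" if "jet X" for X i j
      by (intro integral_nonneg integrable_K continuous_powr_p p jet_continuous that) auto
    have P0: "0 \<le> integral K (\<lambda>x. \<bar>pull_dirs e1 e2 X i j x\<bar> powr p)" if "jet X" for X i j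
      by (intro integral_nonneg integrable_K continuous_powr_p p pull_dirs_continuous that) auto
    define T where "T = seminorm_K K p U (k + 1)"
    have T0: "0 \<le> T" unfolding T_def seminorm_K_def by (intro sum_nonneg TK0 U)
    define R where "R = (C * ?h ^ ?n * (N * (2 ^ (k + 1) * N))) powr p * T"
    have h0: "0 < ?h" by (rule diam_pos)
    have R0: "0 \<le> R" unfolding R_def using T0 by simp
    have top: "integral K (\<lambda>x. \<bar>pull_dirs e1 e2 U i j x\<bar> powr p) \<le> (2 ^ (k + 1) * N) powr p * T" if ij: "i + j = k + 1" for i j
    proof -
      have "integral K (\<lambda>x. \<bar>pull_dirs e1 e2 U i j x\<bar> powr p)
          \<le> integral K (\<lambda>x. (2 ^ (k + 1) * N) powr p * (\<Sum>l\<le>k + 1. \<bar>U l (k + 1 - l) x\<bar> powr p))"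
      proof (intro integral_le integrable_K continuous_powr_p p pull_dirs_continuous continuous_intros jet_continuous U)
        fix x
        have "\<bar>pull_dirs e1 e2 U i j x\<bar> \<le> 2 ^ (k + 1) * (\<Sum>l\<le>k + 1. \<bar>U l (k + 1 - l) x\<bar>)"
          using pull_dirs_bound[OF e_le_1(1,1) e_le_1(2,2), of U i j x] ij by simp
        then have "\<bar>pull_dirs e1 e2 U i j x\<bar> powr p \<le> (2 ^ (k + 1) * (\<Sum>l\<le>k + 1. \<bar>U l (k + 1 - l) x\<bar>)) powr p"
          using p by (intro powr_mono2) auto
        also have "\<dots> = (2 ^ (k + 1)) powr p * (\<Sum>l\<le>k + 1. \<bar>U l (k + 1 - l) x\<bar>) powr p"
          by (rule powr_mult)
        also have "\<dots> \<le> (2 ^ (k + 1)) powr p * (real (card {..k + 1}) powr p * (\<Sum>l\<le>k + 1. \<bar>U l (k + 1 - l) x\<bar> powr p))"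
          by (intro mult_left_mono sum_powr_le p) auto
        also have "real (card {..k + 1}) = N" by (simp add: N_def)
        finally show "\<bar>pull_dirs e1 e2 U i j x\<bar> powr p \<le> (2 ^ (k + 1) * N) powr p * (\<Sum>l\<le>k + 1. \<bar>U l (k + 1 - l) x\<bar> powr p)"
          using N by (simp add: powr_mult mult.assoc)
      qed
      also have "\<dots> = (2 ^ (k + 1) * N) powr p * T"
      proof -
        have "integral K (\<lambda>x. \<Sum>l\<le>k + 1. \<bar>U l (k + 1 - l) x\<bar> powr p) = T"
          unfolding T_def seminorm_K_def
          by (rule integral_sum) (auto intro!: integrable_K continuous_powr_p[OF jet_continuous[OF U] p])
        then show ?thesis by (simp only: integral_mult_right)
      qed
      finally show ?thesis .
    qed
    have dir: "integral K (\<lambda>x. \<bar>pull_dirs e1 e2 E a b x\<bar> powr p) \<le> R" if ab: "a + b = m" for a b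
    proof -
      have n: "k + 1 - a - b = ?n" using ab by simp
      have "integral K (\<lambda>x. \<bar>pull_dirs e1 e2 E a b x\<bar> powr p)
          \<le> (C * ?h ^ ?n) powr p * (\<Sum>l\<le>?n. integral K (\<lambda>x. \<bar>pull_dirs e1 e2 U (a + l) (b + (?n - l)) x\<bar> powr p))"
        using directional_estimate[OF k C p U _ ref[OF p], of a b] ab m unfolding E_def n by simp
      also have "\<dots> \<le> (C * ?h ^ ?n) powr p * (\<Sum>l\<le>?n. (2 ^ (k + 1) * N) powr p * T)"
        using ab m by (intro mult_left_mono sum_mono top) auto
      also have "(\<Sum>l\<le>?n. (2 ^ (k + 1) * N) powr p * T) = real (?n + 1) * ((2 ^ (k + 1) * N) powr p * T)" by simp
      also have "\<dots> \<le> N powr p * ((2 ^ (k + 1) * N) powr p * T)"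
      proof (rule mult_right_mono)
        have "real (?n + 1) \<le> N" by (simp add: N_def)
        then show "real (?n + 1) \<le> N powr p" using NN by linarith
      qed (use T0 in simp)
      also have "(C * ?h ^ ?n) powr p * (N powr p * ((2 ^ (k + 1) * N) powr p * T)) = R"
        using C h0 N by (simp add: R_def powr_mult mult.assoc)
      finally show ?thesis by (simp add: mult_left_mono)
    qed
    have each: "integral K (\<lambda>x. \<bar>E l (m - l) x\<bar> powr p) \<le> ((4 * ?\<rho>) ^ m * N) powr p * (N * R)" if l: "l \<le> m" for l
    proof -
      have r0: "0 \<le> 4 * ?\<rho>" using ratio_pos by simp
      have "integral K (\<lambda>x. \<bar>E l (m - l) x\<bar> powr p)
          \<le> integral K (\<lambda>x. ((4 * ?\<rho>) ^ m * N) powr p * (\<Sum>q\<le>m. \<bar>pull_dirs e1 e2 E q (m - q) x\<bar> powr p))"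
      proof (intro integral_le integrable_K continuous_powr_p p pull_dirs_continuous continuous_intros jet_continuous E)
        fix x
        have "\<bar>E l (m - l) x\<bar> \<le> (4 * ?\<rho>) ^ m * (\<Sum>q\<le>m. \<bar>pull_dirs e1 e2 E q (m - q) x\<bar>)"
          using jet_in_directions[OF E, of l "m - l" x] l by simp
        then have "\<bar>E l (m - l) x\<bar> powr p \<le> ((4 * ?\<rho>) ^ m * (\<Sum>q\<le>m. \<bar>pull_dirs e1 e2 E q (m - q) x\<bar>)) powr p"
          using p by (intro powr_mono2) auto
        also have "\<dots> = ((4 * ?\<rho>) ^ m) powr p * (\<Sum>q\<le>m. \<bar>pull_dirs e1 e2 E q (m - q) x\<bar>) powr p"
          by (rule powr_mult)
        also have "\<dots> \<le> ((4 * ?\<rho>) ^ m) powr p * (real (card {..m}) powr p * (\<Sum>q\<le>m. \<bar>pull_dirs e1 e2 E q (m - q) x\<bar> powr p))"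
          by (intro mult_left_mono sum_powr_le p) auto
        also have "\<dots> \<le> ((4 * ?\<rho>) ^ m) powr p * (N powr p * (\<Sum>q\<le>m. \<bar>pull_dirs e1 e2 E q (m - q) x\<bar> powr p))"
          using m p by (intro mult_left_mono mult_right_mono powr_mono2 sum_nonneg) (auto simp: N_def)
        also have "\<dots> = ((4 * ?\<rho>) ^ m * N) powr p * (\<Sum>q\<le>m. \<bar>pull_dirs e1 e2 E q (m - q) x\<bar> powr p)"
        proof -
          have "0 \<le> (4 * ?\<rho>) ^ m" using r0 by (rule zero_le_power)
          then show ?thesis using N by (simp only: powr_mult mult.assoc)
        qed
        finally show "\<bar>E l (m - l) x\<bar> powr p \<le> ((4 * ?\<rho>) ^ m * N) powr p * (\<Sum>q\<le>m. \<bar>pull_dirs e1 e2 E q (m - q) x\<bar> powr p)" .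
      qed
      also have "\<dots> = ((4 * ?\<rho>) ^ m * N) powr p * (\<Sum>q\<le>m. integral K (\<lambda>x. \<bar>pull_dirs e1 e2 E q (m - q) x\<bar> powr p))"
        unfolding integral_mult_right
        by (rule arg_cong[where f = "\<lambda>y. ((4 * ?\<rho>) ^ m * N) powr p * y"], rule integral_sum)
          (auto intro!: integrable_K continuous_powr_p[OF pull_dirs_continuous[OF E] p])
      also have "\<dots> \<le> ((4 * ?\<rho>) ^ m * N) powr p * (\<Sum>q\<le>m. R)"
        by (intro mult_left_mono sum_mono dir) auto
      also have "\<dots> \<le> ((4 * ?\<rho>) ^ m * N) powr p * (N * R)"
        using m R0 by (intro mult_left_mono) (auto simp: N_def intro!: mult_right_mono)
      finally show ?thesis .
    qed
    have "seminorm_K K p E m \<le> (\<Sum>l\<le>m. ((4 * ?\<rho>) ^ m * N) powr p * (N * R))"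
      unfolding seminorm_K_def by (intro sum_mono each) auto
    also have "\<dots> \<le> N * (((4 * ?\<rho>) ^ m * N) powr p * (N * R))"
      using m R0 N by (auto simp: N_def intro!: mult_right_mono)
    also have "\<dots> = ((4 * ?\<rho>) ^ m * N) powr p * (N * N) * R" by simp
    also have "\<dots> \<le> ((4 * ?\<rho>) ^ m * N) powr p * (N powr p * N powr p) * R"
      using NN N R0 by (intro mult_right_mono mult_left_mono mult_mono) auto
    also have "\<dots> = (((4 * ?\<rho>) ^ m * N) * (N * N) * (C * ?h ^ ?n * (N * (2 ^ (k + 1) * N)))) powr p * T"
    proof -
      define X where "X = (4 * ?\<rho>) ^ m * N"
      define Y where "Y = C * ?h ^ ?n * (N * (2 ^ (k + 1) * N))"
      have "0 \<le> X" "0 \<le> Y" unfolding X_def Y_def using ratio_pos N C h0 by (auto intro!: mult_nonneg_nonneg)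
      then have "(X * (N * N) * Y) powr p = X powr p * (N powr p * N powr p) * Y powr p"
        using N by (simp add: powr_mult)
      then show ?thesis unfolding R_def X_def[symmetric] Y_def[symmetric] by simp
    qed
    also have "\<dots> \<le> (C' * ?\<rho> ^ m * ?h ^ ?n) powr p * T"
    proof (intro mult_right_mono powr_mono2 T0)
      have "((4 * ?\<rho>) ^ m * N) * (N * N) * (C * ?h ^ ?n * (N * (2 ^ (k + 1) * N)))
          = 4 ^ m * (N * (N * N) * C * (N * (2 ^ (k + 1) * N)) * ?\<rho> ^ m * ?h ^ ?n)"
        by (simp only: power_mult_distrib mult_ac)
      also have "\<dots> \<le> 4 ^ k * (N * (N * N) * C * (N * (2 ^ (k + 1) * N)) * ?\<rho> ^ m * ?h ^ ?n)"
        using m N C h0 ratio_pos by (intro mult_right_mono power_increasing mult_nonneg_nonneg) auto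
      also have "\<dots> = C' * ?\<rho> ^ m * ?h ^ ?n" by (simp only: C'_def mult_ac)
      finally show "((4 * ?\<rho>) ^ m * N) * (N * N) * (C * ?h ^ ?n * (N * (2 ^ (k + 1) * N))) \<le> C' * ?\<rho> ^ m * ?h ^ ?n" .
    qed (use p N C h0 ratio_pos in \<open>auto intro!: mult_nonneg_nonneg\<close>)
    finally show ?thesis unfolding E_def T_def .
  qed
  ultimately show ?thesis by blast
qed

section \<open>Mollification\<close>

definition exp_flat :: "real poly \<Rightarrow> real \<Rightarrow> real" where
  "exp_flat P t = (if t > 0 then poly P (1 / t) * exp (- (1 / t)) else 0)"

text \<open>Effect of differentiation on the polynomial factor: in s = 1 / t the derivative of P(s)
  exp(-s) with respect to \<open>t\<close> is s^2 (P - P')(s) exp(-s).\<close>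

definition exp_flat_step :: "real poly \<Rightarrow> real poly" where
  "exp_flat_step P = [:0, 0, 1:] * (P - pderiv P)"

lemma poly_exp_tendsto_0: "((\<lambda>s. poly P s * exp (- s)) \<longlongrightarrow> 0) at_top" for P :: "real poly"
proof -
  have "((\<lambda>s. \<Sum>i\<le>degree P. coeff P i * (s ^ i / exp s)) \<longlongrightarrow> (\<Sum>i\<le>degree P. coeff P i * 0)) at_top"
    by (intro tendsto_intros tendsto_power_div_exp_0)
  moreover have "(\<Sum>i\<le>degree P. coeff P i * (s ^ i / exp s)) = poly P s * exp (- s)" for s
    by (simp add: poly_altdef sum_distrib_right exp_minus divide_inverse mult.assoc)
  ultimately show ?thesis by simp
qed

lemma exp_flat_has_derivative: "(exp_flat P has_real_derivative exp_flat (exp_flat_step P) t) (at t)"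
proof -
  consider "t > 0" | "t < 0" | "t = 0" by linarith
  then show ?thesis
  proof cases
    case 1
    have "((\<lambda>t. poly P (1 / t) * exp (- (1 / t))) has_real_derivative exp_flat (exp_flat_step P) t) (at t)"
      using 1 by (auto intro!: derivative_eq_intros poly_DERIV[THEN DERIV_chain2]
          simp: exp_flat_def exp_flat_step_def field_simps power2_eq_square)
    then show ?thesis
      by (rule has_field_derivative_transform_within_open[of _ _ _ "{0<..}"]) (use 1 in \<open>auto simp: exp_flat_def\<close>)
  next
    case 2
    have "((\<lambda>t. 0 :: real) has_real_derivative 0) (at t)" by simp
    then have "(exp_flat P has_real_derivative 0) (at t)"
      by (rule has_field_derivative_transform_within_open[of _ _ _ "{..<0}"]) (use 2 in \<open>auto simp: exp_flat_def\<close>)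
    then show ?thesis using 2 by (simp add: exp_flat_def)
  next
    case 3
    \<comment> \<open>The difference quotient at zero is s P(s) exp(-s) with s = 1 / t, and
      \<open>pCons 0 P\<close> is the polynomial s P(s).\<close>
    have "((\<lambda>t. poly (pCons 0 P) (inverse t) * exp (- inverse t)) \<longlongrightarrow> 0) (at_right 0)"
      using filterlim_compose[OF poly_exp_tendsto_0 filterlim_inverse_at_top_right] .
    then have r: "((\<lambda>t. exp_flat P t / t) \<longlongrightarrow> 0) (at_right 0)"
      by (rule Lim_transform_eventually)
        (auto simp: eventually_at_filter exp_flat_def field_simps intro!: always_eventually)
    have l: "((\<lambda>t. exp_flat P t / t) \<longlongrightarrow> 0) (at_left 0)"
      by (rule Lim_transform_eventually[OF tendsto_const])
        (auto simp: eventually_at_filter exp_flat_def intro!: always_eventually)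
    have "((\<lambda>t. exp_flat P t / t) \<longlongrightarrow> 0) (at 0)"
      using l r by (simp add: filterlim_split_at)
    then show ?thesis using 3 by (simp add: has_field_derivative_iff exp_flat_def)
  qed
qed

lemma dir_shift_funpow_zero:
  "(\<And>i j. T i j x = 0) \<Longrightarrow> (dir_shift e ^^ n) T i j x = 0"
  by (induction n arbitrary: i j) (auto simp: dir_shift_def)

text \<open>The bump is a multiple of f(t) f(1 - t), where f(t) = exp(-1/t) for positive
  \<open>t\<close> and 0 otherwise. It vanishes with all derivatives outside the open unit
  interval.\<close>

lemma bump_exists:
  "\<exists>g :: nat \<Rightarrow> real \<Rightarrow> real. (\<forall>n t. (g n has_real_derivative g (Suc n) t) (at t)) \<and>
     (\<forall>n t. t \<le> 0 \<or> 1 \<le> t \<longrightarrow> g n t = 0) \<and> (\<forall>t. 0 \<le> g 0 t) \<and> integral {0..1} (g 0) = 1"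
proof -
  define f where "f n = exp_flat ((exp_flat_step ^^ n) 1)" for n
  have f: "(f n has_real_derivative f (Suc n) t) (at t)" for n t
    unfolding f_def using exp_flat_has_derivative by simp
  define T where "T = (\<lambda>a b (x :: plane). f a (x $ 1) * f b (x $ 2))"
  have T: "jet T" unfolding T_def by (rule jet_tensor[of f f, OF f f])
  \<comment> \<open>The product f(t) f(1 - t) is the tensor product restricted to the line t
    \<mapsto> (t, 1 - t). Its derivatives are directional derivatives along (1, -1), so no Leibniz
    formula is required.\<close>
  define V where "V = (\<lambda>a b x. pull_dirs (pt 1 (- 1)) 0 T a b (aff (pt 0 1) (pt 1 (- 1)) 0 x))"
  have V: "jet V" unfolding V_def by (rule jet_affine[OF T])
  define G where "G n t = V n 0 (pt t 0)" for n t
  have a: "aff (pt 0 1) (pt 1 (- 1)) 0 (pt t 0) = pt t (1 - t)" for t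
    by (simp add: aff_def vec_eq_iff forall_2)
  have G: "(G n has_real_derivative G (Suc n) t) (at t)" for n t
    unfolding G_def by (rule jet_DERIV_1[OF V])
  have G0: "G n t = 0" if "t \<le> 0 \<or> 1 \<le> t" for n t
    unfolding G_def V_def a pull_dirs_def
    using that by (intro dir_shift_funpow_zero) (auto simp: T_def f_def exp_flat_def)
  have Geq: "G 0 t = f 0 t * f 0 (1 - t)" for t
    by (simp add: G_def V_def a T_def)
  have Gnn: "0 \<le> G 0 t" for t by (simp add: Geq f_def exp_flat_def)
  have Gc: "continuous_on S (G n)" for S n
    by (meson G DERIV_continuous continuous_at_imp_continuous_on)
  define c where "c = integral {0..1} (G 0)"
  have "c \<noteq> 0"
  proof
    assume "c = 0"
    then have "G 0 (1/2) = 0"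
      using integral_eq_0_iff[of 0 1 "G 0"] Gc Gnn by (auto simp: c_def)
    then show False by (simp add: Geq f_def exp_flat_def)
  qed
  moreover have "0 \<le> c" unfolding c_def by (intro integral_nonneg integrable_continuous_real Gc Gnn)
  ultimately have c: "0 < c" by simp
  show ?thesis
  proof (intro exI[of _ "\<lambda>n t. G n t / c"] conjI allI impI)
    show "((\<lambda>t. G n t / c) has_real_derivative G (Suc n) t / c) (at t)" for n t
      by (rule DERIV_cdivide[OF G])
    show "integral {0..1} (\<lambda>t. G 0 t / c) = 1" using c by (simp add: c_def[symmetric])
  qed (use G0 Gnn c in auto)
qed

definition bump :: "nat \<Rightarrow> real \<Rightarrow> real" where
  "bump = (SOME g. (\<forall>n t. (g n has_real_derivative g (Suc n) t) (at t)) \<and>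
     (\<forall>n t. t \<le> 0 \<or> 1 \<le> t \<longrightarrow> g n t = 0) \<and> (\<forall>t. 0 \<le> g 0 t) \<and> integral {0..1} (g 0) = 1)"

lemma bump_deriv: "(bump n has_real_derivative bump (Suc n) t) (at t)"
  and bump_zero: "t \<le> 0 \<or> 1 \<le> t \<Longrightarrow> bump n t = 0"
  and bump_nonneg: "0 \<le> bump 0 t"
  and bump_integral: "integral {0..1} (bump 0) = 1"
  using someI_ex[OF bump_exists] unfolding bump_def[symmetric] by blast+

lemma bump_continuous: "continuous_on S (bump n)"
  by (meson bump_deriv DERIV_continuous continuous_at_imp_continuous_on)

lemma bump_comp_continuous:
  "continuous_on S f \<Longrightarrow> continuous_on S (\<lambda>x. bump n (f x))"
  by (rule continuous_on_compose2[OF bump_continuous[of UNIV]]) auto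

definition bump_max :: real where "bump_max = (SOME M. \<forall>t. bump 0 t \<le> M)"

lemma bump_le: "bump 0 t \<le> bump_max"
proof -
  have "compact (bump 0 ` {0..1})" by (intro compact_continuous_image bump_continuous) auto
  then have "bounded (bump 0 ` {0..1})" by (rule compact_imp_bounded)
  then obtain M where M: "\<forall>t\<in>{0..1}. \<bar>bump 0 t\<bar> \<le> M" by (auto simp: bounded_iff)
  have "bump 0 t \<le> \<bar>M\<bar>" for t
  proof (cases "t \<in> {0..1}")
    case True
    then have "\<bar>bump 0 t\<bar> \<le> M" using M by blast
    then show ?thesis by linarith
  next
    case False
    then have "bump 0 t = 0" by (intro bump_zero) auto
    then show ?thesis by simp
  qed
  then have "\<exists>M. \<forall>t. bump 0 t \<le> M" by blast
  then show ?thesis unfolding bump_max_def by (rule someI2_ex) blast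
qed

text \<open>The support of \<open>moll h x 0 0\<close> is the square with lower left corner \<open>x\<close> and side \<open>h\<close>, matching
  the squares for which the library provides Lebesgue's differentiation theorem.\<close>

definition moll :: "real \<Rightarrow> plane \<Rightarrow> nat \<Rightarrow> nat \<Rightarrow> plane \<Rightarrow> real" where
  "moll h x a b y = (1 / h) ^ (a + 1) * bump a ((y $ 1 - x $ 1) / h) * ((1 / h) ^ (b + 1) * bump b ((y $ 2 - x $ 2) / h))"

lemma jet_moll: "h \<noteq> 0 \<Longrightarrow> jet (moll h x)"
proof -
  assume h: "h \<noteq> 0"
  have d: "((\<lambda>s. (1 / h) ^ (n + 1) * bump n ((s - c) / h)) has_real_derivative (1 / h) ^ (Suc n + 1) * bump (Suc n) ((s - c) / h)) (at s)" for n c s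
    using h by (auto intro!: derivative_eq_intros bump_deriv[THEN DERIV_chain2] simp: field_simps)
  show ?thesis
    unfolding moll_def[abs_def]
    by (rule jet_tensor[of "\<lambda>n s. (1 / h) ^ (n + 1) * bump n ((s - x $ 1) / h)" "\<lambda>n s. (1 / h) ^ (n + 1) * bump n ((s - x $ 2) / h)"])
      (rule d)+
qed

abbreviation square :: "real \<Rightarrow> plane \<Rightarrow> plane set" where
  "square h x \<equiv> cbox x (x + h *\<^sub>R 1)"

lemma square_iff: "y \<in> square h x \<longleftrightarrow> x $ 1 \<le> y $ 1 \<and> y $ 1 \<le> x $ 1 + h \<and> x $ 2 \<le> y $ 2 \<and> y $ 2 \<le> x $ 2 + h"
  by (auto simp: mem_box_cart forall_2)

lemma moll_zero: "h > 0 \<Longrightarrow> y \<notin> square h x \<Longrightarrow> moll h x a b y = 0"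
proof -
  assume h: "h > 0" and "y \<notin> square h x"
  then consider "(y $ 1 - x $ 1) / h \<le> 0 \<or> 1 \<le> (y $ 1 - x $ 1) / h" | "(y $ 2 - x $ 2) / h \<le> 0 \<or> 1 \<le> (y $ 2 - x $ 2) / h"
    by (auto simp: square_iff field_simps)
  then show ?thesis by cases (simp_all only: moll_def bump_zero mult_zero_left mult_zero_right)
qed

lemma moll_nonneg: "h > 0 \<Longrightarrow> 0 \<le> moll h x 0 0 y"
  by (simp add: moll_def bump_nonneg)

lemma moll_le: "h > 0 \<Longrightarrow> moll h x 0 0 y \<le> bump_max\<^sup>2 / h\<^sup>2"
proof -
  assume h: "h > 0"
  let ?s = "bump 0 ((y $ 1 - x $ 1) / h)" and ?t = "bump 0 ((y $ 2 - x $ 2) / h)"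
  have "?s * ?t \<le> bump_max * bump_max"
    by (intro mult_mono bump_le bump_nonneg order_trans[OF bump_nonneg bump_le])
  then have "(?s * ?t) / (h * h) \<le> (bump_max * bump_max) / (h * h)" using h by (intro divide_right_mono) auto
  moreover have "moll h x 0 0 y = (?s * ?t) / (h * h)" by (simp add: moll_def)
  ultimately show ?thesis by (simp only: power2_eq_square)
qed

lemma moll_continuous: "h \<noteq> 0 \<Longrightarrow> continuous_on S (moll h x a b)"
  by (intro jet_continuous jet_moll)

text \<open>With multiplication by 1 / h in place of division, the continuity rules apply without
  the side condition h \<noteq> 0.\<close>

lemma moll_alt: "moll h x a b y = ((1 / h) ^ (a + 1) * (1 / h) ^ (b + 1)) *
    (bump a ((1 / h) * (y $ 1 - x $ 1)) * bump b ((1 / h) * (y $ 2 - x $ 2)))"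
  by (simp add: moll_def)

lemma moll_comp_continuous:
  assumes "continuous_on S f" "continuous_on S g"
  shows "continuous_on S (\<lambda>z. moll h (f z) a b (g z))"
  unfolding moll_alt
  by (intro continuous_on_mult continuous_on_const bump_comp_continuous continuous_on_diff
      continuous_on_component assms)

lemmas moll_continuous_2 = moll_comp_continuous[OF continuous_on_fst continuous_on_snd, OF continuous_on_id continuous_on_id]

section \<open>Families of derivatives as smooth functions, and smoothing by convolution\<close>

lemma partial_jet:
  assumes "jet U"
  shows "partial 1 (U a b) = U (Suc a) b" "partial 2 (U a b) = U a (Suc b)"
proof -
  have "frechet_derivative (U a b) (at x) = (\<lambda>h. h $ 1 * U (Suc a) b x + h $ 2 * U a (Suc b) x)" for x
    by (rule frechet_derivative_at[symmetric, OF jetD[OF assms]])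
  then show "partial 1 (U a b) = U (Suc a) b" "partial 2 (U a b) = U a (Suc b)"
    by (simp_all add: partial_def fun_eq_iff axis_def)
qed

lemma foldr_partial_jet:
  assumes "jet U"
  shows "\<exists>a b. foldr partial ds (U 0 0) = U a b"
proof (induction ds)
  case (Cons d ds)
  then obtain a b where "foldr partial ds (U 0 0) = U a b" by blast
  then show ?case using partial_jet[OF assms, of a b] exhaust_2[of d] by auto
qed auto

lemma jet_smooth: "jet U \<Longrightarrow> smooth (U 0 0)"
  unfolding smooth_def
proof (intro allI)
  fix ds x assume U: "jet U"
  obtain a b where "foldr partial ds (U 0 0) = U a b" using foldr_partial_jet[OF U] by blast
  then show "foldr partial ds (U 0 0) differentiable (at x)"
    using jetD[OF U, of a b x] by (auto simp: differentiable_def)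
qed

lemma mpartial_jet:
  assumes "jet U"
  shows "mpartial (a, b) (U 0 0) = U a b"
proof -
  have "(partial 2 ^^ b) (U 0 0) = U 0 b" by (induction b) (auto simp: partial_jet assms)
  moreover have "(partial 1 ^^ a) (U 0 b) = U a b" by (induction a) (auto simp: partial_jet assms)
  ultimately show ?thesis by (simp add: mpartial_def)
qed

lemma test_function_moll:
  assumes "h > 0" "square h x \<subseteq> \<Omega>"
  shows "test_function \<Omega> (moll h x 0 0)"
proof -
  have s: "{y. moll h x 0 0 y \<noteq> 0} \<subseteq> square h x" using moll_zero[OF assms(1)] by blast
  then have "closure {y. moll h x 0 0 y \<noteq> 0} \<subseteq> square h x" by (rule closure_minimal) auto
  then show ?thesis
    using assms jet_smooth[OF jet_moll[of h x]]
    by (auto simp: test_function_def compact_closure intro: bounded_subset[OF bounded_cbox s])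
qed

text \<open>The sign makes \<open>smoothing S f h\<close> a jet in the variable \<open>x\<close>.\<close>

definition smoothing :: "plane set \<Rightarrow> (plane \<Rightarrow> real) \<Rightarrow> real \<Rightarrow> nat \<Rightarrow> nat \<Rightarrow> plane \<Rightarrow> real" where
  "smoothing S f h a b x = (- 1) ^ (a + b) * integral S (\<lambda>y. f y * moll h x a b y)"

lemma moll_deriv_x:
  assumes "h \<noteq> 0"
  shows "((\<lambda>x. moll h x a b y) has_derivative
    (\<lambda>v. - (v $ 1 * moll h x (Suc a) b y + v $ 2 * moll h x a (Suc b) y))) (at x)"
proof -
  have d: "((\<lambda>s. (1 / h) ^ (n + 1) * bump n ((c - s) / h)) has_real_derivative - ((1 / h) ^ (Suc n + 1) * bump (Suc n) ((c - s) / h))) (at s)" for n c s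
    using assms by (auto intro!: derivative_eq_intros bump_deriv[THEN DERIV_chain2] simp: field_simps)
  show ?thesis
    unfolding moll_def
    using has_derivative_mult[OF has_derivative_coord1[OF d] has_derivative_coord2[OF d], where x = x]
    by (rule has_derivative_eq_rhs) (auto simp: fun_eq_iff algebra_simps)
qed

lemma jet_smoothing:
  assumes h: "h \<noteq> 0" and f: "continuous_on UNIV f"
  shows "jet (smoothing (cbox p q) f h)"
  unfolding jet_def
proof (intro allI)
  fix a b x0
  have fc: "continuous_on S f" for S using f continuous_on_subset by blast
  have f2: "continuous_on S (\<lambda>z. f (snd z))" for S
    by (rule continuous_on_compose2[OF f]) (auto intro!: continuous_intros)
  \<comment> \<open>The gradient of the kernel as a vector: the derivative under the integral
    becomes an inner product with it, and its continuity is what the Leibniz rule asks for.\<close>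
  define g where "g x y = f y *\<^sub>R pt (moll h x (Suc a) b y) (moll h x a (Suc b) y)" for x y
  have cg: "continuous_on S (\<lambda>z. g (fst z) (snd z))" for S
    unfolding g_def by (intro continuous_intros continuous_on_pt moll_continuous_2 f2)
  have cgx: "continuous_on S (g x)" for S x
    unfolding g_def by (intro continuous_intros continuous_on_pt moll_continuous h fc)
  have "((\<lambda>x. integral (cbox p q) (\<lambda>y. f y * moll h x a b y)) has_derivative
      blinfun_apply (integral (cbox p q) (\<lambda>y. blinfun_inner_left (- g x0 y)))) (at x0 within UNIV)"
  proof (rule leibniz_rule)
    fix x y
    have "((\<lambda>x. f y * moll h x a b y) has_derivative
        (\<lambda>v. f y * - (v $ 1 * moll h x (Suc a) b y + v $ 2 * moll h x a (Suc b) y))) (at x)"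
      by (intro has_derivative_mult_right moll_deriv_x h)
    then show "((\<lambda>x. f y * moll h x a b y) has_derivative blinfun_apply (blinfun_inner_left (- g x y))) (at x within UNIV)"
      by (rule has_derivative_eq_rhs) (auto simp: fun_eq_iff g_def inner_vec_def sum_2 algebra_simps)
  next
    show "(\<lambda>y. f y * moll h x a b y) integrable_on cbox p q" for x
      by (intro integrable_continuous continuous_intros fc moll_continuous h)
    show "continuous_on (UNIV \<times> cbox p q) (\<lambda>(x, y). blinfun_inner_left (- g x y))"
      unfolding split_beta
      by (intro bounded_linear.continuous_on[OF bounded_linear_blinfun_inner_left] continuous_intros cg)
  qed auto
  then have D: "(smoothing (cbox p q) f h a b has_derivative
      (\<lambda>v. (- 1) ^ (a + b) * blinfun_apply (integral (cbox p q) (\<lambda>y. blinfun_inner_left (- g x0 y))) v)) (at x0)"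
    unfolding smoothing_def[abs_def] by (intro has_derivative_mult_right) simp
  have "(- 1) ^ (a + b) * blinfun_apply (integral (cbox p q) (\<lambda>y. blinfun_inner_left (- g x0 y))) v
      = v $ 1 * smoothing (cbox p q) f h (Suc a) b x0 + v $ 2 * smoothing (cbox p q) f h a (Suc b) x0" for v
  proof -
    let ?I = "\<lambda>a b. integral (cbox p q) (\<lambda>y. f y * moll h x0 a b y)"
    have i: "(\<lambda>y. f y * moll h x0 a b y) integrable_on cbox p q" for a b
      by (intro integrable_continuous continuous_intros fc moll_continuous h)
    have "blinfun_apply (integral (cbox p q) (\<lambda>y. blinfun_inner_left (- g x0 y))) v
        = integral (cbox p q) (\<lambda>y. blinfun_inner_left (- g x0 y) v)"
      by (intro blinfun_apply_integral integrable_continuous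
          bounded_linear.continuous_on[OF bounded_linear_blinfun_inner_left] continuous_intros cgx)
    also have "(\<lambda>y. blinfun_inner_left (- g x0 y) v)
        = (\<lambda>y. (- (v $ 1)) * (f y * moll h x0 (Suc a) b y) + (- (v $ 2)) * (f y * moll h x0 a (Suc b) y))"
      by (auto simp: fun_eq_iff g_def inner_vec_def sum_2 algebra_simps)
    also have "integral (cbox p q) \<dots> = (- (v $ 1)) * ?I (Suc a) b + (- (v $ 2)) * ?I a (Suc b)"
      unfolding integral_add[OF integrable_on_mult_right[OF i] integrable_on_mult_right[OF i]]
        integral_mult_right ..
    finally have e: "blinfun_apply (integral (cbox p q) (\<lambda>y. blinfun_inner_left (- g x0 y))) v
        = (- (v $ 1)) * ?I (Suc a) b + (- (v $ 2)) * ?I a (Suc b)" .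
    show ?thesis unfolding e smoothing_def by (simp add: algebra_simps)
  qed
  with D show "(smoothing (cbox p q) f h a b has_derivative
      (\<lambda>v. v $ 1 * smoothing (cbox p q) f h (Suc a) b x0 + v $ 2 * smoothing (cbox p q) f h a (Suc b) x0)) (at x0)"
    by simp
qed

section \<open>Mass of the kernel\<close>

lemma integral_moll_unit: "integral (cbox (pt 0 0) (pt 1 1)) (\<lambda>z. bump 0 (z $ 1) * bump 0 (z $ 2)) = 1"
proof -
  have "continuous_on UNIV (\<lambda>z :: plane. bump 0 (z $ 1) * bump 0 (z $ 2))"
    by (intro continuous_intros bump_comp_continuous)
  from integral_plane_box[OF this, of 0 0 1 1] show ?thesis
    by (simp add: bump_integral)
qed

lemma nn_integral_bump: "(\<integral>\<^sup>+z. ennreal (bump 0 (z $ 1) * bump 0 ((z :: plane) $ 2)) \<partial>lborel) = 1"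
proof -
  have "(\<integral>\<^sup>+z. ennreal (bump 0 (z $ 1) * bump 0 ((z :: plane) $ 2)) \<partial>lborel)
      = (\<integral>\<^sup>+z. ennreal (indicator (cbox (pt 0 0) (pt 1 1)) z * (bump 0 (z $ 1) * bump 0 ((z :: plane) $ 2))) \<partial>lborel)"
  proof (intro nn_integral_cong)
    fix z :: plane
    show "ennreal (bump 0 (z $ 1) * bump 0 (z $ 2)) = ennreal (indicator (cbox (pt 0 0) (pt 1 1)) z * (bump 0 (z $ 1) * bump 0 (z $ 2)))"
    proof (cases "z \<in> cbox (pt 0 0) (pt 1 1)")
      case False
      then consider "z $ 1 \<le> 0 \<or> 1 \<le> z $ 1" | "z $ 2 \<le> 0 \<or> 1 \<le> z $ 2"
        by (auto simp: mem_box_cart forall_2)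
      then have "bump 0 (z $ 1) * bump 0 (z $ 2) = 0" by cases (simp_all only: bump_zero mult_zero_left mult_zero_right)
      then show ?thesis by (simp only: mult_zero_right)
    qed simp
  qed
  also have "\<dots> = ennreal (integral (cbox (pt 0 0) (pt 1 1)) (\<lambda>z. bump 0 (z $ 1) * bump 0 (z $ 2)))"
    by (rule nn_integral_compact)
      (auto intro!: continuous_intros bump_comp_continuous mult_nonneg_nonneg bump_nonneg)
  also have "\<dots> = ennreal 1" by (simp only: integral_moll_unit)
  finally show ?thesis by simp
qed

lemma moll_measurable [measurable]: "h \<noteq> 0 \<Longrightarrow> moll h x a b \<in> borel_measurable borel"
  by (intro borel_measurable_continuous_onI moll_continuous)

lemma moll_measurable_x [measurable]: "(\<lambda>x. moll h x a b y) \<in> borel_measurable borel"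
  by (intro borel_measurable_continuous_onI moll_comp_continuous continuous_on_id continuous_on_const)

text \<open>The kernel depends on \<open>y - x\<close> only, so it has mass one in either variable.
  In \<open>y\<close> this makes it a probability density; in \<open>x\<close> it gives the
  contraction after Tonelli's theorem.\<close>

lemma nn_integral_moll:
  assumes h: "h > 0"
  shows "(\<integral>\<^sup>+y. ennreal (moll h x 0 0 y) \<partial>lborel) = 1" "(\<integral>\<^sup>+x. ennreal (moll h x 0 0 y) \<partial>lborel) = 1"
proof -
  let ?B = "\<lambda>z :: plane. bump 0 (z $ 1) * bump 0 (z $ 2)"
  have *: "ennreal (h\<^sup>2) * ennreal ((1 / h)\<^sup>2 * t) = ennreal t" if "0 \<le> t" for t
    using h that by (subst ennreal_mult[symmetric]) (auto simp: field_simps)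
  have m: "moll h x 0 0 (x + h *\<^sub>R z) = (1 / h)\<^sup>2 * ?B z" "moll h (y + (- h) *\<^sub>R z) 0 0 y = (1 / h)\<^sup>2 * ?B z" for z
    using h by (simp_all add: moll_def power2_eq_square)
  have B0: "0 \<le> ?B z" for z by (simp add: bump_nonneg)
  have cm: "continuous_on UNIV (\<lambda>z. (1 / h)\<^sup>2 * ?B z)"
    by (intro continuous_intros bump_comp_continuous)
  have meas: "(\<lambda>z. ennreal ((1 / h)\<^sup>2 * ?B z)) \<in> borel_measurable lborel"
    using borel_measurable_continuous_onI[OF cm] by simp
  have "(\<integral>\<^sup>+y. ennreal (moll h x 0 0 y) \<partial>lborel) = ennreal (h\<^sup>2) * (\<integral>\<^sup>+z. ennreal (moll h x 0 0 (x + h *\<^sub>R z)) \<partial>lborel)"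
    using h by (intro nn_integral_plane_affine) auto
  also have "\<dots> = (\<integral>\<^sup>+z. ennreal (?B z) \<partial>lborel)"
    unfolding m nn_integral_cmult[OF meas, symmetric] using * B0 by simp
  finally show "(\<integral>\<^sup>+y. ennreal (moll h x 0 0 y) \<partial>lborel) = 1" by (simp add: nn_integral_bump)
  have "(\<integral>\<^sup>+x. ennreal (moll h x 0 0 y) \<partial>lborel) = ennreal ((- h)\<^sup>2) * (\<integral>\<^sup>+z. ennreal (moll h (y + (- h) *\<^sub>R z) 0 0 y) \<partial>lborel)"
    using h by (intro nn_integral_plane_affine) auto
  also have "\<dots> = (\<integral>\<^sup>+z. ennreal (?B z) \<partial>lborel)"
    unfolding m power2_minus nn_integral_cmult[OF meas, symmetric] using * B0 by simp
  finally show "(\<integral>\<^sup>+x. ennreal (moll h x 0 0 y) \<partial>lborel) = 1" by (simp add: nn_integral_bump)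
qed

lemma One_plane: "(\<Sum>Basis :: plane) = 1"
proof -
  have B: "(Basis :: plane set) = {axis 1 1, axis 2 1}" by (auto simp: Basis_vec_def UNIV_2)
  have "axis 1 1 \<noteq> (axis 2 1 :: plane)" by (simp add: axis_eq_axis)
  then show ?thesis by (simp add: B vec_eq_iff forall_2 axis_def)
qed

lemma integral_square_const: "h > 0 \<Longrightarrow> integral (square h x) (\<lambda>_. c :: real) = c * h\<^sup>2"
proof -
  assume h: "h > 0"
  have "square h x = cbox (pt (x $ 1) (x $ 2)) (pt (x $ 1 + h) (x $ 2 + h))"
    by (rule arg_cong2[where f = cbox]) (auto simp: vec_eq_iff forall_2)
  then show ?thesis using h by (simp add: content_cbox_pt power2_eq_square)
qed

section \<open>Lebesgue points and convergence of averages\<close>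

lemma integrable_lborel_imp_on:
  fixes f :: "plane \<Rightarrow> real"
  assumes "integrable lborel f" "S \<in> sets borel"
  shows "f integrable_on S" "(LINT x|lborel. indicator S x * f x) = integral S f"
proof -
  have "set_integrable lborel S f"
    using integrable_mult_indicator[of S lborel f] assms by (simp add: set_integrable_def)
  then show "f integrable_on S" "(LINT x|lborel. indicator S x * f x) = integral S f"
    using set_borel_integral_eq_integral[of S f] by (simp_all add: set_lebesgue_integral_def)
qed

text \<open>The differentiation theorem is applied to \<open>\<bar>f - q\<bar>\<close> for every rational \<open>q\<close>.\<close>

lemma lebesgue_points:
  fixes f :: "plane \<Rightarrow> real"
  assumes f: "integrable lborel f"
  obtains N where "negligible N"
    "\<And>x e. x \<notin> N \<Longrightarrow> 0 < e \<Longrightarrow> \<exists>d>0. \<forall>h. 0 < h \<and> h < d \<longrightarrow> integral (square h x) (\<lambda>y. \<bar>f y - f x\<bar>) < e * h\<^sup>2"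
proof -
  have fi: "f integrable_on cbox a b" "(\<lambda>x. \<bar>f x\<bar>) integrable_on cbox a b" for a b
    by (intro integrable_lborel_imp_on f integrable_abs; simp)+
  have ai: "(\<lambda>y. \<bar>f y - c\<bar>) integrable_on cbox a b" for a b c
  proof -
    have "f absolutely_integrable_on cbox a b" using fi by (intro absolutely_integrable_onI) auto
    moreover have "(\<lambda>_. c) absolutely_integrable_on cbox a b" by (intro absolutely_integrable_continuous continuous_on_const)
    ultimately have "(\<lambda>y. f y - c) absolutely_integrable_on cbox a b" by (rule set_integral_diff(1))
    then show ?thesis by (simp add: absolutely_integrable_on_def)
  qed
  have "\<exists>N. negligible N \<and> (\<forall>x e. x \<notin> N \<longrightarrow> 0 < e \<longrightarrow> (\<exists>d>0. \<forall>h. 0 < h \<and> h < d \<longrightarrow>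
      \<bar>integral (square h x) (\<lambda>y. \<bar>f y - q\<bar>) / h\<^sup>2 - \<bar>f x - q\<bar>\<bar> < e))" for q
  proof -
    obtain N where "negligible N" and N: "\<And>x e. x \<notin> N \<Longrightarrow> 0 < e \<Longrightarrow> \<exists>d>0. \<forall>h. 0 < h \<and> h < d \<longrightarrow>
        norm (integral (cbox x (x + h *\<^sub>R (\<Sum>Basis))) (\<lambda>y. \<bar>f y - q\<bar>) /\<^sub>R h ^ DIM(plane) - \<bar>f x - q\<bar>) < e"
      using integrable_ccontinuous_explicit[of "\<lambda>y. \<bar>f y - q\<bar>", OF ai] by metis
    then show ?thesis by (intro exI[of _ N]) (simp add: One_plane divide_inverse mult.commute)
  qed
  then obtain N where N: "\<And>q. negligible (N q)"
    "\<And>q x e. x \<notin> N q \<Longrightarrow> 0 < e \<Longrightarrow> \<exists>d>0. \<forall>h. 0 < h \<and> h < d \<longrightarrow>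
      \<bar>integral (square h x) (\<lambda>y. \<bar>f y - q\<bar>) / h\<^sup>2 - \<bar>f x - q\<bar>\<bar> < e" by metis
  show thesis
  proof (rule that[of "\<Union>(N ` \<rat>)"])
    show "negligible (\<Union>(N ` \<rat>))" using N(1) countable_rat by (intro negligible_countable_Union) auto
    fix x e assume x: "x \<notin> \<Union>(N ` \<rat>)" and e: "0 < (e :: real)"
    obtain q where q: "q \<in> \<rat>" "f x - e / 4 < q" "q < f x + e / 4"
      using Rats_dense_in_real[of "f x - e / 4" "f x + e / 4"] e by auto
    have "x \<notin> N q" using x q by blast
    from N(2)[OF this, of "e / 4"] e obtain d where d: "d > 0"
      "\<And>h. 0 < h \<Longrightarrow> h < d \<Longrightarrow> \<bar>integral (square h x) (\<lambda>y. \<bar>f y - q\<bar>) / h\<^sup>2 - \<bar>f x - q\<bar>\<bar> < e / 4"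
      by auto
    have "integral (square h x) (\<lambda>y. \<bar>f y - f x\<bar>) < e * h\<^sup>2" if h: "0 < h" "h < d" for h
    proof -
      have "integral (square h x) (\<lambda>y. \<bar>f y - f x\<bar>) \<le> integral (square h x) (\<lambda>y. \<bar>f y - q\<bar> + \<bar>q - f x\<bar>)"
        by (intro integral_le integrable_add ai) auto
      also have "\<dots> = integral (square h x) (\<lambda>y. \<bar>f y - q\<bar>) + \<bar>q - f x\<bar> * h\<^sup>2"
        by (subst integral_add) (auto intro: ai simp: integral_square_const h simp del: integral_const)
      also have "\<dots> < e * h\<^sup>2"
      proof -
        \<comment> \<open>A quarter of \<open>e\<close> comes from the differentiation theorem for
          \<open>q\<close>, another from \<bar>f x - q\<bar>. The final passage from
          \<open>q\<close> to \<open>f x\<close> adds at most a third quarter, which leaves room for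
          strictness.\<close>
        have "integral (square h x) (\<lambda>y. \<bar>f y - q\<bar>) / h\<^sup>2 < e / 4 + e / 4"
          using d(2)[OF h] q by linarith
        then have "integral (square h x) (\<lambda>y. \<bar>f y - q\<bar>) < (e / 2) * h\<^sup>2" using h by (simp add: pos_divide_less_eq)
        moreover have "\<bar>q - f x\<bar> * h\<^sup>2 \<le> (e / 4) * h\<^sup>2" 
        proof (rule mult_right_mono)
          show "\<bar>q - f x\<bar> \<le> e / 4" using q by linarith
        qed simp
        moreover have "0 < (e / 4) * h\<^sup>2" using e h by simp
        ultimately show ?thesis by (simp add: algebra_simps)
      qed
      finally show ?thesis .
    qed
    with d(1) show "\<exists>d>0. \<forall>h. 0 < h \<and> h < d \<longrightarrow> integral (square h x) (\<lambda>y. \<bar>f y - f x\<bar>) < e * h\<^sup>2" by blast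
  qed
qed

lemma moll_integral:
  assumes "h > 0"
  shows "integrable lborel (moll h x 0 0)" "(LINT y|lborel. moll h x 0 0 y) = 1"
proof -
  show i: "integrable lborel (moll h x 0 0)"
    using assms nn_integral_moll(1)[OF assms, of x]
    by (intro integrableI_nonneg) (auto simp: moll_nonneg)
  show "(LINT y|lborel. moll h x 0 0 y) = 1"
    using assms nn_integral_moll(1)[OF assms, of x] by (simp add: integral_eq_nn_integral moll_nonneg)
qed

lemma integrable_mult_moll:
  fixes f :: "plane \<Rightarrow> real"
  assumes "h > 0" "integrable lborel f"
  shows "integrable lborel (\<lambda>y. f y * moll h x 0 0 y)"
proof (rule Bochner_Integration.integrable_bound)
  show "integrable lborel (\<lambda>y. (bump_max\<^sup>2 / h\<^sup>2) * f y)" using assms by simp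
  show "(\<lambda>y. f y * moll h x 0 0 y) \<in> borel_measurable lborel" using assms by auto
  show "AE y in lborel. norm (f y * moll h x 0 0 y) \<le> norm ((bump_max\<^sup>2 / h\<^sup>2) * f y)"
  proof (rule AE_I2)
    fix y
    have "\<bar>f y\<bar> * \<bar>moll h x 0 0 y\<bar> \<le> \<bar>f y\<bar> * \<bar>bump_max\<^sup>2 / h\<^sup>2\<bar>"
      using moll_nonneg[OF assms(1), of x y] moll_le[OF assms(1), of x y] by (intro mult_left_mono) auto
    then show "norm (f y * moll h x 0 0 y) \<le> norm ((bump_max\<^sup>2 / h\<^sup>2) * f y)"
      by (simp only: real_norm_def abs_mult mult.commute)
  qed
qed

text \<open>The kernel has integral one, lives on the square and is at most \<open>bump_max\<close>
  squared over h^2, so the deviation is a bounded multiple of the plain average over the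
  square.\<close>

lemma moll_average_diff:
  fixes f :: "plane \<Rightarrow> real"
  assumes h: "h > 0" and f: "integrable lborel f"
  shows "\<bar>(LINT y|lborel. f y * moll h x 0 0 y) - c\<bar> \<le> bump_max\<^sup>2 / h\<^sup>2 * integral (square h x) (\<lambda>y. \<bar>f y - c\<bar>)"
proof -
  have i1: "integrable lborel (\<lambda>y. f y * moll h x 0 0 y - c * moll h x 0 0 y)"
    by (intro Bochner_Integration.integrable_diff integrable_mult_moll h f integrable_mult_right moll_integral)
  have isq: "integrable lborel (\<lambda>y. indicator (square h x) y * (f y - c))"
  proof -
    have "integrable lborel (\<lambda>y. indicator (square h x) y *\<^sub>R f y)" using f by (intro integrable_mult_indicator) auto
    moreover have "integrable lborel (\<lambda>y. c * indicator (square h x) y)"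
      by (intro integrable_mult_right integrable_real_indicator) (use emeasure_lborel_cbox_finite[of x "x + h *\<^sub>R 1"] in auto)
    ultimately have "integrable lborel (\<lambda>y. indicator (square h x) y *\<^sub>R f y - c * indicator (square h x) y)"
      by (rule Bochner_Integration.integrable_diff)
    then show ?thesis by (simp add: algebra_simps)
  qed
  have "(LINT y|lborel. f y * moll h x 0 0 y) - c = (LINT y|lborel. f y * moll h x 0 0 y) - (LINT y|lborel. c * moll h x 0 0 y)"
    by (simp add: moll_integral h)
  also have "\<dots> = (LINT y|lborel. f y * moll h x 0 0 y - c * moll h x 0 0 y)"
    by (intro Bochner_Integration.integral_diff[symmetric] integrable_mult_moll h f integrable_mult_right moll_integral)
  finally have "\<bar>(LINT y|lborel. f y * moll h x 0 0 y) - c\<bar> \<le> (LINT y|lborel. \<bar>f y * moll h x 0 0 y - c * moll h x 0 0 y\<bar>)"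
    using integral_abs_bound[of lborel "\<lambda>y. f y * moll h x 0 0 y - c * moll h x 0 0 y"] by simp
  also have "\<dots> \<le> (LINT y|lborel. bump_max\<^sup>2 / h\<^sup>2 * \<bar>indicator (square h x) y * (f y - c)\<bar>)"
  proof (intro integral_mono integrable_abs i1 integrable_mult_right isq)
    fix y
    show "\<bar>f y * moll h x 0 0 y - c * moll h x 0 0 y\<bar> \<le> bump_max\<^sup>2 / h\<^sup>2 * \<bar>indicator (square h x) y * (f y - c)\<bar>"
    proof (cases "y \<in> square h x")
      case True
      have "\<bar>f y * moll h x 0 0 y - c * moll h x 0 0 y\<bar> = moll h x 0 0 y * \<bar>f y - c\<bar>"
        using moll_nonneg[OF h, of x y] by (simp add: abs_mult flip: left_diff_distrib)
      also have "\<dots> \<le> bump_max\<^sup>2 / h\<^sup>2 * \<bar>f y - c\<bar>" by (intro mult_right_mono moll_le h) auto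
      finally show ?thesis using True by simp
    next
      case False then show ?thesis by (simp only: moll_zero[OF h False]) simp
    qed
  qed
  also have "\<dots> = bump_max\<^sup>2 / h\<^sup>2 * (LINT y|lborel. \<bar>indicator (square h x) y * (f y - c)\<bar>)"
    by (rule integral_mult_right_zero)
  also have "(LINT y|lborel. \<bar>indicator (square h x) y * (f y - c)\<bar>) = integral (square h x) (\<lambda>y. \<bar>f y - c\<bar>)"
  proof -
    have "set_integrable lborel (square h x) (\<lambda>y. \<bar>f y - c\<bar>)"
      using integrable_abs[OF isq] by (simp add: set_integrable_def abs_mult)
    from set_borel_integral_eq_integral(2)[OF this] show ?thesis
      by (simp add: set_lebesgue_integral_def abs_mult)
  qed
  finally show ?thesis .
qed

lemma moll_converges_AE:
  fixes f :: "plane \<Rightarrow> real"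
  assumes f: "integrable lborel f" and h: "\<And>n. 0 < h n" "h \<longlonglongrightarrow> 0"
  shows "AE x in lborel. (\<lambda>n. LINT y|lborel. f y * moll (h n) x 0 0 y) \<longlonglongrightarrow> f x"
proof -
  obtain N where N: "negligible N"
    "\<And>x e. x \<notin> N \<Longrightarrow> 0 < e \<Longrightarrow> \<exists>d>0. \<forall>h. 0 < h \<and> h < d \<longrightarrow> integral (square h x) (\<lambda>y. \<bar>f y - f x\<bar>) < e * h\<^sup>2"
    using lebesgue_points[OF f] by metis
  have conv: "(\<lambda>n. LINT y|lborel. f y * moll (h n) x 0 0 y) \<longlonglongrightarrow> f x" if x: "x \<notin> N" for x
  proof (rule LIMSEQ_I)
    fix e :: real assume e: "0 < e"
    \<comment> \<open>One is added to the squared bound to make the denominator positive and the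
      last inequality strict.\<close>
    define e' where "e' = e / (bump_max\<^sup>2 + 1)"
    have bp: "0 < bump_max\<^sup>2 + 1" by (simp add: add_nonneg_pos)
    have e': "0 < e'" using e bp by (simp add: e'_def)
    obtain d where d: "d > 0" "\<And>h. 0 < h \<Longrightarrow> h < d \<Longrightarrow> integral (square h x) (\<lambda>y. \<bar>f y - f x\<bar>) < e' * h\<^sup>2"
      using N(2)[OF x e'] by blast
    obtain n0 where n0: "\<And>n. n \<ge> n0 \<Longrightarrow> h n < d"
      using order_tendstoD(2)[OF h(2) d(1)] by (auto simp: eventually_sequentially)
    show "\<exists>n0. \<forall>n\<ge>n0. norm ((LINT y|lborel. f y * moll (h n) x 0 0 y) - f x) < e"
    proof (intro exI[of _ n0] allI impI)
      fix n assume n: "n \<ge> n0"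
      have hn: "0 < (h n)\<^sup>2" using h(1)[of n] by simp
      have "\<bar>(LINT y|lborel. f y * moll (h n) x 0 0 y) - f x\<bar> \<le> bump_max\<^sup>2 / (h n)\<^sup>2 * integral (square (h n) x) (\<lambda>y. \<bar>f y - f x\<bar>)"
        by (rule moll_average_diff[OF h(1) f])
      also have "\<dots> \<le> bump_max\<^sup>2 / (h n)\<^sup>2 * (e' * (h n)\<^sup>2)"
        using d(2)[OF h(1) n0[OF n]] by (intro mult_left_mono) auto
      also have "\<dots> = bump_max\<^sup>2 * e'" using hn by simp
      also have "\<dots> < (bump_max\<^sup>2 + 1) * e'" using e' by simp
      also have "\<dots> = e" using bp by (simp add: e'_def)
      finally show "norm ((LINT y|lborel. f y * moll (h n) x 0 0 y) - f x) < e" by simp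
    qed
  qed
  have "N \<in> null_sets lebesgue" using N(1) by (simp add: negligible_iff_null_sets)
  then have "AE x in lebesgue. (\<lambda>n. LINT y|lborel. f y * moll (h n) x 0 0 y) \<longlonglongrightarrow> f x"
    by (rule AE_I') (use conv in blast)
  then show ?thesis by (simp add: AE_completion_iff)
qed

text \<open>The kernel is taken as the density of a probability measure, so the average falls under
  \<open>jensen_powr\<close>.\<close>

lemma moll_jensen:
  fixes w :: "plane \<Rightarrow> real"
  assumes p: "1 \<le> p" and h: "h > 0" and [measurable]: "w \<in> borel_measurable borel"
    and wi: "integrable lborel (\<lambda>x. \<bar>w x\<bar> powr p)"
  shows "ennreal (\<bar>LINT y|lborel. w y * moll h x 0 0 y\<bar> powr p)
      \<le> (\<integral>\<^sup>+y. ennreal (\<bar>w y\<bar> powr p) * ennreal (moll h x 0 0 y) \<partial>lborel)"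
proof -
  define M where "M = density lborel (\<lambda>y. ennreal (moll h x 0 0 y))"
  have [measurable]: "moll h x 0 0 \<in> borel_measurable borel" using h by simp
  have m0: "0 \<le> moll h x 0 0 y" for y by (rule moll_nonneg[OF h])
  interpret prob_space M
    by (rule prob_spaceI) (simp add: M_def emeasure_density nn_integral_moll h)
  have dens: "(LINT y|M. g y) = (LINT y|lborel. moll h x 0 0 y * g y)" if [measurable]: "g \<in> borel_measurable borel" for g :: "plane \<Rightarrow> real"
    unfolding M_def by (subst integral_density) (auto simp: m0)
  have int: "integrable M (\<lambda>y. \<bar>w y\<bar> powr p)"
    unfolding M_def using integrable_mult_moll[OF h wi, of x]
    by (subst integrable_density) (auto simp: m0 mult.commute)
  have "\<bar>LINT y|lborel. w y * moll h x 0 0 y\<bar> \<le> (LINT y|lborel. \<bar>w y * moll h x 0 0 y\<bar>)" by (rule integral_abs_bound)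
  also have "\<dots> = (LINT y|M. \<bar>w y\<bar>)" using m0 by (simp add: dens abs_mult mult.commute)
  finally have "\<bar>LINT y|lborel. w y * moll h x 0 0 y\<bar> powr p \<le> (LINT y|M. \<bar>w y\<bar>) powr p"
    using p by (intro powr_mono2) auto
  also have "\<dots> \<le> (LINT y|M. \<bar>w y\<bar> powr p)"
    by (rule jensen_powr(2)[OF p _ _ int]) (auto simp: M_def)
  finally have "ennreal (\<bar>LINT y|lborel. w y * moll h x 0 0 y\<bar> powr p) \<le> ennreal (LINT y|M. \<bar>w y\<bar> powr p)"
    by (rule ennreal_leI)
  also have "\<dots> = (\<integral>\<^sup>+y. ennreal (\<bar>w y\<bar> powr p) \<partial>M)"
    by (rule nn_integral_eq_integral[symmetric, OF int]) auto
  also have "\<dots> = (\<integral>\<^sup>+y. ennreal (\<bar>w y\<bar> powr p) * ennreal (moll h x 0 0 y) \<partial>lborel)"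
    unfolding M_def by (subst nn_integral_density) (auto simp: mult.commute)
  finally show ?thesis .
qed

lemma moll_pair_measurable [measurable]: "(\<lambda>z. moll h (fst z) a b (snd z)) \<in> borel_measurable (borel \<Otimes>\<^sub>M borel)"
  unfolding borel_prod by (intro borel_measurable_continuous_onI moll_comp_continuous continuous_intros)

text \<open>Jensen's inequality for each \<open>x\<close>, then Tonelli's theorem, then mass one in
  the variable \<open>x\<close>.\<close>

lemma moll_Lp_contraction:
  fixes w :: "plane \<Rightarrow> real"
  assumes p: "1 \<le> p" and h: "h > 0" and [measurable]: "w \<in> borel_measurable borel"
    and wi: "integrable lborel (\<lambda>x. \<bar>w x\<bar> powr p)"
  shows "(\<integral>\<^sup>+x. ennreal (\<bar>LINT y|lborel. w y * moll h x 0 0 y\<bar> powr p) \<partial>lborel) \<le> (\<integral>\<^sup>+y. ennreal (\<bar>w y\<bar> powr p) \<partial>lborel)"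
proof -
  have "(\<integral>\<^sup>+x. ennreal (\<bar>LINT y|lborel. w y * moll h x 0 0 y\<bar> powr p) \<partial>lborel)
      \<le> (\<integral>\<^sup>+x. \<integral>\<^sup>+y. ennreal (\<bar>w y\<bar> powr p) * ennreal (moll h x 0 0 y) \<partial>lborel \<partial>lborel)"
    by (intro nn_integral_mono moll_jensen assms)
  also have "\<dots> = (\<integral>\<^sup>+y. \<integral>\<^sup>+x. ennreal (\<bar>w y\<bar> powr p) * ennreal (moll h x 0 0 y) \<partial>lborel \<partial>lborel)"
    by (rule lborel_pair.Fubini'[symmetric]) (simp add: split_beta)
  also have "\<dots> = (\<integral>\<^sup>+y. ennreal (\<bar>w y\<bar> powr p) \<partial>lborel)"
    by (simp add: nn_integral_cmult nn_integral_moll h)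
  finally show ?thesis .
qed

text \<open>Convergence almost everywhere says nothing about the interpolation nodes, so continuity
  of \<open>f\<close> is used there. The centres move because the dilation moves the nodes.\<close>

lemma smoothing_converges:
  assumes f: "continuous_on UNIV f" and h: "\<And>n. 0 < h n" "h \<longlonglongrightarrow> 0" and y: "y \<longlonglongrightarrow> x"
    and S: "\<And>n. square (h n) (y n) \<subseteq> cbox p q"
  shows "(\<lambda>n. smoothing (cbox p q) f (h n) 0 0 (y n)) \<longlonglongrightarrow> f x"
proof (rule LIMSEQ_I)
  fix e :: real assume e: "0 < e"
  have fc: "continuous_on S f" for S using f continuous_on_subset by blast
  obtain d where d: "d > 0" "\<And>z. dist z x < d \<Longrightarrow> dist (f z) (f x) < e / 2"
    using f e by (force simp: continuous_on_eq_continuous_at continuous_at_eps_delta dest: spec[of _ "e / 2"])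
  have "\<forall>\<^sub>F n in sequentially. dist (y n) x < d / 2" using y d by (intro tendstoD) auto
  moreover have "\<forall>\<^sub>F n in sequentially. h n < d / 4" using order_tendstoD(2)[OF h(2), of "d / 4"] d by simp
  ultimately have "\<forall>\<^sub>F n in sequentially. norm (smoothing (cbox p q) f (h n) 0 0 (y n) - f x) < e"
  proof eventually_elim
    case (elim n)
    let ?B = "cbox p q" and ?m = "moll (h n) (y n) 0 0"
    have near: "\<bar>f z - f x\<bar> < e / 2" if "z \<in> square (h n) (y n)" for z
    proof -
      have "norm (z - y n) \<le> \<bar>(z - y n) $ 1\<bar> + \<bar>(z - y n) $ 2\<bar>"
        using norm_le_l1_cart[of "z - y n"] by (simp add: sum_2)
      also have "\<dots> \<le> h n + h n" using that by (auto simp: square_iff)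
      finally have "dist z (y n) < d / 2" using elim by (simp add: dist_norm)
      then have "dist z x < d" using elim dist_triangle[of z x "y n"] by linarith
      then show ?thesis using d(2) by (simp add: dist_real_def)
    qed
    have mi: "?m integrable_on ?B" by (rule integrable_lborel_imp_on) (auto intro: moll_integral h)
    have m1: "integral ?B ?m = 1"
    proof -
      have "(LINT z|lborel. indicator ?B z * ?m z) = (LINT z|lborel. ?m z)"
      proof (rule Bochner_Integration.integral_cong)
        fix z show "indicator ?B z * ?m z = ?m z"
          using S[of n] moll_zero[OF h(1)[of n], of z "y n" 0 0] by (cases "z \<in> ?B") auto
      qed simp
      then show ?thesis using integrable_lborel_imp_on(2)[of ?m ?B] h(1)[of n]
        by (simp add: moll_integral)
    qed
    have "smoothing ?B f (h n) 0 0 (y n) - f x = integral ?B (\<lambda>z. f z * ?m z) - integral ?B (\<lambda>z. f x * ?m z)"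
      by (simp only: integral_mult_right m1) (simp add: smoothing_def)
    also have "\<dots> = integral ?B (\<lambda>z. f z * ?m z - f x * ?m z)"
      using h(1)[of n] by (intro integral_diff[symmetric] integrable_continuous continuous_intros fc moll_continuous) auto
    finally have "norm (smoothing ?B f (h n) 0 0 (y n) - f x) \<le> integral ?B (\<lambda>z. e / 2 * ?m z)"
    proof (simp only:, intro integral_norm_bound_integral)
      show "(\<lambda>z. f z * ?m z - f x * ?m z) integrable_on ?B"
        using h(1)[of n] by (intro integrable_continuous continuous_intros fc moll_continuous) auto
      show "(\<lambda>z. e / 2 * ?m z) integrable_on ?B" by (intro integrable_on_mult_right mi)
      fix z
      show "norm (f z * ?m z - f x * ?m z) \<le> e / 2 * ?m z"
      proof (cases "z \<in> square (h n) (y n)")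
        case True
        have "norm (f z * ?m z - f x * ?m z) = \<bar>f z - f x\<bar> * ?m z"
          using moll_nonneg[OF h(1)[of n], of "y n" z] by (simp add: abs_mult flip: left_diff_distrib)
        also have "\<dots> \<le> e / 2 * ?m z"
          using near[OF True] moll_nonneg[OF h(1)[of n], of "y n" z] by (intro mult_right_mono) auto
        finally show ?thesis .
      next
        case False then show ?thesis by (simp only: moll_zero[OF h(1) False]) simp
      qed
    qed
    also have "\<dots> = e / 2" by (simp only: integral_mult_right m1)
    finally show ?case using e by simp
  qed
  then show "\<exists>n0. \<forall>n\<ge>n0. norm (smoothing (cbox p q) f (h n) 0 0 (y n) - f x) < e"
    by (simp add: eventually_sequentially)
qed

section \<open>Dilation, mollification and the limit on a triangle\<close>

context labelled_triangle
begin

lemma convex_K: "convex K"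
proof -
  have *: "aff z A B (u *\<^sub>R x + t *\<^sub>R y) = u *\<^sub>R aff z A B x + t *\<^sub>R aff z A B y" if "u + t = 1" for u t x y
  proof -
    have "z = (u + t) *\<^sub>R z" using that by simp
    then show ?thesis by (simp add: aff_def algebra_simps)
  qed
  show ?thesis
    unfolding K_eq
  proof (rule convexI)
    fix x y u t assume "x \<in> aff z A B ` unit_tri" "y \<in> aff z A B ` unit_tri" and ut: "0 \<le> u" "0 \<le> t" "u + t = (1 :: real)"
    then obtain x' y' where "x = aff z A B x'" "x' \<in> unit_tri" "y = aff z A B y'" "y' \<in> unit_tri" by blast
    then show "u *\<^sub>R x + t *\<^sub>R y \<in> aff z A B ` unit_tri"
      using *[OF ut(3), of x' y', symmetric] convexD[OF convex_unit_tri _ _ ut] by auto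
  qed
qed

lemma interior_nonempty: "interior K \<noteq> {}"
proof
  assume "interior K = {}"
  then have "negligible K" using negligible_convex_interior[OF convex_K] by simp
  then have "integral K (\<lambda>_. 1 :: real) = 0" by (rule integral_negligible)
  then show False using integral_K[of "\<lambda>_. 1"] cross area_pos by (simp add: area_def)
qed

text \<open>Dilating by \<open>r < 1\<close> about an interior point makes room for the mollifier; the resulting
  functions are jets on the whole plane, and Fatou's lemma passes to the limit \<open>r \<rightarrow> 1\<close>.\<close>

lemma limit_estimate:
  fixes w :: "nat \<Rightarrow> nat \<Rightarrow> plane \<Rightarrow> real"
  assumes k: "1 \<le> k" and p: "1 \<le> p" and D: "0 \<le> D"
    and est: "\<And>U. jet U \<Longrightarrow> seminorm_K K p (\<lambda>a b x. U a b x - interp_jet z A B k (U 0 0) a b x) m \<le> D powr p * seminorm_K K p U (k + 1)"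
    and v: "continuous_on UNIV v" and KB: "K \<subseteq> cbox P Q"
    and wm: "\<And>a b. a + b \<le> k + 1 \<Longrightarrow> w a b \<in> borel_measurable borel"
    and wi: "\<And>a b. a + b \<le> k + 1 \<Longrightarrow> integrable lborel (w a b)"
    and wp: "\<And>a b. a + b \<le> k + 1 \<Longrightarrow> integrable lborel (\<lambda>x. \<bar>w a b x\<bar> powr p)"
    and ws: "\<And>a b h y. a + b \<le> k + 1 \<Longrightarrow> 0 < h \<Longrightarrow> square h y \<subseteq> interior K \<Longrightarrow>
      smoothing (cbox P Q) v h a b y = (LINT t|lborel. w a b t * moll h y 0 0 t)"
    and ab: "a + b = m" "m \<le> k"
  shows "(\<integral>\<^sup>+y. indicator (interior K) y * ennreal (\<bar>w a b y - interp_jet z A B k v a b y\<bar> powr p) \<partial>lborel)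
    \<le> ennreal (D powr p) * (\<Sum>l\<le>k + 1. \<integral>\<^sup>+y. ennreal (\<bar>w l (k + 1 - l) y\<bar> powr p) \<partial>lborel)"
proof -
  obtain c d where cd: "0 < d" "ball c d \<subseteq> K"
    using interior_nonempty mem_interior by blast
  have bint: "ball c d \<subseteq> interior K" using cd by (simp add: interior_maximal)
  \<comment> \<open>The double successor keeps the first factor positive, so every dilation is
    invertible.\<close>
  define r where "r n = 1 - inverse (real (Suc (Suc n)))" for n
  have r: "0 < r n" "r n < 1" for n by (auto simp: r_def field_simps)
  have r1: "r \<longlonglongrightarrow> 1"
  proof -
    have "(\<lambda>n. inverse (real (Suc (Suc n)))) \<longlonglongrightarrow> 0"
      by (rule LIMSEQ_Suc[OF LIMSEQ_inverse_real_of_nat])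
    then have "r \<longlonglongrightarrow> 1 - 0" unfolding r_def by (intro tendsto_intros)
    then show ?thesis by simp
  qed
  \<comment> \<open>A point of the square of this side differs from its corner by at most 2 * hh =
    (1 - r) d / 2, which the dilated ball of radius \<open>d\<close> can absorb.\<close>
  define hh where "hh n = (1 - r n) * d / 4" for n
  have hh: "0 < hh n" for n using r[of n] cd by (simp add: hh_def)
  have hh0: "hh \<longlonglongrightarrow> 0"
  proof -
    have "hh \<longlonglongrightarrow> (1 - 1) * d / 4" unfolding hh_def by (intro tendsto_intros r1) simp
    then show ?thesis by simp
  qed
  define \<theta> where "\<theta> n x = (1 - r n) *\<^sub>R c + r n *\<^sub>R x" for n x
  define \<theta>i where "\<theta>i n y = (1 / r n) *\<^sub>R (y - (1 - r n) *\<^sub>R c)" for n y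
  have inv: "\<theta>i n (\<theta> n x) = x" "\<theta> n (\<theta>i n y) = y" for n x y
    using r(1)[of n] by (auto simp: \<theta>_def \<theta>i_def)
  have sq: "square (hh n) (\<theta> n x) \<subseteq> interior K" if x: "x \<in> K" for n x
  proof
    fix t assume t: "t \<in> square (hh n) (\<theta> n x)"
    define s where "s = t - \<theta> n x"
    have "norm s \<le> \<bar>s $ 1\<bar> + \<bar>s $ 2\<bar>" using norm_le_l1_cart[of s] by (simp add: sum_2)
    also have "\<dots> \<le> hh n + hh n" using t by (auto simp: square_iff s_def)
    also have "\<dots> = (1 - r n) * (d / 2)" by (simp add: hh_def)
    finally have ns: "norm s \<le> (1 - r n) * (d / 2)" .
    define u where "u = (1 / (1 - r n)) *\<^sub>R s"
    have "norm u \<le> d / 2"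
      using ns r[of n] by (simp add: u_def pos_divide_le_eq mult.commute)
    then have "c + u \<in> ball c d" using cd by (simp add: dist_norm)
    then have ci: "c + u \<in> interior K" using bint by blast
    have "(1 - r n) *\<^sub>R u = s" using r[of n] by (simp add: u_def)
    then have su: "s = u - r n *\<^sub>R u" by (simp add: algebra_simps)
    \<comment> \<open>The point is the combination r x + (1 - r)(c + u) of a point of
      \<open>K\<close> and an interior point, hence interior; the displacement \<open>s\<close> has
      been charged to the interior point.\<close>
    have "x - (1 - r n) *\<^sub>R (x - (c + u)) \<in> interior K"
      by (rule mem_interior_convex_shrink[OF convex_K ci x]) (use r[of n] in auto)
    also have "x - (1 - r n) *\<^sub>R (x - (c + u)) = \<theta> n x + s"
      unfolding su by (simp add: \<theta>_def algebra_simps)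
    also have "\<theta> n x + s = t" by (simp add: s_def)
    finally show "t \<in> interior K" .
  qed
  define S where "S n a b y = (LINT t|lborel. w a b t * moll (hh n) y 0 0 t)" for n a b y
  \<comment> \<open>The dilated mollification as a family on the whole plane. By the chain rule
    order (a, b) acquires the factor r^(a + b). On \<open>K\<close> its members are averages of weak
    derivatives, because the supporting squares lie in the interior.\<close>
  define U where "U n = (\<lambda>a b x. pull_dirs (pt (r n) 0) (pt 0 (r n)) (smoothing (cbox P Q) v (hh n)) a b
      (aff ((1 - r n) *\<^sub>R c) (pt (r n) 0) (pt 0 (r n)) x))" for n
  have hne: "hh n \<noteq> 0" for n using hh[of n] by simp
  have JU: "jet (U n)" for n unfolding U_def by (intro jet_affine jet_smoothing v hne)
  have affr: "aff ((1 - r n) *\<^sub>R c) (pt (r n) 0) (pt 0 (r n)) x = \<theta> n x" for n x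
    by (simp add: aff_def \<theta>_def vec_eq_iff forall_2)
  have Ueq: "U n a b x = r n ^ (a + b) * smoothing (cbox P Q) v (hh n) a b (\<theta> n x)" for n a b x
  proof -
    have "pt (r n) 0 = r n *\<^sub>R pt 1 0" "pt 0 (r n) = r n *\<^sub>R pt 0 1" by (simp_all add: vec_eq_iff forall_2)
    then have "U n a b x = pull_dirs (r n *\<^sub>R pt 1 0) (r n *\<^sub>R pt 0 1) (smoothing (cbox P Q) v (hh n)) a b (\<theta> n x)"
      unfolding U_def affr by simp
    then show ?thesis unfolding pull_dirs_scale pull_dirs_id by (simp add: power_add)
  qed
  have US: "U n a b x = r n ^ (a + b) * S n a b (\<theta> n x)" if "a + b \<le> k + 1" "x \<in> K" for n a b x
    unfolding Ueq S_def using ws[OF that(1) hh sq[OF that(2)]] by simp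
  have S_meas: "S n a b \<in> borel_measurable borel" if "a + b \<le> k + 1" for n a b
  proof -
    have [measurable]: "w a b \<in> borel_measurable borel" by (rule wm[OF that])
    have "(\<lambda>y. LINT t|lborel. w a b t * moll (hh n) y 0 0 t) \<in> borel_measurable (borel :: plane measure)"
      by (rule lborel.borel_measurable_lebesgue_integral) (simp add: split_beta)
    then show ?thesis by (simp add: S_def[abs_def])
  qed
  have scale: "(\<integral>\<^sup>+y. g y \<partial>lborel) = ennreal ((r n)\<^sup>2) * (\<integral>\<^sup>+x. g (\<theta> n x) \<partial>lborel)"
    if "g \<in> borel_measurable borel" for g n
    unfolding \<theta>_def using r(1)[of n] by (intro nn_integral_plane_affine that) simp
  define W where "W = (\<Sum>l\<le>k + 1. \<integral>\<^sup>+y. ennreal (\<bar>w l (k + 1 - l) y\<bar> powr p) \<partial>lborel)"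
  have rhs: "ennreal (seminorm_K K p (U n) (k + 1)) \<le> W" for n
  proof -
    have "ennreal (integral K (\<lambda>x. \<bar>U n l (k + 1 - l) x\<bar> powr p)) \<le> (\<integral>\<^sup>+y. ennreal (\<bar>w l (k + 1 - l) y\<bar> powr p) \<partial>lborel)"
      if l: "l \<le> k + 1" for l
    proof -
      let ?b = "k + 1 - l"
      define G where "G y = ennreal (\<bar>S n l ?b y\<bar> powr p)" for y
      have lb: "l + ?b \<le> k + 1" "l + ?b = k + 1" using l by auto
      have [measurable]: "S n l ?b \<in> borel_measurable borel" by (rule S_meas[OF lb(1)])
      have Gm: "G \<in> borel_measurable borel" unfolding G_def by measurable
      \<comment> \<open>The Jacobian of the substitution costs r^(-2). The chain rule factor of
        order k + 1 \<ge> 2, raised to a power p \<ge> 1, compensates for it, so the seminorm does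
        not grow.\<close>
      have rp: "\<bar>r n ^ (k + 1)\<bar> powr p \<le> (r n)\<^sup>2"
      proof -
        have le1: "r n ^ (k + 1) \<le> 1" using r[of n] by (intro power_le_one) auto
        have "\<bar>r n ^ (k + 1)\<bar> powr p \<le> \<bar>r n ^ (k + 1)\<bar> powr 1"
          using p le1 r[of n] by (intro powr_mono') auto
        also have "\<dots> = r n ^ (k + 1)" using r[of n] by simp
        also have "\<dots> \<le> (r n)\<^sup>2" using k r[of n] by (intro power_decreasing) auto
        finally show ?thesis .
      qed
      have "ennreal (integral K (\<lambda>x. \<bar>U n l ?b x\<bar> powr p)) = (\<integral>\<^sup>+x. ennreal (indicator K x * \<bar>U n l ?b x\<bar> powr p) \<partial>lborel)"
        by (rule nn_integral_compact[symmetric, OF compact_K]) (auto intro!: continuous_powr_p[OF jet_continuous[OF JU] p])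
      also have "\<dots> \<le> (\<integral>\<^sup>+x. ennreal ((r n)\<^sup>2) * G (\<theta> n x) \<partial>lborel)"
      proof (rule nn_integral_mono)
        fix x
        show "ennreal (indicator K x * \<bar>U n l ?b x\<bar> powr p) \<le> ennreal ((r n)\<^sup>2) * G (\<theta> n x)"
        proof (cases "x \<in> K")
          case True
          have "\<bar>U n l ?b x\<bar> powr p = \<bar>r n ^ (k + 1)\<bar> powr p * \<bar>S n l ?b (\<theta> n x)\<bar> powr p"
            unfolding US[OF lb(1) True] lb(2) abs_mult by (rule powr_mult)
          also have "\<dots> \<le> (r n)\<^sup>2 * \<bar>S n l ?b (\<theta> n x)\<bar> powr p" by (intro mult_right_mono rp) auto
          finally have "ennreal (\<bar>U n l ?b x\<bar> powr p) \<le> ennreal ((r n)\<^sup>2 * \<bar>S n l ?b (\<theta> n x)\<bar> powr p)" by (rule ennreal_leI)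
          then show ?thesis using True by (simp add: G_def ennreal_mult)
        qed simp
      qed
      also have "\<dots> = ennreal ((r n)\<^sup>2) * (\<integral>\<^sup>+x. G (\<theta> n x) \<partial>lborel)"
        by (rule nn_integral_cmult) (use Gm in \<open>auto simp: \<theta>_def\<close>)
      also have "\<dots> = (\<integral>\<^sup>+y. G y \<partial>lborel)" by (rule scale[OF Gm, symmetric])
      also have "\<dots> \<le> (\<integral>\<^sup>+y. ennreal (\<bar>w l ?b y\<bar> powr p) \<partial>lborel)"
        unfolding G_def S_def by (rule moll_Lp_contraction[OF p hh wm[OF lb(1)] wp[OF lb(1)]])
      finally show ?thesis .
    qed
    then have "(\<Sum>l\<le>k + 1. ennreal (integral K (\<lambda>x. \<bar>U n l (k + 1 - l) x\<bar> powr p))) \<le> W"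
      unfolding W_def by (intro sum_mono) auto
    then show ?thesis
      unfolding seminorm_K_def
      by (subst sum_ennreal[symmetric]) (auto intro!: integral_nonneg integrable_K continuous_powr_p[OF jet_continuous[OF JU] p])
  qed
  have abk: "a + b \<le> k + 1" using ab by simp
  let ?R = "\<lambda>n. interp_jet z A B k (U n 0 0) a b"
  have R: "continuous_on X (?R n)" for X n by (intro jet_continuous polyjet_jet[OF polyjet_interp_jet])
  \<comment> \<open>The error is carried back to the fixed variable y = \<theta> n x. Averages
    converge almost everywhere at fixed points only, so the limit cannot be taken in the variable
    \<open>x\<close>.\<close>
  define F where "F n y = indicator (\<theta> n ` K) y * ennreal (\<bar>r n ^ m * S n a b y - ?R n (\<theta>i n y)\<bar> powr p)" for n y
  have Fm: "F n \<in> borel_measurable borel" for n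
  proof -
    have "compact (\<theta> n ` K)" unfolding \<theta>_def by (intro compact_continuous_image continuous_intros compact_K)
    then have [measurable]: "\<theta> n ` K \<in> sets borel" by (simp add: compact_imp_closed)
    have [measurable]: "S n a b \<in> borel_measurable borel" by (rule S_meas[OF abk])
    have "continuous_on UNIV (\<lambda>y. ?R n (\<theta>i n y))"
      by (rule continuous_on_compose2[OF R[of UNIV]]) (auto simp: \<theta>i_def intro!: continuous_intros)
    then have [measurable]: "(\<lambda>y. ?R n (\<theta>i n y)) \<in> borel_measurable borel" by (rule borel_measurable_continuous_onI)
    show ?thesis unfolding F_def by measurable
  qed
  have Fb: "(\<integral>\<^sup>+y. F n y \<partial>lborel) \<le> ennreal (D powr p) * W" for n
  proof -
    let ?E = "\<lambda>x. U n a b x - ?R n x"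
    have cE: "continuous_on X (\<lambda>x. \<bar>?E x\<bar> powr p)" for X
      by (intro continuous_powr_p p continuous_intros R jet_continuous JU)
    have "(\<integral>\<^sup>+y. F n y \<partial>lborel) = ennreal ((r n)\<^sup>2) * (\<integral>\<^sup>+x. F n (\<theta> n x) \<partial>lborel)" by (rule scale[OF Fm])
    also have "\<dots> \<le> 1 * (\<integral>\<^sup>+x. F n (\<theta> n x) \<partial>lborel)"
    proof (rule mult_right_mono)
      have "(r n)\<^sup>2 \<le> 1" using r[of n] by (intro power_le_one) auto
      then show "ennreal ((r n)\<^sup>2) \<le> 1" by (simp add: ennreal_le_1)
    qed simp
    also have "(\<integral>\<^sup>+x. F n (\<theta> n x) \<partial>lborel) = (\<integral>\<^sup>+x. ennreal (indicator K x * \<bar>?E x\<bar> powr p) \<partial>lborel)"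
    proof (rule nn_integral_cong)
      fix x
      have "\<theta> n x \<in> \<theta> n ` K \<longleftrightarrow> x \<in> K" using inv(1) by (metis image_iff)
      then show "F n (\<theta> n x) = ennreal (indicator K x * \<bar>?E x\<bar> powr p)"
        by (cases "x \<in> K") (auto simp: F_def inv US[OF abk] ab(1))
    qed
    also have "\<dots> = ennreal (integral K (\<lambda>x. \<bar>?E x\<bar> powr p))"
      by (rule nn_integral_compact[OF compact_K cE]) auto
    also have "integral K (\<lambda>x. \<bar>?E x\<bar> powr p) \<le> seminorm_K K p (\<lambda>a b x. U n a b x - interp_jet z A B k (U n 0 0) a b x) m"
    proof -
      have JE: "jet (\<lambda>a b x. U n a b x - interp_jet z A B k (U n 0 0) a b x)"
        by (intro jet_diff JU polyjet_jet[OF polyjet_interp_jet])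
      have nn: "0 \<le> integral K (\<lambda>x. \<bar>U n l (m - l) x - interp_jet z A B k (U n 0 0) l (m - l) x\<bar> powr p)" for l
        by (intro integral_nonneg integrable_K continuous_powr_p[OF jet_continuous[OF JE] p]) auto
      have "integral K (\<lambda>x. \<bar>U n a (m - a) x - interp_jet z A B k (U n 0 0) a (m - a) x\<bar> powr p)
          \<le> seminorm_K K p (\<lambda>a b x. U n a b x - interp_jet z A B k (U n 0 0) a b x) m"
        unfolding seminorm_K_def using ab nn
        by (intro member_le_sum[of a "{..m}" "\<lambda>l. integral K (\<lambda>x. \<bar>U n l (m - l) x - interp_jet z A B k (U n 0 0) l (m - l) x\<bar> powr p)"])
          auto
      moreover have "m - a = b" using ab by simp
      ultimately show ?thesis by simp
    qed
    also have "\<dots> \<le> D powr p * seminorm_K K p (U n) (k + 1)" by (rule est[OF JU])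
    also have "ennreal (D powr p * seminorm_K K p (U n) (k + 1)) = ennreal (D powr p) * ennreal (seminorm_K K p (U n) (k + 1))"
    proof (rule ennreal_mult)
      show "0 \<le> seminorm_K K p (U n) (k + 1)"
        unfolding seminorm_K_def
        by (intro sum_nonneg integral_nonneg integrable_K continuous_powr_p[OF jet_continuous[OF JU] p]) auto
    qed simp
    also have "\<dots> \<le> ennreal (D powr p) * W" by (intro mult_left_mono rhs) simp
    finally show ?thesis by (simp add: ennreal_leI)
  qed
  have conv: "AE y in lborel. (\<lambda>n. S n a b y) \<longlonglongrightarrow> w a b y"
    unfolding S_def by (rule moll_converges_AE[OF wi[OF abk] hh hh0])
  have "AE y in lborel. indicator (interior K) y * ennreal (\<bar>w a b y - interp_jet z A B k v a b y\<bar> powr p) \<le> liminf (\<lambda>n. F n y)"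
    using conv
  proof eventually_elim
    case (elim y)
    show ?case
    proof (cases "y \<in> interior K")
      case True
      have ti: "(\<lambda>n. \<theta>i n y) \<longlonglongrightarrow> y"
      proof -
        have "(\<lambda>n. \<theta>i n y) \<longlonglongrightarrow> (1 / 1) *\<^sub>R (y - (1 - 1) *\<^sub>R c)"
          unfolding \<theta>i_def by (intro tendsto_intros r1) simp
        then show ?thesis by simp
      qed
      have "\<forall>\<^sub>F n in sequentially. \<theta>i n y \<in> interior K"
        using ti True by (intro topological_tendstoD) auto
      \<comment> \<open>Interior points are eventually covered by the dilated triangles, so the
        indicator in \<open>F\<close> is eventually one.\<close>
      then have ev: "\<forall>\<^sub>F n in sequentially. y \<in> \<theta> n ` K"
      proof eventually_elim
        case (elim n)
        then show ?case using inv(2)[of n y] interior_subset[of K] by (intro image_eqI[of _ _ "\<theta>i n y"]) auto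
      qed
      have nodes: "(\<lambda>n. U n 0 0 x) \<longlonglongrightarrow> v x" if x: "x \<in> K" for x
      proof -
        have "(\<lambda>n. \<theta> n x) \<longlonglongrightarrow> (1 - 1) *\<^sub>R c + 1 *\<^sub>R x" unfolding \<theta>_def by (intro tendsto_intros r1)
        then have "(\<lambda>n. \<theta> n x) \<longlonglongrightarrow> x" by simp
        then have "(\<lambda>n. smoothing (cbox P Q) v (hh n) 0 0 (\<theta> n x)) \<longlonglongrightarrow> v x"
          by (rule smoothing_converges[OF v hh hh0]) (use sq[OF x] KB interior_subset[of K] in blast)
        then show ?thesis by (simp add: Ueq)
      qed
      have q: "(\<lambda>n. ?R n (\<theta>i n y)) \<longlonglongrightarrow> interp_jet z A B k v a b y"
      proof (rule tendsto_interp_jet[OF nodes ti])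
        fix s t assume "s + t \<le> k"
        then have "pt (real s / real k) (real t / real k) \<in> unit_tri"
          using k by (auto simp: unit_tri_def add_divide_distrib[symmetric] simp flip: of_nat_add)
        then show "aff z A B (pt (real s / real k) (real t / real k)) \<in> K" unfolding K_eq by (rule imageI)
      qed
      have "(\<lambda>n. r n ^ m * S n a b y - ?R n (\<theta>i n y)) \<longlonglongrightarrow> 1 ^ m * w a b y - interp_jet z A B k v a b y"
        by (intro tendsto_intros r1 elim q)
      then have l: "(\<lambda>n. r n ^ m * S n a b y - ?R n (\<theta>i n y)) \<longlonglongrightarrow> w a b y - interp_jet z A B k v a b y" by simp
      have "isCont (\<lambda>t :: real. \<bar>t\<bar> powr p) s" for s
        using continuous_powr_p[OF continuous_on_id p, of UNIV] by (simp add: continuous_on_eq_continuous_at)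
      from isCont_tendsto_compose[OF this l]
      have "(\<lambda>n. ennreal (\<bar>r n ^ m * S n a b y - ?R n (\<theta>i n y)\<bar> powr p)) \<longlonglongrightarrow> ennreal (\<bar>w a b y - interp_jet z A B k v a b y\<bar> powr p)"
        by (rule tendsto_ennrealI)
      then have "(\<lambda>n. F n y) \<longlonglongrightarrow> ennreal (\<bar>w a b y - interp_jet z A B k v a b y\<bar> powr p)"
        by (rule Lim_transform_eventually) (use ev in \<open>auto elim!: eventually_mono simp: F_def\<close>)
      then have "liminf (\<lambda>n. F n y) = ennreal (\<bar>w a b y - interp_jet z A B k v a b y\<bar> powr p)"
        by (intro lim_imp_Liminf) auto
      then show ?thesis using True by simp
    qed simp
  qed
  then have "(\<integral>\<^sup>+y. indicator (interior K) y * ennreal (\<bar>w a b y - interp_jet z A B k v a b y\<bar> powr p) \<partial>lborel)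
      \<le> (\<integral>\<^sup>+y. liminf (\<lambda>n. F n y) \<partial>lborel)"
    by (rule nn_integral_mono_AE)
  also have "\<dots> \<le> liminf (\<lambda>n. \<integral>\<^sup>+y. F n y \<partial>lborel)"
    by (rule nn_integral_liminf) (use Fm in simp)
  also have "\<dots> \<le> liminf (\<lambda>n :: nat. ennreal (D powr p) * W)"
    by (intro Liminf_mono always_eventually allI Fb)
  also have "\<dots> = ennreal (D powr p) * W" by (simp add: Liminf_const)
  finally show ?thesis by (simp add: W_def)
qed

end

section \<open>Weak derivatives\<close>

text \<open>Weak derivatives are only Lebesgue measurable; this replaces them by Borel
  representatives on the plane, where products and Tonelli's theorem are available. Agreement is
  required only where the test function does not vanish.\<close>

lemma LINT_lebesgue_on_rep:
  fixes g u \<phi> :: "plane \<Rightarrow> real"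
  assumes \<Omega>: "\<Omega> \<in> sets lebesgue" and [measurable]: "u \<in> borel_measurable borel" "\<phi> \<in> borel_measurable borel"
    and ae: "AE x in lebesgue. \<phi> x \<noteq> 0 \<longrightarrow> x \<in> \<Omega> \<and> g x = u x"
  shows "(LINT x|lebesgue_on \<Omega>. g x * \<phi> x) = (LINT x|lborel. u x * \<phi> x)"
proof -
  have m: "(\<lambda>x. u x * \<phi> x) \<in> borel_measurable lebesgue" by (intro measurable_completion) measurable
  have ae': "AE x in lebesgue. u x * \<phi> x = indicator \<Omega> x *\<^sub>R (g x * \<phi> x)"
    using ae by eventually_elim (auto simp: indicator_def)
  have "(LINT x|lebesgue_on \<Omega>. g x * \<phi> x) = (LINT x|lebesgue. indicator \<Omega> x *\<^sub>R (g x * \<phi> x))"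
    using \<Omega> by (intro integral_restrict_space) auto
  also have "\<dots> = (LINT x|lebesgue. u x * \<phi> x)"
    by (rule integral_cong_AE[OF borel_measurable_AE[OF m ae'] m]) (use ae' in eventually_elim, rule sym)
  also have "\<dots> = (LINT x|lborel. u x * \<phi> x)" by (rule integral_completion) measurable
  finally show ?thesis .
qed

lemma borel_rep:
  fixes g :: "plane \<Rightarrow> real"
  assumes "integrable lebesgue g"
  obtains u where "u \<in> borel_measurable borel" "integrable lborel u" "AE x in lebesgue. g x = u x"
proof -
  obtain u where u: "u \<in> borel_measurable lborel" "AE x in lborel. g x = u x"
    using completion_ex_borel_measurable_real[OF borel_measurable_integrable[OF assms]] by blast
  have ae: "AE x in lebesgue. g x = u x" by (rule AE_completion[OF u(2)])
  have "integrable lebesgue u"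
    by (rule Bochner_Integration.integrable_cong_AE_imp[OF assms measurable_completion[OF u(1)]])
      (use ae in eventually_elim, simp)
  then have "integrable lborel u" using integrable_completion[OF u(1)] by blast
  then show thesis using that[of u] u ae by simp
qed

text \<open>The mollifier is an admissible test function, so both candidates have the same averages
  over small squares, and averages converge to the function almost everywhere. It also shows that
  the choice made in \<open>weak_partial\<close> is immaterial.\<close>

lemma weak_partial_unique:
  assumes \<Omega>: "open \<Omega>" and w: "has_weak_partial \<Omega> \<delta> v w" and w': "has_weak_partial \<Omega> \<delta> v w'"
  shows "AE x in lebesgue. x \<in> \<Omega> \<longrightarrow> w x = w' x"
proof -
  \<comment> \<open>Integrability is only local, so each candidate is cut off to a compact set;
    points in the interior of that set see the cut-off for small squares only inside it.\<close>
  obtain C where C: "\<And>n :: nat. compact (C n)" "\<And>n. C n \<subseteq> \<Omega>" "\<And>n. C n \<subseteq> interior (C (Suc n))" "\<Union>(range C) = \<Omega>"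
    by (rule open_Union_compact_subsets[OF \<Omega>], rule that)
  have \<Omega>m: "\<Omega> \<in> sets lebesgue" using \<Omega> by simp
  have loc: "integrable lebesgue (\<lambda>x. indicator (C n) x *\<^sub>R g x)" if "locally_integrable \<Omega> g" for g n
  proof -
    have "integrable (lebesgue_on (C n)) g" using that C(1)[of n] C(2)[of n] unfolding locally_integrable_def by blast
    then show ?thesis using C(1)[of n] by (subst (asm) integrable_restrict_space) (auto simp: compact_imp_closed)
  qed
  define h where "h m = inverse (real (Suc m))" for m
  have h: "0 < h m" for m by (simp add: h_def)
  have h0: "h \<longlonglongrightarrow> 0" unfolding h_def by (rule LIMSEQ_inverse_real_of_nat)
  have "AE x in lebesgue. x \<in> interior (C n) \<longrightarrow> w x = w' x" for n
  proof -
    have lw: "locally_integrable \<Omega> w" "locally_integrable \<Omega> w'" using w w' by (auto simp: has_weak_partial_def)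
    have l: "integrable lebesgue (\<lambda>x. indicator (C n) x *\<^sub>R w x)" "integrable lebesgue (\<lambda>x. indicator (C n) x *\<^sub>R w' x)"
      by (rule loc[OF lw(1)], rule loc[OF lw(2)])
    obtain u where [measurable]: "u \<in> borel_measurable borel" and ui: "integrable lborel u"
      and uw: "AE x in lebesgue. indicator (C n) x *\<^sub>R w x = u x"
      by (rule borel_rep[OF l(1)])
    obtain u' where [measurable]: "u' \<in> borel_measurable borel" and ui': "integrable lborel u'"
      and uw': "AE x in lebesgue. indicator (C n) x *\<^sub>R w' x = u' x"
      by (rule borel_rep[OF l(2)])
    have eq: "(LINT y|lborel. u y * moll a x 0 0 y) = (LINT y|lborel. u' y * moll a x 0 0 y)"
      if a: "0 < a" "square a x \<subseteq> C n" for a x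
    proof -
      have t: "test_function \<Omega> (moll a x 0 0)" by (rule test_function_moll[OF a(1) subset_trans[OF a(2) C(2)]])
      have [measurable]: "moll a x 0 0 \<in> borel_measurable borel" using a by simp
      have supp: "y \<in> C n" if "moll a x 0 0 y \<noteq> 0" for y using moll_zero[OF a(1), of y x 0 0] a(2) that by blast
      have "(LINT y|lebesgue_on \<Omega>. w y * moll a x 0 0 y) = (LINT y|lebesgue_on \<Omega>. w' y * moll a x 0 0 y)"
        using w w' t by (auto simp: has_weak_partial_def)
      moreover have "(LINT y|lebesgue_on \<Omega>. w y * moll a x 0 0 y) = (LINT y|lborel. u y * moll a x 0 0 y)"
      proof (rule LINT_lebesgue_on_rep[OF \<Omega>m])
        show "AE y in lebesgue. moll a x 0 0 y \<noteq> 0 \<longrightarrow> y \<in> \<Omega> \<and> w y = u y"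
          using uw
        proof eventually_elim
          case (elim y)
          then show ?case using supp[of y] C(2)[of n] by (cases "y \<in> C n") auto
        qed
      qed measurable
      moreover have "(LINT y|lebesgue_on \<Omega>. w' y * moll a x 0 0 y) = (LINT y|lborel. u' y * moll a x 0 0 y)"
      proof (rule LINT_lebesgue_on_rep[OF \<Omega>m])
        show "AE y in lebesgue. moll a x 0 0 y \<noteq> 0 \<longrightarrow> y \<in> \<Omega> \<and> w' y = u' y"
          using uw'
        proof eventually_elim
          case (elim y)
          then show ?case using supp[of y] C(2)[of n] by (cases "y \<in> C n") auto
        qed
      qed measurable
      ultimately show ?thesis by simp
    qed
    have small: "\<forall>\<^sub>F m in sequentially. square (h m) x \<subseteq> C n" if x: "x \<in> interior (C n)" for x
    proof -
      obtain e where e: "0 < e" "ball x e \<subseteq> C n" using x mem_interior by blast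
      have "\<forall>\<^sub>F m in sequentially. h m < e / 2" using order_tendstoD(2)[OF h0, of "e / 2"] e by simp
      then show ?thesis
      proof eventually_elim
        case (elim m)
        have "y \<in> ball x e" if y: "y \<in> square (h m) x" for y
        proof -
          have "norm (y - x) \<le> \<bar>(y - x) $ 1\<bar> + \<bar>(y - x) $ 2\<bar>" using norm_le_l1_cart[of "y - x"] by (simp add: sum_2)
          also have "\<dots> \<le> h m + h m" using y by (auto simp: square_iff)
          finally show ?thesis using elim by (simp add: dist_norm norm_minus_commute)
        qed
        then show ?case using e by blast
      qed
    qed
    show ?thesis
      using AE_completion[OF moll_converges_AE[OF ui h h0]] AE_completion[OF moll_converges_AE[OF ui' h h0]] uw uw'
    proof eventually_elim
      case (elim x)
      show ?case
      proof
        assume x: "x \<in> interior (C n)"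
        have "\<forall>\<^sub>F m in sequentially. (LINT y|lborel. u y * moll (h m) x 0 0 y) = (LINT y|lborel. u' y * moll (h m) x 0 0 y)"
          using small[OF x] by eventually_elim (rule eq[OF h])
        then have "(\<lambda>m. LINT y|lborel. u' y * moll (h m) x 0 0 y) \<longlonglongrightarrow> u x"
          by (rule Lim_transform_eventually[OF elim(1)])
        then have "u x = u' x" using elim(2) LIMSEQ_unique by blast
        then show "w x = w' x" using elim x interior_subset[of "C n"] by (auto simp: indicator_def subset_iff)
      qed
    qed
  qed
  then have "AE x in lebesgue. \<forall>n. x \<in> interior (C n) \<longrightarrow> w x = w' x"
    by (subst AE_all_countable) blast
  then show ?thesis
  proof eventually_elim
    case (elim x)
    show ?case using elim C(3,4) by blast
  qed
qed

section \<open>Test functions and integration by parts\<close>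

lemma smooth_partial: "smooth \<phi> \<Longrightarrow> smooth (partial d \<phi>)"
  unfolding smooth_def
proof (intro allI)
  fix ds x assume s: "\<forall>ds x. foldr partial ds \<phi> differentiable at x"
  have "foldr partial (ds @ [d]) \<phi> differentiable at x" by (rule s[rule_format])
  then show "foldr partial ds (partial d \<phi>) differentiable at x" by simp
qed

lemma smooth_differentiable: "smooth \<phi> \<Longrightarrow> \<phi> differentiable at x"
proof -
  assume "smooth \<phi>"
  then have "foldr partial [] \<phi> differentiable (at x)" unfolding smooth_def by (elim allE)
  then show ?thesis by simp
qed

lemma smooth_continuous: "smooth \<phi> \<Longrightarrow> continuous_on S \<phi>"
  by (intro continuous_at_imp_continuous_on ballI differentiable_imp_continuous_within smooth_differentiable)

lemma test_function_partial:
  assumes "test_function \<Omega> \<phi>"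
  shows "test_function \<Omega> (partial d \<phi>)"
proof -
  let ?C = "closure {x. \<phi> x \<noteq> 0}"
  have "partial d \<phi> x = 0" if x: "x \<notin> ?C" for x
  proof -
    have "((\<lambda>_. 0 :: real) has_derivative (\<lambda>_. 0)) (at x)" by simp
    then have "(\<phi> has_derivative (\<lambda>_. 0)) (at x)"
      by (rule has_derivative_transform_within_open[of _ _ _ _ "- ?C"]) (use x closure_subset[of "{x. \<phi> x \<noteq> 0}"] in auto)
    from frechet_derivative_at[OF this, symmetric] show ?thesis by (simp add: partial_def)
  qed
  then have sub: "closure {x. partial d \<phi> x \<noteq> 0} \<subseteq> ?C" by (intro closure_minimal) auto
  have C: "smooth \<phi>" "compact ?C" "?C \<subseteq> \<Omega>" using assms by (auto simp: test_function_def)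
  have "compact (?C \<inter> closure {x. partial d \<phi> x \<noteq> 0})" by (intro compact_Int_closed C closed_closure)
  then have "compact (closure {x. partial d \<phi> x \<noteq> 0})" using sub by (simp only: Int_absorb1)
  then show ?thesis
    unfolding test_function_def using smooth_partial[OF C(1)] subset_trans[OF sub C(3)] by blast
qed

lemma smooth_DERIV:
  assumes "smooth \<phi>"
  shows "((\<lambda>s. \<phi> (pt s t)) has_real_derivative partial 1 \<phi> (pt s t)) (at s)"
    "((\<lambda>t. \<phi> (pt s t)) has_real_derivative partial 2 \<phi> (pt s t)) (at t)"
proof -
  have D: "(\<phi> has_derivative frechet_derivative \<phi> (at x)) (at x)" for x
    using smooth_differentiable[OF assms] frechet_derivative_works by blast
  have lin: "frechet_derivative \<phi> (at x) (h *\<^sub>R e) = h * frechet_derivative \<phi> (at x) e" for x h e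
    using linear_frechet_derivative[OF smooth_differentiable[OF assms]] by (simp add: linear_scale)
  have e: "pt h 0 = h *\<^sub>R axis 1 1" "pt 0 h = h *\<^sub>R axis 2 1" for h by (simp_all add: vec_eq_iff forall_2 axis_def)
  have "((\<lambda>s. pt s t) has_derivative (\<lambda>h. pt h 0)) (at s)"
    by (subst pt_combination) (auto intro!: derivative_eq_intros simp: e vec_eq_iff forall_2 axis_def)
  from has_derivative_compose[OF this D]
  show "((\<lambda>s. \<phi> (pt s t)) has_real_derivative partial 1 \<phi> (pt s t)) (at s)"
    by (simp add: has_field_derivative_def e lin partial_def mult.commute[of _ "frechet_derivative _ _ _"])
  have "((\<lambda>t. pt s t) has_derivative (\<lambda>h. pt 0 h)) (at t)"
    by (subst pt_combination) (auto intro!: derivative_eq_intros simp: e vec_eq_iff forall_2 axis_def)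
  from has_derivative_compose[OF this D]
  show "((\<lambda>t. \<phi> (pt s t)) has_real_derivative partial 2 \<phi> (pt s t)) (at t)"
    by (simp add: has_field_derivative_def e lin partial_def mult.commute[of _ "frechet_derivative _ _ _"])
qed

lemma LINT_box:
  fixes f :: "plane \<Rightarrow> real"
  assumes f: "continuous_on UNIV f" and z: "\<And>x. x \<notin> cbox p q \<Longrightarrow> f x = 0"
  shows "integrable lborel f" "(LINT x|lborel. f x) = integral (cbox p q) f"
proof -
  have e: "(\<lambda>x. indicator (cbox p q) x *\<^sub>R f x) = f" using z by (auto simp: indicator_def fun_eq_iff)
  have i: "integrable lborel (\<lambda>x. indicator (cbox p q) x *\<^sub>R f x)"
    by (rule borel_integrable_compact[OF compact_cbox continuous_on_subset[OF f]]) auto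
  then show "integrable lborel f" by (simp only: e)
  have "set_integrable lborel (cbox p q) f" unfolding set_integrable_def by (rule i)
  from set_borel_integral_eq_integral(2)[OF this]
  show "(LINT x|lborel. f x) = integral (cbox p q) f" unfolding set_lebesgue_integral_def e .
qed

lemma integral_plane_box':
  assumes f: "continuous_on UNIV (f :: plane \<Rightarrow> real)"
  shows "integral (cbox (pt a c) (pt b d)) f = integral {c..d} (\<lambda>t. integral {a..b} (\<lambda>s. f (pt s t)))"
proof -
  have "continuous_on (cbox (a, c) (b, d)) (\<lambda>(s, t). f (pt s t))"
    unfolding split_beta by (rule continuous_on_compose2[OF f]) (auto intro!: continuous_on_pt continuous_intros)
  from integral_swap_continuous[OF this] show ?thesis by (simp add: integral_plane_box f)
qed

text \<open>On a large box the derivative of the product has zero integral along every line in the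
  relevant direction, because the test function vanishes at both ends.\<close>

lemma integration_by_parts:
  assumes \<Omega>: "open \<Omega>" and U: "jet U" and \<phi>: "test_function \<Omega> \<phi>"
  shows "(LINT x|lebesgue_on \<Omega>. U a b x * partial 1 \<phi> x) = - (LINT x|lebesgue_on \<Omega>. U (Suc a) b x * \<phi> x)"
    "(LINT x|lebesgue_on \<Omega>. U a b x * partial 2 \<phi> x) = - (LINT x|lebesgue_on \<Omega>. U a (Suc b) x * \<phi> x)"
proof -
  have s: "smooth \<phi>" "smooth (partial d \<phi>)" for d using \<phi> smooth_partial by (auto simp: test_function_def)
  have c\<phi>: "continuous_on S \<phi>" "continuous_on S (partial d \<phi>)" for S d by (intro smooth_continuous s)+
  have cU: "continuous_on S (U i j)" for S i j by (rule jet_continuous[OF U])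
  have \<Omega>m: "\<Omega> \<in> sets lebesgue" using \<Omega> by simp
  have "bounded (closure {x. \<phi> x \<noteq> 0} \<union> (\<Union>d. closure {x. partial d \<phi> x \<noteq> 0}))"
    using \<phi> test_function_partial[OF \<phi>] by (intro bounded_Un[THEN iffD2] conjI bounded_UN) (auto simp: test_function_def compact_imp_bounded)
  \<comment> \<open>The strict inequality makes the functions vanish on the boundary of the box as
    well, where the boundary terms are evaluated.\<close>
  then obtain M where M: "\<And>x. x \<in> closure {x. \<phi> x \<noteq> 0} \<union> (\<Union>d. closure {x. partial d \<phi> x \<noteq> 0}) \<Longrightarrow> norm x < M"
    unfolding bounded_pos_less by blast
  have z: "\<phi> x = 0" "partial d \<phi> x = 0" if "M \<le> \<bar>x $ i\<bar>" for x i d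
  proof -
    have "M \<le> norm x" using that component_le_norm_cart[of x i] by linarith
    then have "\<not> norm x < M" by simp
    then have "x \<notin> closure {x. \<phi> x \<noteq> 0}" "x \<notin> closure {x. partial d \<phi> x \<noteq> 0}" using M[of x] by auto
    then have "x \<notin> {x. \<phi> x \<noteq> 0}" "x \<notin> {x. partial d \<phi> x \<noteq> 0}" by (meson closure_subset subsetD)+
    then show "\<phi> x = 0" "partial d \<phi> x = 0" by auto
  qed
  let ?L = "\<bar>M\<bar>"
  let ?B = "cbox (pt (- ?L) (- ?L)) (pt ?L ?L)"
  have zB: "\<phi> x = 0" "partial d \<phi> x = 0" if "x \<notin> ?B" for x d
  proof -
    have "?L \<le> \<bar>x $ 1\<bar> \<or> ?L \<le> \<bar>x $ 2\<bar>" using that by (auto simp: mem_box_cart forall_2)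
    then have "M \<le> \<bar>x $ 1\<bar> \<or> M \<le> \<bar>x $ 2\<bar>" by linarith
    then show "\<phi> x = 0" "partial d \<phi> x = 0" using z(1)[of x 1] z(1)[of x 2] z(2)[of x 1 d] z(2)[of x 2 d] by argo+
  qed
  have conv: "(LINT x|lebesgue_on \<Omega>. U i j x * \<psi> x) = integral ?B (\<lambda>x. U i j x * \<psi> x)"
    if \<psi>: "test_function \<Omega> \<psi>" "\<And>x. x \<notin> ?B \<Longrightarrow> \<psi> x = 0" for \<psi> i j
  proof -
    have cont: "continuous_on UNIV \<psi>" using \<psi>(1) by (intro smooth_continuous) (simp add: test_function_def)
    have "{x. \<psi> x \<noteq> 0} \<subseteq> \<Omega>" using \<psi>(1) closure_subset[of "{x. \<psi> x \<noteq> 0}"] unfolding test_function_def by blast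
    then have "(LINT x|lebesgue_on \<Omega>. U i j x * \<psi> x) = (LINT x|lborel. U i j x * \<psi> x)"
      by (intro LINT_lebesgue_on_rep[OF \<Omega>m] borel_measurable_continuous_onI cU cont) auto
    also have "\<dots> = integral ?B (\<lambda>x. U i j x * \<psi> x)"
      by (rule LINT_box(2)) (auto intro!: continuous_intros cU cont simp: \<psi>(2))
    finally show ?thesis .
  qed
  note conv\<phi> = conv[OF \<phi> zB(1)] and convp = conv[OF test_function_partial[OF \<phi>] zB(2)]
  have fc: "continuous_on UNIV (\<lambda>x. U i j x * \<phi> x)" "continuous_on UNIV (\<lambda>x. U i j x * partial d \<phi> x)" for i j d
    by (intro continuous_intros cU c\<phi>)+
  have ib: "(\<lambda>x. U i j x * \<phi> x) integrable_on ?B" "(\<lambda>x. U i j x * partial d \<phi> x) integrable_on ?B" for i j d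
    by (intro integrable_continuous continuous_intros cU c\<phi>)+
  have "integral ?B (\<lambda>x. U a (Suc b) x * \<phi> x + U a b x * partial 2 \<phi> x)
      = integral {- ?L..?L} (\<lambda>s. integral {- ?L..?L} (\<lambda>t. U a (Suc b) (pt s t) * \<phi> (pt s t) + U a b (pt s t) * partial 2 \<phi> (pt s t)))"
    by (rule integral_plane_box) (intro continuous_intros cU c\<phi>)
  also have "(\<lambda>s. integral {- ?L..?L} (\<lambda>t. U a (Suc b) (pt s t) * \<phi> (pt s t) + U a b (pt s t) * partial 2 \<phi> (pt s t))) = (\<lambda>_. 0)"
  proof
    fix s
    have "((\<lambda>t. U a (Suc b) (pt s t) * \<phi> (pt s t) + U a b (pt s t) * partial 2 \<phi> (pt s t)) has_integral
        U a b (pt s ?L) * \<phi> (pt s ?L) - U a b (pt s (- ?L)) * \<phi> (pt s (- ?L))) {- ?L..?L}"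
    proof (rule fundamental_theorem_of_calculus)
      fix t
      have "((\<lambda>t. U a b (pt s t) * \<phi> (pt s t)) has_real_derivative
          U a (Suc b) (pt s t) * \<phi> (pt s t) + U a b (pt s t) * partial 2 \<phi> (pt s t)) (at t)"
        using DERIV_mult[OF jet_DERIV_2[OF U] smooth_DERIV(2)[OF s(1)]] by (simp add: algebra_simps)
      then show "((\<lambda>t. U a b (pt s t) * \<phi> (pt s t)) has_vector_derivative
          U a (Suc b) (pt s t) * \<phi> (pt s t) + U a b (pt s t) * partial 2 \<phi> (pt s t)) (at t within {- ?L..?L})"
        by (simp add: has_real_derivative_iff_has_vector_derivative has_vector_derivative_at_within)
    qed simp
    moreover have "\<phi> (pt s ?L) = 0" "\<phi> (pt s (- ?L)) = 0" by (rule z(1)[of _ 2]; simp)+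
    ultimately show "integral {- ?L..?L} (\<lambda>t. U a (Suc b) (pt s t) * \<phi> (pt s t) + U a b (pt s t) * partial 2 \<phi> (pt s t)) = 0"
      by (simp add: integral_unique)
  qed
  finally have "integral ?B (\<lambda>x. U a (Suc b) x * \<phi> x) + integral ?B (\<lambda>x. U a b x * partial 2 \<phi> x) = 0"
    by (simp add: integral_add[OF ib(1) ib(2)])
  then show "(LINT x|lebesgue_on \<Omega>. U a b x * partial 2 \<phi> x) = - (LINT x|lebesgue_on \<Omega>. U a (Suc b) x * \<phi> x)"
    by (simp add: conv\<phi> convp)
  have "integral ?B (\<lambda>x. U (Suc a) b x * \<phi> x + U a b x * partial 1 \<phi> x)
      = integral {- ?L..?L} (\<lambda>t. integral {- ?L..?L} (\<lambda>s. U (Suc a) b (pt s t) * \<phi> (pt s t) + U a b (pt s t) * partial 1 \<phi> (pt s t)))"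
    by (rule integral_plane_box') (intro continuous_intros cU c\<phi>)
  also have "(\<lambda>t. integral {- ?L..?L} (\<lambda>s. U (Suc a) b (pt s t) * \<phi> (pt s t) + U a b (pt s t) * partial 1 \<phi> (pt s t))) = (\<lambda>_. 0)"
  proof
    fix t
    have "((\<lambda>s. U (Suc a) b (pt s t) * \<phi> (pt s t) + U a b (pt s t) * partial 1 \<phi> (pt s t)) has_integral
        U a b (pt ?L t) * \<phi> (pt ?L t) - U a b (pt (- ?L) t) * \<phi> (pt (- ?L) t)) {- ?L..?L}"
    proof (rule fundamental_theorem_of_calculus)
      fix s
      have "((\<lambda>s. U a b (pt s t) * \<phi> (pt s t)) has_real_derivative
          U (Suc a) b (pt s t) * \<phi> (pt s t) + U a b (pt s t) * partial 1 \<phi> (pt s t)) (at s)"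
        using DERIV_mult[OF jet_DERIV_1[OF U] smooth_DERIV(1)[OF s(1)]] by (simp add: algebra_simps)
      then show "((\<lambda>s. U a b (pt s t) * \<phi> (pt s t)) has_vector_derivative
          U (Suc a) b (pt s t) * \<phi> (pt s t) + U a b (pt s t) * partial 1 \<phi> (pt s t)) (at s within {- ?L..?L})"
        by (simp add: has_real_derivative_iff_has_vector_derivative has_vector_derivative_at_within)
    qed simp
    moreover have "\<phi> (pt ?L t) = 0" "\<phi> (pt (- ?L) t) = 0" by (rule z(1)[of _ 1]; simp)+
    ultimately show "integral {- ?L..?L} (\<lambda>s. U (Suc a) b (pt s t) * \<phi> (pt s t) + U a b (pt s t) * partial 1 \<phi> (pt s t)) = 0"
      by (simp add: integral_unique)
  qed
  finally have "integral ?B (\<lambda>x. U (Suc a) b x * \<phi> x) + integral ?B (\<lambda>x. U a b x * partial 1 \<phi> x) = 0"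
    by (simp add: integral_add[OF ib(1) ib(2)])
  then show "(LINT x|lebesgue_on \<Omega>. U a b x * partial 1 \<phi> x) = - (LINT x|lebesgue_on \<Omega>. U (Suc a) b x * \<phi> x)"
    by (simp add: conv\<phi> convp)
qed

lemma test_function_partial_funpow: "test_function \<Omega> \<phi> \<Longrightarrow> test_function \<Omega> ((partial d ^^ n) \<phi>)"
  by (induction n) (auto intro: test_function_partial)

text \<open>This is what identifies the weak derivatives of the interpolant with its classical
  ones.\<close>

lemma jet_has_weak_partial:
  assumes \<Omega>: "open \<Omega>" and U: "jet U"
  shows "has_weak_partial \<Omega> (a, b) (U 0 0) (U a b)"
  unfolding has_weak_partial_def
proof (intro conjI allI impI)
  have "locally_integrable \<Omega> (U i j)" for i j
    unfolding locally_integrable_def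
  proof (intro allI impI)
    fix S assume S: "compact S \<and> S \<subseteq> \<Omega>"
    have "U i j absolutely_integrable_on S"
      using S by (intro absolutely_integrable_onI integrable_on_compact continuous_intros jet_continuous U) auto
    then show "integrable (lebesgue_on S) (U i j)"
      using S by (subst integrable_restrict_space) (auto simp: set_integrable_def compact_imp_closed)
  qed
  then show "locally_integrable \<Omega> (U 0 0)" "locally_integrable \<Omega> (U a b)" by blast+
  fix \<phi> assume \<phi>: "test_function \<Omega> \<phi>"
  have 1: "(LINT x|lebesgue_on \<Omega>. U i j x * (partial 1 ^^ n) \<psi> x) = (- 1) ^ n * (LINT x|lebesgue_on \<Omega>. U (i + n) j x * \<psi> x)"
    if "test_function \<Omega> \<psi>" for \<psi> i j n
  proof (induction n arbitrary: i)
    case (Suc n)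
    show ?case
      using integration_by_parts(1)[OF \<Omega> U test_function_partial_funpow[OF that, where d = 1 and n = n], of i j] Suc[of "Suc i"] by simp
  qed simp
  have 2: "(LINT x|lebesgue_on \<Omega>. U i j x * (partial 2 ^^ n) \<phi> x) = (- 1) ^ n * (LINT x|lebesgue_on \<Omega>. U i (j + n) x * \<phi> x)"
    for i j n
  proof (induction n arbitrary: j)
    case (Suc n)
    show ?case
      using integration_by_parts(2)[OF \<Omega> U test_function_partial_funpow[OF \<phi>, where d = 2 and n = n], of i j] Suc[of "Suc j"] by simp
  qed simp
  show "(LINT x|lebesgue_on \<Omega>. U 0 0 x * mpartial (a, b) \<phi> x) = (- 1) ^ mi_order (a, b) * (LINT x|lebesgue_on \<Omega>. U a b x * \<phi> x)"
    using 1[OF test_function_partial_funpow[OF \<phi>, where d = 2 and n = b], of 0 0 a] 2[of a 0 b]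
    by (simp add: mpartial_def mi_order_def power_add)
qed

lemma integrable_lebesgue_on_iff:
  fixes f :: "plane \<Rightarrow> real"
  shows "S \<in> sets lebesgue \<Longrightarrow> integrable (lebesgue_on S) f \<longleftrightarrow> integrable lebesgue (\<lambda>x. indicator S x *\<^sub>R f x)"
  by (rule integrable_restrict_space) simp

text \<open>A test function is bounded and confines the product to a compact subset. Integrability
  is what allows the integral of a difference to be split for weak derivatives.\<close>

lemma locally_integrable_mult_test:
  assumes \<Omega>: "open \<Omega>" and f: "locally_integrable \<Omega> f" and \<psi>: "test_function \<Omega> \<psi>"
  shows "integrable (lebesgue_on \<Omega>) (\<lambda>x. f x * \<psi> x)"
proof -
  let ?S = "closure {x. \<psi> x \<noteq> 0}"
  have S: "compact ?S" "?S \<subseteq> \<Omega>" "smooth \<psi>" using \<psi> by (auto simp: test_function_def)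
  have supp: "\<psi> x = 0" if "x \<notin> ?S" for x using that closure_subset[of "{x. \<psi> x \<noteq> 0}"] by auto
  have c: "continuous_on T \<psi>" for T by (rule smooth_continuous[OF S(3)])
  have "bounded (\<psi> ` ?S)" by (intro compact_imp_bounded compact_continuous_image c S)
  then obtain M where "\<forall>y\<in>\<psi> ` ?S. norm y \<le> M" unfolding bounded_iff by blast
  then have M: "\<bar>\<psi> x\<bar> \<le> M" if "x \<in> ?S" for x using that by auto
  have Ms: "\<bar>\<psi> x\<bar> \<le> \<bar>M\<bar>" for x
  proof (cases "x \<in> ?S")
    case True from M[OF this] show ?thesis by linarith
  next
    case False then show ?thesis using supp[OF False] by simp
  qed
  have "compact ?S \<and> ?S \<subseteq> \<Omega> \<longrightarrow> integrable (lebesgue_on ?S) f"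
    using f unfolding locally_integrable_def by (rule spec[where x = ?S])
  then have fS: "integrable (lebesgue_on ?S) f" using S(1,2) by (elim mp) (rule conjI)
  have i: "integrable lebesgue (\<lambda>x. indicator ?S x *\<^sub>R f x)"
    by (rule integrable_lebesgue_on_iff[THEN iffD1, OF _ fS]) simp
  have \<psi>m: "\<psi> \<in> borel_measurable lebesgue"
    using borel_measurable_continuous_onI[OF c[of UNIV]] by (intro measurable_completion) simp
  have "integrable lebesgue (\<lambda>x. (indicator ?S x *\<^sub>R f x) * \<psi> x)"
  proof (rule Bochner_Integration.integrable_bound)
    show "integrable lebesgue (\<lambda>x. \<bar>M\<bar> * (indicator ?S x *\<^sub>R f x))" by (intro integrable_mult_right i)
    show "(\<lambda>x. (indicator ?S x *\<^sub>R f x) * \<psi> x) \<in> borel_measurable lebesgue"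
      by (intro borel_measurable_times borel_measurable_integrable i \<psi>m)
    show "AE x in lebesgue. norm ((indicator ?S x *\<^sub>R f x) * \<psi> x) \<le> norm (\<bar>M\<bar> * (indicator ?S x *\<^sub>R f x))"
    proof (rule AE_I2)
      fix x
      have "\<bar>indicator ?S x *\<^sub>R f x\<bar> * \<bar>\<psi> x\<bar> \<le> \<bar>indicator ?S x *\<^sub>R f x\<bar> * \<bar>M\<bar>"
        by (rule mult_left_mono[OF Ms]) simp
      then show "norm ((indicator ?S x *\<^sub>R f x) * \<psi> x) \<le> norm (\<bar>M\<bar> * (indicator ?S x *\<^sub>R f x))"
        by (simp only: real_norm_def abs_mult abs_abs mult.commute)
    qed
  qed
  moreover have "(\<lambda>x. (indicator ?S x *\<^sub>R f x) * \<psi> x) = (\<lambda>x. indicator \<Omega> x *\<^sub>R (f x * \<psi> x))"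
  proof
    fix x show "(indicator ?S x *\<^sub>R f x) * \<psi> x = indicator \<Omega> x *\<^sub>R (f x * \<psi> x)"
      using supp[of x] S(2) by (cases "x \<in> ?S") auto
  qed
  ultimately show ?thesis using \<Omega> by (simp add: integrable_lebesgue_on_iff)
qed

lemma test_function_mpartial: "test_function \<Omega> \<phi> \<Longrightarrow> test_function \<Omega> (mpartial \<delta> \<phi>)"
  by (simp add: mpartial_def test_function_partial_funpow)

lemma has_weak_partial_diff:
  assumes \<Omega>: "open \<Omega>" and f: "has_weak_partial \<Omega> \<delta> f g" and f': "has_weak_partial \<Omega> \<delta> f' g'"
  shows "has_weak_partial \<Omega> \<delta> (\<lambda>x. f x - f' x) (\<lambda>x. g x - g' x)"
proof -
  have l: "locally_integrable \<Omega> f" "locally_integrable \<Omega> f'" "locally_integrable \<Omega> g" "locally_integrable \<Omega> g'"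
    using f f' by (auto simp: has_weak_partial_def)
  have sub: "locally_integrable \<Omega> (\<lambda>x. h x - h' x)" if "locally_integrable \<Omega> h" "locally_integrable \<Omega> h'" for h h'
    using that by (auto simp: locally_integrable_def)
  have d: "(LINT x|lebesgue_on \<Omega>. (h x - h' x) * \<psi> x) = (LINT x|lebesgue_on \<Omega>. h x * \<psi> x) - (LINT x|lebesgue_on \<Omega>. h' x * \<psi> x)"
    if "locally_integrable \<Omega> h" "locally_integrable \<Omega> h'" "test_function \<Omega> \<psi>" for h h' \<psi>
    unfolding left_diff_distrib
    by (intro Bochner_Integration.integral_diff locally_integrable_mult_test \<Omega> that)
  show ?thesis
    unfolding has_weak_partial_def
  proof (intro conjI allI impI sub l)
    fix \<phi> assume \<phi>: "test_function \<Omega> \<phi>"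
    show "(LINT x|lebesgue_on \<Omega>. (f x - f' x) * mpartial \<delta> \<phi> x) = (- 1) ^ mi_order \<delta> * (LINT x|lebesgue_on \<Omega>. (g x - g' x) * \<phi> x)"
      using f f' \<phi> unfolding d[OF l(1,2) test_function_mpartial[OF \<phi>]] d[OF l(3,4) \<phi>]
      by (simp add: has_weak_partial_def right_diff_distrib)
  qed
qed

section \<open>Norms computed through Borel representatives\<close>

lemma rep_measurable:
  fixes g u :: "plane \<Rightarrow> real"
  assumes \<Omega>: "open \<Omega>" and [measurable]: "u \<in> borel_measurable borel"
    and ae: "AE x in lebesgue. x \<in> \<Omega> \<longrightarrow> g x = u x"
  shows "g \<in> borel_measurable (lebesgue_on \<Omega>)"
proof -
  have [measurable]: "\<Omega> \<in> sets borel" using \<Omega> by simp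
  have m: "(\<lambda>x. indicator \<Omega> x *\<^sub>R u x) \<in> borel_measurable lebesgue" by (intro measurable_completion) measurable
  have "AE x in lebesgue. indicator \<Omega> x *\<^sub>R u x = indicator \<Omega> x *\<^sub>R g x"
    using ae by eventually_elim (auto simp: indicator_def)
  from borel_measurable_AE[OF m this] show ?thesis
    using \<Omega> by (subst borel_measurable_restrict_space_iff) auto
qed

lemma Lp_norm_rep:
  assumes \<Omega>: "open \<Omega>" and [measurable]: "u \<in> borel_measurable borel"
    and ae: "AE x in lebesgue. x \<in> \<Omega> \<longrightarrow> g x = u x" and q: "1 \<le> q"
  shows "Lp_norm (ennreal q) \<Omega> g powr q = (LINT x|lborel. indicator \<Omega> x * \<bar>u x\<bar> powr q)"
proof -
  have [measurable]: "\<Omega> \<in> sets borel" using \<Omega> by simp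
  have "(LINT x|lebesgue_on \<Omega>. \<bar>g x\<bar> powr q) = (LINT x|lebesgue_on \<Omega>. \<bar>g x\<bar> powr q * indicator \<Omega> x)"
    by (rule Bochner_Integration.integral_cong) auto
  also have "\<dots> = (LINT x|lborel. \<bar>u x\<bar> powr q * indicator \<Omega> x)"
  proof (rule LINT_lebesgue_on_rep)
    show "AE x in lebesgue. indicator \<Omega> x \<noteq> (0 :: real) \<longrightarrow> x \<in> \<Omega> \<and> \<bar>g x\<bar> powr q = \<bar>u x\<bar> powr q"
      using ae by eventually_elim (auto simp: indicator_def)
  qed (use \<Omega> in auto)
  finally have e: "(LINT x|lebesgue_on \<Omega>. \<bar>g x\<bar> powr q) = (LINT x|lborel. indicator \<Omega> x * \<bar>u x\<bar> powr q)"
    by (simp add: mult.commute)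
  have "0 \<le> (LINT x|lborel. indicator \<Omega> x * \<bar>u x\<bar> powr q)"
    by (rule integral_nonneg_AE) auto
  then show ?thesis using q e by (simp add: Lp_norm_def powr_powr)
qed

lemma Lp_norm_inf_le:
  assumes \<Omega>: "open \<Omega>" and [measurable]: "u \<in> borel_measurable borel"
    and ae: "AE x in lebesgue. x \<in> \<Omega> \<longrightarrow> g x = u x" and B: "0 \<le> B" "AE x in lebesgue. x \<in> \<Omega> \<longrightarrow> \<bar>u x\<bar> \<le> B"
  shows "esssup (lebesgue_on \<Omega>) (\<lambda>x. ereal \<bar>g x\<bar>) \<le> ereal B" "Lp_norm \<infinity> \<Omega> g \<le> B"
proof -
  have [measurable]: "g \<in> borel_measurable (lebesgue_on \<Omega>)" by (rule rep_measurable[OF \<Omega> assms(2) ae])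
  have "AE x in lebesgue. x \<in> \<Omega> \<longrightarrow> ereal \<bar>g x\<bar> \<le> ereal B" using ae B(2) by eventually_elim auto
  then have "AE x in lebesgue_on \<Omega>. ereal \<bar>g x\<bar> \<le> ereal B"
    using \<Omega> by (subst AE_restrict_space_iff) auto
  then show e: "esssup (lebesgue_on \<Omega>) (\<lambda>x. ereal \<bar>g x\<bar>) \<le> ereal B" by (intro esssup_I) auto
  \<comment> \<open>The essential supremum might be minus infinity, which
    \<open>real_of_ereal\<close> sends to 0; hence the assumption that \<open>B\<close> is
    nonnegative.\<close>
  then show "Lp_norm \<infinity> \<Omega> g \<le> B"
    using B(1) unfolding Lp_norm_def by (cases "esssup (lebesgue_on \<Omega>) (\<lambda>x. ereal \<bar>g x\<bar>)") auto
qed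

lemma Lp_norm_inf_ge:
  assumes \<Omega>: "open \<Omega>" and e: "esssup (lebesgue_on \<Omega>) (\<lambda>x. ereal \<bar>g x\<bar>) \<le> ereal B"
  shows "AE x in lebesgue. x \<in> \<Omega> \<longrightarrow> \<bar>g x\<bar> \<le> Lp_norm \<infinity> \<Omega> g"
proof -
  have "AE x in lebesgue_on \<Omega>. ereal \<bar>g x\<bar> \<le> esssup (lebesgue_on \<Omega>) (\<lambda>x. ereal \<bar>g x\<bar>)" by (rule esssup_AE)
  then have "AE x in lebesgue. x \<in> \<Omega> \<longrightarrow> ereal \<bar>g x\<bar> \<le> esssup (lebesgue_on \<Omega>) (\<lambda>x. ereal \<bar>g x\<bar>)"
    using \<Omega> by (subst (asm) AE_restrict_space_iff) auto
  then show ?thesis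
    by eventually_elim (use e in \<open>cases "esssup (lebesgue_on \<Omega>) (\<lambda>x. ereal \<bar>g x\<bar>)"; auto simp: Lp_norm_def\<close>)
qed

lemma exponent_real:
  assumes "1 \<le> p" "p \<noteq> \<infinity>"
  shows "1 \<le> enn2real p" "p = ennreal (enn2real p)"
proof -
  have fin: "p < top" using assms(2) by (simp add: less_top)
  have "enn2real 1 \<le> enn2real p" by (rule enn2real_mono[OF assms(1) fin])
  then show "1 \<le> enn2real p" by simp
  show "p = ennreal (enn2real p)" using fin by simp
qed

text \<open>Boundedness of the domain gives finite measure, so functions in any of these spaces are
  integrable; for finite exponents by t \<le> 1 + t^p. The representative is cut off to zero
  outside, which turns integrals over the domain into integrals over the plane.\<close>

lemma Lp_space_rep:
  assumes \<Omega>: "open \<Omega>" "bounded \<Omega>" and w: "w \<in> Lp_space p \<Omega>" and p: "1 \<le> p"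
  obtains u where "u \<in> borel_measurable borel" "integrable lborel u" "\<And>x. x \<notin> \<Omega> \<Longrightarrow> u x = 0"
    "AE x in lebesgue. x \<in> \<Omega> \<longrightarrow> w x = u x"
    "p \<noteq> \<infinity> \<Longrightarrow> integrable lborel (\<lambda>x. \<bar>u x\<bar> powr enn2real p)"
    "p = \<infinity> \<Longrightarrow> \<exists>B\<ge>0. AE x in lebesgue. \<bar>u x\<bar> \<le> B"
proof -
  have \<Omega>b [measurable]: "\<Omega> \<in> sets borel" using \<Omega> by simp
  have \<Omega>l: "\<Omega> \<inter> space lebesgue \<in> sets lebesgue" using \<Omega> by simp
  have fin: "emeasure lebesgue \<Omega> < \<infinity>" using emeasure_bounded_finite[OF \<Omega>(2)] by simp
  have wm: "w \<in> borel_measurable (lebesgue_on \<Omega>)" using w by (simp add: Lp_space_def)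
  have const: "integrable (lebesgue_on \<Omega>) (\<lambda>_. c :: real)" for c
  proof -
    interpret finite_measure "lebesgue_on \<Omega>"
      using fin \<Omega> by (intro finite_measureI) (simp add: emeasure_restrict_space)
    show ?thesis by simp
  qed
  have "integrable (lebesgue_on \<Omega>) w"
  proof (cases "p = \<infinity>")
    case True
    then obtain B where "AE x in lebesgue_on \<Omega>. \<bar>w x\<bar> \<le> B" using w by (auto simp: Lp_space_def)
    then show ?thesis
      by (intro Bochner_Integration.integrable_bound[OF const[of B] wm]) (auto elim!: eventually_mono)
  next
    case False
    then have i: "integrable (lebesgue_on \<Omega>) (\<lambda>x. \<bar>w x\<bar> powr enn2real p)" using w by (simp add: Lp_space_def)
    have "1 \<le> enn2real p" by (rule exponent_real[OF p False])
    then have "\<bar>w x\<bar> \<le> 1 + \<bar>w x\<bar> powr enn2real p" for x by (intro powr_le_1_plus) auto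
    then have "AE x in lebesgue_on \<Omega>. norm (w x) \<le> norm (1 + \<bar>w x\<bar> powr enn2real p)"
      by (intro AE_I2) (metis abs_ge_self order_trans real_norm_def)
    then show ?thesis
      by (rule Bochner_Integration.integrable_bound[OF Bochner_Integration.integrable_add[OF const i] wm])
  qed
  then have "integrable lebesgue (\<lambda>x. indicator \<Omega> x *\<^sub>R w x)" using \<Omega>l by (subst (asm) integrable_restrict_space)
  then obtain u0 where u0 [measurable]: "u0 \<in> borel_measurable borel" and iu0: "integrable lborel u0"
    and ae: "AE x in lebesgue. indicator \<Omega> x *\<^sub>R w x = u0 x"
    by (rule borel_rep)
  define u where "u x = indicator \<Omega> x * u0 x" for x
  have um [measurable]: "u \<in> borel_measurable borel" unfolding u_def by measurable
  have ae': "AE x in lebesgue. x \<in> \<Omega> \<longrightarrow> w x = u x" using ae by eventually_elim (auto simp: u_def)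
  have z: "u x = 0" if "x \<notin> \<Omega>" for x using that by (simp add: u_def)
  show thesis
  proof (rule that[OF um _ z ae'])
    show "integrable lborel u"
      using integrable_mult_indicator[OF _ iu0, of \<Omega>] by (simp add: u_def[abs_def])
    show "integrable lborel (\<lambda>x. \<bar>u x\<bar> powr enn2real p)" if "p \<noteq> \<infinity>"
    proof -
      have i: "integrable lebesgue (\<lambda>x. indicator \<Omega> x *\<^sub>R \<bar>w x\<bar> powr enn2real p)"
        using w that \<Omega>l by (simp add: Lp_space_def integrable_restrict_space)
      have m: "(\<lambda>x. \<bar>u x\<bar> powr enn2real p) \<in> borel_measurable lborel" by measurable
      have "integrable lebesgue (\<lambda>x. \<bar>u x\<bar> powr enn2real p)"
        by (rule Bochner_Integration.integrable_cong_AE_imp[OF i measurable_completion[OF m]])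
          (use ae' in eventually_elim, auto simp: indicator_def z)
      then show ?thesis using integrable_completion[OF m] by blast
    qed
    show "\<exists>B\<ge>0. AE x in lebesgue. \<bar>u x\<bar> \<le> B" if pinf: "p = \<infinity>"
    proof -
      obtain B where "AE x in lebesgue_on \<Omega>. \<bar>w x\<bar> \<le> B" using w pinf by (auto simp: Lp_space_def)
      then have "AE x in lebesgue. x \<in> \<Omega> \<longrightarrow> \<bar>w x\<bar> \<le> B" using \<Omega>l by (subst (asm) AE_restrict_space_iff)
      then have "AE x in lebesgue. \<bar>u x\<bar> \<le> \<bar>B\<bar>"
        using ae'
      proof eventually_elim
        case (elim x) then show ?case by (cases "x \<in> \<Omega>") (auto simp: z)
      qed
      then show ?thesis by (intro exI[of _ "\<bar>B\<bar>"]) simp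
    qed
  qed
qed

text \<open>The estimate for \<open>p = \<infinity>\<close> follows from the finite exponents, since their constant does not
  depend on the exponent.\<close>

lemma ess_bound_from_powers:
  fixes u :: "plane \<Rightarrow> real"
  assumes [measurable]: "u \<in> borel_measurable borel" and c: "0 \<le> c" and B: "0 \<le> B"
    and le: "\<And>n :: nat. (\<integral>\<^sup>+x. ennreal (\<bar>u x\<bar> powr real (Suc n)) \<partial>lborel) \<le> ennreal (c * B powr real (Suc n))"
  shows "AE x in lborel. \<bar>u x\<bar> \<le> B"
proof -
  have "AE x in lborel. \<bar>u x\<bar> < B + e" if e: "0 < e" for e
  proof -
    \<comment> \<open>Chebyshev's inequality for all exponents at once: the measure of this set is
      at most c (B / (B + e))^(n + 1), which tends to zero.\<close>
    define A where "A = {x. B + e \<le> \<bar>u x\<bar>}"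
    have [measurable]: "A \<in> sets borel" unfolding A_def by measurable
    have bound: "emeasure lborel A * ennreal ((B + e) powr real (Suc n)) \<le> ennreal (c * B powr real (Suc n))" for n
    proof -
      have "emeasure lborel A * ennreal ((B + e) powr real (Suc n)) = (\<integral>\<^sup>+x. ennreal ((B + e) powr real (Suc n)) * indicator A x \<partial>lborel)"
        by (subst nn_integral_cmult_indicator) (auto simp: mult.commute)
      also have "\<dots> \<le> (\<integral>\<^sup>+x. ennreal (\<bar>u x\<bar> powr real (Suc n)) \<partial>lborel)"
      proof (rule nn_integral_mono)
        fix x
        show "ennreal ((B + e) powr real (Suc n)) * indicator A x \<le> ennreal (\<bar>u x\<bar> powr real (Suc n))"
        proof (cases "x \<in> A")
          case True
          then have "B + e \<le> \<bar>u x\<bar>" by (simp add: A_def)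
          then have "(B + e) powr real (Suc n) \<le> \<bar>u x\<bar> powr real (Suc n)" using B e by (intro powr_mono2) auto
          then show ?thesis using True by (simp only: indicator_simps mult_1_right ennreal_leI)
        qed simp
      qed
      finally show ?thesis using le[of n] by (rule order_trans)
    qed
    have Be: "0 < B + e" using B e by simp
    have "emeasure lborel A \<noteq> \<infinity>"
    proof
      assume "emeasure lborel A = \<infinity>"
      then have "\<infinity> * ennreal ((B + e) powr real (Suc 0)) \<le> ennreal (c * B powr real (Suc 0))" using bound[of 0] by metis
      then show False using Be by (simp add: ennreal_top_mult top_unique)
    qed
    then obtain a where a: "emeasure lborel A = ennreal a" "0 \<le> a" by (cases "emeasure lborel A") auto
    have "a \<le> c * (B / (B + e)) ^ Suc n" for n
    proof -
      have "ennreal (a * (B + e) powr real (Suc n)) \<le> ennreal (c * B powr real (Suc n))"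
        using bound[of n] a by (simp only: ennreal_mult[symmetric] powr_ge_zero)
      then have "a * (B + e) powr real (Suc n) \<le> c * B powr real (Suc n)"
        using c by (subst (asm) ennreal_le_iff) auto
      moreover have "(B + e) powr real (Suc n) = (B + e) ^ Suc n" by (rule powr_realpow[OF Be])
      moreover have "B powr real (Suc n) = B ^ Suc n"
        using B by (cases "B = 0") (simp_all add: powr_realpow del: of_nat_Suc power_Suc)
      ultimately have "a * (B + e) ^ Suc n \<le> c * B ^ Suc n" by (simp only:)
      then have "a \<le> (c * B ^ Suc n) / (B + e) ^ Suc n" using Be by (subst pos_le_divide_eq) (auto simp del: power_Suc)
      then show ?thesis by (simp only: power_divide times_divide_eq_right)
    qed
    moreover have "(\<lambda>n. c * (B / (B + e)) ^ Suc n) \<longlonglongrightarrow> c * 0"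
      using B e by (intro tendsto_intros LIMSEQ_Suc LIMSEQ_realpow_zero) auto
    ultimately have "a \<le> 0" by (intro LIMSEQ_le_const[of _ "c * 0" a, simplified]) auto
    then have "emeasure lborel A = 0" using a by simp
    then have "A \<in> null_sets lborel" by (simp add: null_sets_def)
    then show ?thesis by (rule AE_I') (auto simp: A_def)
  qed
  then have "AE x in lborel. \<bar>u x\<bar> < B + inverse (real (Suc j))" for j by simp
  then have "AE x in lborel. \<forall>j. \<bar>u x\<bar> < B + inverse (real (Suc j))" by (subst AE_all_countable) blast
  then show ?thesis
  proof eventually_elim
    case (elim x)
    have "(\<lambda>j. B + inverse (real (Suc j))) \<longlonglongrightarrow> B + 0" by (intro tendsto_intros LIMSEQ_inverse_real_of_nat)
    then have "\<bar>u x\<bar> \<le> B + 0" by (rule LIMSEQ_le_const) (use elim in \<open>auto intro: less_imp_le\<close>)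
    then show ?case by simp
  qed
qed

lemma mi_order_set: "{\<delta>. mi_order \<delta> = j} = (\<lambda>l. (l, j - l)) ` {..j}"
  by (auto simp: mi_order_def image_iff)

lemma sum_mi_order: "(\<Sum>\<delta> | mi_order \<delta> = j. F \<delta>) = (\<Sum>l\<le>j. F (l, j - l))"
  unfolding mi_order_set by (subst sum.reindex) (auto simp: inj_on_def)

section \<open>The error estimate\<close>

definition Lp_rep :: "ennreal \<Rightarrow> plane set \<Rightarrow> (plane \<Rightarrow> real) \<Rightarrow> (plane \<Rightarrow> real) \<Rightarrow> bool" where
  "Lp_rep p \<Omega> g u \<longleftrightarrow> u \<in> borel_measurable borel \<and> integrable lborel u \<and> (\<forall>x. x \<notin> \<Omega> \<longrightarrow> u x = 0) \<and>
     (AE x in lebesgue. x \<in> \<Omega> \<longrightarrow> g x = u x) \<and>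
     (p \<noteq> \<infinity> \<longrightarrow> integrable lborel (\<lambda>x. \<bar>u x\<bar> powr enn2real p)) \<and>
     (p = \<infinity> \<longrightarrow> (\<exists>B\<ge>0. AE x in lebesgue. \<bar>u x\<bar> \<le> B))"

lemma has_weak_partial_weak_partial: "has_weak_partial \<Omega> \<delta> v w \<Longrightarrow> has_weak_partial \<Omega> \<delta> v (weak_partial \<Omega> \<delta> v)"
  unfolding weak_partial_def by (rule someI[where P = "has_weak_partial \<Omega> \<delta> v"])

lemma weak_partial_AE:
  assumes "open \<Omega>" "has_weak_partial \<Omega> \<delta> v w"
  shows "AE x in lebesgue. x \<in> \<Omega> \<longrightarrow> weak_partial \<Omega> \<delta> v x = w x"
  by (rule weak_partial_unique[OF assms(1) has_weak_partial_weak_partial[OF assms(2)] assms(2)])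

lemma sobolev_rep:
  assumes \<Omega>: "open \<Omega>" "bounded \<Omega>" and v: "v \<in> sobolev_space n p \<Omega>" and p: "1 \<le> p" and \<delta>: "mi_order \<delta> \<le> n"
  shows "has_weak_partial \<Omega> \<delta> v (weak_partial \<Omega> \<delta> v)" "\<exists>u. Lp_rep p \<Omega> (weak_partial \<Omega> \<delta> v) u"
proof -
  obtain w where w: "w \<in> Lp_space p \<Omega>" "has_weak_partial \<Omega> \<delta> v w"
    using v \<delta> unfolding sobolev_space_def by blast
  show "has_weak_partial \<Omega> \<delta> v (weak_partial \<Omega> \<delta> v)"
    by (rule has_weak_partial_weak_partial[OF w(2)])
  obtain u where u: "u \<in> borel_measurable borel" "integrable lborel u" "\<And>x. x \<notin> \<Omega> \<Longrightarrow> u x = 0"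
    "AE x in lebesgue. x \<in> \<Omega> \<longrightarrow> w x = u x"
    "p \<noteq> \<infinity> \<Longrightarrow> integrable lborel (\<lambda>x. \<bar>u x\<bar> powr enn2real p)"
    "p = \<infinity> \<Longrightarrow> \<exists>B\<ge>0. AE x in lebesgue. \<bar>u x\<bar> \<le> B"
    by (rule Lp_space_rep[OF \<Omega> w(1) p]) (rule that)
  have "AE x in lebesgue. x \<in> \<Omega> \<longrightarrow> weak_partial \<Omega> \<delta> v x = u x"
    using u(4) weak_partial_AE[OF \<Omega>(1) w(2)] by eventually_elim auto
  then show "\<exists>u. Lp_rep p \<Omega> (weak_partial \<Omega> \<delta> v) u"
    using u unfolding Lp_rep_def by blast
qed

text \<open>With the mollifier as test function, the definition of the weak derivative moves the
  derivatives off the kernel; the sign it produces cancels the one built into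
  \<open>smoothing\<close>.\<close>

lemma smoothing_weak_partial:
  assumes \<Omega>: "open \<Omega>" and w: "has_weak_partial \<Omega> (a, b) v g"
    and [measurable]: "u \<in> borel_measurable borel" and ae: "AE x in lebesgue. x \<in> \<Omega> \<longrightarrow> g x = u x"
    and v': "continuous_on UNIV v'" "\<And>x. x \<in> \<Omega> \<Longrightarrow> v' x = v x"
    and sub: "\<Omega> \<subseteq> cbox P Q" and h: "0 < h" and sq: "square h y \<subseteq> \<Omega>"
  shows "smoothing (cbox P Q) v' h a b y = (LINT t|lborel. u t * moll h y 0 0 t)"
proof -
  have mm: "moll h y i j \<in> borel_measurable borel" for i j
    by (rule borel_measurable_continuous_onI[OF moll_continuous]) (use h in auto)
  have z: "moll h y i j t \<noteq> 0 \<Longrightarrow> t \<in> \<Omega>" for i j t using moll_zero[OF h] sq by blast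
  have \<Omega>l: "\<Omega> \<in> sets lebesgue" using \<Omega> by simp
  have v'm: "v' \<in> borel_measurable borel" by (rule borel_measurable_continuous_onI[OF v'(1)])
  have "(LINT x|lebesgue_on \<Omega>. v x * mpartial (a, b) (moll h y 0 0) x) =
      (-1) ^ (a + b) * (LINT x|lebesgue_on \<Omega>. g x * moll h y 0 0 x)"
    using w test_function_moll[OF h sq] unfolding has_weak_partial_def by (simp add: mi_order_def)
  also have "mpartial (a, b) (moll h y 0 0) = moll h y a b"
    using h by (intro mpartial_jet jet_moll) auto
  also have "(LINT x|lebesgue_on \<Omega>. v x * moll h y a b x) = (LINT x|lborel. v' x * moll h y a b x)"
    by (rule LINT_lebesgue_on_rep[OF \<Omega>l v'm mm]) (intro AE_I2 impI conjI z v'(2)[symmetric])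
  also have "\<dots> = integral (cbox P Q) (\<lambda>x. v' x * moll h y a b x)"
  proof (rule LINT_box(2))
    show "continuous_on UNIV (\<lambda>x. v' x * moll h y a b x)"
      using h by (intro continuous_on_mult v'(1) moll_continuous) auto
    show "v' x * moll h y a b x = 0" if "x \<notin> cbox P Q" for x using z[of a b x] sub that by auto
  qed
  also have "(LINT x|lebesgue_on \<Omega>. g x * moll h y 0 0 x) = (LINT x|lborel. u x * moll h y 0 0 x)"
  proof (rule LINT_lebesgue_on_rep[OF \<Omega>l _ mm])
    show "AE x in lebesgue. moll h y 0 0 x \<noteq> 0 \<longrightarrow> x \<in> \<Omega> \<and> g x = u x"
      using ae by eventually_elim (use z in auto)
  qed simp
  finally have e: "integral (cbox P Q) (\<lambda>x. v' x * moll h y a b x) = (-1) ^ (a + b) * (LINT x|lborel. u x * moll h y 0 0 x)" .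
  show ?thesis unfolding smoothing_def e by (simp flip: mult.assoc power_mult_distrib)
qed

context labelled_triangle
begin

lemma lagrange_interp_cong:
  assumes "k > 0" "\<And>x. x \<in> K \<Longrightarrow> v x = v' x"
  shows "lagrange_interp k K v = lagrange_interp k K v'"
proof -
  have "lattice_points k K \<subseteq> K"
    unfolding lattice_points_eq[OF assms(1)] using assms(1)
    unfolding K_eq by (fastforce simp: unit_tri_def divide_simps simp flip: of_nat_add)
  then have "(\<forall>x\<in>lattice_points k K. q x = v x) \<longleftrightarrow> (\<forall>x\<in>lattice_points k K. q x = v' x)" for q
    using assms(2) by auto
  then show ?thesis unfolding lagrange_interp_def by simp
qed

text \<open>Collects what both the finite and the infinite exponent feed into
  \<open>limit_estimate\<close>: Borel representatives of the weak derivatives, a continuous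
  extension, and the weak derivatives of the error.\<close>

lemma weak_representatives:
  assumes k: "1 \<le> k" and p: "1 \<le> p" and vc: "continuous_on K v" and v: "v \<in> sobolev_space (k + 1) p (interior K)"
  obtains u v' P Q where "continuous_on UNIV v'" "K \<subseteq> cbox P Q"
    "\<And>a b. a + b \<le> k + 1 \<Longrightarrow> Lp_rep p (interior K) (weak_partial (interior K) (a, b) v) (u a b)"
    "\<And>a b h y. a + b \<le> k + 1 \<Longrightarrow> 0 < h \<Longrightarrow> square h y \<subseteq> interior K \<Longrightarrow>
      smoothing (cbox P Q) v' h a b y = (LINT t|lborel. u a b t * moll h y 0 0 t)"
    "\<And>a b. a + b \<le> k \<Longrightarrow> AE x in lebesgue. x \<in> interior K \<longrightarrow>
      weak_partial (interior K) (a, b) (\<lambda>x. v x - lagrange_interp k K v x) x = u a b x - interp_jet z A B k v' a b x"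
proof -
  have \<Omega>: "open (interior K)" "bounded (interior K)"
    using compact_K bounded_subset[OF compact_imp_bounded interior_subset] by auto
  \<comment> \<open>Smoothing is differentiated under the integral for functions continuous on the
    whole plane, so \<open>v\<close> is extended by Tietze's theorem.\<close>
  obtain v' where v': "continuous_on UNIV v'" "\<And>x. x \<in> K \<Longrightarrow> v' x = v x"
    by (rule Tietze_unbounded[OF vc, of UNIV]) (simp_all add: compact_imp_closed[OF compact_K])
  have v'i: "x \<in> interior K \<Longrightarrow> v' x = v x" for x by (rule v'(2)[OF subsetD[OF interior_subset]])
  obtain P Q where PQ: "K \<subseteq> cbox P Q"
    using bounded_subset_cbox_symmetric[OF compact_imp_bounded[OF compact_K]] by blast
  have "\<exists>u. a + b \<le> k + 1 \<longrightarrow> Lp_rep p (interior K) (weak_partial (interior K) (a, b) v) u" for a b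
  proof (cases "a + b \<le> k + 1")
    case True
    then have "mi_order (a, b) \<le> k + 1" by (simp add: mi_order_def)
    from sobolev_rep(2)[OF \<Omega> v p this] show ?thesis by blast
  qed blast
  then obtain u where u: "\<And>a b. a + b \<le> k + 1 \<Longrightarrow> Lp_rep p (interior K) (weak_partial (interior K) (a, b) v) (u a b)"
    by metis
  have wp: "has_weak_partial (interior K) (a, b) v (weak_partial (interior K) (a, b) v)" if "a + b \<le> k + 1" for a b
    by (rule sobolev_rep(1)[OF \<Omega> v p]) (use that in \<open>simp add: mi_order_def\<close>)
  have k0: "k > 0" using k by simp
  have J: "jet (interp_jet z A B k v')" by (rule polyjet_jet[OF polyjet_interp_jet])
  have L: "lagrange_interp k K v = interp_jet z A B k v' 0 0"
    unfolding lagrange_interp_eq[OF k0, symmetric] by (rule lagrange_interp_cong[OF k0]) (rule v'(2)[symmetric])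
  show thesis
  proof (rule that[of v' P Q u])
    show "smoothing (cbox P Q) v' h a b y = (LINT t|lborel. u a b t * moll h y 0 0 t)"
      if "a + b \<le> k + 1" "0 < h" "square h y \<subseteq> interior K" for a b h y
    proof (rule smoothing_weak_partial[OF \<Omega>(1) wp[OF that(1)] _ _ v'(1) v'i _ that(2,3)])
      show "interior K \<subseteq> cbox P Q" using PQ interior_subset by (rule order_trans[rotated])
    qed (use u[OF that(1)] in \<open>auto simp only: Lp_rep_def\<close>)
    show "AE x in lebesgue. x \<in> interior K \<longrightarrow>
      weak_partial (interior K) (a, b) (\<lambda>x. v x - lagrange_interp k K v x) x = u a b x - interp_jet z A B k v' a b x"
      if ab: "a + b \<le> k" for a b
    proof -
      have ab': "a + b \<le> k + 1" using ab by simp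
      have "has_weak_partial (interior K) (a, b) (\<lambda>x. v x - lagrange_interp k K v x)
          (\<lambda>x. weak_partial (interior K) (a, b) v x - interp_jet z A B k v' a b x)"
        unfolding L by (intro has_weak_partial_diff \<Omega> wp ab' jet_has_weak_partial J)
      note e1 = weak_partial_AE[OF \<Omega>(1) this]
      have "AE x in lebesgue. x \<in> interior K \<longrightarrow> weak_partial (interior K) (a, b) v x = u a b x"
        using u[OF ab'] by (simp only: Lp_rep_def)
      with e1 show ?thesis by eventually_elim auto
    qed
  qed (fact v'(1) PQ u)+
qed

lemma seminorm_estimate_finite:
  assumes k: "1 \<le> k" and m: "m \<le> k" and p: "1 \<le> p" "p \<noteq> \<infinity>" and D: "0 \<le> D"
    and est: "\<And>U. jet U \<Longrightarrow> seminorm_K K (enn2real p) (\<lambda>a b x. U a b x - interp_jet z A B k (U 0 0) a b x) m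
      \<le> D powr enn2real p * seminorm_K K (enn2real p) U (k + 1)"
    and vc: "continuous_on K v" and v: "v \<in> sobolev_space (k + 1) p (interior K)"
  shows "sobolev_seminorm m p (interior K) (\<lambda>x. v x - lagrange_interp k K v x)
    \<le> real (m + 1) * D * sobolev_seminorm (k + 1) p (interior K) v"
proof -
  define q where "q = enn2real p"
  have q: "1 \<le> q" "p = ennreal q" unfolding q_def using exponent_real[OF p] by auto
  obtain u v' P Q where v': "continuous_on UNIV v'" and PQ: "K \<subseteq> cbox P Q"
    and rep: "\<And>a b. a + b \<le> k + 1 \<Longrightarrow> Lp_rep p (interior K) (weak_partial (interior K) (a, b) v) (u a b)"
    and sm: "\<And>a b h y. a + b \<le> k + 1 \<Longrightarrow> 0 < h \<Longrightarrow> square h y \<subseteq> interior K \<Longrightarrow>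
      smoothing (cbox P Q) v' h a b y = (LINT t|lborel. u a b t * moll h y 0 0 t)"
    and err: "\<And>a b. a + b \<le> k \<Longrightarrow> AE x in lebesgue. x \<in> interior K \<longrightarrow>
      weak_partial (interior K) (a, b) (\<lambda>x. v x - lagrange_interp k K v x) x = u a b x - interp_jet z A B k v' a b x"
    by (rule weak_representatives[OF k p(1) vc v]) (rule that)
  have um: "u a b \<in> borel_measurable borel" and ui: "integrable lborel (u a b)"
    and uz: "x \<notin> interior K \<Longrightarrow> u a b x = 0"
    and uae: "AE x in lebesgue. x \<in> interior K \<longrightarrow> weak_partial (interior K) (a, b) v x = u a b x"
    and up: "integrable lborel (\<lambda>x. \<bar>u a b x\<bar> powr q)"
    if "a + b \<le> k + 1" for a b x
    using rep[OF that] p(2) by (auto simp only: Lp_rep_def q_def)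
  define E where "E a b x = u a b x - interp_jet z A B k v' a b x" for a b x
  define S where "S = (\<Sum>l\<le>k + 1. LINT x|lborel. \<bar>u l (k + 1 - l) x\<bar> powr q)"
  have S0: "0 \<le> S" unfolding S_def by (intro sum_nonneg integral_nonneg_AE) auto
  have J: "jet (interp_jet z A B k v')" by (rule polyjet_jet[OF polyjet_interp_jet])
  have Em: "E a b \<in> borel_measurable borel" if "a + b \<le> k + 1" for a b
    unfolding E_def[abs_def]
    by (intro borel_measurable_diff um that borel_measurable_continuous_onI jet_continuous J)
  have iK [measurable]: "interior K \<in> sets borel" by simp
  have top: "sobolev_seminorm (k + 1) p (interior K) v = S powr (1 / q)"
  proof -
    have "Lp_norm p (interior K) (weak_partial (interior K) (l, k + 1 - l) v) powr q = (LINT x|lborel. \<bar>u l (k + 1 - l) x\<bar> powr q)"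
      if l: "l \<le> k + 1" for l
    proof -
      have lk: "l + (k + 1 - l) \<le> k + 1" using l by simp
      have "Lp_norm (ennreal q) (interior K) (weak_partial (interior K) (l, k + 1 - l) v) powr q
          = (LINT x|lborel. indicator (interior K) x * \<bar>u l (k + 1 - l) x\<bar> powr q)"
        by (rule Lp_norm_rep[OF open_interior um[OF lk] uae[OF lk] q(1)])
      also have "\<dots> = (LINT x|lborel. \<bar>u l (k + 1 - l) x\<bar> powr q)"
        by (rule Bochner_Integration.integral_cong) (use uz[OF lk] in \<open>auto simp: indicator_def\<close>)
      finally show ?thesis by (simp only: q(2))
    qed
    then have "(\<Sum>l\<le>k + 1. Lp_norm p (interior K) (weak_partial (interior K) (l, k + 1 - l) v) powr q) = S"
      unfolding S_def by (intro sum.cong) auto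
    then show ?thesis unfolding sobolev_seminorm_def sum_mi_order using p(2) by (simp flip: q_def)
  qed
  have F: "Lp_norm p (interior K) (weak_partial (interior K) (l, m - l) (\<lambda>x. v x - lagrange_interp k K v x)) powr q \<le> D powr q * S"
    if l: "l \<le> m" for l
  proof -
    have lm: "l + (m - l) = m" "l + (m - l) \<le> k" "l + (m - l) \<le> k + 1" using l m by auto
    have [measurable]: "E l (m - l) \<in> borel_measurable borel" by (rule Em[OF lm(3)])
    have "Lp_norm (ennreal q) (interior K) (weak_partial (interior K) (l, m - l) (\<lambda>x. v x - lagrange_interp k K v x)) powr q
        = (LINT x|lborel. indicator (interior K) x * \<bar>E l (m - l) x\<bar> powr q)"
      unfolding E_def
      by (rule Lp_norm_rep[OF open_interior _ err[OF lm(2)] q(1)]) (use Em[OF lm(3)] in \<open>simp add: E_def[abs_def]\<close>)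
    \<comment> \<open>For a nonnegative measurable function the Bochner integral is
      \<open>enn2real\<close> of the nonnegative integral, so the bound from Fatou's lemma can be
      used before integrability of the error is known.\<close>
    also have "\<dots> = enn2real (\<integral>\<^sup>+x. ennreal (indicator (interior K) x * \<bar>E l (m - l) x\<bar> powr q) \<partial>lborel)"
      by (rule integral_eq_nn_integral) auto
    also have "(\<integral>\<^sup>+x. ennreal (indicator (interior K) x * \<bar>E l (m - l) x\<bar> powr q) \<partial>lborel)
        = (\<integral>\<^sup>+x. indicator (interior K) x * ennreal (\<bar>E l (m - l) x\<bar> powr q) \<partial>lborel)"
      by (rule nn_integral_cong) (simp add: indicator_def)
    also have "enn2real \<dots> \<le> enn2real (ennreal (D powr q * S))"
    proof (rule enn2real_mono)
      have "(\<integral>\<^sup>+x. indicator (interior K) x * ennreal (\<bar>E l (m - l) x\<bar> powr q) \<partial>lborel)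
          \<le> ennreal (D powr q) * (\<Sum>l\<le>k + 1. \<integral>\<^sup>+x. ennreal (\<bar>u l (k + 1 - l) x\<bar> powr q) \<partial>lborel)"
        unfolding E_def
        by (rule limit_estimate[OF k q(1) D est[folded q_def] v' PQ um ui up sm lm(1) m])
      also have "(\<Sum>l\<le>k + 1. \<integral>\<^sup>+x. ennreal (\<bar>u l (k + 1 - l) x\<bar> powr q) \<partial>lborel)
          = (\<Sum>l\<le>k + 1. ennreal (LINT x|lborel. \<bar>u l (k + 1 - l) x\<bar> powr q))"
        by (intro sum.cong refl nn_integral_eq_integral up) auto
      also have "\<dots> = ennreal S" unfolding S_def by (intro sum_ennreal integral_nonneg_AE) auto
      finally show "(\<integral>\<^sup>+x. indicator (interior K) x * ennreal (\<bar>E l (m - l) x\<bar> powr q) \<partial>lborel) \<le> ennreal (D powr q * S)"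
        using S0 by (simp add: ennreal_mult)
    qed simp
    finally show ?thesis using S0 by (simp add: q(2))
  qed
  have "sobolev_seminorm m p (interior K) (\<lambda>x. v x - lagrange_interp k K v x)
      = (\<Sum>l\<le>m. Lp_norm p (interior K) (weak_partial (interior K) (l, m - l) (\<lambda>x. v x - lagrange_interp k K v x)) powr q) powr (1 / q)"
    unfolding sobolev_seminorm_def sum_mi_order using p(2) by (simp flip: q_def)
  also have "\<dots> \<le> (\<Sum>l\<le>m. D powr q * S) powr (1 / q)"
    using q(1) by (intro powr_mono2 sum_mono F sum_nonneg) auto
  also have "\<dots> = real (m + 1) powr (1 / q) * ((D powr q) powr (1 / q) * S powr (1 / q))"
    by (simp add: powr_mult)
  also have "(D powr q) powr (1 / q) = D" using q(1) D by (simp add: powr_powr)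
  \<comment> \<open>The number of multi-indices appears with exponent 1 / q \<le> 1 and is bounded
    by its first power, which makes the constant independent of \<open>q\<close>.\<close>
  also have "real (m + 1) powr (1 / q) * (D * S powr (1 / q)) \<le> real (m + 1) * (D * S powr (1 / q))"
    using q(1) D powr_mono[of "1 / q" 1 "real (m + 1)"] by (intro mult_right_mono) auto
  finally show ?thesis unfolding top by (simp only: mult.assoc)
qed

lemma seminorm_estimate_infinite:
  assumes k: "1 \<le> k" and m: "m \<le> k" and D: "0 \<le> D"
    and est: "\<And>q U. 1 \<le> q \<Longrightarrow> jet U \<Longrightarrow> seminorm_K K q (\<lambda>a b x. U a b x - interp_jet z A B k (U 0 0) a b x) m
      \<le> D powr q * seminorm_K K q U (k + 1)"
    and vc: "continuous_on K v" and v: "v \<in> sobolev_space (k + 1) \<infinity> (interior K)"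
  shows "sobolev_seminorm m \<infinity> (interior K) (\<lambda>x. v x - lagrange_interp k K v x)
    \<le> D * sobolev_seminorm (k + 1) \<infinity> (interior K) v"
    "0 \<le> sobolev_seminorm (k + 1) \<infinity> (interior K) v"
proof -
  obtain u v' P Q where v': "continuous_on UNIV v'" and PQ: "K \<subseteq> cbox P Q"
    and rep: "\<And>a b. a + b \<le> k + 1 \<Longrightarrow> Lp_rep \<infinity> (interior K) (weak_partial (interior K) (a, b) v) (u a b)"
    and sm: "\<And>a b h y. a + b \<le> k + 1 \<Longrightarrow> 0 < h \<Longrightarrow> square h y \<subseteq> interior K \<Longrightarrow>
      smoothing (cbox P Q) v' h a b y = (LINT t|lborel. u a b t * moll h y 0 0 t)"
    and err: "\<And>a b. a + b \<le> k \<Longrightarrow> AE x in lebesgue. x \<in> interior K \<longrightarrow>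
      weak_partial (interior K) (a, b) (\<lambda>x. v x - lagrange_interp k K v x) x = u a b x - interp_jet z A B k v' a b x"
    by (rule weak_representatives[OF k _ vc v]) (simp, rule that)
  have um: "u a b \<in> borel_measurable borel" and ui: "integrable lborel (u a b)"
    and uz: "x \<notin> interior K \<Longrightarrow> u a b x = 0"
    and uae: "AE x in lebesgue. x \<in> interior K \<longrightarrow> weak_partial (interior K) (a, b) v x = u a b x"
    and ub: "\<exists>B\<ge>0. AE x in lebesgue. \<bar>u a b x\<bar> \<le> B"
    if "a + b \<le> k + 1" for a b x
    using rep[OF that] by (auto simp only: Lp_rep_def)
  have iK [measurable]: "interior K \<in> sets borel" by simp
  have finK: "emeasure lborel (interior K) < \<infinity>"
    by (rule emeasure_bounded_finite[OF bounded_subset[OF compact_imp_bounded[OF compact_K] interior_subset]])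
  define \<mu> where "\<mu> = measure lborel (interior K)"
  have \<mu>: "emeasure lborel (interior K) = ennreal \<mu>"
    unfolding \<mu>_def by (rule emeasure_eq_ennreal_measure) (use finK in auto)
  define M where "M = sobolev_seminorm (k + 1) \<infinity> (interior K) v"
  define N where "N l = Lp_norm \<infinity> (interior K) (weak_partial (interior K) (l, k + 1 - l) v)" for l
  have Mdef: "M = Max (N ` {..k + 1})"
    unfolding M_def N_def sobolev_seminorm_def mi_order_set by (simp add: image_image)
  have NM: "N l \<le> M" if "l \<le> k + 1" for l unfolding Mdef using that by (intro Max_ge) auto
  \<comment> \<open>Outside the interior the representative is zero, so the bound there must be
    nonnegative; this is the reason for the maximum with 0.\<close>
  have uN: "AE x in lebesgue. \<bar>u l (k + 1 - l) x\<bar> \<le> max 0 (N l)" if l: "l \<le> k + 1" for l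
  proof -
    have lk: "l + (k + 1 - l) \<le> k + 1" using l by simp
    obtain B where B: "0 \<le> B" "AE x in lebesgue. \<bar>u l (k + 1 - l) x\<bar> \<le> B" using ub[OF lk] by blast
    have "AE x in lebesgue. x \<in> interior K \<longrightarrow> \<bar>u l (k + 1 - l) x\<bar> \<le> B" using B(2) by eventually_elim simp
    note e = Lp_norm_inf_le(1)[OF open_interior um[OF lk] uae[OF lk] B(1) this]
    show ?thesis using Lp_norm_inf_ge[OF open_interior e] uae[OF lk]
    proof eventually_elim
      case (elim x)
      then show ?case using uz[OF lk, of x] by (cases "x \<in> interior K") (auto simp: N_def)
    qed
  qed
  \<comment> \<open>A negative norm would bound an absolute value from above almost everywhere on
    the interior, which would then be a null set.\<close>
  have N0: "0 \<le> N 0"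
  proof (rule ccontr)
    assume neg: "\<not> 0 \<le> N 0"
    have lk: "0 + (k + 1 - 0) \<le> k + 1" by simp
    obtain B where B: "0 \<le> B" "AE x in lebesgue. \<bar>u 0 (k + 1 - 0) x\<bar> \<le> B" using ub[OF lk] by blast
    have "AE x in lebesgue. x \<in> interior K \<longrightarrow> \<bar>u 0 (k + 1 - 0) x\<bar> \<le> B" using B(2) by eventually_elim simp
    note e = Lp_norm_inf_le(1)[OF open_interior um[OF lk] uae[OF lk] B(1) this]
    have "AE x in lebesgue. x \<notin> interior K"
      using Lp_norm_inf_ge[OF open_interior e] by eventually_elim (use neg in \<open>auto simp: N_def\<close>)
    then have "negligible (interior K)"
      unfolding negligible_iff_null_sets by (subst AE_iff_null_sets) auto
    then show False using open_not_negligible[OF open_interior interior_nonempty] by blast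
  qed
  then have M0: "0 \<le> M" using NM[of 0] by simp
  then show "0 \<le> sobolev_seminorm (k + 1) \<infinity> (interior K) v" by (simp add: M_def)
  have J: "jet (interp_jet z A B k v')" by (rule polyjet_jet[OF polyjet_interp_jet])
  have up: "integrable lborel (\<lambda>x. \<bar>u a b x\<bar> powr q)" if ab: "a + b \<le> k + 1" and q: "1 \<le> q" for a b and q :: real
  proof -
    obtain B where B: "0 \<le> B" "AE x in lebesgue. \<bar>u a b x\<bar> \<le> B" using ub[OF ab] by blast
    have [measurable]: "u a b \<in> borel_measurable borel" by (rule um[OF ab])
    have "AE x in lborel. \<bar>u a b x\<bar> \<le> B" using B(2) by (subst (asm) AE_completion_iff) auto
    then have ae: "AE x in lborel. norm (\<bar>u a b x\<bar> powr q) \<le> norm (indicator (interior K) x * (B powr q))"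
    proof eventually_elim
      case (elim x)
      then show ?case using uz[OF ab, of x] q by (cases "x \<in> interior K") (auto intro: powr_mono2)
    qed
    show ?thesis
      by (rule Bochner_Integration.integrable_bound[OF _ _ ae]) (use finK in auto)
  qed
  have key: "AE x in lborel. \<bar>indicator (interior K) x * (u l (m - l) x - interp_jet z A B k v' l (m - l) x)\<bar> \<le> D * M"
    if l: "l \<le> m" for l
  \<comment> \<open>The factor is the number of derivatives of order k + 1 times the measure of the
    interior. It does not depend on the exponent, so its roots tend to a limit that does not enlarge
    the bound.\<close>
  proof (rule ess_bound_from_powers[where c = "real (k + 2) * \<mu>"])
    have lm: "l + (m - l) = m" "l + (m - l) \<le> k + 1" using l m by auto
    have [measurable]: "u l (m - l) \<in> borel_measurable borel" by (rule um[OF lm(2)])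
    have [measurable]: "interp_jet z A B k v' l (m - l) \<in> borel_measurable borel"
      by (intro borel_measurable_continuous_onI jet_continuous J)
    show "(\<lambda>x. indicator (interior K) x * (u l (m - l) x - interp_jet z A B k v' l (m - l) x)) \<in> borel_measurable borel"
      by measurable
    fix n :: nat
    define q where "q = real (Suc n)"
    have q: "1 \<le> q" by (simp add: q_def)
    have upper: "(\<integral>\<^sup>+x. ennreal (\<bar>u j (k + 1 - j) x\<bar> powr q) \<partial>lborel) \<le> ennreal (M powr q * \<mu>)" if j: "j \<le> k + 1" for j
    proof -
      have jk: "j + (k + 1 - j) \<le> k + 1" using j by simp
      have [measurable]: "u j (k + 1 - j) \<in> borel_measurable borel" by (rule um[OF jk])
      have "AE x in lborel. \<bar>u j (k + 1 - j) x\<bar> \<le> max 0 (N j)" using uN[OF j] by (subst (asm) AE_completion_iff) auto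
      then have "AE x in lborel. ennreal (\<bar>u j (k + 1 - j) x\<bar> powr q) \<le> ennreal (M powr q) * indicator (interior K) x"
      proof eventually_elim
        case (elim x)
        then have "\<bar>u j (k + 1 - j) x\<bar> \<le> M" using NM[OF j] M0 by simp
        then show ?case using uz[OF jk, of x] q by (cases "x \<in> interior K") (auto intro!: ennreal_leI powr_mono2)
      qed
      then have "(\<integral>\<^sup>+x. ennreal (\<bar>u j (k + 1 - j) x\<bar> powr q) \<partial>lborel) \<le> (\<integral>\<^sup>+x. ennreal (M powr q) * indicator (interior K) x \<partial>lborel)"
        by (rule nn_integral_mono_AE)
      also have "\<dots> = ennreal (M powr q * \<mu>)" by (simp add: nn_integral_cmult_indicator \<mu> ennreal_mult \<mu>_def)
      finally show ?thesis .
    qed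
    have "(\<integral>\<^sup>+x. ennreal (\<bar>indicator (interior K) x * (u l (m - l) x - interp_jet z A B k v' l (m - l) x)\<bar> powr q) \<partial>lborel)
      = (\<integral>\<^sup>+x. indicator (interior K) x * ennreal (\<bar>u l (m - l) x - interp_jet z A B k v' l (m - l) x\<bar> powr q) \<partial>lborel)"
      using q by (intro nn_integral_cong) (simp add: indicator_def)
    also have "\<dots> \<le> ennreal (D powr q) * (\<Sum>j\<le>k + 1. \<integral>\<^sup>+x. ennreal (\<bar>u j (k + 1 - j) x\<bar> powr q) \<partial>lborel)"
      by (rule limit_estimate[OF k q D est[OF q] v' PQ um ui up[OF _ q] sm lm(1) m])
    also have "\<dots> \<le> ennreal (D powr q) * (\<Sum>j\<le>k + 1. ennreal (M powr q * \<mu>))"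
      by (intro mult_left_mono sum_mono upper) auto
    also have "(\<Sum>j\<le>k + 1. ennreal (M powr q * \<mu>)) = ennreal (\<Sum>j\<le>k + 1. M powr q * \<mu>)"
      by (intro sum_ennreal) (simp add: \<mu>_def)
    also have "ennreal (D powr q) * \<dots> = ennreal (D powr q * (\<Sum>j\<le>k + 1. M powr q * \<mu>))"
      by (rule ennreal_mult[symmetric]) (auto simp: \<mu>_def)
    also have "D powr q * (\<Sum>j\<le>k + 1. M powr q * \<mu>) = real (k + 2) * \<mu> * (D * M) powr q"
      by (simp add: powr_mult)
    finally show "(\<integral>\<^sup>+x. ennreal (\<bar>indicator (interior K) x * (u l (m - l) x - interp_jet z A B k v' l (m - l) x)\<bar> powr real (Suc n)) \<partial>lborel)
      \<le> ennreal (real (k + 2) * \<mu> * (D * M) powr real (Suc n))" by (simp only: q_def)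
  qed (use M0 D in \<open>auto simp: \<mu>_def\<close>)
  have "Lp_norm \<infinity> (interior K) (weak_partial (interior K) (l, m - l) (\<lambda>x. v x - lagrange_interp k K v x)) \<le> D * M"
    if l: "l \<le> m" for l
  proof -
    have lm: "l + (m - l) \<le> k" "l + (m - l) \<le> k + 1" using l m by auto
    have "AE x in lebesgue. \<bar>indicator (interior K) x * (u l (m - l) x - interp_jet z A B k v' l (m - l) x)\<bar> \<le> D * M"
      using key[OF l] by (rule AE_completion)
    then have "AE x in lebesgue. x \<in> interior K \<longrightarrow> \<bar>u l (m - l) x - interp_jet z A B k v' l (m - l) x\<bar> \<le> D * M"
      by eventually_elim auto
    moreover have "(\<lambda>x. u l (m - l) x - interp_jet z A B k v' l (m - l) x) \<in> borel_measurable borel"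
      by (intro borel_measurable_diff um lm(2) borel_measurable_continuous_onI jet_continuous J)
    ultimately show ?thesis
      using Lp_norm_inf_le(2)[OF open_interior _ err[OF lm(1)], of "D * M"] M0 D by simp
  qed
  then show "sobolev_seminorm m \<infinity> (interior K) (\<lambda>x. v x - lagrange_interp k K v x)
    \<le> D * sobolev_seminorm (k + 1) \<infinity> (interior K) v"
    unfolding sobolev_seminorm_def[of m] M_def[symmetric] mi_order_set by simp
qed

end

theorem theorem10:
  fixes k m :: nat and p :: ennreal
  assumes "1 \<le> k" and "m \<le> k" and "1 \<le> p"
  shows "\<exists>C :: real. \<forall>(K :: plane set) (v :: plane \<Rightarrow> real).
    2 simplex K \<longrightarrow> continuous_on K v \<longrightarrow> v \<in> sobolev_space (k + 1) p (interior K) \<longrightarrow>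
      sobolev_seminorm m p (interior K) (\<lambda>x. v x - lagrange_interp k K v x)
        \<le> C * (circumradius K / diameter K) ^ m * diameter K ^ (k + 1 - m)
            * sobolev_seminorm (k + 1) p (interior K) v \<and>
      C * (circumradius K / diameter K) ^ m * diameter K ^ (k + 1 - m)
            * sobolev_seminorm (k + 1) p (interior K) v
        = C * circumradius K ^ m * diameter K powi (int k + 1 - 2 * int m)
            * sobolev_seminorm (k + 1) p (interior K) v"
proof -
  obtain C where C: "1 \<le> C" and all: "\<forall>K z A B q U m. labelled_triangle K z A B \<longrightarrow> 1 \<le> q \<longrightarrow> jet U \<longrightarrow> m \<le> k \<longrightarrow>
    seminorm_K K q (\<lambda>a b x. U a b x - interp_jet z A B k (U 0 0) a b x) m
    \<le> (C * (circumradius K / diameter K) ^ m * diameter K ^ (k + 1 - m)) powr q * seminorm_K K q U (k + 1)"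
    using triangle_estimate[OF assms(1)] by (elim exE conjE) (rule that)
  show ?thesis
  \<comment> \<open>The factor m + 1 is incurred for finite exponents. For the infinite exponent the
    bound may be enlarged by it, since the seminorm on the right is nonnegative.\<close>
  proof (intro exI[of _ "real (m + 1) * C"] allI impI conjI)
    fix K :: "plane set" and v :: "plane \<Rightarrow> real"
    assume K: "2 simplex K" and vc: "continuous_on K v" and v: "v \<in> sobolev_space (k + 1) p (interior K)"
    obtain z A B where "labelled_triangle K z A B" by (rule triangle_label[OF K])
    then interpret labelled_triangle K z A B .
    define D where "D = C * (circumradius K / diameter K) ^ m * diameter K ^ (k + 1 - m)"
    have D: "0 \<le> D" unfolding D_def using C ratio_pos diam_pos by (intro mult_nonneg_nonneg zero_le_power) auto
    have est': "seminorm_K K q (\<lambda>a b x. U a b x - interp_jet z A B k (U 0 0) a b x) m \<le> D powr q * seminorm_K K q U (k + 1)"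
      if "1 \<le> q" "jet U" for q U
      unfolding D_def by (rule all[rule_format, OF labelled_triangle_axioms that assms(2)])
    have "sobolev_seminorm m p (interior K) (\<lambda>x. v x - lagrange_interp k K v x)
        \<le> real (m + 1) * D * sobolev_seminorm (k + 1) p (interior K) v"
    proof (cases "p = \<infinity>")
      case True
      have "D * sobolev_seminorm (k + 1) \<infinity> (interior K) v \<le> real (m + 1) * D * sobolev_seminorm (k + 1) \<infinity> (interior K) v"
        using D seminorm_estimate_infinite(2)[OF assms(1,2) D est' vc v[unfolded True]]
        by (intro mult_right_mono) (auto simp: algebra_simps)
      then show ?thesis
        using seminorm_estimate_infinite(1)[OF assms(1,2) D est' vc v[unfolded True]] True by simp
    next
      case False
      show ?thesis
        by (rule seminorm_estimate_finite[OF assms(1,2,3) False D est'[OF exponent_real(1)[OF assms(3) False]] vc v])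
    qed
    then show "sobolev_seminorm m p (interior K) (\<lambda>x. v x - lagrange_interp k K v x)
        \<le> real (m + 1) * C * (circumradius K / diameter K) ^ m * diameter K ^ (k + 1 - m)
            * sobolev_seminorm (k + 1) p (interior K) v"
      by (simp only: D_def mult.assoc)
    \<comment> \<open>The exponent k + 1 - 2 m may be negative, so it is treated as an integer and
      split into two natural powers.\<close>
    have "diameter K powi (int k + 1 - 2 * int m) = diameter K powi (int (k + 1 - m) - int m)"
      using assms(2) by (intro arg_cong[where f = "power_int (diameter K)"]) (simp add: of_nat_diff)
    also have "\<dots> = diameter K ^ (k + 1 - m) / diameter K ^ m"
      using diam_pos by (subst power_int_diff) (auto simp: power_int_of_nat)
    finally have "(circumradius K / diameter K) ^ m * diameter K ^ (k + 1 - m)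
        = circumradius K ^ m * diameter K powi (int k + 1 - 2 * int m)"
      by (simp add: power_divide)
    then show "real (m + 1) * C * (circumradius K / diameter K) ^ m * diameter K ^ (k + 1 - m)
            * sobolev_seminorm (k + 1) p (interior K) v
        = real (m + 1) * C * circumradius K ^ m * diameter K powi (int k + 1 - 2 * int m)
            * sobolev_seminorm (k + 1) p (interior K) v"
      by (simp only: mult.assoc)
  qed
qed

end
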